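(* Let $\rho,u$ be a solution, in the sense of distributions on $(0,T)\times\mathbb{T}^d$, of either the compressible Navier-Stokes system (NS) $\quad\partial_t(\rho u)+\operatorname{div}(\rho u\otimes u)+\nabla p(\rho)=\operatorname{div}\mathbb{S}(\nabla u),\qquad \partial_t\rho+\operatorname{div}(\rho u)=0,$ or the compressible Navier-Stokes system with degenerate viscosity (DNS) $\quad\partial_t(\rho u)+\operatorname{div}(\rho u\otimes u)+\nabla p(\rho)=\operatorname{div}(\rho\,\mathbb{S}(\nabla u)),\qquad \partial_t\rho+\operatorname{div}(\rho u)=0.$ Assume $$u\in B_3^{\alpha,\infty}((0,T)\times\mathbb{T}^d),\quad u\in L^2(0,T;H^1(\mathbb{T}^d)),\quad \rho,\ \rho u\in B_3^{\beta,\infty}((0,T)\times\mathbb{T}^d),$$ $$0\le\underline{\rho}\le\rho\le\overline{\rho}\ \text{ a.e. in }(0,T)\times\mathbb{T}^d,$$ for some constants $\underline{\rho},\overline{\rho}$ and $0\le\alpha,\beta\le1$ such that $$\beta>\max\left\{1-2\alpha;\ \frac{1-\alpha}{2}\right\}.$$ Assume further that $p\in C[\underline{\rho},\overline{\rho}]$. Then the energy is locally conserved, i.e., in the sense of distributions on $(0,T)\times\mathbb{T}^d$, $$\partial_t\left(\tfrac12\rho|u|^2+P(\rho)\right)+\mathbb{S}(\nabla u):\nabla u+\operatorname{div}\left[\left(\tfrac12\rho|u|^2+p(\rho)+P(\rho)\right)u-\mathbb{S}(\nabla u)u\right]=0$$ in the case of (NS), and $$\partial_t\left(\tfrac12\rho|u|^2+P(\rho)\right)+\rho\,\mathbb{S}(\nabla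 u):\nabla u+\operatorname{div}\left[\left(\tfrac12\rho|u|^2+p(\rho)+P(\rho)\right)u-\rho\,\mathbb{S}(\nabla u)u\right]=0$$ in the case of (DNS).
   Context: $\mathbb{T}^d$ is the $d$-dimensional torus; $u$ is the velocity, $\rho\ge0$ the density, $p=p(\rho)$ the pressure law. $\operatorname{div}$ and $\nabla$ act in the space variable. The viscous stress tensor is $$\mathbb{S}(\nabla u):=\mu\left(\nabla u+(\nabla u)^T-\tfrac23\operatorname{div}u\,\mathbb{I}\right)+\nu\operatorname{div}u\,\mathbb{I},$$ with constants $\mu>0$ and $\nu\ge0$; $\mathbb{I}$ is the identity matrix, and $A:B$ denotes the Frobenius inner product of matrices. The pressure potential is $P(\rho)=\rho\int_1^\rho\frac{p(r)}{r^2}\,dr$, with the value at $\rho=0$ understood as the limit $\rho\to0^+$; the pressure is understood to be given on an interval for which this integral makes sense. For $\Omega=(0,T)\times\mathbb{T}^d$, the Besov space $B_q^{\alpha,\infty}(\Omega)$ consists of those $w$ for which $$\|w\|_{B_q^{\alpha,\infty}(\Omega)}:=\|w\|_{L^q(\Omega)}+\sup_{\xi\in\Omega}\frac{\|w(\cdot+\xi)-w\|_{L^q(\Omega\cap(\Omega-\xi))}}{|\xi|^\alpha}<\infty,$$ where $\xi$ ranges over (nonzero) space-time shifts.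
   Formalization: If the upper density bound is 0 (vacuum a.e.), the pressure is additionally assumed continuous on some [0,h], h>0, with the potential's integral defined there; otherwise the value P(0) need not exist or equal -p(0) and the claim can fail. *)

theory Defs
  imports "HOL-Analysis.Analysis"
begin

text \<open>
  The torus is \<open>\<real>\<^sup>d / \<int>\<^sup>d\<close>: a function on \<open>(0,T)\<close> times the torus is a function on
  \<open>real \<times> (real^'d)\<close> that is 1-periodic in each space coordinate, and integrals over the torus
  are integrals over the unit cell.  Values at times outside \<open>(0,T)\<close> are irrelevant.
\<close>

definition cell :: "(real^'d) set" where
  "cell = cbox 0 1"

definition spacetime :: "real \<Rightarrow> (real \<times> (real^'d)) set" where
  "spacetime T = {0<..<T} \<times> cell"

definition periodic :: "(real^'d \<Rightarrow> 'b) \<Rightarrow> bool" where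
  "periodic v \<longleftrightarrow> (\<forall>x i. v (x + axis i 1) = v x)"

definition space_periodic :: "real \<Rightarrow> (real \<times> (real^'d) \<Rightarrow> 'b) \<Rightarrow> bool" where
  "space_periodic T w \<longleftrightarrow> (\<forall>t\<in>{0<..<T}. periodic (\<lambda>x. w (t, x)))"

definition Lq_on :: "real \<Rightarrow> 'a::euclidean_space set \<Rightarrow> ('a \<Rightarrow> 'b::euclidean_space) \<Rightarrow> bool" where
  "Lq_on q A w \<longleftrightarrow>
     set_borel_measurable lebesgue A w \<and> set_integrable lebesgue A (\<lambda>z. norm (w z) powr q)"

definition Lq_norm :: "real \<Rightarrow> 'a::euclidean_space set \<Rightarrow> ('a \<Rightarrow> 'b::euclidean_space) \<Rightarrow> real" where
  "Lq_norm q A w = (LINT z:A|lebesgue. norm (w z) powr q) powr (1 / q)"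

definition Lq_torus :: "real \<Rightarrow> (real^'d \<Rightarrow> 'b::euclidean_space) \<Rightarrow> bool" where
  "Lq_torus q v \<longleftrightarrow> periodic v \<and> Lq_on q cell v"

definition Lq_spacetime :: "real \<Rightarrow> real \<Rightarrow> (real \<times> (real^'d) \<Rightarrow> 'b::euclidean_space) \<Rightarrow> bool" where
  "Lq_spacetime q T w \<longleftrightarrow> space_periodic T w \<and> Lq_on q (spacetime T) w"

definition L1_loc :: "real \<Rightarrow> (real \<times> (real^'d) \<Rightarrow> 'b::euclidean_space) \<Rightarrow> bool" where
  "L1_loc T w \<longleftrightarrow> (\<forall>a b. 0 < a \<longrightarrow> b < T \<longrightarrow> set_integrable lebesgue ({a..b} \<times> cell) w)"

text \<open>
  \<open>(0,T)\<close> times the torus, intersected with its translate by \<open>-\<xi>\<close>: a shift in space leaves the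
  torus invariant, so only the time component of \<open>\<xi>\<close> matters.
\<close>

definition shift_domain :: "real \<Rightarrow> real \<times> (real^'d) \<Rightarrow> (real \<times> (real^'d)) set" where
  "shift_domain T \<xi> = {z \<in> spacetime T. fst z + fst \<xi> \<in> {0<..<T}}"

text \<open>
  The Besov norm is finite.  Spatial shifts range over all of \<open>\<real>\<^sup>d\<close> with the Euclidean length;
  among the representatives of one torus shift the shortest gives the largest quotient, so this
  is the supremum with respect to the distance on the torus.
\<close>

definition Besov :: "real \<Rightarrow> real \<Rightarrow> real \<Rightarrow> (real \<times> (real^'d) \<Rightarrow> 'b::euclidean_space) \<Rightarrow> bool" where
  "Besov q \<alpha> T w \<longleftrightarrow>
     Lq_spacetime q T w \<and>
     bdd_above ((\<lambda>\<xi>. Lq_norm q (shift_domain T \<xi>) (\<lambda>z. w (z + \<xi>) - w z) / norm \<xi> powr \<alpha>) ` (- {0}))"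

primrec C_k :: "nat \<Rightarrow> ('a::euclidean_space \<Rightarrow> real) \<Rightarrow> bool" where
  "C_k 0 f \<longleftrightarrow> continuous_on UNIV f"
| "C_k (Suc k) f \<longleftrightarrow>
     (\<forall>x. f differentiable at x) \<and> (\<forall>v. C_k k (\<lambda>x. frechet_derivative f (at x) v))"

definition smooth :: "('a::euclidean_space \<Rightarrow> real) \<Rightarrow> bool" where
  "smooth f \<longleftrightarrow> (\<forall>k. C_k k f)"

text \<open>
  \<open>v\<close> belongs to \<open>H\<^sup>1\<close> of the torus and \<open>G\<close> is (a representative of) its weak gradient,
  with \<open>G $ i $ j\<close> the \<open>j\<close>-th partial derivative of \<open>v $ i\<close>.
\<close>

definition H1_gradient :: "(real^'d \<Rightarrow> real^'d) \<Rightarrow> (real^'d \<Rightarrow> real^'d^'d) \<Rightarrow> bool" where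
  "H1_gradient v G \<longleftrightarrow>
     Lq_torus 2 v \<and> Lq_torus 2 G \<and>
     (\<forall>\<eta>. smooth \<eta> \<and> periodic \<eta> \<longrightarrow>
        (\<forall>i j. (LINT x:cell|lebesgue. v x $ i * frechet_derivative \<eta> (at x) (axis j 1))
             = - (LINT x:cell|lebesgue. G x $ i $ j * \<eta> x)))"

text \<open>
  \<open>u\<close> belongs to \<open>L\<^sup>2(0,T;H\<^sup>1)\<close> and \<open>Du\<close> is a jointly measurable representative of its spatial
  gradient; \<open>Du\<close> is determined by \<open>u\<close> up to a null set.  The norm on \<open>real^'d^'d\<close> is the
  Frobenius norm, so square integrability of \<open>u\<close> and \<open>Du\<close> is square integrability of the
  \<open>H\<^sup>1\<close> norm in time.
\<close>

definition L2_H1 :: "real \<Rightarrow> (real \<times> (real^'d) \<Rightarrow> real^'d) \<Rightarrow> (real \<times> (real^'d) \<Rightarrow> real^'d^'d) \<Rightarrow> bool" where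
  "L2_H1 T u Du \<longleftrightarrow>
     Lq_spacetime 2 T u \<and> Lq_spacetime 2 T Du \<and>
     (AE t in lebesgue. t \<in> {0<..<T} \<longrightarrow> H1_gradient (\<lambda>x. u (t, x)) (\<lambda>x. Du (t, x)))"

definition test_fun :: "real \<Rightarrow> (real \<times> (real^'d) \<Rightarrow> real) \<Rightarrow> bool" where
  "test_fun T \<phi> \<longleftrightarrow>
     smooth \<phi> \<and> (\<forall>t. periodic (\<lambda>x. \<phi> (t, x))) \<and>
     (\<exists>a b. 0 < a \<and> b < T \<and> (\<forall>t x. t \<notin> {a..b} \<longrightarrow> \<phi> (t, x) = 0))"

text \<open>
  The distributions \<open>f\<close>, \<open>\<partial>\<^sub>t f\<close>, \<open>\<partial>\<^sub>i f\<close> and \<open>div F\<close>, for locally integrable \<open>f\<close> and \<open>F\<close>, as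
  functionals on test functions.
\<close>

definition distr_fun :: "real \<Rightarrow> (real \<times> (real^'d) \<Rightarrow> real) \<Rightarrow> (real \<times> (real^'d) \<Rightarrow> real) \<Rightarrow> real" where
  "distr_fun T f \<phi> = (LINT z:spacetime T|lebesgue. f z * \<phi> z)"

definition distr_dt :: "real \<Rightarrow> (real \<times> (real^'d) \<Rightarrow> real) \<Rightarrow> (real \<times> (real^'d) \<Rightarrow> real) \<Rightarrow> real" where
  "distr_dt T f \<phi> = - distr_fun T f (\<lambda>z. frechet_derivative \<phi> (at z) (1, 0))"

definition distr_dx :: "real \<Rightarrow> 'd \<Rightarrow> (real \<times> (real^'d) \<Rightarrow> real) \<Rightarrow> (real \<times> (real^'d) \<Rightarrow> real) \<Rightarrow> real" where
  "distr_dx T i f \<phi> = - distr_fun T f (\<lambda>z. frechet_derivative \<phi> (at z) (0, axis i 1))"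

definition distr_div :: "real \<Rightarrow> (real \<times> (real^'d) \<Rightarrow> real^'d) \<Rightarrow> (real \<times> (real^'d) \<Rightarrow> real) \<Rightarrow> real" where
  "distr_div T F \<phi> = (\<Sum>j\<in>UNIV. distr_dx T j (\<lambda>z. F z $ j) \<phi>)"

definition viscous_stress :: "real \<Rightarrow> real \<Rightarrow> real^'d^'d \<Rightarrow> real^'d^'d" where
  "viscous_stress \<mu> \<nu> A =
     \<mu> *\<^sub>R (A + transpose A - (2 / 3 * trace A) *\<^sub>R mat 1) + (\<nu> * trace A) *\<^sub>R mat 1"

text \<open>
  Distributional solutions of
  \<open>\<partial>\<^sub>t(\<rho> u) + div(\<rho> u \<otimes> u) + \<nabla>p(\<rho>) = div \<sigma>\<close>, \<open>\<partial>\<^sub>t\<rho> + div(\<rho> u) = 0\<close> for a given stress \<open>\<sigma>\<close>.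
  Local integrability is required so that every term is a distribution.
\<close>

definition compressible_flow ::
  "real \<Rightarrow> (real \<Rightarrow> real) \<Rightarrow> (real \<times> (real^'d) \<Rightarrow> real^'d^'d) \<Rightarrow>
   (real \<times> (real^'d) \<Rightarrow> real) \<Rightarrow> (real \<times> (real^'d) \<Rightarrow> real^'d) \<Rightarrow> bool" where
  "compressible_flow T p \<sigma> \<rho> u \<longleftrightarrow>
     L1_loc T \<rho> \<and> L1_loc T (\<lambda>z. \<rho> z *\<^sub>R u z) \<and>
     (\<forall>i. L1_loc T (\<lambda>z. (\<rho> z * u z $ i) *\<^sub>R u z)) \<and>
     L1_loc T (\<lambda>z. p (\<rho> z)) \<and> L1_loc T \<sigma> \<and>
     (\<forall>\<phi>. test_fun T \<phi> \<longrightarrow>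
        (\<forall>i. distr_dt T (\<lambda>z. \<rho> z * u z $ i) \<phi> + distr_div T (\<lambda>z. (\<rho> z * u z $ i) *\<^sub>R u z) \<phi>
              + distr_dx T i (\<lambda>z. p (\<rho> z)) \<phi>
            = distr_div T (\<lambda>z. \<sigma> z $ i) \<phi>) \<and>
        distr_dt T \<rho> \<phi> + distr_div T (\<lambda>z. \<rho> z *\<^sub>R u z) \<phi> = 0)"

definition navier_stokes ::
  "real \<Rightarrow> (real \<Rightarrow> real) \<Rightarrow> real \<Rightarrow> real \<Rightarrow> (real \<times> (real^'d) \<Rightarrow> real) \<Rightarrow>
   (real \<times> (real^'d) \<Rightarrow> real^'d) \<Rightarrow> (real \<times> (real^'d) \<Rightarrow> real^'d^'d) \<Rightarrow> bool" where
  "navier_stokes T p \<mu> \<nu> \<rho> u Du \<longleftrightarrow>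
     compressible_flow T p (\<lambda>z. viscous_stress \<mu> \<nu> (Du z)) \<rho> u"

definition degenerate_navier_stokes ::
  "real \<Rightarrow> (real \<Rightarrow> real) \<Rightarrow> real \<Rightarrow> real \<Rightarrow> (real \<times> (real^'d) \<Rightarrow> real) \<Rightarrow>
   (real \<times> (real^'d) \<Rightarrow> real^'d) \<Rightarrow> (real \<times> (real^'d) \<Rightarrow> real^'d^'d) \<Rightarrow> bool" where
  "degenerate_navier_stokes T p \<mu> \<nu> \<rho> u Du \<longleftrightarrow>
     compressible_flow T p (\<lambda>z. \<rho> z *\<^sub>R viscous_stress \<mu> \<nu> (Du z)) \<rho> u"

text \<open>
  \<open>p\<close> is continuous on \<open>[lo, hi]\<close>, and is defined between \<open>1\<close> and the points of this interval so
  that the integral in the pressure potential makes sense.  If \<open>lo = 0 < hi\<close>, the limit defining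
  the potential at \<open>0\<close> exists; for \<open>lo = hi = 0\<close> the condition says nothing about \<open>p\<close> near \<open>0\<close>
  and has to be supplemented by \<open>\<exists>h>0. pressure_law 0 h p\<close>.
\<close>

definition pressure_law :: "real \<Rightarrow> real \<Rightarrow> (real \<Rightarrow> real) \<Rightarrow> bool" where
  "pressure_law lo hi p \<longleftrightarrow>
     continuous_on {lo..hi} p \<and>
     (\<forall>r\<in>{lo..hi}. 0 < r \<longrightarrow>
        interval_lebesgue_integrable lborel (ereal 1) (ereal r) (\<lambda>s. p s / s\<^sup>2))"

definition pressure_potential :: "(real \<Rightarrow> real) \<Rightarrow> real \<Rightarrow> real" where
  "pressure_potential p r =
     (let Q = (\<lambda>r. r * (LBINT s=ereal 1..ereal r. p s / s\<^sup>2))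
      in if r = 0 then Lim (at_right 0) Q else Q r)"

text \<open>
  \<open>\<partial>\<^sub>t(\<rho>\<bar>u\<bar>\<^sup>2/2 + P(\<rho>)) + \<sigma> : \<nabla>u + div((\<rho>\<bar>u\<bar>\<^sup>2/2 + p(\<rho>) + P(\<rho>)) u - \<sigma> u) = 0\<close> in the sense of
  distributions, all terms being locally integrable.  The inner product on \<open>real^'d^'d\<close> is the
  Frobenius product.
\<close>

definition local_energy_equality ::
  "real \<Rightarrow> (real \<Rightarrow> real) \<Rightarrow> (real \<times> (real^'d) \<Rightarrow> real^'d^'d) \<Rightarrow> (real \<times> (real^'d) \<Rightarrow> real) \<Rightarrow>
   (real \<times> (real^'d) \<Rightarrow> real^'d) \<Rightarrow> (real \<times> (real^'d) \<Rightarrow> real^'d^'d) \<Rightarrow> bool" where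
  "local_energy_equality T p \<sigma> \<rho> u Du \<longleftrightarrow>
     (let P = pressure_potential p;
          E = (\<lambda>z. 1/2 * \<rho> z * (norm (u z))\<^sup>2 + P (\<rho> z));
          D = (\<lambda>z. \<sigma> z \<bullet> Du z);
          F = (\<lambda>z. (1/2 * \<rho> z * (norm (u z))\<^sup>2 + p (\<rho> z) + P (\<rho> z)) *\<^sub>R u z - \<sigma> z *v u z)
      in L1_loc T E \<and> L1_loc T D \<and> L1_loc T F \<and>
         (\<forall>\<phi>. test_fun T \<phi> \<longrightarrow> distr_dt T E \<phi> + distr_fun T D \<phi> + distr_div T F \<phi> = 0))"

end

theory Submission
  imports Defs
begin

text \<open>
  The equations are mollified in space and time, the mollified momentum equation is multiplied by the
  mollified velocity, and the errors vanish because they are commutators (Constantin, E and Titi).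

  Write the system with space-time fluxes: \<open>B = (\<rho>, \<rho>u)\<close> is divergence free, and so is
  \<open>u\<^sub>i B + H\<^sub>i\<close> with \<open>H\<^sub>i = (0, p(\<rho>) e\<^sub>i - \<sigma>\<^sub>i)\<close>, where \<open>\<sigma>\<close> is the viscous stress of either system. Testing
  the mollified momentum equation with \<open>\<phi> (k * u\<^sub>i)\<close> and using the continuity equation gives the formal
  balance of kinetic energy for the mollified fields, up to terms that contain the commutator
  \<open>k * (u\<^sub>i B) - (k * u\<^sub>i) (k * B)\<close>. It is quadratic in increments, hence of order
  \<open>\<epsilon>\<^sup>\<alpha>\<^sup>+\<^sup>\<beta>\<close> in \<open>L\<^sup>3\<^sup>/\<^sup>2\<close>, and it is paired with a gradient \<open>D(k * u\<^sub>i)\<close> of order \<open>\<epsilon>\<^sup>\<alpha>\<^sup>-\<^sup>1\<close> in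
  \<open>L\<^sup>3\<close>. Thus it disappears if \<open>2\<alpha> + \<beta> > 1\<close> (\<open>kinetic_limit\<close>, from \<open>commutator_bound\<close>). Pressure and stress
  cause no commutator, since \<open>\<nabla>u\<close> is square integrable and \<open>H\<^sub>i\<close> is too. The mass flux \<open>\<rho>u\<close> is
  mollified as a whole, so that nothing is divided by the density and vacuum is allowed.

  The limit contains the pressure work \<open>p(\<rho>) div u\<close>, which has to be identified with
  \<open>- \<partial>\<^sub>t P(\<rho>) - div(P(\<rho>)u)\<close>. The same commutator argument with \<open>\<rho>\<close> and \<open>(1, u)\<close> in place of \<open>u\<^sub>i\<close> and \<open>B\<close>
  renormalises the continuity equation for every power of \<open>\<rho>\<close>, provided that \<open>2\<beta> + \<alpha> > 1\<close>
  (\<open>renormalised_limit\<close>). The relation between \<open>p\<close> and \<open>P\<close> is linear, and polynomials approximate \<open>p\<close>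
  uniformly together with their potentials, so it suffices that \<open>p\<close> is continuous (\<open>pressure_approx\<close>,
  \<open>renormalised_pressure\<close>). The two strict inequalities are exactly the hypothesis on \<open>\<beta>\<close>. Adding the two
  balances gives \<open>energy_identity\<close>.

  All of this concerns Borel fields that are periodic everywhere and vanish outside \<open>(0,T)\<close>. The
  fields of the theorem agree with such fields almost everywhere (\<open>representative\<close>), and Besov
  regularity, weak gradient and distributions are expressed through them (\<open>besov_incr_of_Besov\<close>,
  \<open>gradient_weak\<close>, \<open>local_energy_of_flow\<close>).
\<close>

section \<open>Calculus of smooth functions\<close>

lemma C_k_SucI:
  fixes f :: "'a::euclidean_space \<Rightarrow> real"
  assumes "\<And>x. (f has_derivative f' x) (at x)" "\<And>v. C_k k (\<lambda>x. f' x v)"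
  shows "C_k (Suc k) f"
proof -
  have "frechet_derivative f (at x) = f' x" for x
    using frechet_derivative_at[OF assms(1)] by simp
  moreover have "f differentiable (at x)" for x
    using assms(1) by (rule differentiableI)
  ultimately show ?thesis using assms(2) by simp
qed

lemma C_k_Suc_imp: "C_k (Suc k) f \<Longrightarrow> C_k k f"
proof (induction k arbitrary: f)
  case 0
  then show ?case
    by (auto intro!: continuous_at_imp_continuous_on differentiable_imp_continuous_within)
next
  case (Suc k)
  then show ?case by auto
qed

lemma C_k_has_derivative:
  "C_k (Suc k) f \<Longrightarrow> (f has_derivative frechet_derivative f (at x)) (at x)"
  by (simp add: frechet_derivative_works[symmetric])

lemma C_k_const: "C_k k (\<lambda>x. c)"
proof (induction k arbitrary: c)
  case 0 then show ?case by simp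
next
  case (Suc k)
  show ?case by (rule C_k_SucI[where f' = "\<lambda>_ _. 0"]) (auto intro: Suc)
qed

lemma C_k_add: "C_k k f \<Longrightarrow> C_k k g \<Longrightarrow> C_k k (\<lambda>x. f x + g x)"
proof (induction k arbitrary: f g)
  case 0 then show ?case by (auto intro: continuous_on_add)
next
  case (Suc k)
  show ?case
    by (rule C_k_SucI[where f' = "\<lambda>x v. frechet_derivative f (at x) v + frechet_derivative g (at x) v"])
       (use Suc in \<open>auto intro!: has_derivative_add simp: frechet_derivative_works[symmetric]\<close>)
qed

lemma C_k_mult: "C_k k f \<Longrightarrow> C_k k g \<Longrightarrow> C_k k (\<lambda>x. f x * g x)"
proof (induction k arbitrary: f g)
  case 0 then show ?case by (auto intro: continuous_on_mult)
next
  case (Suc k)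
  have f: "C_k k f" and g: "C_k k g"
    using Suc.prems C_k_Suc_imp by blast+
  show ?case
  proof (rule C_k_SucI)
    show "((\<lambda>x. f x * g x) has_derivative
       (\<lambda>v. f x * frechet_derivative g (at x) v + frechet_derivative f (at x) v * g x)) (at x)" for x
      using Suc.prems C_k_has_derivative by (intro has_derivative_mult) blast+
    show "C_k k (\<lambda>x. f x * frechet_derivative g (at x) v + frechet_derivative f (at x) v * g x)" for v
      using Suc.prems f g by (intro C_k_add Suc.IH) auto
  qed
qed

text \<open>
  Differentiating \<open>f (c + L x)\<close> in direction \<open>v\<close> gives the derivative
  of \<open>f\<close> in the fixed direction \<open>L v\<close>, again a composition with the
  same affine map; hence the induction on \<open>k\<close> closes for all \<open>f\<close>
  simultaneously.
\<close>

lemma C_k_affine: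
  fixes f :: "'b::euclidean_space \<Rightarrow> real" and L :: "'a::euclidean_space \<Rightarrow> 'b"
  assumes "bounded_linear L"
  shows "C_k k f \<Longrightarrow> C_k k (\<lambda>x. f (c + L x))"
proof (induction k arbitrary: f)
  case 0
  have "continuous_on UNIV L" using assms by (simp add: linear_continuous_on)
  then have "continuous_on UNIV (\<lambda>x. c + L x)" by (intro continuous_intros)
  then show ?case using 0 continuous_on_compose2[of UNIV f UNIV "\<lambda>x. c + L x"] by simp
next
  case (Suc k)
  show ?case
  proof (rule C_k_SucI)
    show "((\<lambda>x. f (c + L x)) has_derivative (\<lambda>v. frechet_derivative f (at (c + L x)) (L v))) (at x)" for x
    proof -
      have "((\<lambda>x. c + L x) has_derivative L) (at x)"
        using bounded_linear_imp_has_derivative[OF assms] has_derivative_add_const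
        by (auto intro!: derivative_eq_intros)
      from diff_chain_at[OF this C_k_has_derivative[OF Suc.prems]]
      show ?thesis by (simp add: o_def)
    qed
    show "C_k k (\<lambda>x. frechet_derivative f (at (c + L x)) (L v))" for v
      using Suc.prems by (intro Suc.IH) auto
  qed
qed

lemma smooth_const: "smooth (\<lambda>x. c)"
  and smooth_add: "smooth f \<Longrightarrow> smooth g \<Longrightarrow> smooth (\<lambda>x. f x + g x)"
  and smooth_mult: "smooth f \<Longrightarrow> smooth g \<Longrightarrow> smooth (\<lambda>x. f x * g x)"
  by (simp_all add: smooth_def C_k_const C_k_add C_k_mult)

lemma smooth_affine: "bounded_linear L \<Longrightarrow> smooth f \<Longrightarrow> smooth (\<lambda>x. f (c + L x))"
  by (simp add: smooth_def C_k_affine)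

lemma smooth_power: "smooth f \<Longrightarrow> smooth (\<lambda>x. f x ^ n)"
  by (induction n) (simp_all add: smooth_const smooth_mult)

lemma smooth_linear:
  fixes L :: "'a::euclidean_space \<Rightarrow> real"
  assumes "bounded_linear L"
  shows "smooth L"
proof -
  have "C_k k L" for k
  proof (cases k)
    case 0 then show ?thesis using assms by (simp add: linear_continuous_on)
  next
    case (Suc n)
    show ?thesis unfolding Suc
      by (rule C_k_SucI[where f' = "\<lambda>x. L"])
         (auto intro: C_k_const bounded_linear_imp_has_derivative[OF assms])
  qed
  then show ?thesis by (simp add: smooth_def)
qed

lemma smooth_has_derivative:
  assumes "smooth f" shows "(f has_derivative frechet_derivative f (at x)) (at x)"
proof -
  have "C_k (Suc 0) f" using assms by (simp only: smooth_def)
  then show ?thesis by (rule C_k_has_derivative)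
qed

lemma smooth_deriv:
  assumes "smooth f" shows "smooth (\<lambda>x. frechet_derivative f (at x) v)"
  unfolding smooth_def
proof
  fix k
  have "C_k (Suc k) f" using assms by (simp only: smooth_def)
  then show "C_k k (\<lambda>x. frechet_derivative f (at x) v)" by simp
qed

lemma smooth_continuous: "smooth f \<Longrightarrow> continuous_on S f"
  unfolding smooth_def using C_k.simps(1) continuous_on_subset by (metis subset_UNIV)

lemma smooth_measurable: "smooth f \<Longrightarrow> f \<in> borel_measurable borel"
  by (intro borel_measurable_continuous_onI smooth_continuous)

lemma smooth_linear_deriv:
  assumes "smooth f" shows "linear (frechet_derivative f (at x))"
  using smooth_has_derivative[OF assms] has_derivative_linear by blast

lemma frechet_sum:
  assumes "smooth f"
  shows "frechet_derivative f (at x) v = (\<Sum>b\<in>Basis. (v \<bullet> b) * frechet_derivative f (at x) b)"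
proof -
  have "frechet_derivative f (at x) (\<Sum>b\<in>Basis. (v \<bullet> b) *\<^sub>R b) = (\<Sum>b\<in>Basis. (v \<bullet> b) * frechet_derivative f (at x) b)"
    using smooth_linear_deriv[OF assms, of x] by (simp add: linear_sum linear_scale)
  then show ?thesis by (simp add: euclidean_representation)
qed

lemma frechet_mult:
  assumes "smooth f" "smooth g"
  shows "frechet_derivative (\<lambda>x. f x * g x) (at x) v
       = f x * frechet_derivative g (at x) v + frechet_derivative f (at x) v * g x"
  using frechet_derivative_at[OF has_derivative_mult[OF smooth_has_derivative[OF assms(1)] smooth_has_derivative[OF assms(2)]]]
  by metis

section \<open>A smooth bump function\<close>

definition bump :: "nat \<Rightarrow> real \<Rightarrow> real" where
  "bump n x = (if x > 0 then exp (- 1 / x) / x ^ n else 0)"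

lemma bump_flat: "((\<lambda>h. bump n h / h) \<longlongrightarrow> 0) (at 0)"
proof -
  have r: "((\<lambda>h. bump n h / h) \<longlongrightarrow> 0) (at_right 0)"
  proof -
    have "((\<lambda>y::real. y ^ (Suc n) / exp y) \<longlongrightarrow> 0) at_top"
      by (rule tendsto_power_div_exp_0)
    then have "((\<lambda>h::real. (inverse h) ^ (Suc n) / exp (inverse h)) \<longlongrightarrow> 0) (at_right 0)"
      by (rule filterlim_compose[OF _ filterlim_inverse_at_top_right])
    then show ?thesis
      by (rule Lim_transform_eventually)
         (auto simp: eventually_at_right_field bump_def field_simps exp_minus intro!: exI[of _ 1])
  qed
  have l: "((\<lambda>h. bump n h / h) \<longlongrightarrow> 0) (at_left 0)"
    by (rule Lim_transform_eventually[OF tendsto_const])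
       (auto simp: eventually_at_left_field bump_def intro!: exI[of _ "-1"])
  show ?thesis using r l by (simp add: filterlim_split_at_real)
qed

text \<open>
  The family \<open>bump n\<close> is closed under differentiation up to linear combinations.
  This is why the denominator \<open>x ^ n\<close> is part of the definition: smoothness of
  every member then follows by one induction on the order of differentiation.
\<close>

lemma bump_deriv:
  "(bump n has_real_derivative (bump (n + 2) x - n * bump (n + 1) x)) (at x)"
proof -
  consider "x > 0" | "x < 0" | "x = 0" by linarith
  then show ?thesis
  proof cases
    case 1
    have "((\<lambda>x. exp (- 1 / x) / x ^ n) has_real_derivative (bump (n + 2) x - n * bump (n + 1) x)) (at x)"
      using 1
      apply (auto intro!: derivative_eq_intros simp: bump_def)
      apply (cases n)
      apply (auto simp: field_simps power2_eq_square power_add)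
      done
    then show ?thesis
      by (rule has_field_derivative_transform_within_open[where S="{0<..}"])
         (use 1 in \<open>auto simp: bump_def\<close>)
  next
    case 2
    have "((\<lambda>x. 0) has_real_derivative (bump (n + 2) x - n * bump (n + 1) x)) (at x)"
      using 2 by (simp add: bump_def)
    then show ?thesis
      by (rule has_field_derivative_transform_within_open[where S="{..<0}"])
         (use 2 in \<open>auto simp: bump_def\<close>)
  next
    case 3
    then show ?thesis
      using bump_flat[of n] by (simp add: has_field_derivative_iff bump_def[of _ 0])
  qed
qed

lemma smooth_bump_radial: "smooth (\<lambda>y::'a::euclidean_space. bump n (1 - y \<bullet> y))"
proof -
  have "C_k k (\<lambda>y::'a. bump n (1 - y \<bullet> y))" for k
  proof (induction k arbitrary: n)
    case 0
    have "continuous_on UNIV (bump n)"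
      using bump_deriv by (meson DERIV_continuous continuous_at_imp_continuous_on)
    moreover have "continuous_on UNIV (\<lambda>y::'a. 1 - y \<bullet> y)" by (intro continuous_intros)
    ultimately show ?case
      using continuous_on_compose2[of UNIV "bump n" UNIV "\<lambda>y::'a. 1 - y \<bullet> y"] by simp
  next
    case (Suc k)
    show ?case
    proof (rule C_k_SucI)
      show "((\<lambda>y::'a. bump n (1 - y \<bullet> y)) has_derivative
         (\<lambda>v. ((-2) * (y \<bullet> v)) * (bump (n + 2) (1 - y \<bullet> y) + (- real n) * bump (n + 1) (1 - y \<bullet> y)))) (at y)" for y
      proof -
        have "((\<lambda>y::'a. 1 - y \<bullet> y) has_derivative (\<lambda>v. (-2) * (y \<bullet> v))) (at y)"
          by (auto intro!: derivative_eq_intros simp: inner_commute)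
        moreover have "(bump n has_derivative
            (*) (bump (n + 2) (1 - y \<bullet> y) - real n * bump (n + 1) (1 - y \<bullet> y))) (at (1 - y \<bullet> y))"
          using bump_deriv[of n "1 - y \<bullet> y"] by (simp add: has_field_derivative_def)
        ultimately have "((\<lambda>y::'a. bump n (1 - y \<bullet> y)) has_derivative
            (\<lambda>v. (bump (n + 2) (1 - y \<bullet> y) - real n * bump (n + 1) (1 - y \<bullet> y)) * ((-2) * (y \<bullet> v)))) (at y)"
          using diff_chain_at by (fastforce simp: o_def)
        then show ?thesis by (simp add: algebra_simps)
      qed
      have "C_k k (\<lambda>y::'a. (-2) * (y \<bullet> v))" for v
        using smooth_linear[OF bounded_linear_const_mult[OF bounded_linear_inner_left, of "-2" v]]
        unfolding smooth_def by blast
      then show "C_k k (\<lambda>y::'a. ((-2) * (y \<bullet> v)) * (bump (n + 2) (1 - y \<bullet> y) + (- real n) * bump (n + 1) (1 - y \<bullet> y)))" for v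
        by (rule C_k_mult[OF _ C_k_add[OF Suc.IH C_k_mult[OF C_k_const Suc.IH]]])
    qed
  qed
  then show ?thesis by (simp add: smooth_def)
qed

section \<open>Mollifiers\<close>

lemma deriv_zero_outside:
  fixes f :: "'a::euclidean_space \<Rightarrow> real"
  assumes "open S" "x \<in> S" "\<And>y. y \<in> S \<Longrightarrow> f y = 0"
  shows "frechet_derivative f (at x) v = 0"
proof -
  have "((\<lambda>_. 0) has_derivative (\<lambda>_. 0)) (at x)" by simp
  then have "(f has_derivative (\<lambda>_. 0)) (at x)"
    by (rule has_derivative_transform_within_open[OF _ assms(1,2)]) (use assms(3) in auto)
  then show ?thesis using fun_cong[OF frechet_derivative_at, of f "\<lambda>_. 0" x v] by simp
qed

text \<open>
  An even kernel concentrated on the ball of radius \<open>\<epsilon>\<close>. The last two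
  clauses say that the kernel and \<open>\<epsilon>\<close> times its gradient are at most
  \<open>C\<close> times the density of the uniform distribution on that ball; all estimates
  compare convolutions with averages over the ball, and \<open>C\<close> must not depend on
  \<open>\<epsilon>\<close>.
\<close>

definition mollifier :: "real \<Rightarrow> real \<Rightarrow> ('a::euclidean_space \<Rightarrow> real) \<Rightarrow> bool" where
  "mollifier C \<epsilon> k \<longleftrightarrow> 0 < \<epsilon> \<and> smooth k \<and> (\<forall>y. 0 \<le> k y) \<and> (\<forall>y. k (- y) = k y) \<and>
     (\<forall>y. \<epsilon> \<le> norm y \<longrightarrow> k y = 0) \<and> integrable lborel k \<and> integral\<^sup>L lborel k = 1 \<and>
     (\<forall>y. k y \<le> C / measure lborel (ball (0::'a) \<epsilon>)) \<and>
     (\<forall>y v. \<bar>frechet_derivative k (at y) v\<bar> \<le> C / (\<epsilon> * measure lborel (ball (0::'a) \<epsilon>)) * norm v)"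

lemma integrable_continuous_compact:
  fixes f :: "'a::euclidean_space \<Rightarrow> 'b::euclidean_space"
  assumes "continuous_on UNIV f" "\<And>y. r \<le> norm y \<Longrightarrow> f y = 0"
  shows "integrable lborel f"
proof -
  have "integrable lborel (\<lambda>x. indicator (cball 0 r) x *\<^sub>R f x)"
    using borel_integrable_compact[of "cball 0 r" f] assms(1)
    by (simp add: set_integrable_def continuous_on_subset)
  moreover have "(\<lambda>x. indicator (cball 0 r) x *\<^sub>R f x) = f"
    using assms(2) by (auto simp: indicator_def fun_eq_iff)
  ultimately show ?thesis by simp
qed

lemma bounded_compact_support:
  fixes f :: "'a::euclidean_space \<Rightarrow> real"
  assumes "continuous_on UNIV f" "\<And>y. r \<le> norm y \<Longrightarrow> f y = 0"
  obtains M where "0 \<le> M" "\<And>y. \<bar>f y\<bar> \<le> M"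
proof -
  have "compact (f ` cball 0 r)"
    using assms(1) by (intro compact_continuous_image) (auto intro: continuous_on_subset)
  then have "bounded (f ` cball 0 r)" by (rule compact_imp_bounded)
  then obtain M where "0 < M" "\<forall>x\<in>f ` cball 0 r. norm x \<le> M" unfolding bounded_pos by blast
  then have M: "0 < M" "\<And>x. x \<in> cball 0 r \<Longrightarrow> \<bar>f x\<bar> \<le> M" by auto
  show thesis
  proof (rule that[of M])
    show "\<bar>f y\<bar> \<le> M" for y
      using M assms(2)[of y] by (cases "norm y \<le> r") auto
  qed (use M in auto)
qed

text \<open>
  The bump is at least \<open>c > 0\<close> on the ball of radius \<open>1/2\<close>, so its
  integral is at least \<open>c / 2 ^ DIM('a)\<close> times the volume of the unit ball. After
  normalising and rescaling, the factor \<open>2 ^ DIM('a) / c\<close> is the same for all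
  radii.
\<close>

lemma mollifier_exists:
  obtains C where "1 \<le> C" "\<And>\<epsilon>. 0 < \<epsilon> \<Longrightarrow> \<exists>k::'a::euclidean_space \<Rightarrow> real. mollifier C \<epsilon> k"
proof -
  define \<eta> :: "'a \<Rightarrow> real" where "\<eta> = (\<lambda>y. bump 0 (1 - y \<bullet> y))"
  define c where "c = bump 0 (3/4)"
  define N where "N = 2 ^ DIM('a) / c"
  have sm: "smooth \<eta>" unfolding \<eta>_def by (rule smooth_bump_radial)
  have c0: "c > 0" by (simp add: c_def bump_def)
  then have N0: "N > 0" by (simp add: N_def)
  have nonneg: "0 \<le> \<eta> y" and le1: "\<eta> y \<le> 1" for y
    by (auto simp: \<eta>_def bump_def)
  have zero: "\<eta> y = 0" if "1 \<le> norm y" for y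
    using that power_mono[of 1 "norm y" 2] by (auto simp: \<eta>_def bump_def power2_norm_eq_inner)
  have low: "c \<le> \<eta> y" if "norm y < 1/2" for y
  proof -
    have "(norm y)\<^sup>2 \<le> (1/2)\<^sup>2" using that by (intro power_mono) auto
    then have "y \<bullet> y \<le> (1/2)\<^sup>2" unfolding power2_norm_eq_inner .
    then have "3/4 \<le> 1 - y \<bullet> y" by (simp add: power2_eq_square)
    then show ?thesis by (auto simp: \<eta>_def bump_def c_def field_simps)
  qed
  have dz: "frechet_derivative \<eta> (at y) v = 0" if "1 < norm y" for y v
    by (rule deriv_zero_outside[of "- cball 0 1"]) (use that zero in auto)
  have "\<exists>M. 0 \<le> M \<and> (\<forall>y. \<bar>frechet_derivative \<eta> (at y) b\<bar> \<le> M)" for b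
    by (rule bounded_compact_support[of "\<lambda>y. frechet_derivative \<eta> (at y) b" 2])
       (use smooth_continuous[OF smooth_deriv[OF sm]] dz in auto)
  then obtain M where M: "\<And>b. 0 \<le> M b" "\<And>b y. \<bar>frechet_derivative \<eta> (at y) b\<bar> \<le> M b" by metis
  define D where "D = (\<Sum>b\<in>(Basis::'a set). M b)"
  have D: "\<bar>frechet_derivative \<eta> (at y) v\<bar> \<le> D * norm v" for y v
  proof -
    have "\<bar>frechet_derivative \<eta> (at y) v\<bar> \<le> (\<Sum>b\<in>Basis. \<bar>(v \<bullet> b) * frechet_derivative \<eta> (at y) b\<bar>)"
      unfolding frechet_sum[OF sm, of y v] by (rule sum_abs)
    also have "\<dots> \<le> (\<Sum>b\<in>Basis. norm v * M b)"
      unfolding abs_mult by (intro sum_mono mult_mono) (auto simp: M Basis_le_norm)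
    finally show ?thesis by (simp add: D_def sum_distrib_left mult.commute)
  qed
  have D0: "0 \<le> D" by (simp add: D_def M sum_nonneg)
  define C where "C = max 1 (max N (N * D))"
  show thesis
  proof (rule that[of C])
    show "1 \<le> C" by (simp add: C_def)
    fix \<epsilon> :: real assume e: "0 < \<epsilon>"
    define h where "h = (\<lambda>y::'a. \<eta> ((1/\<epsilon>) *\<^sub>R y))"
    have bl: "bounded_linear (\<lambda>y::'a. (1/\<epsilon>) *\<^sub>R y)" by (rule bounded_linear_scaleR_right)
    have smh: "smooth h" using smooth_affine[OF bl sm, of 0] by (simp add: h_def)
    have hz: "h y = 0" if "\<epsilon> \<le> norm y" for y
      unfolding h_def using that e by (intro zero) (simp add: field_simps)
    have inth: "integrable lborel h"
      by (rule integrable_continuous_compact[OF smooth_continuous[OF smh] hz])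
    define I where "I = integral\<^sup>L lborel h"
    define V where "V = measure lborel (ball (0::'a) \<epsilon>)"
    have V0: "V > 0" using e by (simp add: V_def)
    have VI: "V \<le> N * I"
    proof -
      have "(\<integral>y. c * indicator (ball (0::'a) (\<epsilon>/2)) y \<partial>lborel) \<le> I"
        unfolding I_def
      proof (rule integral_mono)
        show "integrable lborel (\<lambda>y. c * indicator (ball (0::'a) (\<epsilon>/2)) y)"
          using emeasure_lborel_ball_finite by (intro integrable_mult_right integrable_real_indicator) auto
        show "c * indicator (ball 0 (\<epsilon>/2)) y \<le> h y" for y
          using e by (auto simp: indicator_def h_def nonneg intro!: low simp: field_simps)
      qed (rule inth)
      then have "c * measure lborel (ball (0::'a) (\<epsilon>/2)) \<le> I" by simp
      moreover have "V = 2 ^ DIM('a) * measure lborel (ball (0::'a) (\<epsilon>/2))"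
        using e by (simp add: V_def content_ball power_divide)
      ultimately show ?thesis using c0 by (simp add: N_def field_simps)
    qed
    then have I0: "I > 0" using V0 N0 by (metis less_le_trans zero_less_mult_pos)
    define k where "k = (\<lambda>y. (1 / I) * h y)"
    have Ib: "1 / I \<le> N / V" using VI I0 V0 by (simp add: field_simps)
    have smk: "smooth k" unfolding k_def by (intro smooth_mult smooth_const smh)
    have dk: "frechet_derivative k (at y) v = (1/I) * (1/\<epsilon>) * frechet_derivative \<eta> (at ((1/\<epsilon>) *\<^sub>R y)) v" for y v
    proof -
      have "((\<lambda>y. \<eta> ((1/\<epsilon>) *\<^sub>R y)) has_derivative (\<lambda>v. frechet_derivative \<eta> (at ((1/\<epsilon>) *\<^sub>R y)) ((1/\<epsilon>) *\<^sub>R v))) (at y)"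
        using diff_chain_at[OF bounded_linear_imp_has_derivative[OF bl] smooth_has_derivative[OF sm]]
        by (simp add: o_def)
      then have "(k has_derivative (\<lambda>v. (1/I) * frechet_derivative \<eta> (at ((1/\<epsilon>) *\<^sub>R y)) ((1/\<epsilon>) *\<^sub>R v))) (at y)"
        unfolding k_def h_def by (rule has_derivative_mult_right)
      then have "frechet_derivative k (at y) v = (1/I) * frechet_derivative \<eta> (at ((1/\<epsilon>) *\<^sub>R y)) ((1/\<epsilon>) *\<^sub>R v)"
        by (rule fun_cong[OF frechet_derivative_at, symmetric])
      then show ?thesis
        using linear_scale[OF smooth_linear_deriv[OF sm]] by simp
    qed
    have "mollifier C \<epsilon> k"
      unfolding mollifier_def
    proof (intro conjI allI impI)
      show "0 < \<epsilon>" "smooth k" by (fact e smk)+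
      show "0 \<le> k y" for y using I0 nonneg by (simp add: k_def h_def)
      show "k (- y) = k y" for y by (simp add: k_def h_def \<eta>_def)
      show "k y = 0" if "\<epsilon> \<le> norm y" for y using hz that by (simp add: k_def)
      show "integrable lborel k" unfolding k_def by (intro integrable_mult_right inth)
      show "integral\<^sup>L lborel k = 1" unfolding k_def using I0 by (simp add: I_def)
      show "k y \<le> C / measure lborel (ball (0::'a) \<epsilon>)" for y
      proof -
        have "k y \<le> 1 / I * 1" unfolding k_def h_def using I0 le1 by (intro mult_left_mono) auto
        also have "\<dots> \<le> N / V" using Ib by simp
        also have "\<dots> \<le> C / V" using V0 by (intro divide_right_mono) (auto simp: C_def)
        finally show ?thesis by (simp add: V_def)
      qed
      show "\<bar>frechet_derivative k (at y) v\<bar> \<le> C / (\<epsilon> * measure lborel (ball (0::'a) \<epsilon>)) * norm v" for y v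
      proof -
        have "\<bar>frechet_derivative k (at y) v\<bar> \<le> (1/I) * (1/\<epsilon>) * (D * norm v)"
          unfolding dk abs_mult using I0 e by (intro mult_mono D) auto
        also have "\<dots> \<le> (N / V) * (1/\<epsilon>) * (D * norm v)"
          using Ib D0 e by (intro mult_right_mono) auto
        also have "\<dots> = N * D / (\<epsilon> * V) * norm v" by (simp add: field_simps)
        also have "\<dots> \<le> C / (\<epsilon> * V) * norm v"
          using V0 e by (intro mult_right_mono divide_right_mono) (auto simp: C_def)
        finally show ?thesis by (simp add: V_def)
      qed
    qed
    then show "\<exists>k::'a \<Rightarrow> real. mollifier C \<epsilon> k" by (intro exI[of _ k])
  qed
qed

text \<open>
  Mean value theorem along the segment from \<open>x\<close> to \<open>x + h\<close>, together
  with uniform continuity of the gradient on a compact ball. Uniformity in \<open>x\<close> is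
  what allows differentiation under the convolution integral.
\<close>

lemma smooth_uniform_derivative:
  fixes f :: "'a::euclidean_space \<Rightarrow> real"
  assumes "smooth f" "0 < e"
  obtains d where "0 < d" "\<And>x h. norm x \<le> R \<Longrightarrow> norm h < d \<Longrightarrow>
    \<bar>f (x + h) - f x - frechet_derivative f (at x) h\<bar> \<le> e * norm h"
proof -
  define K where "K = cball (0::'a) (\<bar>R\<bar> + 1)"
  define e' where "e' = e / DIM('a)"
  have e': "e' > 0" using assms(2) by (simp add: e'_def)
  have "\<exists>d>0. \<forall>x\<in>K. \<forall>y\<in>K. dist y x < d \<longrightarrow>
      \<bar>frechet_derivative f (at y) b - frechet_derivative f (at x) b\<bar> < e'" for b
  proof -
    have "uniformly_continuous_on K (\<lambda>x. frechet_derivative f (at x) b)"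
      by (intro compact_uniformly_continuous smooth_continuous smooth_deriv assms) (simp add: K_def)
    then show ?thesis using e' unfolding uniformly_continuous_on_def by (simp add: dist_real_def)
  qed
  then obtain d where d: "\<And>b. d b > 0" "\<And>b x y. x \<in> K \<Longrightarrow> y \<in> K \<Longrightarrow> dist y x < d b \<Longrightarrow>
      \<bar>frechet_derivative f (at y) b - frechet_derivative f (at x) b\<bar> < e'" by metis
  define d0 where "d0 = min 1 (Min (d ` (Basis::'a set)))"
  have d0: "d0 > 0" unfolding d0_def using d(1) by (simp add: finite_Basis)
  have db: "d0 \<le> d b" if "b \<in> Basis" for b
    unfolding d0_def using that by (simp add: min.coboundedI2)
  show thesis
  proof (rule that[OF d0])
    fix x h :: 'a assume x: "norm x \<le> R" and h: "norm h < d0"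
    have "\<exists>t\<in>{0<..<1}. f (x + h) - f x = frechet_derivative f (at (x + t *\<^sub>R h)) h"
    proof -
      have "((\<lambda>t. f (x + t *\<^sub>R h)) has_derivative (\<lambda>s. frechet_derivative f (at (x + t *\<^sub>R h)) (s *\<^sub>R h))) (at t)" for t :: real
      proof -
        have "((\<lambda>t. x + t *\<^sub>R h) has_derivative (\<lambda>s. s *\<^sub>R h)) (at t)"
          by (auto intro!: derivative_eq_intros)
        from diff_chain_at[OF this smooth_has_derivative[OF assms(1)]] show ?thesis by (simp add: o_def)
      qed
      then have "\<And>t. ((\<lambda>t. f (x + t *\<^sub>R h)) has_derivative (\<lambda>s. frechet_derivative f (at (x + t *\<^sub>R h)) (s *\<^sub>R h))) (at t within {0..1})"
        by (rule has_derivative_at_withinI)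
      from mvt_simple[of 0 1 "\<lambda>t. f (x + t *\<^sub>R h)", OF _ this]
      show ?thesis by simp
    qed
    then obtain t where t: "0 < t" "t < 1" "f (x + h) - f x = frechet_derivative f (at (x + t *\<^sub>R h)) h" by auto
    let ?y = "x + t *\<^sub>R h"
    have th: "norm (t *\<^sub>R h) \<le> norm h" using t by (simp add: mult_left_le_one_le)
    have h1: "norm h < 1" using h by (simp add: d0_def)
    have K: "x \<in> K" "?y \<in> K"
      using x th h1 norm_triangle_ineq[of x "t *\<^sub>R h"] by (auto simp: K_def)
    have "\<bar>f (x + h) - f x - frechet_derivative f (at x) h\<bar>
        = \<bar>\<Sum>b\<in>Basis. (h \<bullet> b) * (frechet_derivative f (at ?y) b - frechet_derivative f (at x) b)\<bar>"
      unfolding t(3) frechet_sum[OF assms(1), of _ h]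
      by (simp add: sum_subtractf right_diff_distrib)
    also have "\<dots> \<le> (\<Sum>b\<in>Basis. \<bar>(h \<bullet> b) * (frechet_derivative f (at ?y) b - frechet_derivative f (at x) b)\<bar>)"
      by (rule sum_abs)
    also have "\<dots> \<le> (\<Sum>b\<in>(Basis::'a set). norm h * e')"
      unfolding abs_mult
    proof (intro sum_mono mult_mono)
      fix b :: 'a assume b: "b \<in> Basis"
      show "\<bar>h \<bullet> b\<bar> \<le> norm h" by (rule Basis_le_norm[OF b])
      have "dist ?y x < d b" using th h db[OF b] by (simp add: dist_norm)
      then show "\<bar>frechet_derivative f (at ?y) b - frechet_derivative f (at x) b\<bar> \<le> e'"
        using d(2)[OF K] by force
    qed auto
    also have "\<dots> = e * norm h" by (simp add: e'_def)
    finally show "\<bar>f (x + h) - f x - frechet_derivative f (at x) h\<bar> \<le> e * norm h" .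
  qed
qed

definition conv :: "('a::euclidean_space \<Rightarrow> real) \<Rightarrow> ('a \<Rightarrow> 'b::euclidean_space) \<Rightarrow> 'a \<Rightarrow> 'b" where
  "conv f w z = (\<integral>y. f (z - y) *\<^sub>R w y \<partial>lborel)"

lemma conv_integrable_compact:
  fixes w :: "'a::euclidean_space \<Rightarrow> 'b::euclidean_space"
  assumes f: "continuous_on UNIV f" and w: "integrable lborel w" "\<And>y. R < norm y \<Longrightarrow> w y = 0"
  shows "integrable lborel (\<lambda>y. f (z - y) *\<^sub>R w y)"
proof -
  have "compact (f ` cball z R)"
    using f by (intro compact_continuous_image) (auto intro: continuous_on_subset)
  then have "bounded (f ` cball z R)" by (rule compact_imp_bounded)
  then obtain M where "0 < M" "\<forall>x\<in>f ` cball z R. norm x \<le> M" unfolding bounded_pos by blast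
  then have M: "0 < M" "\<And>x. x \<in> cball z R \<Longrightarrow> \<bar>f x\<bar> \<le> M" by auto
  have fm: "(\<lambda>y. f (z - y)) \<in> borel_measurable borel"
    using f by (intro borel_measurable_continuous_onI continuous_on_compose2[of UNIV f UNIV "\<lambda>y. z - y"]) (auto intro!: continuous_intros)
  show ?thesis
  proof (rule Bochner_Integration.integrable_bound)
    show "integrable lborel (\<lambda>y. M *\<^sub>R w y)" using w by simp
    show "(\<lambda>y. f (z - y) *\<^sub>R w y) \<in> borel_measurable lborel"
      using fm w by measurable
    show "AE y in lborel. norm (f (z - y) *\<^sub>R w y) \<le> norm (M *\<^sub>R w y)"
    proof (rule AE_I2)
      fix y
      show "norm (f (z - y) *\<^sub>R w y) \<le> norm (M *\<^sub>R w y)"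
      proof (cases "norm y \<le> R")
        case True
        then have "\<bar>f (z - y)\<bar> \<le> M" by (intro M) (simp add: dist_norm)
        then show ?thesis using M(1) by (simp add: mult_right_mono)
      qed (use w(2)[of y] in auto)
    qed
  qed
qed

lemma conv_has_derivative_compact:
  fixes w :: "'a::euclidean_space \<Rightarrow> real"
  assumes f: "smooth f" and w: "integrable lborel w" "\<And>y. R < norm y \<Longrightarrow> w y = 0"
  shows "(conv f w has_derivative (\<lambda>v. conv (\<lambda>x. frechet_derivative f (at x) v) w z)) (at z)"
proof -
  have int: "integrable lborel (\<lambda>y. f (z - y) * w y)" for z
    using conv_integrable_compact[OF smooth_continuous[OF f] w] by simp
  have intd: "integrable lborel (\<lambda>y. frechet_derivative f (at (z - y)) v * w y)" for v
    using conv_integrable_compact[OF smooth_continuous[OF smooth_deriv[OF f]] w] by simp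
  note lin = smooth_linear_deriv[OF f]
  have linear: "linear (\<lambda>v. conv (\<lambda>x. frechet_derivative f (at x) v) w z)"
    by (rule linearI)
       (simp_all add: conv_def linear_add[OF lin] linear_scale[OF lin] distrib_right mult.assoc intd)
  define I where "I = (\<integral>y. \<bar>w y\<bar> \<partial>lborel)"
  have I0: "0 \<le> I" by (simp add: I_def)
  show ?thesis
    unfolding has_derivative_at_alt
  proof (intro conjI allI impI)
    show "bounded_linear (\<lambda>v. conv (\<lambda>x. frechet_derivative f (at x) v) w z)"
      using linear by (simp add: linear_conv_bounded_linear)
    fix e :: real assume e: "0 < e"
    obtain d where d: "0 < d" "\<And>x h. norm x \<le> norm z + R \<Longrightarrow> norm h < d \<Longrightarrow>
        \<bar>f (x + h) - f x - frechet_derivative f (at x) h\<bar> \<le> e / (I + 1) * norm h"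
      using smooth_uniform_derivative[OF f, of "e / (I + 1)"] e I0
      by (metis add_nonneg_pos divide_pos_pos zero_less_one)
    have "norm (conv f w (z + h) - conv f w z - conv (\<lambda>x. frechet_derivative f (at x) h) w z) \<le> e * norm h"
      if h: "norm h < d" for h
    proof -
      have eq: "(f (z - y + h) - f (z - y) - frechet_derivative f (at (z - y)) h) * w y
          = f (z + h - y) * w y - f (z - y) * w y - frechet_derivative f (at (z - y)) h * w y" for y
        by (simp add: left_diff_distrib diff_add_eq)
      have "conv f w (z + h) - conv f w z - conv (\<lambda>x. frechet_derivative f (at x) h) w z
          = (\<integral>y. (f (z - y + h) - f (z - y) - frechet_derivative f (at (z - y)) h) * w y \<partial>lborel)"
        unfolding eq using int[of "z + h"] int[of z] intd[of h] by (simp add: conv_def)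
      also have "norm \<dots> \<le> (\<integral>y. e / (I + 1) * norm h * \<bar>w y\<bar> \<partial>lborel)"
      proof (rule order_trans, rule integral_norm_bound, rule integral_mono)
        show "integrable lborel (\<lambda>y. norm ((f (z - y + h) - f (z - y) - frechet_derivative f (at (z - y)) h) * w y))"
          unfolding eq by (intro integrable_norm Bochner_Integration.integrable_diff int intd)
        show "integrable lborel (\<lambda>y. e / (I + 1) * norm h * \<bar>w y\<bar>)" using w by simp
        fix y
        show "norm ((f (z - y + h) - f (z - y) - frechet_derivative f (at (z - y)) h) * w y) \<le> e / (I + 1) * norm h * \<bar>w y\<bar>"
        proof (cases "norm y \<le> R")
          case True
          then have "norm (z - y) \<le> norm z + R" using norm_triangle_ineq4[of z y] by linarith
          from mult_right_mono[OF d(2)[OF this h] abs_ge_zero[of "w y"]] show ?thesis by (simp only: real_norm_def abs_mult)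
        qed (use w(2)[of y] in auto)
      qed
      also have "\<dots> = e / (I + 1) * norm h * I" by (simp add: I_def)
      also have "\<dots> \<le> e * norm h" 
      proof -
        have "e * norm h * (I / (I + 1)) \<le> e * norm h * 1"
          using e I0 by (intro mult_left_mono) auto
        then show ?thesis by simp
      qed
      finally show ?thesis .
    qed
    from this[of "_ - z"] show "\<exists>d>0. \<forall>y. norm (y - z) < d \<longrightarrow>
        norm (conv f w y - conv f w z - conv (\<lambda>x. frechet_derivative f (at x) (y - z)) w z) \<le> e * norm (y - z)"
      using d(1) by (intro exI[of _ d] conjI allI impI) (simp_all add: algebra_simps)
  qed
qed

definition locally_L1 :: "('a::euclidean_space \<Rightarrow> 'b::euclidean_space) \<Rightarrow> bool" where
  "locally_L1 w \<longleftrightarrow> (\<forall>R. integrable lborel (\<lambda>y. indicator (cball 0 R) y *\<^sub>R w y))"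

text \<open>
  Near a point the convolution sees only a bounded part of \<open>w\<close>. This reduces
  periodic and other merely locally integrable functions to integrable functions with bounded
  support.
\<close>

lemma conv_localise:
  fixes w :: "'a::euclidean_space \<Rightarrow> 'b::euclidean_space"
  assumes "(\<forall>x. R \<le> norm x \<longrightarrow> f x = 0) \<or> (\<forall>x. R \<le> norm x \<longrightarrow> w x = 0)" "norm z < S"
  shows "conv f w z = conv f (\<lambda>y. indicator (cball 0 (\<bar>R\<bar> + S)) y *\<^sub>R w y) z"
proof -
  have "f (z - y) *\<^sub>R w y = f (z - y) *\<^sub>R indicator (cball 0 (\<bar>R\<bar> + S)) y *\<^sub>R w y" for y
  proof (cases "norm y \<le> \<bar>R\<bar> + S")
    case False
    moreover have "norm y - norm z \<le> norm (z - y)"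
      using norm_triangle_ineq2[of y z] by (simp add: norm_minus_commute)
    ultimately have "R \<le> norm (z - y)" "R \<le> norm y"
      using assms(2) norm_ge_zero[of z] by linarith+
    then show ?thesis using assms(1) by auto
  qed simp
  then show ?thesis unfolding conv_def by (intro Bochner_Integration.integral_cong refl)
qed

lemma conv_has_derivative:
  fixes w :: "'a::euclidean_space \<Rightarrow> real"
  assumes f: "smooth f" and w: "locally_L1 w"
    and supp: "(\<forall>x. R \<le> norm x \<longrightarrow> f x = 0) \<or> (\<forall>x. R \<le> norm x \<longrightarrow> w x = 0)"
  shows "(conv f w has_derivative (\<lambda>v. conv (\<lambda>x. frechet_derivative f (at x) v) w z)) (at z)"
proof -
  let ?S = "norm z + 1"
  let ?R = "\<bar>R\<bar> + 1 + ?S"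
  let ?w = "\<lambda>y. indicator (cball 0 ?R) y *\<^sub>R w y"
  have supp': "(\<forall>x. \<bar>R\<bar> + 1 \<le> norm x \<longrightarrow> frechet_derivative f (at x) v = 0) \<or> (\<forall>x. \<bar>R\<bar> + 1 \<le> norm x \<longrightarrow> w x = 0)" for v
    using supp
  proof
    assume *: "\<forall>x. R \<le> norm x \<longrightarrow> f x = 0"
    have "frechet_derivative f (at x) v = 0" if "\<bar>R\<bar> + 1 \<le> norm x" for x
      by (rule deriv_zero_outside[of "- cball 0 \<bar>R\<bar>"]) (use that * in auto)
    then show ?thesis by auto
  qed auto
  have supp'': "(\<forall>x. \<bar>R\<bar> + 1 \<le> norm x \<longrightarrow> f x = 0) \<or> (\<forall>x. \<bar>R\<bar> + 1 \<le> norm x \<longrightarrow> w x = 0)"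
    using supp by auto
  have loc: "conv f w z' = conv f ?w z'" if "norm z' < ?S" for z'
    using conv_localise[OF supp'' that] by simp
  have locd: "conv (\<lambda>x. frechet_derivative f (at x) v) w z = conv (\<lambda>x. frechet_derivative f (at x) v) ?w z" for v
    using conv_localise[OF supp', of z ?S] by simp
  have "(conv f ?w has_derivative (\<lambda>v. conv (\<lambda>x. frechet_derivative f (at x) v) ?w z)) (at z)"
    by (rule conv_has_derivative_compact[OF f, of _ ?R]) (use w in \<open>auto simp: locally_L1_def\<close>)
  then have "(conv f w has_derivative (\<lambda>v. conv (\<lambda>x. frechet_derivative f (at x) v) ?w z)) (at z)"
    by (rule has_derivative_transform_within_open[OF _ open_ball[of 0 ?S]]) (auto simp: loc)
  then show ?thesis by (simp add: locd)
qed

lemma conv_smooth: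
  fixes w :: "'a::euclidean_space \<Rightarrow> real"
  assumes f: "smooth f" and w: "locally_L1 w"
    and supp: "(\<forall>x. R \<le> norm x \<longrightarrow> f x = 0) \<or> (\<forall>x. R \<le> norm x \<longrightarrow> w x = 0)"
  shows "smooth (conv f w)"
proof -
  have "C_k k (conv f w)" for k
    using f supp
  proof (induction k arbitrary: f R)
    case 0
    then show ?case
      using conv_has_derivative[OF 0(1) w 0(2)]
      by (auto intro!: continuous_at_imp_continuous_on has_derivative_continuous)
  next
    case (Suc k)
    show ?case
    proof (rule C_k_SucI)
      show "(conv f w has_derivative (\<lambda>v. conv (\<lambda>x. frechet_derivative f (at x) v) w z)) (at z)" for z
        by (rule conv_has_derivative[OF Suc.prems(1) w Suc.prems(2)])
      have "(\<forall>x. \<bar>R\<bar> + 1 \<le> norm x \<longrightarrow> frechet_derivative f (at x) v = 0) \<or> (\<forall>x. \<bar>R\<bar> + 1 \<le> norm x \<longrightarrow> w x = 0)" for v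
        using Suc.prems(2)
      proof
        assume *: "\<forall>x. R \<le> norm x \<longrightarrow> f x = 0"
        have "frechet_derivative f (at x) v = 0" if "\<bar>R\<bar> + 1 \<le> norm x" for x
          by (rule deriv_zero_outside[of "- cball 0 \<bar>R\<bar>"]) (use that * in auto)
        then show ?thesis by auto
      qed auto
      then show "C_k k (\<lambda>z. conv (\<lambda>x. frechet_derivative f (at x) v) w z)" for v
        using Suc.IH[OF smooth_deriv[OF Suc.prems(1)]] by blast
    qed
  qed
  then show ?thesis by (simp add: smooth_def)
qed

lemma conv_deriv:
  fixes w :: "'a::euclidean_space \<Rightarrow> real"
  assumes f: "smooth f" and w: "locally_L1 w"
    and supp: "(\<forall>x. R \<le> norm x \<longrightarrow> f x = 0) \<or> (\<forall>x. R \<le> norm x \<longrightarrow> w x = 0)"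
  shows "frechet_derivative (conv f w) (at z) v = conv (\<lambda>x. frechet_derivative f (at x) v) w z"
  by (rule fun_cong[OF frechet_derivative_at[OF conv_has_derivative[OF assms]], symmetric])

section \<open>Integration of periodic functions\<close>

lemma lborel_distr_affine:
  assumes "\<bar>c\<bar> = 1"
  shows "distr lborel borel (\<lambda>x::'a::euclidean_space. t + c *\<^sub>R x) = lborel"
  using lborel_affine[of c t] assms by (auto simp: density_1)

lemma nn_integral_lborel_affine:
  fixes f :: "'a::euclidean_space \<Rightarrow> ennreal"
  assumes "f \<in> borel_measurable borel" "\<bar>c\<bar> = 1"
  shows "(\<integral>\<^sup>+x. f (t + c *\<^sub>R x) \<partial>lborel) = (\<integral>\<^sup>+x. f x \<partial>lborel)"
  using nn_integral_distr[of "\<lambda>x. t + c *\<^sub>R x" lborel borel f] assms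
  by (simp add: lborel_distr_affine)

lemma integral_lborel_affine:
  fixes f :: "'a::euclidean_space \<Rightarrow> 'b::euclidean_space"
  assumes "f \<in> borel_measurable borel" "\<bar>c\<bar> = 1"
  shows "(\<integral>x. f (t + c *\<^sub>R x) \<partial>lborel) = (\<integral>x. f x \<partial>lborel)"
  using integral_distr[of "\<lambda>x. t + c *\<^sub>R x" lborel borel f] assms
  by (simp add: lborel_distr_affine)

lemma integrable_lborel_affine:
  fixes f :: "'a::euclidean_space \<Rightarrow> 'b::euclidean_space"
  assumes "f \<in> borel_measurable borel" "\<bar>c\<bar> = 1"
  shows "integrable lborel (\<lambda>x. f (t + c *\<^sub>R x)) \<longleftrightarrow> integrable lborel f"
  using integrable_distr_eq[of "\<lambda>x. t + c *\<^sub>R x" lborel borel f] assms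
  by (simp add: lborel_distr_affine)

text \<open>
  All real times are included, although the fields of interest vanish outside
  \<open>(0,T)\<close>: shifts and convolutions in time are then defined everywhere, and the
  measure is invariant under all space-time translations of periodic functions.
\<close>

definition torus :: "(real \<times> (real^'d)) measure" where
  "torus = density lborel (indicator (UNIV \<times> cell))"

definition slab :: "real \<Rightarrow> real \<Rightarrow> (real \<times> (real^'d)) measure" where
  "slab a b = density lborel (indicator ({a..b} \<times> cell))"

definition sper :: "(real \<times> (real^'d) \<Rightarrow> 'b) \<Rightarrow> bool" where
  "sper f \<longleftrightarrow> (\<forall>z i. f (z + (0, axis i 1)) = f z)"

lemma cell_measurable[measurable]: "cell \<in> sets borel" by (simp add: cell_def)

lemma slab_set_measurable[measurable]:
  "{a..b::real} \<times> (cell :: (real^'d) set) \<in> sets borel" "UNIV \<times> (cell :: (real^'d) set) \<in> sets (borel :: (real \<times> (real^'d)) measure)"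
proof -
  show "{a..b} \<times> (cell :: (real^'d) set) \<in> sets borel"
    by (intro borel_closed closed_Times) (auto simp: cell_def)
  show "UNIV \<times> (cell :: (real^'d) set) \<in> sets (borel :: (real \<times> (real^'d)) measure)"
    by (intro borel_closed closed_Times) (auto simp: cell_def)
qed

lemma sets_torus[simp, measurable_cong]: "sets torus = sets borel"
  and sets_slab[simp, measurable_cong]: "sets (slab a b) = sets borel"
  and space_torus[simp]: "space torus = UNIV"
  and space_slab[simp]: "space (slab a b) = UNIV"
  by (simp_all add: torus_def slab_def)

lemma nn_integral_torus:
  "f \<in> borel_measurable borel \<Longrightarrow> (\<integral>\<^sup>+z. f z \<partial>torus) = (\<integral>\<^sup>+z. indicator (UNIV \<times> cell) z * f z \<partial>lborel)"
  and nn_integral_slab: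
  "f \<in> borel_measurable borel \<Longrightarrow> (\<integral>\<^sup>+z. f z \<partial>slab a b) = (\<integral>\<^sup>+z. indicator ({a..b} \<times> cell) z * f z \<partial>lborel)"
  by (simp_all add: torus_def slab_def nn_integral_density)

lemma nn_integral_slab_le_torus:
  assumes "f \<in> borel_measurable borel"
  shows "(\<integral>\<^sup>+z. f z \<partial>slab a b) \<le> (\<integral>\<^sup>+z. f z \<partial>torus)"
  unfolding nn_integral_slab[OF assms] nn_integral_torus[OF assms]
  by (intro nn_integral_mono mult_right_mono) (auto simp: indicator_def)

lemma torus_integral_eq:
  fixes f :: "real \<times> (real^'d) \<Rightarrow> 'b::euclidean_space"
  assumes "f \<in> borel_measurable borel"
  shows "integral\<^sup>L torus f = (\<integral>z. indicator (UNIV \<times> cell) z *\<^sub>R f z \<partial>lborel)"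
    and "integrable torus f \<longleftrightarrow> integrable lborel (\<lambda>z. indicator (UNIV \<times> cell) z *\<^sub>R f z)"
proof -
  have "torus = density lborel (\<lambda>z. ennreal (indicator (UNIV \<times> cell) z))"
    by (simp add: torus_def ennreal_indicator)
  note eq = this
  show "integral\<^sup>L torus f = (\<integral>z. indicator (UNIV \<times> cell) z *\<^sub>R f z \<partial>lborel)"
    unfolding eq using assms by (intro integral_density) auto
  show "integrable torus f \<longleftrightarrow> integrable lborel (\<lambda>z. indicator (UNIV \<times> cell) z *\<^sub>R f z)"
    unfolding eq using assms by (intro integrable_density) auto
qed

lemma slab_integral_eq:
  fixes f :: "real \<times> (real^'d) \<Rightarrow> 'b::euclidean_space"
  assumes "f \<in> borel_measurable borel"
  shows "integral\<^sup>L (slab a b) f = (\<integral>z. indicator ({a..b} \<times> cell) z *\<^sub>R f z \<partial>lborel)"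
    and "integrable (slab a b) f \<longleftrightarrow> integrable lborel (\<lambda>z. indicator ({a..b} \<times> cell) z *\<^sub>R f z)"
proof -
  have "slab a b = density lborel (\<lambda>z. ennreal (indicator ({a..b} \<times> cell) z))"
    by (simp add: slab_def ennreal_indicator)
  note eq = this
  show "integral\<^sup>L (slab a b) f = (\<integral>z. indicator ({a..b} \<times> cell) z *\<^sub>R f z \<partial>lborel)"
    unfolding eq using assms by (intro integral_density) auto
  show "integrable (slab a b) f \<longleftrightarrow> integrable lborel (\<lambda>z. indicator ({a..b} \<times> cell) z *\<^sub>R f z)"
    unfolding eq using assms by (intro integrable_density) auto
qed

lemma torus_slab:
  fixes f :: "real \<times> (real^'d) \<Rightarrow> 'b::euclidean_space"
  assumes "f \<in> borel_measurable borel" "\<And>z. fst z \<notin> {a..b} \<Longrightarrow> f z = 0"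
  shows "integral\<^sup>L torus f = integral\<^sup>L (slab a b) f" "integrable torus f \<longleftrightarrow> integrable (slab a b) f"
proof -
  have "(\<lambda>z. indicator (UNIV \<times> cell) z *\<^sub>R f z) = (\<lambda>z. indicator ({a..b} \<times> cell) z *\<^sub>R f z)"
  proof
    show "indicator (UNIV \<times> cell) z *\<^sub>R f z = indicator ({a..b} \<times> cell) z *\<^sub>R f z" for z
      using assms(2)[of z] by (cases z) (auto simp: indicator_def)
  qed
  then show "integral\<^sup>L torus f = integral\<^sup>L (slab a b) f" "integrable torus f \<longleftrightarrow> integrable (slab a b) f"
    by (simp_all add: torus_integral_eq[OF assms(1)] slab_integral_eq[OF assms(1)])
qed

lemma finite_measure_slab: "finite_measure (slab a b :: (real \<times> (real^'d)) measure)"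
proof
  have "{a..b} \<times> (cell :: (real^'d) set) = cbox (a, 0) (b, 1)"
    by (simp add: cbox_Pair_eq cell_def)
  then have "emeasure lborel ({a..b} \<times> (cell :: (real^'d) set)) < \<infinity>"
    using emeasure_lborel_cbox_finite[of "(a, 0)" "(b, 1)"] by simp
  then show "emeasure (slab a b) (space (slab a b :: (real \<times> (real^'d)) measure)) \<noteq> \<infinity>"
    by (simp add: slab_def emeasure_density)
qed

lemma sigma_finite_torus: "sigma_finite_measure (torus :: (real \<times> (real^'d)) measure)"
  unfolding torus_def
  by (subst sigma_finite_measure.sigma_finite_iff_density_finite[OF sigma_finite_lborel]) (auto simp: indicator_def)

lemma sigma_finite_slab: "sigma_finite_measure (slab a b :: (real \<times> (real^'d)) measure)"
  using finite_measure_slab finite_measure.axioms(1) by blast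

definition lattice :: "(real^'d) set" where
  "lattice = range (\<lambda>g. \<chi> i. of_int (g i))"

lemma lattice_countable: "countable (lattice :: (real^'d) set)"
  by (simp add: lattice_def)

lemma lattice_finite: "finite {k \<in> (lattice :: (real^'d) set). norm k \<le> R}"
proof (rule finite_subset)
  show "{k \<in> (lattice :: (real^'d) set). norm k \<le> R} \<subseteq> (\<lambda>g. \<chi> i. of_int (g i)) ` (\<Pi>\<^sub>E i\<in>UNIV. {-\<lceil>R\<rceil>..\<lceil>R\<rceil>})"
  proof
    fix k :: "real^'d" assume "k \<in> {k \<in> lattice. norm k \<le> R}"
    then obtain g where g: "k = (\<chi> i. of_int (g i))" "norm k \<le> R" by (auto simp: lattice_def)
    have "\<bar>real_of_int (g i)\<bar> \<le> R" for i
      using component_le_norm_cart[of k i] g by simp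
    then have "\<bar>g i\<bar> \<le> \<lceil>R\<rceil>" for i
      by (metis le_of_int_ceiling of_int_abs of_int_le_iff order_trans)
    then have "g \<in> (\<Pi>\<^sub>E i\<in>UNIV. {-\<lceil>R\<rceil>..\<lceil>R\<rceil>})" by (auto simp: abs_le_iff minus_le_iff)
    then show "k \<in> (\<lambda>g. \<chi> i. of_int (g i)) ` (\<Pi>\<^sub>E i\<in>UNIV. {-\<lceil>R\<rceil>..\<lceil>R\<rceil>})" using g by blast
  qed
  show "finite ((\<lambda>g. (\<chi> i. of_int (g i))::real^'d) ` (\<Pi>\<^sub>E i\<in>UNIV. {-\<lceil>R\<rceil>..\<lceil>R\<rceil>}))"
    by (intro finite_imageI finite_PiE) auto
qed

lemma sper_int:
  assumes "sper f" shows "f (z + (0, of_int n *\<^sub>R axis i 1)) = f z"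
proof -
  have one: "f (w + (0, axis j 1)) = f w" for w j using assms unfolding sper_def by blast
  show ?thesis
proof (induction n arbitrary: z rule: int_induct[where k=0])
  case base then show ?case by (simp add: zero_prod_def[symmetric])
next
  case (step1 n)
  have "z + (0, of_int (n + 1) *\<^sub>R axis i 1) = (z + (0, of_int n *\<^sub>R axis i 1)) + (0, axis i 1)"
    by (simp add: scaleR_add_left add.assoc)
  then show ?case using step1(2) by (simp only: one)
next
  case (step2 n)
  have "z + (0, of_int n *\<^sub>R axis i 1) = (z + (0, of_int (n - 1) *\<^sub>R axis i 1)) + (0, axis i 1)"
    by (simp add: scaleR_diff_left add.assoc)
  then show ?case using step2(2)[of z] one[of "z + (0, of_int (n - 1) *\<^sub>R axis i 1)" i] by argo
qed
qed

lemma sper_lattice: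
  assumes "sper f" "k \<in> lattice" shows "f (z + (0, k)) = f z"
proof -
  obtain g where g: "k = (\<chi> i. of_int (g i))" using assms(2) by (auto simp: lattice_def)
  have "f (z + (0, \<Sum>i\<in>I. of_int (g i) *\<^sub>R axis i 1)) = f z" if "finite I" for I
    using that
  proof (induction I arbitrary: z)
    case empty then show ?case by (simp add: zero_prod_def[symmetric])
  next
    case (insert i I)
    have "z + (0, \<Sum>i\<in>insert i I. of_int (g i) *\<^sub>R axis i 1)
        = (z + (0, of_int (g i) *\<^sub>R axis i 1)) + (0, \<Sum>i\<in>I. of_int (g i) *\<^sub>R axis i 1)"
      using insert by (simp add: add.assoc)
    then show ?case by (simp only: insert.IH sper_int[OF assms(1)])
  qed
  from this[of UNIV] have "f (z + (0, \<Sum>i\<in>UNIV. of_int (g i) *\<^sub>R axis i 1)) = f z" by simp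
  moreover have "(\<Sum>i\<in>UNIV. of_int (g i) *\<^sub>R axis i 1) = k"
    using basis_expansion[of k] by (simp add: g scalar_mult_eq_scaleR)
  ultimately show ?thesis by simp
qed

text \<open>
  The half-open cell: its lattice translates tile the space without overlap, whereas those of
  the closed cell overlap on faces.
\<close>

definition hcell :: "(real^'d) set" where "hcell = {x. \<forall>i. 0 \<le> x $ i \<and> x $ i < 1}"

definition vfloor :: "real^'d \<Rightarrow> real^'d" where "vfloor x = (\<chi> i. of_int \<lfloor>x $ i\<rfloor>)"

lemma vfloor_lattice: "vfloor x \<in> lattice" by (auto simp: vfloor_def lattice_def)

lemma hcell_vfloor: "k \<in> lattice \<Longrightarrow> x - k \<in> hcell \<longleftrightarrow> k = vfloor x"
proof -
  assume "k \<in> lattice"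
  then obtain g where g: "k = (\<chi> i. of_int (g i))" by (auto simp: lattice_def)
  have "x - k \<in> hcell \<longleftrightarrow> (\<forall>i. \<lfloor>x $ i\<rfloor> = g i)"
    by (auto simp: hcell_def g floor_eq_iff algebra_simps)
  then show ?thesis by (auto simp: g vfloor_def vec_eq_iff)
qed

lemma hcell_measurable[measurable]: "hcell \<in> sets (borel :: (real^'d) measure)"
proof -
  have "hcell = (\<Inter>i. {x :: real^'d. 0 \<le> x $ i \<and> x $ i < 1})" by (auto simp: hcell_def)
  moreover have "{x :: real^'d. 0 \<le> x $ i \<and> x $ i < 1} \<in> sets borel" for i by measurable
  then have "(\<Inter>i\<in>UNIV. {x :: real^'d. 0 \<le> x $ i \<and> x $ i < 1}) \<in> sets borel"
    by (intro sets.finite_INT) auto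
  ultimately show ?thesis by simp
qed

lemma AE_hcell: "AE z in (lborel :: (real \<times> (real^'d)) measure). z \<in> UNIV \<times> cell \<longleftrightarrow> snd z \<in> hcell"
proof -
  have "AE z in (lborel :: (real \<times> (real^'d)) measure). snd z $ i \<noteq> 1" for i
  proof -
    have b: "(0, axis i 1) \<in> (Basis :: (real \<times> (real^'d)) set)"
      by (auto simp: Basis_prod_def Basis_vec_def)
    have "negligible {z :: real \<times> (real^'d). z \<bullet> (0, axis i 1) = 1}"
      by (rule negligible_standard_hyperplane[OF b])
    then have "{z :: real \<times> (real^'d). z \<bullet> (0, axis i 1) = 1} \<in> null_sets lebesgue"
      by (simp add: negligible_iff_null_sets)
    then have "AE z in (lebesgue :: (real \<times> (real^'d)) measure). z \<notin> {z. z \<bullet> (0, axis i 1) = 1}"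
      by (rule AE_not_in)
    then show ?thesis by (simp add: AE_completion_iff inner_prod_def inner_axis)
  qed
  then have "AE z in (lborel :: (real \<times> (real^'d)) measure). \<forall>i. snd z $ i \<noteq> 1"
    by (intro AE_all_countable[THEN iffD2]) auto
  then show ?thesis
    by eventually_elim (force simp: cell_def hcell_def mem_box_cart less_le)
qed

lemma nn_integral_torus_hcell:
  fixes f :: "real \<times> (real^'d) \<Rightarrow> ennreal"
  assumes "f \<in> borel_measurable borel"
  shows "(\<integral>\<^sup>+z. f z \<partial>torus) = (\<integral>\<^sup>+z. indicator hcell (snd z) * f z \<partial>lborel)"
  unfolding nn_integral_torus[OF assms]
  by (rule nn_integral_cong_AE) (use AE_hcell in \<open>eventually_elim, auto simp: indicator_def\<close>)

lemma borel_snd[measurable]: "(snd :: real \<times> (real^'d) \<Rightarrow> _) \<in> borel_measurable borel"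
  and borel_fst[measurable]: "(fst :: real \<times> (real^'d) \<Rightarrow> _) \<in> borel_measurable borel"
  by (intro borel_measurable_continuous_onI continuous_intros)+

lemma nn_integral_hcell_sum:
  fixes x :: "real^'d"
  shows "(\<integral>\<^sup>+k. indicator hcell (x - k) \<partial>count_space lattice) = 1"
proof -
  have "(\<integral>\<^sup>+k. indicator hcell (x - k) \<partial>count_space lattice) = (\<integral>\<^sup>+k. indicator {vfloor x} k \<partial>count_space lattice)"
    by (intro nn_integral_cong) (auto simp: indicator_def hcell_vfloor)
  also have "\<dots> = 1" by (simp add: vfloor_lattice)
  finally show ?thesis .
qed

text \<open>
  A translate of the cell is cut along the lattice and its pieces are moved back into the cell
  by lattice vectors; periodicity makes the integrand blind to these moves.
\<close>

lemma nn_integral_torus_translate: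
  fixes f :: "real \<times> (real^'d) \<Rightarrow> ennreal"
  assumes f[measurable]: "f \<in> borel_measurable borel" and per: "sper f"
  shows "(\<integral>\<^sup>+z. f (z + y) \<partial>torus) = (\<integral>\<^sup>+z. f z \<partial>torus)"
proof -
  have neg: "k \<in> lattice \<Longrightarrow> - k \<in> lattice" for k :: "real^'d"
  proof -
    assume "k \<in> lattice"
    then obtain g where "k = (\<chi> i. of_int (g i))" by (auto simp: lattice_def)
    then have "- k = (\<chi> i. of_int (- g i))" by (simp add: vec_eq_iff)
    then show "- k \<in> lattice" unfolding lattice_def by (metis rangeI)
  qed
  have "(\<integral>\<^sup>+z. f (z + y) \<partial>torus) = (\<integral>\<^sup>+z. indicator hcell (snd z) * f (z + y) \<partial>lborel)"
    by (rule nn_integral_torus_hcell) measurable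
  also have "\<dots> = (\<integral>\<^sup>+z. indicator hcell (snd (z - y)) * f z \<partial>lborel)"
    using nn_integral_lborel_affine[of "\<lambda>z. indicator hcell (snd (z - y)) * f z" 1 y] by (simp add: add.commute)
  also have "\<dots> = (\<integral>\<^sup>+z. (\<integral>\<^sup>+k. indicator hcell (snd z - k) * (indicator hcell (snd (z - y)) * f z) \<partial>count_space lattice) \<partial>lborel)"
    by (intro nn_integral_cong) (simp add: nn_integral_multc nn_integral_hcell_sum)
  also have "\<dots> = (\<integral>\<^sup>+k. (\<integral>\<^sup>+z. indicator hcell (snd z - k) * (indicator hcell (snd (z - y)) * f z) \<partial>lborel) \<partial>count_space lattice)"
    by (rule nn_integral_count_space_nn_integral[OF lattice_countable]) measurable
  also have "\<dots> = (\<integral>\<^sup>+k. (\<integral>\<^sup>+z. indicator hcell (snd z) * (indicator hcell (snd (z - y) + k) * f z) \<partial>lborel) \<partial>count_space lattice)"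
  proof (rule nn_integral_cong)
    fix k :: "real^'d" assume "k \<in> space (count_space lattice)"
    then have k: "k \<in> lattice" by simp
    have "(\<integral>\<^sup>+z. indicator hcell (snd z - k) * (indicator hcell (snd (z - y)) * f z) \<partial>lborel)
       = (\<integral>\<^sup>+z. indicator hcell (snd (z + (0, k)) - k) * (indicator hcell (snd (z + (0, k) - y)) * f (z + (0, k))) \<partial>lborel)"
      using nn_integral_lborel_affine[of "\<lambda>z. indicator hcell (snd z - k) * (indicator hcell (snd (z - y)) * f z)" 1 "(0, k)"]
      by (simp add: add.commute)
    also have "\<dots> = (\<integral>\<^sup>+z. indicator hcell (snd z) * (indicator hcell (snd (z - y) + k) * f z) \<partial>lborel)"
      using sper_lattice[OF per k] by (simp add: algebra_simps)
    finally show "(\<integral>\<^sup>+z. indicator hcell (snd z - k) * (indicator hcell (snd (z - y)) * f z) \<partial>lborel)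
       = (\<integral>\<^sup>+z. indicator hcell (snd z) * (indicator hcell (snd (z - y) + k) * f z) \<partial>lborel)" .
  qed
  also have "\<dots> = (\<integral>\<^sup>+z. (\<integral>\<^sup>+k. indicator hcell (snd z) * (indicator hcell (snd (z - y) + k) * f z) \<partial>count_space lattice) \<partial>lborel)"
    by (rule nn_integral_count_space_nn_integral[symmetric, OF lattice_countable]) measurable
  also have "\<dots> = (\<integral>\<^sup>+z. indicator hcell (snd z) * f z \<partial>lborel)"
  proof (rule nn_integral_cong)
    fix z :: "real \<times> (real^'d)"
    have "(\<integral>\<^sup>+k. indicator hcell (x + k) \<partial>count_space lattice) = 1" for x :: "real^'d"
    proof -
      have "(\<integral>\<^sup>+k. indicator hcell (x + k) \<partial>count_space lattice) = (\<integral>\<^sup>+k. indicator {- vfloor x} k \<partial>count_space lattice)"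
      proof (intro nn_integral_cong)
        fix k :: "real^'d" assume "k \<in> space (count_space lattice)"
        then have "x - (- k) \<in> hcell \<longleftrightarrow> - k = vfloor x" using neg by (intro hcell_vfloor) auto
        then show "indicator hcell (x + k) = (indicator {- vfloor x} k :: ennreal)"
        proof (cases "- k = vfloor x")
          case True
          then have "k = - vfloor x" by (metis minus_minus)
          then show ?thesis using \<open>x - (- k) \<in> hcell \<longleftrightarrow> - k = vfloor x\<close> by simp
        next
          case False
          then have "k \<noteq> - vfloor x" by auto
          then show ?thesis using \<open>x - (- k) \<in> hcell \<longleftrightarrow> - k = vfloor x\<close> False by (simp add: indicator_def)
        qed
      qed
      also have "\<dots> = 1" by (simp add: vfloor_lattice neg)
      finally show ?thesis .
    qed
    then show "(\<integral>\<^sup>+k. indicator hcell (snd z) * (indicator hcell (snd (z - y) + k) * f z) \<partial>count_space lattice)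
        = indicator hcell (snd z) * f z"
      by (simp add: nn_integral_cmult nn_integral_multc)
  qed
  also have "\<dots> = (\<integral>\<^sup>+z. f z \<partial>torus)" by (rule nn_integral_torus_hcell[OF f, symmetric])
  finally show ?thesis .
qed

lemma integrable_torus_translate:
  fixes f :: "real \<times> (real^'d) \<Rightarrow> 'b::euclidean_space"
  assumes f: "integrable torus f" and per: "sper f"
  shows "integrable torus (\<lambda>z. f (z + y))"
proof -
  have [measurable]: "f \<in> borel_measurable borel" using f by (auto dest: borel_measurable_integrable)
  have "sper (\<lambda>z. ennreal (norm (f z)))" using per by (simp add: sper_def)
  from nn_integral_torus_translate[OF _ this, of y]
  have "(\<integral>\<^sup>+z. norm (f (z + y)) \<partial>torus) = (\<integral>\<^sup>+z. norm (f z) \<partial>torus)" by simp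
  then show ?thesis using f by (simp add: integrable_iff_bounded)
qed

lemma integral_torus_translate:
  fixes f :: "real \<times> (real^'d) \<Rightarrow> real"
  assumes f: "integrable torus f" and per: "sper f"
  shows "(\<integral>z. f (z + y) \<partial>torus) = (\<integral>z. f z \<partial>torus)"
proof -
  have [measurable]: "f \<in> borel_measurable borel" using f by (auto dest: borel_measurable_integrable)
  have 1: "sper (\<lambda>z. ennreal (f z))" and 2: "sper (\<lambda>z. ennreal (- f z))" using per by (simp_all add: sper_def)
  show ?thesis
    using nn_integral_torus_translate[OF _ 1, of y] nn_integral_torus_translate[OF _ 2, of y]
    by (simp add: real_lebesgue_integral_def f integrable_torus_translate[OF f per])
qed

text \<open>
  A ball meets finitely many lattice translates of the cell.
\<close>

lemma locally_L1_of_torus: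
  fixes f :: "real \<times> (real^'d) \<Rightarrow> 'b::euclidean_space"
  assumes f: "integrable torus f" and per: "sper f"
  shows "locally_L1 f"
  unfolding locally_L1_def
proof
  fix R :: real
  have [measurable]: "f \<in> borel_measurable borel" using f by (auto dest: borel_measurable_integrable)
  define g where "g z = ennreal (norm (f z))" for z
  have [measurable]: "g \<in> borel_measurable borel" by (simp add: g_def[abs_def])
  have perg: "sper g" using per by (simp add: sper_def g_def)
  define F where "F = {k \<in> (lattice :: (real^'d) set). norm k \<le> R + real CARD('d)}"
  have finF: "finite F" unfolding F_def by (rule lattice_finite)
  have each: "(\<integral>\<^sup>+z. indicator hcell (snd z - k) * g z \<partial>lborel) = (\<integral>\<^sup>+z. g z \<partial>torus)" if "k \<in> F" for k
  proof -
    have k: "k \<in> lattice" using that by (simp add: F_def)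
    have "(\<integral>\<^sup>+z. indicator hcell (snd z - k) * g z \<partial>lborel)
       = (\<integral>\<^sup>+z. indicator hcell (snd (z + (0, k)) - k) * g (z + (0, k)) \<partial>lborel)"
      using nn_integral_lborel_affine[of "\<lambda>z. indicator hcell (snd z - k) * g z" 1 "(0, k)"]
      by (simp add: add.commute)
    also have "\<dots> = (\<integral>\<^sup>+z. indicator hcell (snd z) * g z \<partial>lborel)"
      using sper_lattice[OF perg k] by simp
    also have "\<dots> = (\<integral>\<^sup>+z. g z \<partial>torus)" by (rule nn_integral_torus_hcell[symmetric]) simp
    finally show ?thesis .
  qed
  have fin: "(\<integral>\<^sup>+z. g z \<partial>torus) < \<infinity>" using f by (simp add: integrable_iff_bounded g_def)
  have "(\<integral>\<^sup>+z. norm (indicator (cball 0 R) z *\<^sub>R f z) \<partial>lborel) \<le> (\<integral>\<^sup>+z. (\<Sum>k\<in>F. indicator hcell (snd z - k) * g z) \<partial>lborel)"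
  proof (rule nn_integral_mono)
    fix z :: "real \<times> (real^'d)"
    show "ennreal (norm (indicator (cball 0 R) z *\<^sub>R f z)) \<le> (\<Sum>k\<in>F. indicator hcell (snd z - k) * g z)"
    proof (cases "norm z \<le> R")
      case True
      have "norm (snd z) \<le> R" using True norm_snd_le[of "snd z" "fst z"] by simp
      have "norm (snd z - vfloor (snd z)) \<le> real CARD('d)"
      proof -
        have "norm (snd z - vfloor (snd z)) \<le> (\<Sum>i\<in>UNIV. \<bar>(snd z - vfloor (snd z)) $ i\<bar>)"
          by (rule norm_le_l1_cart)
        also have "\<dots> \<le> (\<Sum>i\<in>(UNIV::'d set). 1)"
          by (intro sum_mono) (simp add: vfloor_def, linarith)
        finally show ?thesis by simp
      qed
      then have "norm (vfloor (snd z)) \<le> R + real CARD('d)"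
        using \<open>norm (snd z) \<le> R\<close> norm_triangle_ineq2[of "vfloor (snd z)" "snd z"]
        by (simp add: norm_minus_commute)
      then have kF: "vfloor (snd z) \<in> F" by (simp add: F_def vfloor_lattice)
      have "ennreal (norm (indicator (cball 0 R) z *\<^sub>R f z)) = indicator hcell (snd z - vfloor (snd z)) * g z"
        using True hcell_vfloor[OF vfloor_lattice, of "snd z" "snd z"] by (simp add: g_def)
      also have "\<dots> \<le> (\<Sum>k\<in>F. indicator hcell (snd z - k) * g z)"
        by (rule member_le_sum[OF kF _ finF]) auto
      finally show ?thesis .
    qed simp
  qed
  also have "\<dots> = (\<Sum>k\<in>F. (\<integral>\<^sup>+z. g z \<partial>torus))"
    by (subst nn_integral_sum) (auto simp: each)
  also have "\<dots> < \<infinity>" using fin by (simp add: ennreal_mult_less_top of_nat_less_top)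
  finally show "integrable lborel (\<lambda>y. indicator (cball 0 R) y *\<^sub>R f y)"
    unfolding integrable_iff_bounded by (auto intro!: borel_measurable_scaleR borel_measurable_indicator)
qed

section \<open>Fields on the torus and weak equations\<close>

text \<open>
  A Borel representative of a function in \<open>L\<^sup>q\<close> on \<open>(0,T)\<close> times
  the torus, extended by zero in time. Pointwise periodicity and vanishing, rather than almost
  everywhere, keep null sets out of the convolution calculus.
\<close>

definition Lq_field :: "real \<Rightarrow> nat \<Rightarrow> (real \<times> (real^'d) \<Rightarrow> 'b::euclidean_space) \<Rightarrow> bool" where
  "Lq_field T q f \<longleftrightarrow> f \<in> borel_measurable borel \<and> sper f \<and> (\<forall>z. fst z \<notin> {0<..<T} \<longrightarrow> f z = 0) \<and>
     integrable torus (\<lambda>z. norm (f z) ^ q)"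

lemma Lq_fieldD:
  assumes "Lq_field T q f"
  shows "f \<in> borel_measurable borel" "sper f" "fst z \<notin> {0<..<T} \<Longrightarrow> f z = 0"
    "integrable torus (\<lambda>z. norm (f z) ^ q)"
  using assms unfolding Lq_field_def by blast+

lemma Lq_fieldI_bound:
  assumes "f \<in> borel_measurable borel" "sper f" "\<And>z. fst z \<notin> {0<..<T} \<Longrightarrow> f z = 0"
    "integrable torus g" "\<And>z. norm (f z) ^ q \<le> g z"
  shows "Lq_field T q f"
  unfolding Lq_field_def
proof (intro conjI allI impI)
  show "integrable torus (\<lambda>z. norm (f z) ^ q)"
  proof (rule Bochner_Integration.integrable_bound[OF assms(4)])
    show "AE x in torus. norm (norm (f x) ^ q) \<le> norm (g x)"
      using assms(5) by (auto intro!: AE_I2 order_trans[OF assms(5) abs_ge_self])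
    show "(\<lambda>z. norm (f z) ^ q) \<in> borel_measurable torus" using assms(1) by simp
  qed
qed (use assms in auto)

lemma integrable_torus_time: "integrable torus (\<lambda>z :: real \<times> (real^'d). indicator {a..b} (fst z) :: real)"
proof -
  have "integrable (slab a b) (\<lambda>z :: real \<times> (real^'d). indicator {a..b} (fst z) :: real)"
    by (intro finite_measure.integrable_const_bound[OF finite_measure_slab, of _ 1])
       (auto simp: indicator_def)
  then show ?thesis by (subst torus_slab(2)[of _ a b]) auto
qed

text \<open>
  The time interval and the cell are bounded, so lower integrability follows from \<open>x ^ p
  \<le> 1 + x ^ q\<close>; the constant is integrable because \<open>f\<close> vanishes outside
  \<open>(0,T)\<close>.
\<close>

lemma Lq_field_mono:
  assumes "Lq_field T q f" "p \<le> q" "0 < p"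
  shows "Lq_field T p f"
proof (rule Lq_fieldI_bound)
  show "integrable torus (\<lambda>z. indicator {0..T} (fst z) + norm (f z) ^ q)"
    using integrable_torus_time Lq_fieldD(4)[OF assms(1)] by (intro Bochner_Integration.integrable_add)
  show "norm (f z) ^ p \<le> indicator {0..T} (fst z) + norm (f z) ^ q" for z
  proof (cases "fst z \<in> {0<..<T}")
    case True
    show ?thesis
    proof (cases "norm (f z) \<le> 1")
      case True
      then have "norm (f z) ^ p \<le> 1" by (simp add: power_le_one)
      moreover have "0 \<le> norm (f z) ^ q" by simp
      ultimately show ?thesis using \<open>fst z \<in> {0<..<T}\<close> by (auto simp: indicator_def intro: add_increasing2)
    next
      case False
      then have "norm (f z) ^ p \<le> norm (f z) ^ q" using assms(2) by (intro power_increasing) auto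
      then show ?thesis by (simp add: add_increasing)
    qed
  qed (use Lq_fieldD(3)[OF assms(1)] assms(3) in \<open>simp add: zero_power\<close>)
qed (use Lq_fieldD[OF assms(1)] in auto)

lemma Lq_field_L1:
  fixes f :: "real \<times> (real^'d) \<Rightarrow> 'b::euclidean_space"
  assumes "Lq_field T q f" "0 < q"
  shows "integrable torus f" "locally_L1 f"
proof -
  have "Lq_field T 1 f" using Lq_field_mono[OF assms(1)] assms(2) by simp
  then have "integrable torus (\<lambda>z. norm (f z))" "f \<in> borel_measurable torus" "sper f"
    by (auto simp: Lq_field_def)
  then show "integrable torus f" by (simp add: integrable_norm_iff)
  then show "locally_L1 f" using \<open>sper f\<close> by (rule locally_L1_of_torus)
qed

lemma young3:
  fixes x y z :: real
  assumes "0 \<le> x" "0 \<le> y" "0 \<le> z"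
  shows "x * y * z \<le> x ^ 3 + y ^ 3 + z ^ 3"
proof -
  define m where "m = max x (max y z)"
  have m: "x \<le> m" "y \<le> m" "z \<le> m" "0 \<le> m" using assms by (auto simp: m_def)
  have "x * y * z \<le> m * m * m" using m assms by (intro mult_mono) auto
  also have "\<dots> = m ^ 3" by (simp add: power3_eq_cube)
  also have "\<dots> \<le> x ^ 3 + y ^ 3 + z ^ 3"
  proof -
    have "0 \<le> x^3" "0 \<le> y^3" "0 \<le> z^3" using assms by auto
    moreover have "m = x \<or> m = y \<or> m = z" by (auto simp: m_def max_def)
    ultimately show ?thesis by auto
  qed
  finally show ?thesis .
qed

lemma young2: "x * y \<le> x ^ 2 + y ^ 2" if "0 \<le> x" "0 \<le> y" for x y :: real
proof -
  have "0 \<le> (x - y)^2" by simp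
  then have "2 * (x * y) \<le> x^2 + y^2" by (simp add: power2_diff)
  moreover have "0 \<le> x * y" using that by simp
  ultimately show ?thesis by linarith
qed

lemma Lq_field_scaleR:
  fixes f :: "real \<times> (real^'d) \<Rightarrow> real" and g :: "real \<times> (real^'d) \<Rightarrow> 'b::euclidean_space"
  assumes "Lq_field T 2 f" "Lq_field T 2 g"
  shows "Lq_field T 1 (\<lambda>z. f z *\<^sub>R g z)"
proof (rule Lq_fieldI_bound)
  show "integrable torus (\<lambda>z. norm (f z)^2 + norm (g z)^2)"
    by (intro Bochner_Integration.integrable_add Lq_fieldD(4)[OF assms(1)] Lq_fieldD(4)[OF assms(2)])
  show "norm (f z *\<^sub>R g z) ^ 1 \<le> norm (f z)^2 + norm (g z)^2" for z
    using young2[of "norm (f z)" "norm (g z)"] by simp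
qed (use Lq_fieldD[OF assms(1)] Lq_fieldD[OF assms(2)] in \<open>auto simp: sper_def intro!: borel_measurable_scaleR\<close>)

lemma Lq_field_add:
  fixes f g :: "real \<times> (real^'d) \<Rightarrow> 'b::euclidean_space"
  assumes "Lq_field T 1 f" "Lq_field T 1 g"
  shows "Lq_field T 1 (\<lambda>z. f z + g z)"
proof (rule Lq_fieldI_bound)
  show "integrable torus (\<lambda>z. norm (f z)^1 + norm (g z)^1)"
    by (intro Bochner_Integration.integrable_add Lq_fieldD(4)[OF assms(1)] Lq_fieldD(4)[OF assms(2)])
  show "norm (f z + g z) ^ 1 \<le> norm (f z)^1 + norm (g z)^1" for z
    by (simp add: norm_triangle_ineq)
qed (use Lq_fieldD[OF assms(1)] Lq_fieldD[OF assms(2)] in \<open>auto simp: sper_def\<close>)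

lemma Lq_field_inner:
  fixes f :: "real \<times> (real^'d) \<Rightarrow> 'b::euclidean_space"
  assumes "Lq_field T q f"
  shows "Lq_field T q (\<lambda>z. f z \<bullet> e)"
proof (rule Lq_fieldI_bound)
  show "integrable torus (\<lambda>z. norm e ^ q * norm (f z)^q)"
    by (intro integrable_mult_right Lq_fieldD(4)[OF assms(1)])
  show "norm (f z \<bullet> e) ^ q \<le> norm e ^ q * norm (f z)^q" for z
    using power_mono[OF Cauchy_Schwarz_ineq2[of "f z" e], of q] by (simp add: power_mult_distrib mult.commute)
qed (use Lq_fieldD[OF assms(1)] in \<open>auto simp: sper_def\<close>)

subsection \<open>Test functions\<close>

text \<open>
  Test functions with a named time interval of support, which may protrude from
  \<open>(0,T)\<close>: mollification enlarges this interval.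
\<close>

definition slab_test :: "real \<Rightarrow> real \<Rightarrow> (real \<times> (real^'d) \<Rightarrow> real) \<Rightarrow> bool" where
  "slab_test a b g \<longleftrightarrow> smooth g \<and> sper g \<and> (\<forall>z. fst z \<notin> {a..b} \<longrightarrow> g z = 0)"

lemma slab_testD:
  assumes "slab_test a b g" shows "smooth g" "sper g" "fst z \<notin> {a..b} \<Longrightarrow> g z = 0"
  using assms unfolding slab_test_def by blast+

lemma slab_test_test_fun: "slab_test a b g \<Longrightarrow> 0 < a \<Longrightarrow> b < T \<Longrightarrow> test_fun T g"
  unfolding slab_test_def test_fun_def sper_def periodic_def by (fastforce simp: plus_prod_def)

lemma test_fun_slab_test:
  assumes "test_fun T g" obtains a b where "0 < a" "b < T" "slab_test a b g"
proof -
  obtain a b where "0 < a" "b < T" "\<forall>t x. t \<notin> {a..b} \<longrightarrow> g (t, x) = 0"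
    using assms unfolding test_fun_def by blast
  moreover have "sper g" using assms by (auto simp: test_fun_def sper_def periodic_def)
  moreover have "smooth g" using assms by (auto simp: test_fun_def)
  ultimately show thesis by (intro that[of a b]) (auto simp: slab_test_def)
qed

lemma sper_deriv:
  fixes g :: "real \<times> (real^'d) \<Rightarrow> real"
  assumes "smooth g" "sper g"
  shows "sper (\<lambda>z. frechet_derivative g (at z) v)"
  unfolding sper_def
proof (intro allI)
  fix z and i :: 'd
  let ?e = "(0, axis i 1) :: real \<times> (real^'d)"
  have "((\<lambda>w. w + ?e) has_derivative (\<lambda>v. v)) (at z)" by (auto intro!: derivative_eq_intros)
  from diff_chain_at[OF this smooth_has_derivative[OF assms(1)]]
  have "((\<lambda>w. g (w + ?e)) has_derivative frechet_derivative g (at (z + ?e))) (at z)" by (simp add: o_def)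
  moreover have "(\<lambda>w. g (w + ?e)) = g" using assms(2) by (auto simp: sper_def)
  ultimately have "(g has_derivative frechet_derivative g (at (z + ?e))) (at z)" by simp
  from fun_cong[OF frechet_derivative_at[OF this]]
  show "frechet_derivative g (at (z + ?e)) v = frechet_derivative g (at z) v" .
qed

lemma slab_test_deriv:
  assumes "slab_test a b g"
  shows "slab_test a b (\<lambda>z. frechet_derivative g (at z) v)"
proof -
  have "frechet_derivative g (at z) v = 0" if z: "fst z \<notin> {a..b}" for z
  proof (rule deriv_zero_outside)
    have "closed {z :: real \<times> (real^'b). a \<le> fst z \<and> fst z \<le> b}"
      by (intro closed_Collect_conj closed_Collect_le continuous_intros)
    then show "open (- {z :: real \<times> (real^'b). a \<le> fst z \<and> fst z \<le> b})" by auto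
  qed (use assms z in \<open>auto simp: slab_test_def\<close>)
  then show ?thesis
    using assms smooth_deriv sper_deriv unfolding slab_test_def by blast
qed

lemma slab_test_mult: "slab_test a b g \<Longrightarrow> smooth h \<Longrightarrow> sper h \<Longrightarrow> slab_test a b (\<lambda>z. g z * h z)"
  by (simp add: slab_test_def smooth_mult sper_def)

lemma sper_bounded:
  fixes g :: "real \<times> (real^'d) \<Rightarrow> real"
  assumes "continuous_on UNIV g" "sper g"
  obtains M where "0 < M" "\<And>z. fst z \<in> {a..b} \<Longrightarrow> \<bar>g z\<bar> \<le> M"
proof -
  let ?K = "{a..b} \<times> (cell :: (real^'d) set)"
  have "compact ?K" by (intro compact_Times) (auto simp: cell_def)
  then have "compact (g ` ?K)"
    using assms(1) by (intro compact_continuous_image) (auto intro: continuous_on_subset)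
  then have "bounded (g ` ?K)" by (rule compact_imp_bounded)
  then obtain M where M: "0 < M" "\<forall>x\<in>g ` ?K. norm x \<le> M" unfolding bounded_pos by blast
  show thesis
  proof (rule that[OF M(1)])
    fix z :: "real \<times> (real^'d)" assume z: "fst z \<in> {a..b}"
    have "g (z - (0, vfloor (snd z)) + (0, vfloor (snd z))) = g (z - (0, vfloor (snd z)))"
      by (rule sper_lattice[OF assms(2) vfloor_lattice])
    then have 1: "g z = g (z - (0, vfloor (snd z)))" by simp
    have "snd z - vfloor (snd z) \<in> hcell" by (simp add: hcell_vfloor vfloor_lattice)
    then have "snd z - vfloor (snd z) \<in> cell"
      by (auto simp: hcell_def cell_def mem_box_cart less_imp_le)
    then have "z - (0, vfloor (snd z)) \<in> ?K" using z by (simp add: mem_Times_iff)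
    then show "\<bar>g z\<bar> \<le> M" unfolding 1 using M(2) by force
  qed
qed

lemma slab_test_bounded:
  assumes "slab_test a b g"
  obtains M where "0 < M" "\<And>z. \<bar>g z\<bar> \<le> M"
proof -
  obtain M where "0 < M" "\<And>z. fst z \<in> {a..b} \<Longrightarrow> \<bar>g z\<bar> \<le> M"
    using sper_bounded[OF smooth_continuous, of g] assms unfolding slab_test_def by metis
  then show thesis using assms by (intro that[of M]) (force simp: slab_test_def)+
qed

lemma frechet_bound:
  assumes "smooth g" "\<And>e. e \<in> Basis \<Longrightarrow> \<bar>frechet_derivative g (at z) e\<bar> \<le> M e"
  shows "\<bar>frechet_derivative g (at z) v\<bar> \<le> (\<Sum>e\<in>Basis. M e) * norm v"
proof -
  have "\<bar>frechet_derivative g (at z) v\<bar> \<le> (\<Sum>e\<in>Basis. \<bar>(v \<bullet> e) * frechet_derivative g (at z) e\<bar>)"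
    unfolding frechet_sum[OF assms(1), of z v] by (rule sum_abs)
  also have "\<dots> \<le> (\<Sum>e\<in>Basis. norm v * M e)"
    unfolding abs_mult using assms(2) by (intro sum_mono mult_mono) (auto simp: Basis_le_norm)
  finally show ?thesis by (simp add: sum_distrib_right mult.commute[of "norm v"])
qed

lemma slab_test_deriv_bounded:
  assumes "slab_test a b g"
  obtains M where "0 < M" "\<And>z v. \<bar>frechet_derivative g (at z) v\<bar> \<le> M * norm v"
proof -
  have "\<exists>M>0. \<forall>z. \<bar>frechet_derivative g (at z) e\<bar> \<le> M" for e
    using slab_test_bounded[OF slab_test_deriv[OF assms, of e]] by metis
  then obtain M where M: "\<And>e. M e > 0" "\<And>e z. \<bar>frechet_derivative g (at z) e\<bar> \<le> M e" by metis
  show thesis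
  proof (rule that[of "\<Sum>e\<in>Basis. M e"])
    show "0 < (\<Sum>e\<in>Basis. M e)" using M by (intro sum_pos) auto
    show "\<bar>frechet_derivative g (at z) v\<bar> \<le> (\<Sum>e\<in>Basis. M e) * norm v" for z v
      using assms M by (intro frechet_bound) (auto simp: slab_test_def)
  qed
qed

lemma integrable_torus_continuous:
  fixes F :: "real \<times> (real^'d) \<Rightarrow> real"
  assumes "continuous_on UNIV F" "\<And>z. fst z \<notin> {a..b} \<Longrightarrow> F z = 0"
  shows "integrable torus F"
proof -
  have m: "F \<in> borel_measurable borel" using assms(1) by (rule borel_measurable_continuous_onI)
  have "compact ({a..b} \<times> (cell :: (real^'d) set))" by (intro compact_Times) (auto simp: cell_def)
  then have "integrable lborel (\<lambda>z. indicator ({a..b} \<times> cell) z *\<^sub>R F z)"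
    using assms(1) by (intro borel_integrable_compact) (auto intro: continuous_on_subset)
  then have "integrable (slab a b) F" by (simp add: slab_integral_eq[OF m])
  then show ?thesis using torus_slab(2)[OF m assms(2)] by blast
qed

lemma integrable_slab_test: "slab_test a b g \<Longrightarrow> integrable torus g"
  by (rule integrable_torus_continuous[of _ a b]) (auto simp: slab_test_def smooth_continuous)

subsection \<open>Mollification\<close>

lemma mollifierD:
  assumes "mollifier C \<epsilon> (k :: 'a::euclidean_space \<Rightarrow> real)"
  shows "0 < \<epsilon>" "smooth k" "0 \<le> k y" "k (- y) = k y" "\<epsilon> \<le> norm y \<Longrightarrow> k y = 0"
    "integrable lborel k" "integral\<^sup>L lborel k = 1" "k y \<le> C / measure lborel (ball (0::'a) \<epsilon>)"
    "\<bar>frechet_derivative k (at y) v\<bar> \<le> C / (\<epsilon> * measure lborel (ball (0::'a) \<epsilon>)) * norm v"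
    "k \<in> borel_measurable borel"
  using assms by (auto simp: mollifier_def smooth_measurable)

lemma conv_integrable:
  fixes w :: "'a::euclidean_space \<Rightarrow> 'b::euclidean_space"
  assumes f: "continuous_on UNIV f" "\<And>y. R \<le> norm y \<Longrightarrow> f y = 0" and w: "locally_L1 w"
  shows "integrable lborel (\<lambda>y. f (z - y) *\<^sub>R w y)"
proof -
  let ?S = "\<bar>R\<bar> + (norm z + 1)"
  have "integrable lborel (\<lambda>y. f (z - y) *\<^sub>R (indicator (cball 0 ?S) y *\<^sub>R w y))"
    by (rule conv_integrable_compact[OF f(1), of _ ?S]) (use w in \<open>auto simp: locally_L1_def\<close>)
  moreover have "f (z - y) *\<^sub>R (indicator (cball 0 ?S) y *\<^sub>R w y) = f (z - y) *\<^sub>R w y" for y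
  proof (cases "norm y \<le> ?S")
    case False
    moreover have "norm y - norm z \<le> norm (z - y)"
      using norm_triangle_ineq2[of y z] by (simp add: norm_minus_commute)
    ultimately have "R \<le> norm (z - y)" using norm_ge_zero[of z] by linarith
    then show ?thesis using f(2) by simp
  qed simp
  ultimately show ?thesis by (simp only:)
qed

lemma conv_alt:
  fixes w :: "'a::euclidean_space \<Rightarrow> 'b::euclidean_space"
  assumes "f \<in> borel_measurable borel" "w \<in> borel_measurable borel"
  shows "conv f w z = (\<integral>y. f y *\<^sub>R w (z - y) \<partial>lborel)"
    "integrable lborel (\<lambda>y. f (z - y) *\<^sub>R w y) \<longleftrightarrow> integrable lborel (\<lambda>y. f y *\<^sub>R w (z - y))"
proof -
  have m: "(\<lambda>y. f (z - y) *\<^sub>R w y) \<in> borel_measurable borel" using assms by measurable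
  show "conv f w z = (\<integral>y. f y *\<^sub>R w (z - y) \<partial>lborel)"
    using integral_lborel_affine[OF m, of "-1" z] by (simp add: conv_def)
  show "integrable lborel (\<lambda>y. f (z - y) *\<^sub>R w y) \<longleftrightarrow> integrable lborel (\<lambda>y. f y *\<^sub>R w (z - y))"
    using integrable_lborel_affine[OF m, of "-1" z] by simp
qed

context
  fixes C \<epsilon> :: real and k :: "real \<times> (real^'d) \<Rightarrow> real"
  assumes k: "mollifier C \<epsilon> k"
begin

lemma moll_smooth: "locally_L1 w \<Longrightarrow> smooth (conv k w)"
  using mollifierD[OF k] by (intro conv_smooth[of k w \<epsilon>]) auto

lemma moll_integrable: "locally_L1 w \<Longrightarrow> integrable lborel (\<lambda>y. k (z - y) *\<^sub>R w y)"
  using mollifierD[OF k] by (intro conv_integrable[of k \<epsilon>]) (auto simp: smooth_continuous)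

lemma moll_integrable':
  "locally_L1 w \<Longrightarrow> w \<in> borel_measurable borel \<Longrightarrow> integrable lborel (\<lambda>y. k y *\<^sub>R w (z - y))"
  using moll_integrable conv_alt(2) mollifierD(10)[OF k] by blast

lemma moll_inner: "locally_L1 w \<Longrightarrow> conv k w z \<bullet> e = conv k (\<lambda>z. w z \<bullet> e) z"
  unfolding conv_def using moll_integrable[of w z] by (subst integral_inner_left[symmetric]) auto

lemma moll_add: "locally_L1 w \<Longrightarrow> locally_L1 v \<Longrightarrow> conv k (\<lambda>z. w z + v z) z = conv k w z + conv k v z"
  unfolding conv_def scaleR_add_right by (intro Bochner_Integration.integral_add moll_integrable)

lemma moll_sper:
  assumes "w \<in> borel_measurable borel" "sper w"
  shows "sper (conv k w)"
  unfolding sper_def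
proof (intro allI)
  fix z and i :: 'd
  have "w (z + (0, axis i 1) - y) = w (z - y)" for y
    using assms(2) unfolding sper_def by (metis add_diff_eq add.commute diff_add_eq)
  then show "conv k w (z + (0, axis i 1)) = conv k w z"
    using assms(1) by (simp add: conv_alt mollifierD(10)[OF k])
qed

lemma moll_commute:
  fixes w :: "_ \<Rightarrow> real"
  shows "w \<in> borel_measurable borel \<Longrightarrow> conv k w z = conv w k z"
  using conv_alt(1)[OF mollifierD(10)[OF k], of w z] by (simp add: conv_def mult.commute)

lemma kernel_locally_L1: "locally_L1 k"
proof -
  have "integrable lborel (\<lambda>y. indicator (cball 0 R) y *\<^sub>R k y)" for R
    using integrable_mult_indicator[OF _ mollifierD(6)[OF k], of "cball 0 R"] by simp
  then show ?thesis by (simp add: locally_L1_def)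
qed

lemma moll_slab_test_deriv:
  assumes g: "slab_test a b g"
  shows "frechet_derivative (conv k g) (at z) v = conv k (\<lambda>x. frechet_derivative g (at x) v) z"
proof -
  have m: "g \<in> borel_measurable borel" "(\<lambda>x. frechet_derivative g (at x) v) \<in> borel_measurable borel"
    using g smooth_measurable smooth_deriv by (auto simp: slab_test_def)
  have "conv k g = conv g k" using moll_commute[OF m(1)] by auto
  moreover have "frechet_derivative (conv g k) (at z) v = conv (\<lambda>x. frechet_derivative g (at x) v) k z"
    using g kernel_locally_L1 mollifierD(5)[OF k] by (intro conv_deriv[of _ _ \<epsilon>]) (auto simp: slab_test_def)
  ultimately show ?thesis using moll_commute[OF m(2)] by simp
qed

lemma slab_test_locally_L1: "slab_test a b g \<Longrightarrow> locally_L1 g"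
  using locally_L1_of_torus integrable_slab_test by (auto simp: slab_test_def)

lemma moll_slab_test:
  assumes g: "slab_test a b g"
  shows "slab_test (a - \<epsilon>) (b + \<epsilon>) (conv k g)"
  unfolding slab_test_def
proof (intro conjI allI impI)
  have m: "g \<in> borel_measurable borel" using g smooth_measurable by (auto simp: slab_test_def)
  show "smooth (conv k g)" by (intro moll_smooth slab_test_locally_L1[OF g])
  show "sper (conv k g)" using g m by (intro moll_sper) (auto simp: slab_test_def)
  fix z :: "real \<times> (real^'d)" assume z: "fst z \<notin> {a - \<epsilon>..b + \<epsilon>}"
  have "k y * g (z - y) = 0" for y
  proof (cases "\<epsilon> \<le> norm y")
    case False
    moreover have "\<bar>fst y\<bar> \<le> norm y" using norm_fst_le[of "fst y" "snd y"] by simp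
    ultimately have "fst (z - y) \<notin> {a..b}" using z by auto
    then show ?thesis using slab_testD(3)[OF g] by simp
  qed (use mollifierD(5)[OF k] in auto)
  then have "(\<lambda>y. k y *\<^sub>R g (z - y)) = (\<lambda>_. 0)" by (simp only: real_scaleR_def)
  then show "conv k g z = 0" by (simp only: conv_alt(1)[OF mollifierD(10)[OF k] m] Bochner_Integration.integral_zero)
qed

text \<open>
  Fubini and translation invariance of the torus; the kernel is even, so it is its own adjoint.
\<close>

lemma moll_adjoint:
  fixes s h :: "real \<times> (real^'d) \<Rightarrow> real"
  assumes h: "slab_test a b h" and s: "Lq_field T 1 s"
  shows "(\<integral>z. conv k h z * s z \<partial>torus) = (\<integral>z. h z * conv k s z \<partial>torus)"
proof -
  have [measurable]: "h \<in> borel_measurable borel" "s \<in> borel_measurable borel" "k \<in> borel_measurable borel"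
    using h smooth_measurable Lq_fieldD(1)[OF s] mollifierD(10)[OF k] by (auto simp: slab_test_def)
  have perh: "sper h" and pers: "sper s" using h Lq_fieldD(2)[OF s] by (auto simp: slab_test_def)
  have ints: "integrable torus s" using Lq_field_L1[OF s] by simp
  obtain M where M: "0 < M" "\<And>z. \<bar>h z\<bar> \<le> M" using slab_test_bounded[OF h] by metis
  interpret pair_sigma_finite "lborel :: (real \<times> (real^'d)) measure" "torus :: (real \<times> (real^'d)) measure"
    unfolding pair_sigma_finite_def using sigma_finite_torus sigma_finite_lborel by blast
  define I where "I = (\<integral>\<^sup>+z. norm (s z) \<partial>torus)"
  have I: "I < \<infinity>" using ints by (simp add: integrable_iff_bounded I_def)
  have Kfin: "(\<integral>\<^sup>+y. ennreal (M * k y) * I \<partial>lborel) < \<infinity>"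
  proof -
    have "(\<integral>\<^sup>+y. ennreal (M * k y) \<partial>lborel) < \<infinity>"
      using mollifierD(3,6)[OF k] M by (subst nn_integral_eq_integral) auto
    then show ?thesis using I by (simp add: nn_integral_multc ennreal_mult_less_top)
  qed
  have int: "integrable (lborel \<Otimes>\<^sub>M torus) (case_prod F)"
    if [measurable]: "case_prod F \<in> borel_measurable (borel \<Otimes>\<^sub>M borel)"
      and b: "\<And>y. (\<integral>\<^sup>+z. norm (F y z) \<partial>torus) \<le> ennreal (M * k y) * I" for F :: "real \<times> (real^'d) \<Rightarrow> real \<times> (real^'d) \<Rightarrow> real"
    unfolding integrable_iff_bounded
  proof
    show [measurable]: "case_prod F \<in> borel_measurable (lborel \<Otimes>\<^sub>M torus)"
      using that(1) by (simp cong: measurable_cong_sets sets_pair_measure_cong)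
    have "(\<integral>\<^sup>+x. norm (case_prod F x) \<partial>(lborel \<Otimes>\<^sub>M torus)) = (\<integral>\<^sup>+y. \<integral>\<^sup>+z. norm (F y z) \<partial>torus \<partial>lborel)"
      using M2.nn_integral_fst[of "\<lambda>x. norm (case_prod F x)" lborel] by simp
    also have "\<dots> \<le> (\<integral>\<^sup>+y. ennreal (M * k y) * I \<partial>lborel)" by (intro nn_integral_mono b)
    finally show "(\<integral>\<^sup>+x. norm (case_prod F x) \<partial>(lborel \<Otimes>\<^sub>M torus)) < \<infinity>" using Kfin by (rule le_less_trans)
  qed
  have b1: "(\<integral>\<^sup>+z. norm (k y * h (z - y) * s z) \<partial>torus) \<le> ennreal (M * k y) * I" for y
  proof -
    have "(\<integral>\<^sup>+z. norm (k y * h (z - y) * s z) \<partial>torus) \<le> (\<integral>\<^sup>+z. ennreal (M * k y) * norm (s z) \<partial>torus)"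
    proof (intro nn_integral_mono)
      fix z
      have "norm (k y * h (z - y) * s z) \<le> (M * k y) * norm (s z)"
        unfolding norm_mult using M mollifierD(3)[OF k, of y]
        using mult_mono[OF M(2) order_refl[of "k y"]] by (intro mult_right_mono) (auto simp: mult.commute)
      then show "ennreal (norm (k y * h (z - y) * s z)) \<le> ennreal (M * k y) * norm (s z)"
        using M mollifierD(3)[OF k, of y] by (simp add: ennreal_mult[symmetric] ennreal_leI)
    qed
    also have "\<dots> = ennreal (M * k y) * I" unfolding I_def by (rule nn_integral_cmult) simp
    finally show ?thesis .
  qed
  have b2: "(\<integral>\<^sup>+z. norm (k y * h z * s (z + y)) \<partial>torus) \<le> ennreal (M * k y) * I" for y
  proof -
    have "(\<integral>\<^sup>+z. norm (k y * h z * s (z + y)) \<partial>torus) \<le> (\<integral>\<^sup>+z. ennreal (M * k y) * norm (s (z + y)) \<partial>torus)"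
    proof (intro nn_integral_mono)
      fix z
      have "norm (k y * h z * s (z + y)) \<le> (M * k y) * norm (s (z + y))"
        unfolding norm_mult using M mollifierD(3)[OF k, of y]
        using mult_mono[OF M(2) order_refl[of "k y"]] by (intro mult_right_mono) (auto simp: mult.commute)
      then show "ennreal (norm (k y * h z * s (z + y))) \<le> ennreal (M * k y) * norm (s (z + y))"
        using M mollifierD(3)[OF k, of y] by (simp add: ennreal_mult[symmetric] ennreal_leI)
    qed
    also have "\<dots> = ennreal (M * k y) * (\<integral>\<^sup>+z. norm (s (z + y)) \<partial>torus)" by (rule nn_integral_cmult) simp
    also have "(\<integral>\<^sup>+z. norm (s (z + y)) \<partial>torus) = I"
      unfolding I_def using pers
      by (intro nn_integral_torus_translate[of "\<lambda>z. ennreal (norm (s z))"]) (auto simp: sper_def)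
    finally show ?thesis .
  qed
  have "(\<integral>z. conv k h z * s z \<partial>torus) = (\<integral>z. (\<integral>y. k y * h (z - y) * s z \<partial>lborel) \<partial>torus)"
    by (simp add: conv_alt)
  also have "\<dots> = (\<integral>y. (\<integral>z. k y * h (z - y) * s z \<partial>torus) \<partial>lborel)"
    by (rule Fubini_integral[OF int]) (measurable, rule b1)
  also have "\<dots> = (\<integral>y. (\<integral>z. k y * h z * s (z + y) \<partial>torus) \<partial>lborel)"
  proof (rule Bochner_Integration.integral_cong[OF refl])
    fix y
    let ?F = "\<lambda>z. k y * h (z - y) * s z"
    have "integrable torus ?F"
    proof (rule integrableI_bounded)
      show "(\<integral>\<^sup>+z. norm (?F z) \<partial>torus) < \<infinity>"
        by (rule le_less_trans[OF b1[of y]]) (use I in \<open>simp add: ennreal_mult_less_top\<close>)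
    qed measurable
    moreover have "h (z + (0, axis i 1) - y) = h (z - y)" for z i
      using perh unfolding sper_def by (metis add_diff_eq add.commute diff_add_eq)
    then have "sper ?F" using pers by (simp add: sper_def)
    ultimately have "(\<integral>z. ?F (z + y) \<partial>torus) = integral\<^sup>L torus ?F"
      by (rule integral_torus_translate[of ?F y])
    then show "integral\<^sup>L torus ?F = (\<integral>z. k y * h z * s (z + y) \<partial>torus)" by simp
  qed
  also have "\<dots> = (\<integral>z. (\<integral>y. k y * h z * s (z + y) \<partial>lborel) \<partial>torus)"
    by (rule Fubini_integral[OF int, symmetric]) (measurable, rule b2)
  also have "\<dots> = (\<integral>z. h z * conv k s z \<partial>torus)"
  proof (intro Bochner_Integration.integral_cong refl)
    fix z
    have "(\<integral>y. k y * h z * s (z + y) \<partial>lborel) = (\<integral>y. h z * (k (- y) * s (z + y)) \<partial>lborel)"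
      by (simp add: mollifierD(4)[OF k] mult_ac)
    also have "\<dots> = h z * (\<integral>y. k (- y) * s (z + y) \<partial>lborel)" by simp
    also have "(\<integral>y. k (- y) * s (z + y) \<partial>lborel) = conv k s z"
      using integral_lborel_affine[of "\<lambda>y. k (- y) * s (z + y)" "-1" 0] by (simp add: conv_alt)
    finally show "(\<integral>y. k y * h z * s (z + y) \<partial>lborel) = h z * conv k s z" .
  qed
  finally show ?thesis .
qed

end

text \<open>
  The distributional equation \<open>div\<^sub>t\<^sub>,\<^sub>x A = - S\<close>. The flux
  \<open>A\<close> has a time component, so \<open>\<partial>\<^sub>t\<close> and the spatial
  divergence are treated as one operator and space-time mollification acts on it directly.
\<close>

definition weak :: "real \<Rightarrow> (real \<times> (real^'d) \<Rightarrow> real \<times> (real^'d)) \<Rightarrow> (real \<times> (real^'d) \<Rightarrow> real) \<Rightarrow> bool" where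
  "weak T A S \<longleftrightarrow> (\<forall>\<phi>. test_fun T \<phi> \<longrightarrow>
     (\<integral>z. frechet_derivative \<phi> (at z) (A z) \<partial>torus) = (\<integral>z. S z * \<phi> z \<partial>torus))"

lemma integrable_bounded_mult:
  fixes h s :: "real \<times> (real^'d) \<Rightarrow> real"
  assumes "h \<in> borel_measurable borel" "\<And>z. \<bar>h z\<bar> \<le> M" "integrable torus s"
  shows "integrable torus (\<lambda>z. h z * s z)"
proof (rule Bochner_Integration.integrable_bound)
  show "integrable torus (\<lambda>z. M * s z)" using assms(3) by simp
  show "(\<lambda>z. h z * s z) \<in> borel_measurable torus" using assms(1,3) by (auto dest: borel_measurable_integrable)
  show "AE z in torus. norm (h z * s z) \<le> norm (M * s z)"
    using assms(2) order_trans[OF assms(2) abs_ge_self]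
    by (intro AE_I2) (simp add: abs_mult mult_right_mono)
qed

text \<open>
  Testing the mollified equation with \<open>g\<close> is testing the original one with the
  mollified \<open>g\<close>. That function is admissible as long as its enlarged time support
  stays inside \<open>(0,T)\<close>.
\<close>

lemma moll_weak:
  fixes k :: "real \<times> (real^'d) \<Rightarrow> real"
  assumes k: "mollifier C \<epsilon> k" and A: "Lq_field T 1 A" and S: "Lq_field T 1 S" and w: "weak T A S"
    and g: "slab_test a b g" and ab: "0 < a - \<epsilon>" "b + \<epsilon> < T"
  shows "(\<integral>z. frechet_derivative g (at z) (conv k A z) \<partial>torus) = (\<integral>z. conv k S z * g z \<partial>torus)"
proof -
  let ?\<phi> = "conv k g"
  have sg: "smooth g" using g by (simp add: slab_test_def)
  have t: "slab_test (a - \<epsilon>) (b + \<epsilon>) ?\<phi>" by (rule moll_slab_test[OF k g])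
  have test: "test_fun T ?\<phi>" using slab_test_test_fun[OF t] ab by simp
  note Ae = Lq_field_inner[OF A]
  have locA: "locally_L1 A" using Lq_field_L1[OF A] by simp
  have int: "integrable torus (\<lambda>z. h z * s z)" if h: "slab_test a' b' h" and "integrable torus s" for h s :: "_ \<Rightarrow> real" and a' b'
  proof -
    obtain M where "0 < M" "\<And>z. \<bar>h z\<bar> \<le> M" using slab_test_bounded[OF h] by metis
    moreover have "h \<in> borel_measurable borel" using h smooth_measurable by (auto simp: slab_test_def)
    ultimately show ?thesis using that(2) by (intro integrable_bounded_mult)
  qed
  have intA: "integrable torus (\<lambda>z. A z \<bullet> e)" for e using Lq_field_L1(1)[OF Ae] by simp
  have intc: "integrable torus (\<lambda>z. frechet_derivative g (at z) e * conv k (\<lambda>z. A z \<bullet> e) z)" for e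
  proof (rule integrable_torus_continuous[of _ a b])
    have "smooth (\<lambda>z. frechet_derivative g (at z) e * conv k (\<lambda>z. A z \<bullet> e) z)"
      using Lq_field_L1(2)[OF Ae] by (intro smooth_mult smooth_deriv sg moll_smooth[OF k]) auto
    then show "continuous_on UNIV (\<lambda>z. frechet_derivative g (at z) e * conv k (\<lambda>z. A z \<bullet> e) z)"
      by (rule smooth_continuous)
    show "frechet_derivative g (at z) e * conv k (\<lambda>z. A z \<bullet> e) z = 0" if "fst z \<notin> {a..b}" for z
      using slab_testD(3)[OF slab_test_deriv[OF g, of e] that] by simp
  qed
  have "(\<integral>z. frechet_derivative g (at z) (conv k A z) \<partial>torus)
      = (\<integral>z. (\<Sum>e\<in>Basis. frechet_derivative g (at z) e * conv k (\<lambda>z. A z \<bullet> e) z) \<partial>torus)"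
    by (simp add: frechet_sum[OF sg, of _ "conv k A _"] moll_inner[OF k locA] mult.commute)
  also have "\<dots> = (\<Sum>e\<in>Basis. (\<integral>z. frechet_derivative g (at z) e * conv k (\<lambda>z. A z \<bullet> e) z \<partial>torus))"
    by (rule Bochner_Integration.integral_sum) (rule intc)
  also have "\<dots> = (\<Sum>e\<in>Basis. (\<integral>z. frechet_derivative ?\<phi> (at z) e * (A z \<bullet> e) \<partial>torus))"
    using moll_adjoint[OF k slab_test_deriv[OF g] Ae] by (simp add: moll_slab_test_deriv[OF k g])
  also have "\<dots> = (\<integral>z. (\<Sum>e\<in>Basis. frechet_derivative ?\<phi> (at z) e * (A z \<bullet> e)) \<partial>torus)"
    by (rule Bochner_Integration.integral_sum[symmetric]) (rule int[OF slab_test_deriv[OF t] intA])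
  also have "\<dots> = (\<integral>z. frechet_derivative ?\<phi> (at z) (A z) \<partial>torus)"
    using t by (simp add: frechet_sum[of ?\<phi> _ "A _"] mult.commute slab_test_def)
  also have "\<dots> = (\<integral>z. ?\<phi> z * S z \<partial>torus)"
    using w test by (simp add: weak_def mult.commute)
  also have "\<dots> = (\<integral>z. conv k S z * g z \<partial>torus)"
    using moll_adjoint[OF k g S] by (simp add: mult.commute)
  finally show ?thesis .
qed

text \<open>
  The integral of \<open>g (z + h *\<^sub>R v)\<close> does not depend on \<open>h\<close>, so
  the integrals of the difference quotients vanish. Applied to products this is integration by
  parts.
\<close>

lemma integral_deriv_zero:
  assumes g: "slab_test a b g"
  shows "(\<integral>z. frechet_derivative g (at z) v \<partial>torus) = 0"
proof -
  have sg: "smooth g" using g by (simp add: slab_test_def)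
  obtain M where M: "0 < M" "\<And>z v. \<bar>frechet_derivative g (at z) v\<bar> \<le> M * norm v"
    using slab_test_deriv_bounded[OF g] by metis
  let ?h = "\<lambda>n::nat. 1 / real (Suc n)"
  let ?q = "\<lambda>n z. (g (z + ?h n *\<^sub>R v) - g z) / ?h n"
  let ?a = "a - norm v" and ?b = "b + norm v"
  have hb: "\<bar>?h n\<bar> \<le> 1" for n by simp
  have [measurable]: "g \<in> borel_measurable borel" "(\<lambda>z. frechet_derivative g (at z) v) \<in> borel_measurable borel"
    using sg smooth_measurable smooth_deriv by auto
  have z0: "?q n z = 0" "frechet_derivative g (at z) v = 0" if z: "fst z \<notin> {?a..?b}" for n z
  proof -
    have 1: "\<bar>fst v\<bar> \<le> norm v" using norm_fst_le[of "fst v" "snd v"] by simp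
    have "\<bar>?h n * fst v\<bar> \<le> \<bar>fst v\<bar>" unfolding abs_mult using hb[of n] by (intro mult_left_le_one_le) auto
    then have "\<bar>?h n * fst v\<bar> \<le> norm v" using 1 by linarith
    moreover have "fst (z + ?h n *\<^sub>R v) = fst z + ?h n * fst v" by simp
    ultimately have "fst (z + ?h n *\<^sub>R v) \<notin> {a..b}" "fst z \<notin> {a..b}"
      using z norm_ge_zero[of v] unfolding abs_le_iff atLeastAtMost_iff by linarith+
    then show "?q n z = 0" "frechet_derivative g (at z) v = 0"
      using slab_testD(3)[OF g] slab_testD(3)[OF slab_test_deriv[OF g, of v]] by simp_all
  qed
  have "(\<lambda>n. integral\<^sup>L (slab ?a ?b) (?q n)) \<longlonglongrightarrow> (\<integral>z. frechet_derivative g (at z) v \<partial>slab ?a ?b)"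
  proof (rule integral_dominated_convergence[where w="\<lambda>_. M * norm v"])
    show "integrable (slab ?a ?b) (\<lambda>_. M * norm v)"
      by (rule finite_measure.integrable_const[OF finite_measure_slab])
    show "AE z in slab ?a ?b. (\<lambda>n. ?q n z) \<longlonglongrightarrow> frechet_derivative g (at z) v"
    proof (rule AE_I2)
      fix z
      have "((\<lambda>t. g (z + t *\<^sub>R v)) has_derivative (\<lambda>s. frechet_derivative g (at z) (s *\<^sub>R v))) (at 0)"
      proof -
        have "((\<lambda>t. z + t *\<^sub>R v) has_derivative (\<lambda>s. s *\<^sub>R v)) (at 0)" by (auto intro!: derivative_eq_intros)
        moreover have "(g has_derivative frechet_derivative g (at z)) (at (z + 0 *\<^sub>R v))"
          using smooth_has_derivative[OF sg, of z] by simp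
        ultimately show ?thesis using diff_chain_at[of "\<lambda>t. z + t *\<^sub>R v" "\<lambda>s. s *\<^sub>R v" 0 g] by (simp add: o_def)
      qed
      then have "((\<lambda>t. g (z + t *\<^sub>R v)) has_field_derivative frechet_derivative g (at z) v) (at 0)"
        by (simp add: has_field_derivative_def linear_scale[OF smooth_linear_deriv[OF sg]] mult.commute[of _ "frechet_derivative g (at z) v"])
      then have lim: "((\<lambda>t. (g (z + t *\<^sub>R v) - g z) / t) \<longlongrightarrow> frechet_derivative g (at z) v) (at 0)"
        by (simp add: has_field_derivative_iff)
      have "filterlim ?h (at 0) sequentially"
        unfolding filterlim_at using LIMSEQ_inverse_real_of_nat by (auto simp: inverse_eq_divide)
      from filterlim_compose[OF lim this] show "(\<lambda>n. ?q n z) \<longlonglongrightarrow> frechet_derivative g (at z) v" .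
    qed
    show "AE z in slab ?a ?b. norm (?q n z) \<le> M * norm v" for n
    proof (rule AE_I2)
      fix z
      have "\<bar>g (z + ?h n *\<^sub>R v) - g z\<bar> \<le> M * norm (z + ?h n *\<^sub>R v - z)"
      proof (rule differentiable_bound[of UNIV g "\<lambda>x. frechet_derivative g (at x)" M, simplified])
        show "(g has_derivative frechet_derivative g (at x)) (at x)" for x by (rule smooth_has_derivative[OF sg])
        show "onorm (frechet_derivative g (at x)) \<le> M" for x
          using M by (intro onorm_le) auto
      qed
      also have "\<dots> = M * norm v * ?h n" by simp
      finally have *: "\<bar>g (z + ?h n *\<^sub>R v) - g z\<bar> \<le> M * norm v * ?h n" .
      have hp: "?h n > 0" by simp
      show "norm (?q n z) \<le> M * norm v"
        using * pos_divide_le_eq[OF hp] hp unfolding real_norm_def abs_divide by (metis abs_of_pos abs_divide)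
    qed
  qed measurable
  moreover have "integral\<^sup>L (slab ?a ?b) (?q n) = 0" for n
  proof -
    have ig: "integrable torus g" by (rule integrable_slab_test[OF g])
    have pg: "sper g" using g by (simp add: slab_test_def)
    have "integral\<^sup>L torus (?q n) = 0"
      using integrable_torus_translate[OF ig pg] integral_torus_translate[OF ig pg] ig by simp
    moreover have "integral\<^sup>L torus (?q n) = integral\<^sup>L (slab ?a ?b) (?q n)"
      by (rule torus_slab(1)) (use z0 in auto)
    ultimately show ?thesis by simp
  qed
  ultimately have "(\<integral>z. frechet_derivative g (at z) v \<partial>slab ?a ?b) = 0"
    by (simp add: LIMSEQ_const_iff)
  moreover have "(\<integral>z. frechet_derivative g (at z) v \<partial>torus) = (\<integral>z. frechet_derivative g (at z) v \<partial>slab ?a ?b)"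
    by (rule torus_slab(1)) (use z0 in auto)
  ultimately show ?thesis by simp
qed

section \<open>Convergence of mollifications\<close>

lemma power_sum3:
  fixes x y w :: real
  assumes "0 \<le> x" "0 \<le> y" "0 \<le> w"
  shows "(x + y + w) ^ q \<le> 3 ^ q * (x ^ q + y ^ q + w ^ q)"
proof -
  define m where "m = max x (max y w)"
  have m: "x \<le> m" "y \<le> m" "w \<le> m" by (auto simp: m_def)
  have "(x + y + w) ^ q \<le> (3 * m) ^ q" using m assms by (intro power_mono) auto
  also have "\<dots> = 3 ^ q * m ^ q" by (rule power_mult_distrib)
  also have "m ^ q \<le> x ^ q + y ^ q + w ^ q"
  proof -
    have "0 \<le> x^q" "0 \<le> y^q" "0 \<le> w^q" using assms by auto
    moreover have "m = x \<or> m = y \<or> m = w" by (auto simp: m_def max_def)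
    ultimately show ?thesis by auto
  qed
  finally show ?thesis by simp
qed

text \<open>
  The radial retraction onto the ball of radius \<open>M\<close>: a truncation that is
  continuous.
\<close>

definition retract_ball :: "real \<Rightarrow> 'b::euclidean_space \<Rightarrow> 'b" where
  "retract_ball M x = (1 / max 1 (norm x / M)) *\<^sub>R x"

lemma retract_ball:
  assumes "0 < M"
  shows "norm (retract_ball M x) \<le> M" "norm (x - retract_ball M x) \<le> norm x"
    "norm x \<le> M \<Longrightarrow> retract_ball M x = x" "continuous_on UNIV (retract_ball M)"
proof -
  show "norm (retract_ball M x) \<le> M"
  proof (cases "norm x \<le> M")
    case True
    then show ?thesis using assms by (simp add: retract_ball_def max_def field_simps)
  next
    case False
    then have "max 1 (norm x / M) = norm x / M" using assms by (simp add: max_def field_simps)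
    then show ?thesis using assms False by (simp add: retract_ball_def)
  qed
  have c: "0 \<le> 1 / max 1 (norm x / M)" "1 / max 1 (norm x / M) \<le> 1" by auto
  have "x - retract_ball M x = (1 - 1 / max 1 (norm x / M)) *\<^sub>R x"
    by (simp add: retract_ball_def scaleR_diff_left)
  then have "norm (x - retract_ball M x) = (1 - 1 / max 1 (norm x / M)) * norm x" using c by simp
  also have "\<dots> \<le> 1 * norm x" using c by (intro mult_right_mono) auto
  finally show "norm (x - retract_ball M x) \<le> norm x" by simp
  show "norm x \<le> M \<Longrightarrow> retract_ball M x = x" using assms by (simp add: retract_ball_def max_def field_simps)
  show "continuous_on UNIV (retract_ball M)"
    unfolding retract_ball_def using assms by (intro continuous_intros) auto
qed

text \<open>
  Truncation makes \<open>f\<close> bounded. A bounded measurable function is an almost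
  everywhere limit of continuous functions, and truncating these too gives an integrable
  majorant.
\<close>

lemma continuous_approx:
  fixes f :: "'a::euclidean_space \<Rightarrow> 'b::euclidean_space"
  assumes f[measurable]: "f \<in> borel_measurable borel"
    and int: "integrable lborel (\<lambda>z. indicator (cball 0 R) z *\<^sub>R norm (f z) ^ q)"
    and q: "0 < q" and e: "0 < e"
  obtains g where "continuous_on UNIV g"
    "(\<integral>\<^sup>+z. indicator (cball 0 R) z * ennreal (norm (f z - g z) ^ q) \<partial>lborel) \<le> ennreal e"
proof -
  let ?K = "cball (0::'a) R"
  define e1 where "e1 = e / (3 * 3 ^ q)"
  have e1: "e1 > 0" using e by (simp add: e1_def)
  have [measurable]: "?K \<in> sets borel" by simp
  have Kfin: "integrable lborel (indicat_real ?K)"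
    using emeasure_lborel_cball_finite[of "0::'a" R] by (intro integrable_real_indicator) auto
  let ?r = "\<lambda>n. retract_ball (real (Suc n))"
  have rm[measurable]: "retract_ball M \<in> borel_measurable borel" if "0 < M" for M
    using retract_ball(4)[OF that] by (rule borel_measurable_continuous_onI)
  have "(\<lambda>n. \<integral>z. indicator ?K z * norm (f z - ?r n (f z)) ^ q \<partial>lborel) \<longlonglongrightarrow> (\<integral>z. 0 \<partial>(lborel :: 'a measure))"
  proof (rule integral_dominated_convergence[OF _ _ int])
    show "AE z in lborel. (\<lambda>n. indicator ?K z * norm (f z - ?r n (f z)) ^ q) \<longlonglongrightarrow> 0"
    proof (rule AE_I2)
      fix z
      obtain n0 where n0: "norm (f z) \<le> real n0" using real_arch_simple by blast
      have "\<forall>\<^sub>F n in sequentially. indicator ?K z * norm (f z - ?r n (f z)) ^ q = 0"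
      proof (rule eventually_sequentiallyI[of n0])
        fix n assume "n0 \<le> n"
        then have "norm (f z) \<le> real (Suc n)" using n0 by linarith
        then have "?r n (f z) = f z" by (intro retract_ball(3)) auto
        then show "indicator ?K z * norm (f z - ?r n (f z)) ^ q = 0" using q by (simp add: zero_power)
      qed
      then show "(\<lambda>n. indicator ?K z * norm (f z - ?r n (f z)) ^ q) \<longlonglongrightarrow> 0"
        by (rule tendsto_eventually)
    qed
    show "AE z in lborel. norm (indicator ?K z * norm (f z - ?r n (f z)) ^ q) \<le> indicator ?K z *\<^sub>R norm (f z) ^ q" for n
      by (intro AE_I2) (auto simp: indicator_def intro!: power_mono retract_ball(2))
    show "(\<lambda>z. indicator ?K z * norm (f z - ?r n (f z)) ^ q) \<in> borel_measurable lborel" for n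
    proof -
      have [measurable]: "(\<lambda>z. ?r n (f z)) \<in> borel_measurable borel"
        by (rule measurable_compose[OF f rm]) simp
      show ?thesis by measurable
    qed
  qed simp
  then have "\<forall>\<^sub>F n in sequentially. (\<integral>z. indicator ?K z * norm (f z - ?r n (f z)) ^ q \<partial>lborel) < e1"
    using e1 by (simp add: order_tendstoD)
  then obtain n where n: "(\<integral>z. indicator ?K z * norm (f z - ?r n (f z)) ^ q \<partial>lborel) < e1"
    by (meson eventually_sequentially order_refl)
  define M where "M = real (Suc n)"
  have M: "M > 0" by (simp add: M_def)
  define h where "h = (\<lambda>z. retract_ball M (f z))"
  have h[measurable]: "h \<in> borel_measurable borel" unfolding h_def using measurable_compose[OF f rm[OF M]] .
  have hM: "norm (h z) \<le> M" for z unfolding h_def by (rule retract_ball(1)[OF M])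
  have ih: "integrable lborel (\<lambda>z. indicator ?K z * norm (f z - h z) ^ q)"
  proof (rule Bochner_Integration.integrable_bound[OF int])
    show "AE z in lborel. norm (indicator ?K z * norm (f z - h z) ^ q) \<le> norm (indicator ?K z *\<^sub>R norm (f z) ^ q)"
      using M unfolding h_def by (intro AE_I2) (auto simp: indicator_def intro!: power_mono retract_ball(2))
  qed measurable
  have s1: "(\<integral>\<^sup>+z. indicator ?K z * ennreal (norm (f z - h z) ^ q) \<partial>lborel) \<le> ennreal e1"
  proof -
    have "(\<integral>\<^sup>+z. indicator ?K z * ennreal (norm (f z - h z) ^ q) \<partial>lborel) = (\<integral>\<^sup>+z. ennreal (indicator ?K z * norm (f z - h z) ^ q) \<partial>lborel)"
      by (intro nn_integral_cong) (auto simp: indicator_def)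
    also have "\<dots> = ennreal (\<integral>z. indicator ?K z * norm (f z - h z) ^ q \<partial>lborel)"
      by (rule nn_integral_eq_integral[OF ih]) auto
    finally show ?thesis using n by (simp add: h_def M_def ennreal_leI)
  qed
  have "h \<in> borel_measurable lebesgue" using h by (simp add: measurable_completion)
  then have "h measurable_on UNIV" by (rule lebesgue_measurable_imp_measurable_on) simp
  then obtain N g where N: "negligible N" and g: "\<And>n. continuous_on UNIV (g n)"
    and lim: "\<And>x. x \<notin> N \<Longrightarrow> (\<lambda>n. g n x) \<longlonglongrightarrow> h x"
    unfolding measurable_on_def by auto
  define G where "G = (\<lambda>n z. retract_ball M (g n z))"
  have G: "continuous_on UNIV (G n)" for n
    unfolding G_def using continuous_on_compose2[OF retract_ball(4)[OF M] g[of n]] by simp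
  have Gm[measurable]: "G n \<in> borel_measurable borel" for n by (rule borel_measurable_continuous_onI[OF G])
  have GM: "norm (G n z) \<le> M" for n z unfolding G_def by (rule retract_ball(1)[OF M])
  have "(\<lambda>n. \<integral>z. indicator ?K z * norm (h z - G n z) ^ q \<partial>lborel) \<longlonglongrightarrow> (\<integral>z. 0 \<partial>(lborel :: 'a measure))"
  proof (rule integral_dominated_convergence[where w="\<lambda>z. (2 * M) ^ q * indicator ?K z"])
    show "integrable lborel (\<lambda>z. (2 * M) ^ q * indicat_real ?K z)" using Kfin by simp
    have "AE z in lborel. z \<notin> N"
      using N AE_not_in AE_completion_iff unfolding negligible_iff_null_sets by blast
    then show "AE z in lborel. (\<lambda>n. indicator ?K z * norm (h z - G n z) ^ q) \<longlonglongrightarrow> 0"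
    proof eventually_elim
      fix z assume "z \<notin> N"
      have "(\<lambda>n. G n z) \<longlonglongrightarrow> retract_ball M (h z)"
        unfolding G_def using continuous_on_tendsto_compose[OF retract_ball(4)[OF M] lim[OF \<open>z \<notin> N\<close>]] by simp
      then have "(\<lambda>n. G n z) \<longlonglongrightarrow> h z" using retract_ball(3)[OF M hM[of z]] by simp
      then have "(\<lambda>n. indicator ?K z * norm (h z - G n z) ^ q) \<longlonglongrightarrow> indicator ?K z * norm (h z - h z) ^ q"
        by (intro tendsto_intros)
      then show "(\<lambda>n. indicator ?K z * norm (h z - G n z) ^ q) \<longlonglongrightarrow> 0" using q by (simp add: zero_power)
    qed
    show "AE z in lborel. norm (indicator ?K z * norm (h z - G n z) ^ q) \<le> (2 * M) ^ q * indicator ?K z" for n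
    proof (intro AE_I2)
      fix z
      have "norm (h z - G n z) \<le> 2 * M" using norm_triangle_ineq4[of "h z" "G n z"] hM[of z] GM[of n z] by linarith
      then have "norm (h z - G n z) ^ q \<le> (2 * M) ^ q" by (rule power_mono) simp
      then show "norm (indicator ?K z * norm (h z - G n z) ^ q) \<le> (2 * M) ^ q * indicator ?K z"
        by (simp add: indicator_def)
    qed
  qed measurable
  then have "\<forall>\<^sub>F n in sequentially. (\<integral>z. indicator ?K z * norm (h z - G n z) ^ q \<partial>lborel) < e1"
    using e1 by (simp add: order_tendstoD)
  then obtain m where m: "(\<integral>z. indicator ?K z * norm (h z - G m z) ^ q \<partial>lborel) < e1"
    by (meson eventually_sequentially order_refl)
  have iG: "integrable lborel (\<lambda>z. indicator ?K z * norm (h z - G m z) ^ q)"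
  proof (rule Bochner_Integration.integrable_bound)
    show "integrable lborel (\<lambda>z. (2 * M) ^ q * indicat_real ?K z)" using Kfin by simp
    show "AE z in lborel. norm (indicator ?K z * norm (h z - G m z) ^ q) \<le> norm ((2 * M) ^ q * indicat_real ?K z)"
    proof (intro AE_I2)
      fix z
      have "norm (h z - G m z) \<le> 2 * M" using norm_triangle_ineq4[of "h z" "G m z"] hM[of z] GM[of m z] by linarith
      then have "norm (h z - G m z) ^ q \<le> (2 * M) ^ q" by (rule power_mono) simp
      then show "norm (indicator ?K z * norm (h z - G m z) ^ q) \<le> norm ((2 * M) ^ q * indicat_real ?K z)"
        using M by (simp add: indicator_def)
    qed
  qed measurable
  have s2: "(\<integral>\<^sup>+z. indicator ?K z * ennreal (norm (h z - G m z) ^ q) \<partial>lborel) \<le> ennreal e1"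
  proof -
    have "(\<integral>\<^sup>+z. indicator ?K z * ennreal (norm (h z - G m z) ^ q) \<partial>lborel) = (\<integral>\<^sup>+z. ennreal (indicator ?K z * norm (h z - G m z) ^ q) \<partial>lborel)"
      by (intro nn_integral_cong) (auto simp: indicator_def)
    also have "\<dots> = ennreal (\<integral>z. indicator ?K z * norm (h z - G m z) ^ q \<partial>lborel)"
      by (rule nn_integral_eq_integral[OF iG]) auto
    finally show ?thesis using m by (simp add: ennreal_leI)
  qed
  show thesis
  proof (rule that[OF G[of m]])
    have "(\<integral>\<^sup>+z. indicator ?K z * ennreal (norm (f z - G m z) ^ q) \<partial>lborel)
      \<le> (\<integral>\<^sup>+z. ennreal (3 ^ q) * (indicator ?K z * ennreal (norm (f z - h z) ^ q)) + ennreal (3 ^ q) * (indicator ?K z * ennreal (norm (h z - G m z) ^ q)) \<partial>lborel)"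
    proof (rule nn_integral_mono)
      fix z
      have "norm (f z - G m z) ^ q \<le> (norm (f z - h z) + norm (h z - G m z) + 0) ^ q"
        using norm_triangle_ineq[of "f z - h z" "h z - G m z"] by (intro power_mono) auto
      also have "\<dots> \<le> 3 ^ q * (norm (f z - h z) ^ q + norm (h z - G m z) ^ q + 0 ^ q)"
        by (rule power_sum3) auto
      finally have "norm (f z - G m z) ^ q \<le> 3 ^ q * norm (f z - h z) ^ q + 3 ^ q * norm (h z - G m z) ^ q"
        using q by (simp add: zero_power algebra_simps)
      then have "ennreal (norm (f z - G m z) ^ q) \<le> ennreal (3 ^ q) * ennreal (norm (f z - h z) ^ q) + ennreal (3 ^ q) * ennreal (norm (h z - G m z) ^ q)"
        by (simp add: ennreal_mult[symmetric] ennreal_plus[symmetric] ennreal_leI del: ennreal_plus)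
      then show "indicator ?K z * ennreal (norm (f z - G m z) ^ q) \<le> ennreal (3 ^ q) * (indicator ?K z * ennreal (norm (f z - h z) ^ q)) + ennreal (3 ^ q) * (indicator ?K z * ennreal (norm (h z - G m z) ^ q))"
        by (auto simp: indicator_def)
    qed
    also have "\<dots> = ennreal (3 ^ q) * (\<integral>\<^sup>+z. indicator ?K z * ennreal (norm (f z - h z) ^ q) \<partial>lborel) + ennreal (3 ^ q) * (\<integral>\<^sup>+z. indicator ?K z * ennreal (norm (h z - G m z) ^ q) \<partial>lborel)"
      by (subst nn_integral_add) (auto simp: nn_integral_cmult)
    also have "\<dots> \<le> ennreal (3 ^ q) * ennreal e1 + ennreal (3 ^ q) * ennreal e1"
      by (intro add_mono mult_left_mono s1 s2) auto
    also have "\<dots> = ennreal (3 ^ q * e1 + 3 ^ q * e1)"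
      using e1 by (simp add: ennreal_mult[symmetric] ennreal_plus[symmetric] del: ennreal_plus)
    also have "\<dots> \<le> ennreal e" using e by (intro ennreal_leI) (simp add: e1_def)
    finally show "(\<integral>\<^sup>+z. indicator ?K z * ennreal (norm (f z - G m z) ^ q) \<partial>lborel) \<le> ennreal e" .
  qed
qed

text \<open>
  Approximate \<open>f\<close> by a continuous function, which is uniformly continuous on a
  compact neighbourhood of the slab.
\<close>

lemma translation_continuous:
  fixes f :: "real \<times> (real^'d) \<Rightarrow> 'b::euclidean_space"
  assumes f[measurable]: "f \<in> borel_measurable borel"
    and loc: "locally_L1 (\<lambda>z. norm (f z) ^ q)" and q: "0 < q" and e: "0 < e"
  obtains d where "0 < d"
    "\<And>y. norm y < d \<Longrightarrow> (\<integral>\<^sup>+z. ennreal (norm (f (z - y) - f z) ^ q) \<partial>slab a b) \<le> ennreal e"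
proof -
  let ?S = "{a..b} \<times> (cell :: (real^'d) set)"
  have "compact ?S" by (intro compact_Times) (auto simp: cell_def)
  then have "bounded ?S" by (rule compact_imp_bounded)
  then obtain R where R: "\<And>z. z \<in> ?S \<Longrightarrow> norm z \<le> R" unfolding bounded_iff by blast
  let ?K = "cball (0 :: real \<times> (real^'d)) (R + 1)"
  have [measurable]: "?K \<in> sets borel" by simp
  define e1 where "e1 = e / (3 * 3 ^ q)"
  have e1: "e1 > 0" using e by (simp add: e1_def)
  obtain g where g: "continuous_on UNIV g"
    and fg: "(\<integral>\<^sup>+z. indicator ?K z * ennreal (norm (f z - g z) ^ q) \<partial>lborel) \<le> ennreal e1"
    by (rule continuous_approx[OF f loc[unfolded locally_L1_def, rule_format, of "R + 1"] q e1])
  have [measurable]: "g \<in> borel_measurable borel" by (rule borel_measurable_continuous_onI[OF g])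
  define V where "V = measure (slab a b :: (real \<times> (real^'d)) measure) UNIV"
  have V: "emeasure (slab a b :: (real \<times> (real^'d)) measure) UNIV = ennreal V" "0 \<le> V"
    using finite_measure.emeasure_eq_measure[OF finite_measure_slab] by (auto simp: V_def)
  define e2 where "e2 = min 1 (e1 / (V + 1))"
  have e2: "0 < e2" "e2 \<le> 1" using e1 V by (auto simp: e2_def)
  have e2q: "e2 ^ q * V \<le> e1"
  proof -
    have "e2 ^ q \<le> e2 ^ 1" using e2 q by (intro power_decreasing) auto
    then have "e2 ^ q * V \<le> e1 / (V + 1) * V" using V by (intro mult_right_mono) (auto simp: e2_def)
    also have "\<dots> \<le> e1" using V e1 by (simp add: field_simps)
    finally show ?thesis .
  qed
  have "uniformly_continuous_on ?K g"
    using g by (intro compact_uniformly_continuous) (auto intro: continuous_on_subset)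
  then obtain d where d: "d > 0" "\<And>x y. x \<in> ?K \<Longrightarrow> y \<in> ?K \<Longrightarrow> dist y x < d \<Longrightarrow> dist (g y) (g x) < e2"
    unfolding uniformly_continuous_on_def using e2(1) by blast
  show thesis
  proof (rule that[of "min d 1"])
    show "0 < min d 1" using d by simp
    fix y :: "real \<times> (real^'d)" assume y: "norm y < min d 1"
    have t1: "(\<integral>\<^sup>+z. ennreal (norm (f (z - y) - g (z - y)) ^ q) \<partial>slab a b) \<le> ennreal e1"
    proof -
      have "(\<integral>\<^sup>+z. ennreal (norm (f (z - y) - g (z - y)) ^ q) \<partial>slab a b)
          = (\<integral>\<^sup>+z. indicator ?S z * ennreal (norm (f (z - y) - g (z - y)) ^ q) \<partial>lborel)"
        by (rule nn_integral_slab) measurable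
      also have "\<dots> \<le> (\<integral>\<^sup>+z. indicator ?K (z - y) * ennreal (norm (f (z - y) - g (z - y)) ^ q) \<partial>lborel)"
      proof (intro nn_integral_mono mult_right_mono)
        fix z
        have "norm (z - y) \<le> R + 1" if "z \<in> ?S"
          using R[OF that] y norm_triangle_ineq4[of z y] by linarith
        then show "(indicator ?S z :: ennreal) \<le> indicator ?K (z - y)" by (simp add: indicator_def)
      qed simp
      also have "\<dots> = (\<integral>\<^sup>+z. indicator ?K z * ennreal (norm (f z - g z) ^ q) \<partial>lborel)"
      proof -
        have m: "(\<lambda>z. indicator ?K z * ennreal (norm (f z - g z) ^ q)) \<in> borel_measurable borel" by measurable
        show ?thesis using nn_integral_lborel_affine[OF m, of 1 "- y"] by simp
      qed
      finally show ?thesis using fg by (rule order_trans)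
    qed
    have t3: "(\<integral>\<^sup>+z. ennreal (norm (g z - f z) ^ q) \<partial>slab a b) \<le> ennreal e1"
    proof -
      have "(\<integral>\<^sup>+z. ennreal (norm (g z - f z) ^ q) \<partial>slab a b)
          = (\<integral>\<^sup>+z. indicator ?S z * ennreal (norm (f z - g z) ^ q) \<partial>lborel)"
        by (subst nn_integral_slab) (auto simp: norm_minus_commute)
      also have "\<dots> \<le> (\<integral>\<^sup>+z. indicator ?K z * ennreal (norm (f z - g z) ^ q) \<partial>lborel)"
      proof (intro nn_integral_mono mult_right_mono)
        fix z
        have "norm z \<le> R + 1" if "z \<in> ?S" using R[OF that] by linarith
        then show "(indicator ?S z :: ennreal) \<le> indicator ?K z" by (simp add: indicator_def)
      qed simp
      finally show ?thesis using fg by (rule order_trans)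
    qed
    have t2: "(\<integral>\<^sup>+z. ennreal (norm (g (z - y) - g z) ^ q) \<partial>slab a b) \<le> ennreal e1"
    proof -
      have "(\<integral>\<^sup>+z. ennreal (norm (g (z - y) - g z) ^ q) \<partial>slab a b)
          = (\<integral>\<^sup>+z. indicator ?S z * ennreal (norm (g (z - y) - g z) ^ q) \<partial>lborel)"
        by (rule nn_integral_slab) measurable
      also have "\<dots> \<le> (\<integral>\<^sup>+z. indicator ?S z * ennreal (e2 ^ q) \<partial>lborel)"
      proof (intro nn_integral_mono)
        fix z
        have "norm (g (z - y) - g z) \<le> e2" if "z \<in> ?S"
        proof -
          have "norm (z - y) \<le> R + 1" "norm z \<le> R + 1"
            using R[OF that] y norm_triangle_ineq4[of z y] by linarith+
          then have "dist (g (z - y)) (g z) < e2" using y by (intro d(2)) (simp_all add: dist_norm norm_minus_commute)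
          then show ?thesis by (simp add: dist_norm)
        qed
        then show "indicator ?S z * ennreal (norm (g (z - y) - g z) ^ q) \<le> indicator ?S z * ennreal (e2 ^ q)"
          by (auto simp: indicator_def intro!: ennreal_leI power_mono)
      qed
      also have "\<dots> = (\<integral>\<^sup>+z. ennreal (e2 ^ q) \<partial>(slab a b :: (real \<times> (real^'d)) measure))"
        by (rule nn_integral_slab[symmetric]) simp
      also have "\<dots> = ennreal (e2 ^ q * V)" using V e2 by (simp add: ennreal_mult)
      also have "\<dots> \<le> ennreal e1" by (rule ennreal_leI[OF e2q])
      finally show ?thesis .
    qed
    have "(\<integral>\<^sup>+z. ennreal (norm (f (z - y) - f z) ^ q) \<partial>slab a b)
      \<le> (\<integral>\<^sup>+z. ennreal (3 ^ q) * (ennreal (norm (f (z - y) - g (z - y)) ^ q) + ennreal (norm (g (z - y) - g z) ^ q) + ennreal (norm (g z - f z) ^ q)) \<partial>slab a b)"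
    proof (rule nn_integral_mono)
      fix z
      have "norm (f (z - y) - f z) = norm ((f (z - y) - g (z - y)) + (g (z - y) - g z) + (g z - f z))" by simp
      also have "\<dots> \<le> norm (f (z - y) - g (z - y)) + norm (g (z - y) - g z) + norm (g z - f z)"
        by (rule norm_triangle_le) (rule add_right_mono, rule norm_triangle_ineq)
      finally have "norm (f (z - y) - f z) \<le> norm (f (z - y) - g (z - y)) + norm (g (z - y) - g z) + norm (g z - f z)" .
      then have "norm (f (z - y) - f z) ^ q \<le> (norm (f (z - y) - g (z - y)) + norm (g (z - y) - g z) + norm (g z - f z)) ^ q"
        by (rule power_mono) simp
      also have "\<dots> \<le> 3 ^ q * (norm (f (z - y) - g (z - y)) ^ q + norm (g (z - y) - g z) ^ q + norm (g z - f z) ^ q)"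
        by (rule power_sum3) auto
      finally show "ennreal (norm (f (z - y) - f z) ^ q) \<le> ennreal (3 ^ q) * (ennreal (norm (f (z - y) - g (z - y)) ^ q) + ennreal (norm (g (z - y) - g z) ^ q) + ennreal (norm (g z - f z) ^ q))"
        by (simp add: ennreal_mult[symmetric] ennreal_plus[symmetric] ennreal_leI del: ennreal_plus)
    qed
    also have "\<dots> = ennreal (3 ^ q) * ((\<integral>\<^sup>+z. ennreal (norm (f (z - y) - g (z - y)) ^ q) \<partial>slab a b)
         + (\<integral>\<^sup>+z. ennreal (norm (g (z - y) - g z) ^ q) \<partial>slab a b) + (\<integral>\<^sup>+z. ennreal (norm (g z - f z) ^ q) \<partial>slab a b))"
      by (simp add: nn_integral_cmult nn_integral_add)
    also have "\<dots> \<le> ennreal (3 ^ q) * (ennreal e1 + ennreal e1 + ennreal e1)"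
      by (intro add_mono mult_left_mono t1 t2 t3) auto
    also have "\<dots> = ennreal (3 ^ q * (e1 + e1 + e1))"
      using e1 by (simp add: ennreal_mult[symmetric] ennreal_plus[symmetric] del: ennreal_plus)
    also have "3 ^ q * (e1 + e1 + e1) = e" by (simp add: e1_def)
    finally show "(\<integral>\<^sup>+z. ennreal (norm (f (z - y) - f z) ^ q) \<partial>slab a b) \<le> ennreal e" .
  qed
qed

lemma power_tangent:
  fixes x c :: real
  assumes "0 \<le> x" "0 \<le> c"
  shows "c ^ Suc n + real (Suc n) * c ^ n * (x - c) \<le> x ^ Suc n"
proof (induction n)
  case (Suc n)
  have "c ^ Suc (Suc n) + real (Suc (Suc n)) * c ^ Suc n * (x - c) + real (Suc n) * c ^ n * (x - c) ^ 2
      = x * (c ^ Suc n + real (Suc n) * c ^ n * (x - c))"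
    by (simp add: algebra_simps power2_eq_square)
  also have "\<dots> \<le> x * x ^ Suc n" using Suc assms by (intro mult_left_mono)
  finally have "c ^ Suc (Suc n) + real (Suc (Suc n)) * c ^ Suc n * (x - c) + real (Suc n) * c ^ n * (x - c) ^ 2 \<le> x ^ Suc (Suc n)"
    by simp
  moreover have "0 \<le> real (Suc n) * c ^ n * (x - c) ^ 2" using assms by simp
  ultimately show ?case by linarith
qed simp

text \<open>
  Integrate the tangent inequality at the point \<open>c = \<integral>X\<close>, where the
  linear term drops out.
\<close>

lemma jensen_power:
  assumes prob_measure: "emeasure M (space M) = 1"
    and X[measurable]: "X \<in> borel_measurable M" and "\<And>x. 0 \<le> X x" and q: "0 < q"
  shows "ennreal ((\<integral>x. X x \<partial>M) ^ q) \<le> (\<integral>\<^sup>+x. ennreal (X x ^ q) \<partial>M)"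
proof (cases "integrable M (\<lambda>x. X x ^ q)")
  case False
  then have "(\<integral>\<^sup>+x. ennreal (X x ^ q) \<partial>M) = \<infinity>"
    using assms(3) by (simp add: integrable_iff_bounded not_less top_unique)
  then show ?thesis by simp
next
  case True
  interpret finite_measure M by standard (simp add: prob_measure)
  have m1: "measure M (space M) = 1" using prob_measure by (simp add: measure_def)
  have iX: "integrable M X"
  proof (rule Bochner_Integration.integrable_bound)
    show "integrable M (\<lambda>x. 1 + X x ^ q)" using True by simp
    show "AE x in M. norm (X x) \<le> norm (1 + X x ^ q)"
    proof (rule AE_I2)
      fix x
      have "X x \<le> 1 + X x ^ q"
      proof (cases "X x \<le> 1")
        case True then show ?thesis using assms(3)[of x] by (simp add: add_increasing2)
      next
        case False
        then have "X x ^ 1 \<le> X x ^ q" using q by (intro power_increasing) auto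
        then show ?thesis by simp
      qed
      then show "norm (X x) \<le> norm (1 + X x ^ q)" using assms(3)[of x] by simp
    qed
  qed simp
  obtain n where n: "q = Suc n" using q gr0_implies_Suc by blast
  define c where "c = integral\<^sup>L M X"
  have c: "0 \<le> c" unfolding c_def using assms(3) by simp
  have "c ^ q = (\<integral>x. c ^ Suc n + real (Suc n) * c ^ n * (X x - c) \<partial>M)"
    using iX by (simp add: n m1 c_def)
  also have "\<dots> \<le> (\<integral>x. X x ^ q \<partial>M)"
    using iX True assms(3) c unfolding n by (intro integral_mono power_tangent) auto
  finally have "ennreal (c ^ q) \<le> ennreal (\<integral>x. X x ^ q \<partial>M)" by (rule ennreal_leI)
  also have "\<dots> = (\<integral>\<^sup>+x. ennreal (X x ^ q) \<partial>M)"
    using True assms(3) by (intro nn_integral_eq_integral[symmetric]) auto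
  finally show ?thesis by (simp add: c_def)
qed

text \<open>
  Jensen's inequality for the probability measure with density \<open>k\<close>.
\<close>

lemma moll_power_bound:
  fixes k :: "real \<times> (real^'d) \<Rightarrow> real" and f :: "real \<times> (real^'d) \<Rightarrow> 'b::euclidean_space"
  assumes k: "mollifier C \<epsilon> k" and f[measurable]: "f \<in> borel_measurable borel" and loc: "locally_L1 f" and q: "0 < q"
  shows "ennreal (norm (conv k f z - c) ^ q) \<le> (\<integral>\<^sup>+y. ennreal (k y * norm (f (z - y) - c) ^ q) \<partial>lborel)"
proof -
  have [measurable]: "k \<in> borel_measurable borel" by (rule mollifierD(10)[OF k])
  note k0 = mollifierD(3)[OF k]
  let ?M = "density lborel (\<lambda>y. ennreal (k y))"
  have "emeasure ?M (space ?M) = (\<integral>\<^sup>+y. ennreal (k y) \<partial>lborel)" by (simp add: emeasure_density)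
  also have "\<dots> = 1" using mollifierD(6,7)[OF k] k0 by (simp add: nn_integral_eq_integral)
  finally have p: "emeasure ?M (space ?M) = 1" .
  have i1: "integrable lborel (\<lambda>y. k y *\<^sub>R f (z - y))" by (rule moll_integrable'[OF k loc f])
  have i2: "integrable lborel (\<lambda>y. k y *\<^sub>R c)" using mollifierD(6)[OF k] by simp
  have "conv k f z - c = (\<integral>y. k y *\<^sub>R f (z - y) \<partial>lborel) - (\<integral>y. k y *\<^sub>R c \<partial>lborel)"
    using mollifierD(6,7)[OF k] by (simp add: conv_alt)
  also have "\<dots> = (\<integral>y. k y *\<^sub>R (f (z - y) - c) \<partial>lborel)"
    using i1 i2 by (simp add: scaleR_diff_right)
  finally have eq: "conv k f z - c = (\<integral>y. k y *\<^sub>R (f (z - y) - c) \<partial>lborel)" .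
  have "norm (conv k f z - c) \<le> (\<integral>y. norm (k y *\<^sub>R (f (z - y) - c)) \<partial>lborel)"
    unfolding eq by (rule integral_norm_bound)
  also have "\<dots> = (\<integral>y. k y *\<^sub>R norm (f (z - y) - c) \<partial>lborel)" using k0 by simp
  also have "\<dots> = (\<integral>y. norm (f (z - y) - c) \<partial>?M)"
    using k0 by (subst integral_density) auto
  finally have "norm (conv k f z - c) \<le> (\<integral>y. norm (f (z - y) - c) \<partial>?M)" .
  then have "ennreal (norm (conv k f z - c) ^ q) \<le> ennreal ((\<integral>y. norm (f (z - y) - c) \<partial>?M) ^ q)"
    by (intro ennreal_leI power_mono) auto
  also have "\<dots> \<le> (\<integral>\<^sup>+y. ennreal (norm (f (z - y) - c) ^ q) \<partial>?M)"
    by (rule jensen_power[OF p _ _ q]) auto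
  also have "\<dots> = (\<integral>\<^sup>+y. ennreal (k y * norm (f (z - y) - c) ^ q) \<partial>lborel)"
    using k0 by (subst nn_integral_density) (auto simp: ennreal_mult)
  finally show ?thesis .
qed

text \<open>
  By \<open>moll_power_bound\<close> and Tonelli the error is an average of translation errors,
  with shifts shorter than \<open>\<epsilon>\<close>.
\<close>

lemma moll_slab_bound:
  fixes k :: "real \<times> (real^'d) \<Rightarrow> real" and f :: "real \<times> (real^'d) \<Rightarrow> 'b::euclidean_space"
  assumes k: "mollifier C \<epsilon> k" and f[measurable]: "f \<in> borel_measurable borel" and loc: "locally_L1 f" and q: "0 < q"
    and e: "\<And>y. norm y < \<epsilon> \<Longrightarrow> (\<integral>\<^sup>+z. ennreal (norm (f (z - y) - f z) ^ q) \<partial>slab a b) \<le> e"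
  shows "(\<integral>\<^sup>+z. ennreal (norm (conv k f z - f z) ^ q) \<partial>slab a b) \<le> e"
proof -
  have [measurable]: "k \<in> borel_measurable borel" by (rule mollifierD(10)[OF k])
  note k0 = mollifierD(3)[OF k]
  interpret pair_sigma_finite "lborel :: (real \<times> (real^'d)) measure" "slab a b :: (real \<times> (real^'d)) measure"
    unfolding pair_sigma_finite_def using sigma_finite_slab sigma_finite_lborel by blast
  have "(\<integral>\<^sup>+z. ennreal (norm (conv k f z - f z) ^ q) \<partial>slab a b)
      \<le> (\<integral>\<^sup>+z. (\<integral>\<^sup>+y. ennreal (k y * norm (f (z - y) - f z) ^ q) \<partial>lborel) \<partial>slab a b)"
    by (intro nn_integral_mono moll_power_bound[OF k f loc q])
  also have "\<dots> = (\<integral>\<^sup>+y. (\<integral>\<^sup>+z. ennreal (k y * norm (f (z - y) - f z) ^ q) \<partial>slab a b) \<partial>lborel)"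
    by (rule Fubini') measurable
  also have "\<dots> \<le> (\<integral>\<^sup>+y. ennreal (k y) * e \<partial>lborel)"
  proof (rule nn_integral_mono)
    fix y
    have "(\<integral>\<^sup>+z. ennreal (k y * norm (f (z - y) - f z) ^ q) \<partial>slab a b)
        = ennreal (k y) * (\<integral>\<^sup>+z. ennreal (norm (f (z - y) - f z) ^ q) \<partial>slab a b)"
      using k0 by (simp add: ennreal_mult nn_integral_cmult)
    also have "\<dots> \<le> ennreal (k y) * e"
    proof (cases "norm y < \<epsilon>")
      case True then show ?thesis by (intro mult_left_mono e) auto
    next
      case False then show ?thesis using mollifierD(5)[OF k, of y] by simp
    qed
    finally show "(\<integral>\<^sup>+z. ennreal (k y * norm (f (z - y) - f z) ^ q) \<partial>slab a b) \<le> ennreal (k y) * e" .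
  qed
  also have "\<dots> = (\<integral>\<^sup>+y. ennreal (k y) \<partial>lborel) * e" by (rule nn_integral_multc) simp
  also have "(\<integral>\<^sup>+y. ennreal (k y) \<partial>lborel) = 1"
    using mollifierD(6,7)[OF k] k0 by (simp add: nn_integral_eq_integral)
  finally show ?thesis by simp
qed

lemma ennreal_tendsto_0I:
  assumes "\<And>e::real. 0 < e \<Longrightarrow> eventually (\<lambda>n. A n \<le> ennreal e) F"
  shows "(A \<longlongrightarrow> (0::ennreal)) F"
proof (rule order_tendstoI)
  fix a :: ennreal assume "0 < a"
  then obtain r where r: "0 < r" "r < a" using dense by blast
  then have "r < \<infinity>" by (metis infinity_ennreal_def order_less_le_trans top_greatest)
  then obtain e where e: "r = ennreal e" "0 \<le> e" by (cases r) auto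
  then have "0 < e" using r by auto
  from assms[OF this] show "eventually (\<lambda>n. A n < a) F"
    by eventually_elim (use r e in auto)
qed simp

lemma moll_tendsto:
  fixes f :: "real \<times> (real^'d) \<Rightarrow> 'b::euclidean_space"
  assumes k: "\<And>n. mollifier C (\<epsilon> n) (k n)" and \<epsilon>: "\<epsilon> \<longlonglongrightarrow> 0" and f: "Lq_field T q f" and q: "0 < q"
  shows "(\<lambda>n. \<integral>\<^sup>+z. ennreal (norm (conv (k n) f z - f z) ^ q) \<partial>slab a b) \<longlonglongrightarrow> 0"
proof (rule ennreal_tendsto_0I)
  fix e :: real assume e: "0 < e"
  have m: "f \<in> borel_measurable borel" by (rule Lq_fieldD(1)[OF f])
  have "sper (\<lambda>z. norm (f z) ^ q)" using Lq_fieldD(2)[OF f] by (simp add: sper_def)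
  with Lq_fieldD(4)[OF f] have "locally_L1 (\<lambda>z. norm (f z) ^ q)" by (rule locally_L1_of_torus)
  then obtain d where d: "0 < d"
    "\<And>y. norm y < d \<Longrightarrow> (\<integral>\<^sup>+z. ennreal (norm (f (z - y) - f z) ^ q) \<partial>slab a b) \<le> ennreal e"
    by (rule translation_continuous[OF m _ q e, of a b]) blast
  have "\<forall>\<^sub>F n in sequentially. \<epsilon> n < d" using \<epsilon> d(1) by (rule order_tendstoD(2))
  then show "\<forall>\<^sub>F n in sequentially. (\<integral>\<^sup>+z. ennreal (norm (conv (k n) f z - f z) ^ q) \<partial>slab a b) \<le> ennreal e"
  proof eventually_elim
    case (elim n)
    show ?case by (rule moll_slab_bound[OF k m Lq_field_L1(2)[OF f q] q]) (use d elim in auto)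
  qed
qed

subsection \<open>Limits of products\<close>

text \<open>
  An increment of \<open>x ^ q\<close> is small relative to \<open>D ^ q\<close> when
  \<open>S\<close> is small relative to \<open>D\<close>, and is otherwise controlled by
  \<open>S ^ q\<close>.
\<close>

lemma power_increment_bound:
  fixes \<kappa> :: real
  assumes "0 < \<kappa>"
  obtains c where "0 \<le> c" "\<And>D S. 0 \<le> D \<Longrightarrow> 0 \<le> S \<Longrightarrow> (D + S) ^ q - D ^ q \<le> \<kappa> * D ^ q + c * S ^ q"
proof -
  have "(\<lambda>t::real. (1 + t) ^ q) \<midarrow>0\<rightarrow> (1 + 0) ^ q" by (intro tendsto_intros)
  then have "\<forall>\<^sub>F t in at 0. (1 + t :: real) ^ q < 1 + \<kappa>" using assms by (intro order_tendstoD(2)) auto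
  then have "\<forall>\<^sub>F t in at_right 0. (1 + t :: real) ^ q < 1 + \<kappa>" by (simp add: eventually_at_split)
  then obtain b :: real where b: "0 < b" "\<forall>t>0. t < b \<longrightarrow> (1 + t) ^ q < 1 + \<kappa>"
    unfolding eventually_at_right_field by blast
  define t where "t = b / 2"
  have t: "0 < t" "(1 + t) ^ q < 1 + \<kappa>" using b by (auto simp: t_def)
  define c where "c = (1 / t + 1) ^ q"
  show thesis
  proof (rule that[of c])
    show "0 \<le> c" using t by (simp add: c_def)
    fix D S :: real assume DS: "0 \<le> D" "0 \<le> S"
    show "(D + S) ^ q - D ^ q \<le> \<kappa> * D ^ q + c * S ^ q"
    proof (cases "S \<le> t * D")
      case True
      have "(D + S) ^ q \<le> ((1 + t) * D) ^ q" using True DS by (intro power_mono) (auto simp: algebra_simps)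
      also have "\<dots> = (1 + t) ^ q * D ^ q" by (rule power_mult_distrib)
      also have "\<dots> \<le> (1 + \<kappa>) * D ^ q" using t DS by (intro mult_right_mono) auto
      moreover have "0 \<le> c * S ^ q" using t DS by (simp add: c_def)
      ultimately show ?thesis by (simp add: algebra_simps)
    next
      case False
      then have "D \<le> S / t" using t by (simp add: field_simps)
      then have "(D + S) ^ q \<le> ((1 / t + 1) * S) ^ q" using DS by (intro power_mono) (auto simp: algebra_simps)
      also have "\<dots> = c * S ^ q" by (simp add: power_mult_distrib c_def)
      moreover have "0 \<le> D ^ q" "0 \<le> \<kappa> * D ^ q" using DS assms by auto
      ultimately show ?thesis by linarith
    qed
  qed
qed

text \<open>
  A form of Hoelder's inequality adapted to products of \<open>q\<close> factors. Here
  \<open>D\<close> stands for the size of the limit factors and \<open>S n\<close> for the sum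
  of the errors of the approximating ones; the difference of the two products is then an
  increment \<open>(D + S) ^ q - D ^ q\<close>. By \<open>power_increment_bound\<close> its
  integral is at most \<open>\<kappa>\<close> times a constant plus a multiple of the vanishing
  error, with \<open>\<kappa>\<close> as small as desired.
\<close>

lemma integral_limit_product:
  fixes F :: "nat \<Rightarrow> 'a \<Rightarrow> real"
  assumes int: "\<And>n. integrable M (F n)" "integrable M G"
    and D[measurable]: "D \<in> borel_measurable M" "\<And>x. 0 \<le> D x" "(\<integral>\<^sup>+x. ennreal (D x ^ q) \<partial>M) < \<infinity>"
    and S[measurable]: "\<And>n. S n \<in> borel_measurable M" "\<And>n x. 0 \<le> S n x" "(\<lambda>n. \<integral>\<^sup>+x. ennreal (S n x ^ q) \<partial>M) \<longlonglongrightarrow> 0"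
    and K: "0 \<le> K" "\<And>n x. \<bar>F n x - G x\<bar> \<le> K * ((D x + S n x) ^ q - D x ^ q)"
  shows "(\<lambda>n. integral\<^sup>L M (F n)) \<longlonglongrightarrow> integral\<^sup>L M G"
proof (rule tendsto_L1_int)
  show "(\<lambda>n. \<integral>\<^sup>+x. norm (F n x - G x) \<partial>M) \<longlonglongrightarrow> 0"
  proof (rule ennreal_tendsto_0I)
    fix e :: real assume e: "0 < e"
    obtain d where d: "(\<integral>\<^sup>+x. ennreal (D x ^ q) \<partial>M) = ennreal d" "0 \<le> d"
      using D(3) by (cases "\<integral>\<^sup>+x. ennreal (D x ^ q) \<partial>M") auto
    define \<kappa> where "\<kappa> = e / (2 * ((K + 1) * (d + 1)))"
    have \<kappa>: "0 < \<kappa>" using e K d by (simp add: \<kappa>_def)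
    obtain c where c: "0 \<le> c" "\<And>D S. 0 \<le> D \<Longrightarrow> 0 \<le> S \<Longrightarrow> (D + S) ^ q - D ^ q \<le> \<kappa> * D ^ q + c * S ^ q"
      by (rule power_increment_bound[OF \<kappa>, of q]) blast
    have b: "(\<integral>\<^sup>+x. norm (F n x - G x) \<partial>M) \<le> ennreal (K * \<kappa> * d) + ennreal (K * c) * (\<integral>\<^sup>+x. ennreal (S n x ^ q) \<partial>M)" for n
    proof -
      have "(\<integral>\<^sup>+x. norm (F n x - G x) \<partial>M) \<le> (\<integral>\<^sup>+x. ennreal (K * \<kappa>) * ennreal (D x ^ q) + ennreal (K * c) * ennreal (S n x ^ q) \<partial>M)"
      proof (rule nn_integral_mono)
        fix x
        have "\<bar>F n x - G x\<bar> \<le> K * (\<kappa> * D x ^ q + c * S n x ^ q)"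
          by (rule order_trans[OF K(2)]) (intro mult_left_mono c D S K)
        then have "\<bar>F n x - G x\<bar> \<le> K * \<kappa> * D x ^ q + K * c * S n x ^ q" by (simp add: algebra_simps)
        then show "ennreal (norm (F n x - G x)) \<le> ennreal (K * \<kappa>) * ennreal (D x ^ q) + ennreal (K * c) * ennreal (S n x ^ q)"
          using K(1) \<kappa> c(1) D(2)[of x] S(2)[of n x]
          by (simp add: ennreal_mult[symmetric] ennreal_plus[symmetric] ennreal_leI del: ennreal_plus)
      qed
      also have "\<dots> = ennreal (K * \<kappa>) * ennreal d + ennreal (K * c) * (\<integral>\<^sup>+x. ennreal (S n x ^ q) \<partial>M)"
        using d by (simp add: nn_integral_add nn_integral_cmult)
      finally show ?thesis using K(1) \<kappa> d by (simp add: ennreal_mult)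
    qed
    have "K * \<kappa> * d \<le> e / 2"
    proof -
      have "K * d \<le> (K + 1) * (d + 1)" using K d by (simp add: algebra_simps)
      then have "\<kappa> * (K * d) \<le> \<kappa> * ((K + 1) * (d + 1))" using \<kappa> by (intro mult_left_mono) auto
      also have "\<dots> = e / 2" using K d by (simp add: \<kappa>_def)
      finally show ?thesis by (simp add: mult_ac)
    qed
    have "\<forall>\<^sub>F n in sequentially. (\<integral>\<^sup>+x. ennreal (S n x ^ q) \<partial>M) < ennreal (e / (2 * (K * c + 1)))"
    proof (rule order_tendstoD(2)[OF S(3)])
      have "0 \<le> K * c" using K(1) c(1) by simp
      then show "0 < ennreal (e / (2 * (K * c + 1)))" using e by simp
    qed
    then show "\<forall>\<^sub>F n in sequentially. (\<integral>\<^sup>+x. norm (F n x - G x) \<partial>M) \<le> ennreal e"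
    proof eventually_elim
      case (elim n)
      have "(\<integral>\<^sup>+x. norm (F n x - G x) \<partial>M) \<le> ennreal (e / 2) + ennreal (K * c) * ennreal (e / (2 * (K * c + 1)))"
        using elim \<open>K * \<kappa> * d \<le> e / 2\<close> by (intro order_trans[OF b] add_mono mult_left_mono ennreal_leI) auto
      also have "\<dots> = ennreal (e / 2 + K * c * (e / (2 * (K * c + 1))))"
        using e K c by (simp add: ennreal_mult[symmetric] ennreal_plus[symmetric] del: ennreal_plus)
      also have "\<dots> \<le> ennreal e"
      proof (rule ennreal_leI)
        have "0 \<le> K * c" using K(1) c(1) by simp
        then have "K * c / (K * c + 1) \<le> 1" by simp
        then have "e / 2 * (K * c / (K * c + 1)) \<le> e / 2 * 1" using e by (intro mult_left_mono) auto
        then show "e / 2 + K * c * (e / (2 * (K * c + 1))) \<le> e" by (simp add: field_simps)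
      qed
      finally show ?case .
    qed
  qed
qed (use int in auto)

section \<open>Commutator estimates\<close>

text \<open>
  Besov regularity \<open>s\<close> away from the ends of the time interval, expressed by cubes
  of \<open>L\<^sup>3\<close> norms so that no roots are taken. Shifts of norm below
  \<open>\<epsilon>\<close> are bounded by a power of \<open>\<epsilon>\<close>, the form in
  which they appear in averages over balls.
\<close>

definition besov_incr :: "real \<Rightarrow> real \<Rightarrow> real \<Rightarrow> (real \<times> (real^'d) \<Rightarrow> 'b::euclidean_space) \<Rightarrow> bool" where
  "besov_incr a b s f \<longleftrightarrow> (\<exists>K\<ge>0. \<exists>\<delta>>0. \<forall>\<epsilon> y. 0 < \<epsilon> \<longrightarrow> \<epsilon> < \<delta> \<longrightarrow> norm y < \<epsilon> \<longrightarrow>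
     (\<integral>\<^sup>+z. ennreal (norm (f (z - y) - f z) ^ 3) \<partial>slab a b) \<le> ennreal (K * \<epsilon> powr (3 * s)))"

definition ball_unif :: "real \<Rightarrow> (real \<times> (real^'d)) measure" where
  "ball_unif \<epsilon> = uniform_measure lborel (ball 0 \<epsilon>)"

lemma ball_unif_basic[simp, measurable_cong]: "sets (ball_unif \<epsilon>) = sets borel" "space (ball_unif \<epsilon>) = UNIV"
  by (simp_all add: ball_unif_def)

lemma emeasure_ball_unif:
  assumes "0 < \<epsilon>" shows "emeasure (ball_unif \<epsilon> :: (real \<times> (real^'d)) measure) UNIV = 1"
proof -
  have "measure lborel (ball (0 :: real \<times> (real^'d)) \<epsilon>) > 0" using assms by simp
  then have "emeasure lborel (ball (0 :: real \<times> (real^'d)) \<epsilon>) \<noteq> 0" by (auto simp: measure_def)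
  moreover have "emeasure lborel (ball (0 :: real \<times> (real^'d)) \<epsilon>) \<noteq> \<infinity>"
    using emeasure_lborel_ball_finite[of "0 :: real \<times> (real^'d)" \<epsilon>] by auto
  ultimately show ?thesis by (simp add: ball_unif_def ennreal_divide_self less_top)
qed

lemma nn_integral_ball_unif:
  fixes G :: "real \<times> (real^'d) \<Rightarrow> ennreal"
  assumes "0 < \<epsilon>" "G \<in> borel_measurable borel"
  shows "(\<integral>\<^sup>+y. G y \<partial>ball_unif \<epsilon>) = (\<integral>\<^sup>+y. ennreal (indicator (ball 0 \<epsilon>) y / measure lborel (ball (0 :: real \<times> (real^'d)) \<epsilon>)) * G y \<partial>lborel)"
proof -
  let ?V = "measure lborel (ball (0 :: real \<times> (real^'d)) \<epsilon>)"
  have V: "?V > 0" using assms by simp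
  have "emeasure lborel (ball (0 :: real \<times> (real^'d)) \<epsilon>) = ennreal ?V"
    using emeasure_lborel_ball_finite[of "0 :: real \<times> (real^'d)" \<epsilon>] by (intro emeasure_eq_ennreal_measure) auto
  then have "indicator (ball (0 :: real \<times> (real^'d)) \<epsilon>) y / emeasure lborel (ball (0 :: real \<times> (real^'d)) \<epsilon>)
     = ennreal (indicator (ball 0 \<epsilon>) y / ?V)" for y
    using V by (auto simp: indicator_def divide_ennreal[symmetric])
  then have eq: "(\<lambda>y. indicator (ball (0 :: real \<times> (real^'d)) \<epsilon>) y / emeasure lborel (ball (0 :: real \<times> (real^'d)) \<epsilon>))
     = (\<lambda>y. ennreal (indicator (ball 0 \<epsilon>) y / ?V))" by (rule ext)
  have [measurable]: "ball (0 :: real \<times> (real^'d)) \<epsilon> \<in> sets borel" "G \<in> borel_measurable borel" using assms(2) by simp_all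
  show ?thesis
    unfolding ball_unif_def uniform_measure_def eq by (rule nn_integral_density) measurable
qed

lemma nn_integral_le_ball_unif:
  fixes G :: "real \<times> (real^'d) \<Rightarrow> ennreal"
  assumes "0 < \<epsilon>" "0 \<le> c" "G \<in> borel_measurable borel"
    and "\<And>y. 0 \<le> h y" "\<And>y. h y \<le> c / measure lborel (ball (0 :: real \<times> (real^'d)) \<epsilon>)" "\<And>y. \<epsilon> \<le> norm y \<Longrightarrow> h y = 0"
  shows "(\<integral>\<^sup>+y. ennreal (h y) * G y \<partial>lborel) \<le> ennreal c * (\<integral>\<^sup>+y. G y \<partial>ball_unif \<epsilon>)"
proof -
  let ?V = "measure lborel (ball (0 :: real \<times> (real^'d)) \<epsilon>)"
  have "(\<integral>\<^sup>+y. ennreal (h y) * G y \<partial>lborel) \<le> (\<integral>\<^sup>+y. ennreal c * (ennreal (indicator (ball 0 \<epsilon>) y / ?V) * G y) \<partial>lborel)"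
  proof (rule nn_integral_mono)
    fix y
    have "h y \<le> c * (indicator (ball 0 \<epsilon>) y / ?V)"
      using assms(5,6)[of y] by (auto simp: indicator_def)
    then have "ennreal (h y) \<le> ennreal c * ennreal (indicator (ball 0 \<epsilon>) y / ?V)"
      using assms(2) by (simp add: ennreal_mult[symmetric] ennreal_leI)
    then show "ennreal (h y) * G y \<le> ennreal c * (ennreal (indicator (ball 0 \<epsilon>) y / ?V) * G y)"
      by (metis mult.assoc mult_right_mono zero_le)
  qed
  also have "\<dots> = ennreal c * (\<integral>\<^sup>+y. G y \<partial>ball_unif \<epsilon>)"
  proof -
    have [measurable]: "ball (0 :: real \<times> (real^'d)) \<epsilon> \<in> sets borel" "G \<in> borel_measurable borel" using assms(3) by simp_all
    show ?thesis unfolding nn_integral_ball_unif[OF assms(1,3)] by (rule nn_integral_cmult) measurable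
  qed
  finally show ?thesis .
qed

lemma sigma_finite_ball_unif:
  assumes "0 < \<epsilon>" shows "sigma_finite_measure (ball_unif \<epsilon> :: (real \<times> (real^'d)) measure)"
proof -
  have "finite_measure (ball_unif \<epsilon> :: (real \<times> (real^'d)) measure)"
    by standard (simp add: emeasure_ball_unif[OF assms])
  then show ?thesis using finite_measure.axioms(1) by blast
qed

lemma ball_unif_average_bound:
  fixes f :: "real \<times> (real^'d) \<Rightarrow> 'b::euclidean_space"
  assumes e: "0 < \<epsilon>" and f[measurable]: "f \<in> borel_measurable borel"
    and b: "\<And>y. norm y < \<epsilon> \<Longrightarrow> (\<integral>\<^sup>+z. ennreal (norm (f (z - y) - f z) ^ 3) \<partial>slab a b) \<le> B"
  shows "(\<integral>\<^sup>+z. (\<integral>\<^sup>+y. ennreal (norm (f (z - y) - f z) ^ 3) \<partial>ball_unif \<epsilon>) \<partial>slab a b) \<le> B"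
proof -
  interpret pair_sigma_finite "ball_unif \<epsilon> :: (real \<times> (real^'d)) measure" "slab a b :: (real \<times> (real^'d)) measure"
    unfolding pair_sigma_finite_def using sigma_finite_slab sigma_finite_ball_unif[OF e] by blast
  have "(\<integral>\<^sup>+z. (\<integral>\<^sup>+y. ennreal (norm (f (z - y) - f z) ^ 3) \<partial>ball_unif \<epsilon>) \<partial>slab a b)
      = (\<integral>\<^sup>+y. (\<integral>\<^sup>+z. ennreal (norm (f (z - y) - f z) ^ 3) \<partial>slab a b) \<partial>ball_unif \<epsilon>)"
    by (rule Fubini') measurable
  also have "\<dots> \<le> (\<integral>\<^sup>+y. B \<partial>(ball_unif \<epsilon> :: (real \<times> (real^'d)) measure))"
  proof (rule nn_integral_mono_AE)
    have "AE y in (ball_unif \<epsilon> :: (real \<times> (real^'d)) measure). y \<in> ball 0 \<epsilon>"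
      unfolding ball_unif_def by (rule AE_uniform_measureI) auto
    then show "AE y in (ball_unif \<epsilon> :: (real \<times> (real^'d)) measure). (\<integral>\<^sup>+z. ennreal (norm (f (z - y) - f z) ^ 3) \<partial>slab a b) \<le> B"
      by eventually_elim (use b in auto)
  qed
  also have "\<dots> = B" using emeasure_ball_unif[OF e, where 'd='d] by simp
  finally show ?thesis .
qed

text \<open>
  The derivative of the kernel has integral zero, so \<open>D(k * w)\<close> is a convolution
  with the increments \<open>w (z - y) - w z\<close>. The kernel gradient costs \<open>1 /
  \<epsilon>\<close>, the increments give back \<open>\<epsilon>\<^sup>s\<close>.
\<close>

lemma moll_deriv_bound:
  fixes w :: "real \<times> (real^'d) \<Rightarrow> real"
  assumes k: "mollifier C \<epsilon> k" and C: "1 \<le> C" and w[measurable]: "w \<in> borel_measurable borel" and loc: "locally_L1 w"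
  shows "ennreal (\<bar>frechet_derivative (conv k w) (at z) v\<bar> ^ 3)
    \<le> ennreal ((C / \<epsilon> * norm v) ^ 3) * (\<integral>\<^sup>+y. ennreal (norm (w (z - y) - w z) ^ 3) \<partial>ball_unif \<epsilon>)"
proof -
  have e: "0 < \<epsilon>" by (rule mollifierD(1)[OF k])
  let ?V = "measure lborel (ball (0 :: real \<times> (real^'d)) \<epsilon>)"
  have V: "?V > 0" using e by simp
  define D where "D = (\<lambda>y. frechet_derivative k (at y) v)"
  have sk: "smooth k" by (rule mollifierD(2)[OF k])
  have Dm[measurable]: "D \<in> borel_measurable borel" unfolding D_def by (intro smooth_measurable smooth_deriv sk)
  have Dz: "D y = 0" if "\<epsilon> \<le> norm y" for y
  proof -
    have out: "D y = 0" if "\<epsilon> < norm y" for y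
      unfolding D_def by (rule deriv_zero_outside[of "- cball 0 \<epsilon>"]) (use that mollifierD(5)[OF k] in auto)
    have "continuous_on UNIV D" unfolding D_def by (intro smooth_continuous smooth_deriv sk)
    then have "isCont D x" for x by (simp add: continuous_on_eq_continuous_at del: split_paired_All)
    then have c: "isCont (\<lambda>t::real. D (t *\<^sub>R y)) 1"
      by (intro continuous_at_compose[unfolded o_def, of _ "\<lambda>t. t *\<^sub>R y" D]) (auto intro!: continuous_intros)
    have "((\<lambda>t::real. D (t *\<^sub>R y)) \<longlongrightarrow> D (1 *\<^sub>R y)) (at_right 1)"
      using c unfolding isCont_def by (rule tendsto_within_subset) simp
    moreover have "\<forall>\<^sub>F t in at_right 1. D (t *\<^sub>R y) = 0"
      unfolding eventually_at_right_field
    proof (intro exI[of _ 2] conjI allI impI)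
      fix t :: real assume "1 < t"
      then have "1 * norm y < t * norm y" using e that by (intro mult_strict_right_mono) auto
      then have "norm y < t * norm y" by simp
      then show "D (t *\<^sub>R y) = 0" using \<open>1 < t\<close> that by (intro out) auto
    qed simp
    ultimately have "((\<lambda>t::real. 0) \<longlongrightarrow> D (1 *\<^sub>R y)) (at_right 1)" by (rule Lim_transform_eventually)
    then show ?thesis by (simp add: tendsto_const_iff)
  qed
  have Db: "\<bar>D y\<bar> \<le> (C / \<epsilon> * norm v) / ?V" for y
    using mollifierD(9)[OF k, of y v] by (simp add: D_def)
  have Dc: "continuous_on UNIV D" unfolding D_def by (intro smooth_continuous smooth_deriv sk)
  have intD: "integrable lborel (\<lambda>y. D y)" by (rule integrable_continuous_compact[OF Dc Dz])
  have one: "locally_L1 (\<lambda>_ :: real \<times> (real^'d). 1 :: real)"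
    unfolding locally_L1_def using emeasure_lborel_cball_finite[of "0 :: real \<times> (real^'d)"]
    by (auto intro!: integrable_real_indicator)
  have D0: "(\<integral>y. D y \<partial>lborel) = 0"
  proof -
    have "conv k (\<lambda>_. 1) = (\<lambda>_. 1 :: real)"
      using mollifierD(6,7)[OF k] by (auto simp: conv_alt[OF mollifierD(10)[OF k]])
    then have "frechet_derivative (conv k (\<lambda>_. 1 :: real)) (at 0) v = 0" by simp
    moreover have "frechet_derivative (conv k (\<lambda>_. 1 :: real)) (at 0) v = conv D (\<lambda>_. 1) 0"
      unfolding D_def using mollifierD(5)[OF k] by (intro conv_deriv[OF sk one, of \<epsilon>]) auto
    ultimately show ?thesis by (simp add: conv_alt)
  qed
  have i1: "integrable lborel (\<lambda>y. D y * w (z - y))"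
  proof -
    have "integrable lborel (\<lambda>y. D (z - y) *\<^sub>R w y)"
      by (rule conv_integrable[where R=\<epsilon>, OF Dc _ loc]) (rule Dz)
    then show ?thesis unfolding conv_alt(2)[OF Dm w] by simp
  qed
  have i2: "integrable lborel (\<lambda>y. D y * (w (z - y) - w z))"
    using i1 intD by (simp add: right_diff_distrib)
  have "frechet_derivative (conv k w) (at z) v = conv D w z"
    unfolding D_def using mollifierD(5)[OF k] by (intro conv_deriv[OF sk loc, of \<epsilon>]) auto
  also have "\<dots> = (\<integral>y. D y * w (z - y) \<partial>lborel)" by (simp add: conv_alt)
  also have "\<dots> = (\<integral>y. D y * (w (z - y) - w z) \<partial>lborel)"
    using i1 intD D0 by (simp add: right_diff_distrib)
  finally have eq: "frechet_derivative (conv k w) (at z) v = (\<integral>y. D y * (w (z - y) - w z) \<partial>lborel)" .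
  have iw: "integrable (ball_unif \<epsilon>) (\<lambda>y. \<bar>w (z - y) - w z\<bar>)"
  proof (rule integrableI_bounded)
    have "integrable lborel (\<lambda>y. indicator (ball 0 \<epsilon>) y / ?V * \<bar>w (z - y) - w z\<bar>)"
    proof -
      define S where "S = norm z + \<epsilon>"
      have "integrable lborel (\<lambda>y. indicator (cball 0 S) y *\<^sub>R \<bar>w y\<bar>)"
      proof -
        have "integrable lborel (\<lambda>y. indicator (cball 0 S) y *\<^sub>R w y)" using loc unfolding locally_L1_def by blast
        from integrable_norm[OF this] show ?thesis by (simp add: abs_mult)
      qed
      moreover have m: "(\<lambda>y. indicator (cball 0 S) y *\<^sub>R \<bar>w y\<bar>) \<in> borel_measurable borel"
      proof -
        have [measurable]: "cball (0 :: real \<times> (real^'d)) S \<in> sets borel" by simp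
        show ?thesis by measurable
      qed
      ultimately have "integrable lborel (\<lambda>y. indicator (cball 0 S) (z - y) *\<^sub>R \<bar>w (z - y)\<bar>)"
        using integrable_lborel_affine[OF m, of "-1" z] by simp
      moreover have "integrable lborel (\<lambda>y. \<bar>w z\<bar> * indicat_real (ball (0 :: real \<times> (real^'d)) \<epsilon>) y)"
        using emeasure_lborel_ball_finite[of "0 :: real \<times> (real^'d)" \<epsilon>]
        by (intro integrable_mult_right integrable_real_indicator) auto
      ultimately have i: "integrable lborel (\<lambda>y. (indicator (cball 0 S) (z - y) *\<^sub>R \<bar>w (z - y)\<bar> + \<bar>w z\<bar> * indicat_real (ball (0 :: real \<times> (real^'d)) \<epsilon>) y) / ?V)"
        by (intro integrable_divide Bochner_Integration.integrable_add)
      show ?thesis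
      proof (rule Bochner_Integration.integrable_bound[OF i])
        have [measurable]: "ball (0 :: real \<times> (real^'d)) \<epsilon> \<in> sets borel" by simp
        show "(\<lambda>y. indicator (ball 0 \<epsilon>) y / ?V * \<bar>w (z - y) - w z\<bar>) \<in> borel_measurable lborel" by measurable
        show "AE y in lborel. norm (indicator (ball 0 \<epsilon>) y / ?V * \<bar>w (z - y) - w z\<bar>)
           \<le> norm ((indicator (cball 0 S) (z - y) *\<^sub>R \<bar>w (z - y)\<bar> + \<bar>w z\<bar> * indicat_real (ball (0 :: real \<times> (real^'d)) \<epsilon>) y) / ?V)"
        proof (rule AE_I2)
          fix y
          show "norm (indicator (ball 0 \<epsilon>) y / ?V * \<bar>w (z - y) - w z\<bar>)
             \<le> norm ((indicator (cball 0 S) (z - y) *\<^sub>R \<bar>w (z - y)\<bar> + \<bar>w z\<bar> * indicat_real (ball (0 :: real \<times> (real^'d)) \<epsilon>) y) / ?V)"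
          proof (cases "norm y < \<epsilon>")
            case True
            then have "z - y \<in> cball 0 S" using norm_triangle_ineq4[of z y] by (simp add: S_def)
            then show ?thesis using True V abs_triangle_ineq4[of "w (z - y)" "w z"] by (simp add: divide_right_mono)
          qed simp
        qed
      qed
    qed
    then have "(\<integral>\<^sup>+y. ennreal (norm (indicator (ball 0 \<epsilon>) y / ?V * \<bar>w (z - y) - w z\<bar>)) \<partial>lborel) < \<infinity>"
      by (simp add: integrable_iff_bounded)
    then show "(\<integral>\<^sup>+y. ennreal (norm \<bar>w (z - y) - w z\<bar>) \<partial>ball_unif \<epsilon>) < \<infinity>"
    proof -
      have "ennreal (norm (indicator (ball 0 \<epsilon>) y / ?V * \<bar>w (z - y) - w z\<bar>))
          = ennreal (indicator (ball 0 \<epsilon>) y / ?V) * ennreal (norm \<bar>w (z - y) - w z\<bar>)" for y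
        using V by (subst ennreal_mult[symmetric]) (auto simp: abs_mult)
      moreover have m: "(\<lambda>y. ennreal (norm \<bar>w (z - y) - w z\<bar>)) \<in> borel_measurable borel" by measurable
      ultimately show ?thesis
        using \<open>(\<integral>\<^sup>+y. ennreal (norm (indicator (ball 0 \<epsilon>) y / ?V * \<bar>w (z - y) - w z\<bar>)) \<partial>lborel) < \<infinity>\<close>
        by (simp only: nn_integral_ball_unif[OF e m])
    qed
  qed measurable
  have "ennreal \<bar>frechet_derivative (conv k w) (at z) v\<bar> \<le> (\<integral>\<^sup>+y. ennreal (norm (D y * (w (z - y) - w z))) \<partial>lborel)"
    unfolding eq using integral_norm_bound_ennreal[OF i2] by simp
  also have "\<dots> = (\<integral>\<^sup>+y. ennreal \<bar>D y\<bar> * ennreal \<bar>w (z - y) - w z\<bar> \<partial>lborel)"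
    by (simp add: abs_mult ennreal_mult)
  also have "\<dots> \<le> ennreal (C / \<epsilon> * norm v) * (\<integral>\<^sup>+y. ennreal \<bar>w (z - y) - w z\<bar> \<partial>ball_unif \<epsilon>)"
    using e C Db Dz by (intro nn_integral_le_ball_unif) auto
  also have "\<dots> = ennreal (C / \<epsilon> * norm v * (\<integral>y. \<bar>w (z - y) - w z\<bar> \<partial>ball_unif \<epsilon>))"
    using iw e C by (subst ennreal_mult) (auto simp: nn_integral_eq_integral)
  finally have "\<bar>frechet_derivative (conv k w) (at z) v\<bar> \<le> C / \<epsilon> * norm v * (\<integral>y. \<bar>w (z - y) - w z\<bar> \<partial>ball_unif \<epsilon>)"
    using e C by (subst (asm) ennreal_le_iff) auto
  then have "ennreal (\<bar>frechet_derivative (conv k w) (at z) v\<bar> ^ 3) \<le> ennreal ((C / \<epsilon> * norm v * (\<integral>y. \<bar>w (z - y) - w z\<bar> \<partial>ball_unif \<epsilon>)) ^ 3)"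
    by (intro ennreal_leI power_mono) auto
  also have "\<dots> = ennreal ((C / \<epsilon> * norm v) ^ 3) * ennreal ((\<integral>y. \<bar>w (z - y) - w z\<bar> \<partial>ball_unif \<epsilon>) ^ 3)"
    by (subst power_mult_distrib, rule ennreal_mult) (use e C in auto)
  also have "\<dots> \<le> ennreal ((C / \<epsilon> * norm v) ^ 3) * (\<integral>\<^sup>+y. ennreal (\<bar>w (z - y) - w z\<bar> ^ 3) \<partial>ball_unif \<epsilon>)"
    by (intro mult_left_mono jensen_power) (auto simp: emeasure_ball_unif[OF e])
  finally show ?thesis by simp
qed

text \<open>
  The identity of Constantin, E and Titi writes the commutator through increments only: it
  equals \<open>\<integral> k(y) \<delta>f(y) \<delta>W(y) dy - (\<integral> k \<delta>f)
  (\<integral> k \<delta>W)\<close> with \<open>\<delta>f(y) = f(z - y) - f(z)\<close>. The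
  weights \<open>\<theta>\<^sub>i\<close> in Young's inequality are free, so that it can replace
  Hoelder's inequality for three factors.
\<close>

lemma commutator_pointwise:
  fixes f :: "real \<times> (real^'d) \<Rightarrow> real" and W :: "real \<times> (real^'d) \<Rightarrow> 'b::euclidean_space"
  assumes k: "mollifier C \<epsilon> k" and C: "1 \<le> C"
    and m[measurable]: "f \<in> borel_measurable borel" "W \<in> borel_measurable borel"
    and loc: "locally_L1 f" "locally_L1 W" "locally_L1 (\<lambda>z. f z *\<^sub>R W z)"
    and \<theta>: "0 < \<theta>1" "0 < \<theta>2" "0 < \<theta>3" and Q: "0 \<le> Q"
  shows "ennreal (norm (conv k (\<lambda>z. f z *\<^sub>R W z) z - conv k f z *\<^sub>R conv k W z) * Q)
    \<le> ennreal (2 * C\<^sup>2 * (\<theta>1 * \<theta>2 * \<theta>3)) *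
       (ennreal (1 / \<theta>1 ^ 3) * (\<integral>\<^sup>+y. ennreal (norm (f (z - y) - f z) ^ 3) \<partial>ball_unif \<epsilon>)
        + ennreal (1 / \<theta>2 ^ 3) * (\<integral>\<^sup>+y. ennreal (norm (W (z - y) - W z) ^ 3) \<partial>ball_unif \<epsilon>)
        + ennreal (1 / \<theta>3 ^ 3 * Q ^ 3))" (is "_ \<le> ennreal (2 * C\<^sup>2 * ?\<theta>) * ?R")
proof -
  have e: "0 < \<epsilon>" by (rule mollifierD(1)[OF k])
  have km[measurable]: "k \<in> borel_measurable borel" by (rule mollifierD(10)[OF k])
  note k0 = mollifierD(3)[OF k] and k1 = mollifierD(6,7)[OF k]
  define df where "df = (\<lambda>y. f (z - y) - f z)"
  define dW where "dW = (\<lambda>y. W (z - y) - W z)"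
  have dm[measurable]: "df \<in> borel_measurable borel" "dW \<in> borel_measurable borel"
    unfolding df_def dW_def by measurable
  let ?fW = "\<lambda>z. f z *\<^sub>R W z"
  have i1: "integrable lborel (\<lambda>y. k y * f (z - y))" using moll_integrable'[OF k loc(1) m(1), of z] by simp
  have i2: "integrable lborel (\<lambda>y. k y *\<^sub>R W (z - y))" by (rule moll_integrable'[OF k loc(2) m(2)])
  have i3: "integrable lborel (\<lambda>y. k y *\<^sub>R (f (z - y) *\<^sub>R W (z - y)))"
    by (rule moll_integrable'[OF k loc(3)]) measurable
  have j1: "integrable lborel (\<lambda>y. k y * df y)" using i1 k1 by (simp add: df_def right_diff_distrib)
  have j2: "integrable lborel (\<lambda>y. k y *\<^sub>R dW y)" using i2 k1 by (simp add: dW_def scaleR_diff_right)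
  have e1: "(\<integral>y. k y * df y \<partial>lborel) = conv k f z - f z"
    using i1 k1 by (simp add: df_def right_diff_distrib conv_alt)
  have e2: "(\<integral>y. k y *\<^sub>R dW y \<partial>lborel) = conv k W z - W z"
    using i2 k1 by (simp add: dW_def scaleR_diff_right conv_alt)
  have expand: "k y *\<^sub>R (df y *\<^sub>R dW y) = k y *\<^sub>R (f (z - y) *\<^sub>R W (z - y)) - f z *\<^sub>R (k y *\<^sub>R W (z - y))
      - (k y * f (z - y)) *\<^sub>R W z + k y *\<^sub>R (f z *\<^sub>R W z)" for y
    by (simp add: df_def dW_def algebra_simps)
  have j3: "integrable lborel (\<lambda>y. k y *\<^sub>R (df y *\<^sub>R dW y))"
    unfolding expand using i1 i2 i3 k1 by (intro Bochner_Integration.integrable_add Bochner_Integration.integrable_diff integrable_scaleR_right integrable_scaleR_left) auto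
  have e3: "(\<integral>y. k y *\<^sub>R (df y *\<^sub>R dW y) \<partial>lborel) = conv k ?fW z - f z *\<^sub>R conv k W z - conv k f z *\<^sub>R W z + f z *\<^sub>R W z"
  proof -
    have a2: "integrable lborel (\<lambda>y. f z *\<^sub>R (k y *\<^sub>R W (z - y)))" using i2 by (rule integrable_scaleR_right)
    have a3: "integrable lborel (\<lambda>y. (k y * f (z - y)) *\<^sub>R W z)" using i1 by (rule integrable_scaleR_left)
    have a4: "integrable lborel (\<lambda>y. k y *\<^sub>R (f z *\<^sub>R W z))" using k1(1) by (rule integrable_scaleR_left)
    have v1: "(\<integral>y. k y *\<^sub>R (f (z - y) *\<^sub>R W (z - y)) \<partial>lborel) = conv k ?fW z"
      by (rule conv_alt(1)[symmetric]) measurable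
    have v2: "(\<integral>y. f z *\<^sub>R (k y *\<^sub>R W (z - y)) \<partial>lborel) = f z *\<^sub>R conv k W z"
      unfolding conv_alt(1)[OF km m(2)] by (rule integral_scaleR_right)
    have v3: "(\<integral>y. (k y * f (z - y)) *\<^sub>R W z \<partial>lborel) = conv k f z *\<^sub>R W z"
      unfolding conv_alt(1)[OF km m(1)] real_scaleR_def by (rule integral_scaleR_left, rule i1)
    have v4: "(\<integral>y. k y *\<^sub>R (f z *\<^sub>R W z) \<partial>lborel) = f z *\<^sub>R W z"
      using integral_scaleR_left[of "f z *\<^sub>R W z" lborel k] k1 by simp
    show ?thesis
      unfolding expand
      by (simp only: Bochner_Integration.integral_add Bochner_Integration.integral_diff
          Bochner_Integration.integrable_diff i3 a2 a3 a4 v1 v2 v3 v4)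
  qed
  have "conv k ?fW z - conv k f z *\<^sub>R conv k W z
      = (\<integral>y. k y *\<^sub>R (df y *\<^sub>R dW y) \<partial>lborel) - (\<integral>y. k y * df y \<partial>lborel) *\<^sub>R (\<integral>y. k y *\<^sub>R dW y \<partial>lborel)"
    unfolding e1 e2 e3 by (simp add: algebra_simps)
  then have "norm (conv k ?fW z - conv k f z *\<^sub>R conv k W z)
      \<le> norm (\<integral>y. k y *\<^sub>R (df y *\<^sub>R dW y) \<partial>lborel) + norm (\<integral>y. k y * df y \<partial>lborel) * norm (\<integral>y. k y *\<^sub>R dW y \<partial>lborel)"
    using norm_triangle_ineq4[of "\<integral>y. k y *\<^sub>R (df y *\<^sub>R dW y) \<partial>lborel" "(\<integral>y. k y * df y \<partial>lborel) *\<^sub>R (\<integral>y. k y *\<^sub>R dW y \<partial>lborel)"]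
    by (simp only: norm_scaleR real_norm_def)
  then have "ennreal (norm (conv k ?fW z - conv k f z *\<^sub>R conv k W z))
      \<le> ennreal (norm (\<integral>y. k y *\<^sub>R (df y *\<^sub>R dW y) \<partial>lborel)) + ennreal (norm (\<integral>y. k y * df y \<partial>lborel)) * ennreal (norm (\<integral>y. k y *\<^sub>R dW y \<partial>lborel))"
    by (simp add: ennreal_mult[symmetric] ennreal_plus[symmetric] ennreal_leI del: ennreal_plus)
  also have "\<dots> \<le> (\<integral>\<^sup>+y. ennreal (norm (k y *\<^sub>R (df y *\<^sub>R dW y))) \<partial>lborel)
      + (\<integral>\<^sup>+y. ennreal (norm (k y * df y)) \<partial>lborel) * (\<integral>\<^sup>+y. ennreal (norm (k y *\<^sub>R dW y)) \<partial>lborel)"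
    by (intro add_mono mult_mono integral_norm_bound_ennreal j1 j2 j3) auto
  also have "\<dots> = (\<integral>\<^sup>+y. ennreal (k y) * ennreal (\<bar>df y\<bar> * norm (dW y)) \<partial>lborel)
      + (\<integral>\<^sup>+y. ennreal (k y) * ennreal \<bar>df y\<bar> \<partial>lborel) * (\<integral>\<^sup>+y. ennreal (k y) * ennreal (norm (dW y)) \<partial>lborel)"
    using k0 by (simp add: abs_mult ennreal_mult mult.assoc)
  also have "\<dots> \<le> ennreal C * (\<integral>\<^sup>+y. ennreal (\<bar>df y\<bar> * norm (dW y)) \<partial>ball_unif \<epsilon>)
      + (ennreal C * (\<integral>\<^sup>+y. ennreal \<bar>df y\<bar> \<partial>ball_unif \<epsilon>)) * (ennreal C * (\<integral>\<^sup>+y. ennreal (norm (dW y)) \<partial>ball_unif \<epsilon>))"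
    using e C k0 mollifierD(5,8)[OF k]
    by (intro add_mono mult_mono nn_integral_le_ball_unif) auto
  finally have A: "ennreal (norm (conv k ?fW z - conv k f z *\<^sub>R conv k W z))
      \<le> ennreal C * (\<integral>\<^sup>+y. ennreal (\<bar>df y\<bar> * norm (dW y)) \<partial>ball_unif \<epsilon>)
      + (ennreal C * (\<integral>\<^sup>+y. ennreal \<bar>df y\<bar> \<partial>ball_unif \<epsilon>)) * (ennreal C * (\<integral>\<^sup>+y. ennreal (norm (dW y)) \<partial>ball_unif \<epsilon>))" .
  have young: "ennreal (\<bar>x\<bar> * norm v) * ennreal Q \<le> ennreal ?\<theta> * (ennreal (1 / \<theta>1 ^ 3) * ennreal (norm x ^ 3)
      + ennreal (1 / \<theta>2 ^ 3) * ennreal (norm v ^ 3) + ennreal (1 / \<theta>3 ^ 3 * Q ^ 3))" for x :: real and v :: 'b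
  proof -
    have "(\<bar>x\<bar> / \<theta>1) * (norm v / \<theta>2) * (Q / \<theta>3) \<le> (\<bar>x\<bar> / \<theta>1) ^ 3 + (norm v / \<theta>2) ^ 3 + (Q / \<theta>3) ^ 3"
      using \<theta> Q by (intro young3) auto
    then have "?\<theta> * ((\<bar>x\<bar> / \<theta>1) * (norm v / \<theta>2) * (Q / \<theta>3)) \<le> ?\<theta> * ((\<bar>x\<bar> / \<theta>1) ^ 3 + (norm v / \<theta>2) ^ 3 + (Q / \<theta>3) ^ 3)"
      using \<theta> by (intro mult_left_mono) auto
    moreover have "?\<theta> * ((\<bar>x\<bar> / \<theta>1) * (norm v / \<theta>2) * (Q / \<theta>3)) = \<bar>x\<bar> * norm v * Q" using \<theta> by simp
    ultimately have "\<bar>x\<bar> * norm v * Q \<le> ?\<theta> * (1 / \<theta>1 ^ 3 * norm x ^ 3 + 1 / \<theta>2 ^ 3 * norm v ^ 3 + 1 / \<theta>3 ^ 3 * Q ^ 3)"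
      by (simp add: power_divide)
    then have "ennreal (\<bar>x\<bar> * norm v * Q) \<le> ennreal (?\<theta> * (1 / \<theta>1 ^ 3 * norm x ^ 3 + 1 / \<theta>2 ^ 3 * norm v ^ 3 + 1 / \<theta>3 ^ 3 * Q ^ 3))"
      by (rule ennreal_leI)
    also have "\<dots> = ennreal ?\<theta> * (ennreal (1 / \<theta>1 ^ 3) * ennreal (norm x ^ 3)
      + ennreal (1 / \<theta>2 ^ 3) * ennreal (norm v ^ 3) + ennreal (1 / \<theta>3 ^ 3 * Q ^ 3))"
      using \<theta> Q by (subst ennreal_mult) (auto simp: ennreal_mult[symmetric] ennreal_plus[symmetric] simp del: ennreal_plus)
    finally show ?thesis using Q by (simp add: ennreal_mult)
  qed
  have u1: "emeasure (ball_unif \<epsilon> :: (real \<times> (real^'d)) measure) UNIV = 1" by (rule emeasure_ball_unif[OF e])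
  have B1: "(\<integral>\<^sup>+y. ennreal (\<bar>df y\<bar> * norm (dW y)) \<partial>ball_unif \<epsilon>) * ennreal Q \<le> ennreal ?\<theta> * ?R"
  proof -
    have "(\<integral>\<^sup>+y. ennreal (\<bar>df y\<bar> * norm (dW y)) \<partial>ball_unif \<epsilon>) * ennreal Q = (\<integral>\<^sup>+y. ennreal (\<bar>df y\<bar> * norm (dW y)) * ennreal Q \<partial>ball_unif \<epsilon>)"
      by (rule nn_integral_multc[symmetric]) measurable
    also have "\<dots> \<le> (\<integral>\<^sup>+y. ennreal ?\<theta> * (ennreal (1 / \<theta>1 ^ 3) * ennreal (norm (df y) ^ 3)
        + ennreal (1 / \<theta>2 ^ 3) * ennreal (norm (dW y) ^ 3) + ennreal (1 / \<theta>3 ^ 3 * Q ^ 3)) \<partial>ball_unif \<epsilon>)"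
      by (intro nn_integral_mono young)
    also have "\<dots> = ennreal ?\<theta> * ?R"
      by (simp add: nn_integral_cmult nn_integral_add u1 df_def dW_def)
    finally show ?thesis .
  qed
  have B2: "(\<integral>\<^sup>+y. ennreal \<bar>df y\<bar> \<partial>ball_unif \<epsilon>) * (\<integral>\<^sup>+y. ennreal (norm (dW y)) \<partial>ball_unif \<epsilon>) * ennreal Q \<le> ennreal ?\<theta> * ?R"
  proof -
    have "(\<integral>\<^sup>+y. ennreal \<bar>df y\<bar> \<partial>ball_unif \<epsilon>) * (\<integral>\<^sup>+y. ennreal (norm (dW y)) \<partial>ball_unif \<epsilon>) * ennreal Q
        = (\<integral>\<^sup>+y. (\<integral>\<^sup>+y'. ennreal (\<bar>df y\<bar> * norm (dW y')) * ennreal Q \<partial>ball_unif \<epsilon>) \<partial>ball_unif \<epsilon>)"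
      by (simp add: ennreal_mult nn_integral_cmult nn_integral_multc mult.assoc)
    also have "\<dots> \<le> (\<integral>\<^sup>+y. (\<integral>\<^sup>+y'. ennreal ?\<theta> * (ennreal (1 / \<theta>1 ^ 3) * ennreal (norm (df y) ^ 3)
        + ennreal (1 / \<theta>2 ^ 3) * ennreal (norm (dW y') ^ 3) + ennreal (1 / \<theta>3 ^ 3 * Q ^ 3)) \<partial>ball_unif \<epsilon>) \<partial>ball_unif \<epsilon>)"
      by (intro nn_integral_mono young)
    also have "\<dots> = ennreal ?\<theta> * ?R"
      by (simp add: nn_integral_cmult nn_integral_add u1 df_def dW_def)
    finally show ?thesis .
  qed
  have "ennreal (norm (conv k ?fW z - conv k f z *\<^sub>R conv k W z) * Q)
      = ennreal (norm (conv k ?fW z - conv k f z *\<^sub>R conv k W z)) * ennreal Q"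
    using Q by (simp add: ennreal_mult)
  also have "\<dots> \<le> (ennreal C * (\<integral>\<^sup>+y. ennreal (\<bar>df y\<bar> * norm (dW y)) \<partial>ball_unif \<epsilon>)
      + (ennreal C * (\<integral>\<^sup>+y. ennreal \<bar>df y\<bar> \<partial>ball_unif \<epsilon>)) * (ennreal C * (\<integral>\<^sup>+y. ennreal (norm (dW y)) \<partial>ball_unif \<epsilon>))) * ennreal Q"
    by (intro mult_right_mono A) auto
  also have "\<dots> = ennreal C * ((\<integral>\<^sup>+y. ennreal (\<bar>df y\<bar> * norm (dW y)) \<partial>ball_unif \<epsilon>) * ennreal Q)
      + ennreal C * ennreal C * ((\<integral>\<^sup>+y. ennreal \<bar>df y\<bar> \<partial>ball_unif \<epsilon>) * (\<integral>\<^sup>+y. ennreal (norm (dW y)) \<partial>ball_unif \<epsilon>) * ennreal Q)"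
    by (simp only: distrib_left distrib_right mult_ac)
  also have "\<dots> \<le> ennreal C * (ennreal ?\<theta> * ?R) + ennreal C * ennreal C * (ennreal ?\<theta> * ?R)"
    by (intro add_mono mult_left_mono B1 B2) auto
  also have "\<dots> = (ennreal C + ennreal C * ennreal C) * ennreal ?\<theta> * ?R" by (simp add: distrib_right mult.assoc)
  also have "\<dots> \<le> ennreal (2 * C\<^sup>2 * ?\<theta>) * ?R"
  proof (rule mult_right_mono)
    have "C * 1 \<le> C * C" using C by (intro mult_left_mono) auto
    then have "(C + C * C) * ?\<theta> \<le> 2 * C\<^sup>2 * ?\<theta>" using \<theta> by (intro mult_right_mono) (auto simp: power2_eq_square)
    moreover have "(ennreal C + ennreal C * ennreal C) * ennreal ?\<theta> = ennreal ((C + C * C) * ?\<theta>)"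
      using C \<theta> by (simp add: ennreal_mult[symmetric] ennreal_plus[symmetric] del: ennreal_plus)
    ultimately show "(ennreal C + ennreal C * ennreal C) * ennreal ?\<theta> \<le> ennreal (2 * C\<^sup>2 * ?\<theta>)"
      by (simp add: ennreal_leI)
  qed simp
  finally show ?thesis .
qed

text \<open>
  With weights \<open>\<theta>\<^sub>i = \<epsilon>\<^sup>s\<^sup>i\<close> each of the three
  terms is bounded independently of \<open>\<epsilon>\<close>, and the product of the weights
  remains in front.
\<close>

lemma commutator_bound:
  fixes f :: "real \<times> (real^'d) \<Rightarrow> real" and W :: "real \<times> (real^'d) \<Rightarrow> 'b::euclidean_space"
  assumes k: "mollifier C \<epsilon> k" and C: "1 \<le> C"
    and m[measurable]: "f \<in> borel_measurable borel" "W \<in> borel_measurable borel" "Q \<in> borel_measurable borel"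
    and loc: "locally_L1 f" "locally_L1 W" "locally_L1 (\<lambda>z. f z *\<^sub>R W z)"
    and Q: "\<And>z. 0 \<le> Q z"
    and Kf: "0 \<le> Kf" "\<And>y. norm y < \<epsilon> \<Longrightarrow> (\<integral>\<^sup>+z. ennreal (norm (f (z - y) - f z) ^ 3) \<partial>slab a b) \<le> ennreal (Kf * \<epsilon> powr (3 * s1))"
    and KW: "0 \<le> KW" "\<And>y. norm y < \<epsilon> \<Longrightarrow> (\<integral>\<^sup>+z. ennreal (norm (W (z - y) - W z) ^ 3) \<partial>slab a b) \<le> ennreal (KW * \<epsilon> powr (3 * s2))"
    and KQ: "0 \<le> KQ" "(\<integral>\<^sup>+z. ennreal (Q z ^ 3) \<partial>slab a b) \<le> ennreal (KQ * \<epsilon> powr (3 * s3))"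
  shows "(\<integral>\<^sup>+z. ennreal (norm (conv k (\<lambda>z. f z *\<^sub>R W z) z - conv k f z *\<^sub>R conv k W z) * Q z) \<partial>slab a b)
     \<le> ennreal (2 * C\<^sup>2 * (Kf + KW + KQ) * \<epsilon> powr (s1 + s2 + s3))"
proof -
  have e: "0 < \<epsilon>" by (rule mollifierD(1)[OF k])
  have cube: "(\<epsilon> powr s) ^ 3 = \<epsilon> powr (3 * s)" for s
    using e by (simp add: powr_power mult.commute)
  let ?\<theta> = "\<epsilon> powr s1 * \<epsilon> powr s2 * \<epsilon> powr s3"
  have th: "?\<theta> = \<epsilon> powr (s1 + s2 + s3)" by (simp add: powr_add)
  interpret P: sigma_finite_measure "ball_unif \<epsilon> :: (real \<times> (real^'d)) measure" by (rule sigma_finite_ball_unif[OF e])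
  have n: "ennreal (1 / (\<epsilon> powr s) ^ 3) * A \<le> ennreal K"
    if "A \<le> ennreal (K * \<epsilon> powr (3 * s))" "0 \<le> K" for A s K
  proof -
    have "ennreal (1 / (\<epsilon> powr s) ^ 3) * A \<le> ennreal (1 / (\<epsilon> powr s) ^ 3) * ennreal (K * \<epsilon> powr (3 * s))"
      using that by (intro mult_left_mono) auto
    also have "\<dots> = ennreal K" using e that(2) by (simp add: ennreal_mult[symmetric] cube)
    finally show ?thesis .
  qed
  have "(\<integral>\<^sup>+z. ennreal (norm (conv k (\<lambda>z. f z *\<^sub>R W z) z - conv k f z *\<^sub>R conv k W z) * Q z) \<partial>slab a b)
    \<le> (\<integral>\<^sup>+z. ennreal (2 * C\<^sup>2 * ?\<theta>) *
       (ennreal (1 / (\<epsilon> powr s1) ^ 3) * (\<integral>\<^sup>+y. ennreal (norm (f (z - y) - f z) ^ 3) \<partial>ball_unif \<epsilon>)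
        + ennreal (1 / (\<epsilon> powr s2) ^ 3) * (\<integral>\<^sup>+y. ennreal (norm (W (z - y) - W z) ^ 3) \<partial>ball_unif \<epsilon>)
        + ennreal (1 / (\<epsilon> powr s3) ^ 3 * Q z ^ 3)) \<partial>slab a b)"
    using e by (intro nn_integral_mono commutator_pointwise[OF k C m(1,2) loc]) (auto simp: Q)
  also have "\<dots> = ennreal (2 * C\<^sup>2 * ?\<theta>) *
       (ennreal (1 / (\<epsilon> powr s1) ^ 3) * (\<integral>\<^sup>+z. (\<integral>\<^sup>+y. ennreal (norm (f (z - y) - f z) ^ 3) \<partial>ball_unif \<epsilon>) \<partial>slab a b)
        + ennreal (1 / (\<epsilon> powr s2) ^ 3) * (\<integral>\<^sup>+z. (\<integral>\<^sup>+y. ennreal (norm (W (z - y) - W z) ^ 3) \<partial>ball_unif \<epsilon>) \<partial>slab a b)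
        + ennreal (1 / (\<epsilon> powr s3) ^ 3) * (\<integral>\<^sup>+z. ennreal (Q z ^ 3) \<partial>slab a b))"
  proof -
    have q: "ennreal (1 / (\<epsilon> powr s3) ^ 3 * Q z ^ 3) = ennreal (1 / (\<epsilon> powr s3) ^ 3) * ennreal (Q z ^ 3)" for z
      using Q by (intro ennreal_mult) auto
    show ?thesis unfolding q by (subst nn_integral_cmult, measurable) (simp add: nn_integral_cmult nn_integral_add)
  qed
  also have "\<dots> \<le> ennreal (2 * C\<^sup>2 * ?\<theta>) * (ennreal Kf + ennreal KW + ennreal KQ)"
    using e by (intro mult_left_mono add_mono n ball_unif_average_bound Kf KW KQ m) auto
  also have "\<dots> = ennreal (2 * C\<^sup>2 * (Kf + KW + KQ) * \<epsilon> powr (s1 + s2 + s3))"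
    using Kf(1) KW(1) KQ(1) by (simp add: powr_add ennreal_mult[symmetric] ennreal_plus[symmetric] mult_ac del: ennreal_plus)
  finally show ?thesis .
qed

section \<open>Balances of the mollified fields\<close>

lemma smooth_sum:
  assumes "\<And>i. i \<in> I \<Longrightarrow> smooth (f i)"
  shows "smooth (\<lambda>x. \<Sum>i\<in>I. f i x)"
  using assms
proof (induction I rule: infinite_finite_induct)
  case (insert i I)
  then show ?case by (simp add: smooth_add)
qed (simp_all add: smooth_const)

lemma smooth_frechet_field:
  assumes "smooth f" "\<And>e. e \<in> Basis \<Longrightarrow> smooth (\<lambda>z. V z \<bullet> e)"
  shows "smooth (\<lambda>z. frechet_derivative f (at z) (V z))"
  unfolding frechet_sum[OF assms(1), of _ "V _"]
  by (intro smooth_sum smooth_mult assms smooth_deriv)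

lemma measurable_frechet_field:
  fixes V :: "'a::euclidean_space \<Rightarrow> 'a"
  assumes "smooth f" "V \<in> borel_measurable borel"
  shows "(\<lambda>z. frechet_derivative f (at z) (V z)) \<in> borel_measurable borel"
proof -
  have [measurable]: "(\<lambda>z. frechet_derivative f (at z) e) \<in> borel_measurable borel" for e
    by (intro smooth_measurable smooth_deriv assms)
  have [measurable]: "V \<in> borel_measurable borel" by (rule assms)
  show ?thesis unfolding frechet_sum[OF assms(1), of _ "V _"] by measurable
qed

lemma frechet_power:
  assumes "smooth f"
  shows "frechet_derivative (\<lambda>x. f x ^ Suc n) (at z) v = real (Suc n) * f z ^ n * frechet_derivative f (at z) v"
proof (induction n)
  case (Suc n)
  have "frechet_derivative (\<lambda>x. f x * f x ^ Suc n) (at z) v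
      = f z * frechet_derivative (\<lambda>x. f x ^ Suc n) (at z) v + frechet_derivative f (at z) v * f z ^ Suc n"
    by (rule frechet_mult[OF assms smooth_power[OF assms]])
  then show ?case unfolding Suc.IH by (simp add: algebra_simps)
qed simp

lemma integrable_slab_test_mult:
  assumes "slab_test a b g" "smooth h"
  shows "integrable torus (\<lambda>z. g z * h z)"
proof (rule integrable_torus_continuous[of _ a b])
  show "continuous_on UNIV (\<lambda>z. g z * h z)"
    using assms by (intro smooth_continuous smooth_mult) (auto dest: slab_testD)
  show "g z * h z = 0" if "fst z \<notin> {a..b}" for z using slab_testD(3)[OF assms(1) that] by simp
qed

lemma frechet_field_zero_outside:
  assumes "slab_test a b g" "fst z \<notin> {a..b}"
  shows "frechet_derivative g (at z) v = 0"
  using slab_testD(3)[OF slab_test_deriv[OF assms(1)] assms(2)] .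

lemma integrable_slab_test_deriv:
  assumes g: "slab_test a b g" and V: "\<And>e. e \<in> Basis \<Longrightarrow> smooth (\<lambda>z. V z \<bullet> e)" and h: "smooth h"
  shows "integrable torus (\<lambda>z. frechet_derivative g (at z) (V z) * h z)"
proof (rule integrable_torus_continuous[of _ a b])
  show "continuous_on UNIV (\<lambda>z. frechet_derivative g (at z) (V z) * h z)"
    using slab_testD[OF g] V h by (intro smooth_continuous smooth_mult smooth_frechet_field) auto
  show "frechet_derivative g (at z) (V z) * h z = 0" if "fst z \<notin> {a..b}" for z
    by (simp add: frechet_field_zero_outside[OF g that])
qed

context
  fixes T a b C \<epsilon> :: real and k :: "real \<times> (real^'d) \<Rightarrow> real" and \<phi> :: "real \<times> (real^'d) \<Rightarrow> real"
  assumes k: "mollifier C \<epsilon> k" and ab: "0 < a - \<epsilon>" "b + \<epsilon> < T" and \<phi>: "slab_test a b \<phi>"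
begin

lemma smooth_moll_inner:
  fixes W :: "real \<times> (real^'d) \<Rightarrow> real \<times> (real^'d)"
  assumes "Lq_field T 1 W"
  shows "smooth (\<lambda>z. conv k W z \<bullet> e)"
  using moll_smooth[OF k, of "\<lambda>z. W z \<bullet> e"] moll_inner[OF k Lq_field_L1(2)[OF assms], of _ e] Lq_field_L1(2)[OF Lq_field_inner[OF assms]]
  by simp

lemma smooth_moll:
  fixes w :: "real \<times> (real^'d) \<Rightarrow> real"
  assumes "Lq_field T 1 w" shows "smooth (conv k w)" "sper (conv k w)"
  using moll_smooth[OF k Lq_field_L1(2)[OF assms]] moll_sper[OF k Lq_fieldD(1,2)[OF assms]] by auto

text \<open>
  The field \<open>B\<close> stands for \<open>(\<rho>, \<rho>u)\<close>, \<open>w\<close> for a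
  component of \<open>u\<close>, \<open>H\<close> for the pressure and stress part of its
  momentum flux, and \<open>\<Gamma>\<close> for \<open>\<nabla>w\<close>. The last two terms
  are the only ones that mollification adds to the formal balance. The term \<open>\<phi> (k *
  w) D(k * w)(k * B)\<close> cancels between the momentum equation and half of the continuity
  equation. A direction in which \<open>H\<close> vanishes needs no weak derivative of
  \<open>w\<close>; this is the time direction, in which \<open>u\<close> has none.
\<close>

lemma kinetic_step:
  fixes w :: "real \<times> (real^'d) \<Rightarrow> real" and B H \<Gamma> :: "real \<times> (real^'d) \<Rightarrow> real \<times> (real^'d)"
  assumes w: "Lq_field T 2 w" and B: "Lq_field T 2 B" and H: "Lq_field T 2 H" and \<Gamma>: "Lq_field T 2 \<Gamma>"
    and mom: "weak T (\<lambda>z. w z *\<^sub>R B z + H z) (\<lambda>_. 0)"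
    and cont: "weak T B (\<lambda>_. 0)"
    and grad: "\<And>e. e \<in> Basis \<Longrightarrow> (\<forall>z. H z \<bullet> e = 0) \<or> weak T (\<lambda>z. w z *\<^sub>R e) (\<lambda>z. - (\<Gamma> z \<bullet> e))"
  defines "cm \<equiv> \<lambda>z. conv k (\<lambda>z. w z *\<^sub>R B z) z - conv k w z *\<^sub>R conv k B z"
  shows "(\<integral>z. 1/2 * (conv k w z)\<^sup>2 * frechet_derivative \<phi> (at z) (conv k B z) \<partial>torus)
    + (\<integral>z. conv k w z * frechet_derivative \<phi> (at z) (conv k H z) \<partial>torus)
    + (\<integral>z. \<phi> z * (conv k \<Gamma> z \<bullet> conv k H z) \<partial>torus)
    + (\<integral>z. conv k w z * frechet_derivative \<phi> (at z) (cm z) \<partial>torus)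
    + (\<integral>z. \<phi> z * frechet_derivative (conv k w) (at z) (cm z) \<partial>torus) = 0"
proof -
  have w1: "Lq_field T 1 w" and B1: "Lq_field T 1 B" and H1: "Lq_field T 1 H" and G1: "Lq_field T 1 \<Gamma>"
    using w B H \<Gamma> Lq_field_mono[of T 2 _ 1] by auto
  have wB1: "Lq_field T 1 (\<lambda>z. w z *\<^sub>R B z)" by (rule Lq_field_scaleR[OF w B])
  define w' where "w' = conv k w"
  define B' where "B' = conv k B"
  define H' where "H' = conv k H"
  define \<Gamma>' where "\<Gamma>' = conv k \<Gamma>"
  have sw: "smooth w'" and pw: "sper w'" unfolding w'_def using smooth_moll[OF w1] by auto
  have sB: "smooth (\<lambda>z. B' z \<bullet> e)" and sH: "smooth (\<lambda>z. H' z \<bullet> e)" and sG: "smooth (\<lambda>z. \<Gamma>' z \<bullet> e)"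
    and swB: "smooth (\<lambda>z. conv k (\<lambda>z. w z *\<^sub>R B z) z \<bullet> e)" for e
    unfolding B'_def H'_def \<Gamma>'_def using smooth_moll_inner B1 H1 G1 wB1 by auto
  have cme: "cm z \<bullet> e = conv k (\<lambda>z. w z *\<^sub>R B z) z \<bullet> e + (-1) * (w' z * (B' z \<bullet> e))" for z e
    by (simp add: cm_def w'_def B'_def inner_diff_left)
  have sc: "smooth (\<lambda>z. cm z \<bullet> e)" for e
    unfolding cme by (intro smooth_add smooth_mult smooth_const swB sw sB)
  have s\<phi>: "smooth \<phi>" by (rule slab_testD(1)[OF \<phi>])
  let ?d = "\<lambda>z. frechet_derivative \<phi> (at z)" and ?dw = "\<lambda>z. frechet_derivative w' (at z)"
  note lin\<phi> = smooth_linear_deriv[OF s\<phi>] and linw = smooth_linear_deriv[OF sw]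
  have F0: "Lq_field T 1 (\<lambda>_ :: real \<times> (real^'d). 0 :: real)" by (simp add: Lq_field_def sper_def)
  have z0: "conv k (\<lambda>_. 0 :: real) z = 0" for z by (simp add: conv_def)
  have i1: "integrable torus (\<lambda>z. w' z ^ 2 * ?d z (B' z))"
    using integrable_slab_test_deriv[OF \<phi> sB smooth_power[OF sw, of 2]] by (simp add: mult.commute)
  have i2: "integrable torus (\<lambda>z. w' z * ?d z (H' z))"
    using integrable_slab_test_deriv[OF \<phi> sH sw] by (simp add: mult.commute)
  have i4: "integrable torus (\<lambda>z. w' z * ?d z (cm z))"
    using integrable_slab_test_deriv[OF \<phi> sc sw] by (simp add: mult.commute)
  have i5: "integrable torus (\<lambda>z. \<phi> z * ?dw z (cm z))"
    by (rule integrable_slab_test_mult[OF \<phi> smooth_frechet_field[OF sw sc]])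
  have i6: "integrable torus (\<lambda>z. \<phi> z * (w' z * ?dw z (B' z)))"
    by (rule integrable_slab_test_mult[OF \<phi> smooth_mult[OF sw smooth_frechet_field[OF sw sB]]])
  have i7: "integrable torus (\<lambda>z. \<phi> z * ?dw z (H' z))"
    by (rule integrable_slab_test_mult[OF \<phi> smooth_frechet_field[OF sw sH]])
  have GH: "\<Gamma>' z \<bullet> H' z = (\<Sum>e\<in>Basis. (\<Gamma>' z \<bullet> e) * (H' z \<bullet> e))" for z by (rule euclidean_inner)
  \<comment> \<open>the momentum equation tested with \<open>\<phi> w'\<close>\<close>
  have X1: "(\<integral>z. \<phi> z * (w' z * ?dw z (B' z)) \<partial>torus) + (\<integral>z. \<phi> z * ?dw z (cm z) \<partial>torus) + (\<integral>z. \<phi> z * ?dw z (H' z) \<partial>torus)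
      + (\<integral>z. w' z ^ 2 * ?d z (B' z) \<partial>torus) + (\<integral>z. w' z * ?d z (cm z) \<partial>torus) + (\<integral>z. w' z * ?d z (H' z) \<partial>torus) = 0"
  proof -
    have g: "slab_test a b (\<lambda>z. \<phi> z * w' z)" by (rule slab_test_mult[OF \<phi> sw pw])
    have "(\<integral>z. frechet_derivative (\<lambda>z. \<phi> z * w' z) (at z) (conv k (\<lambda>z. w z *\<^sub>R B z + H z) z) \<partial>torus) = 0"
      using moll_weak[OF k Lq_field_add[OF wB1 H1] F0 mom g ab] by (simp add: z0)
    moreover have "frechet_derivative (\<lambda>z. \<phi> z * w' z) (at z) (conv k (\<lambda>z. w z *\<^sub>R B z + H z) z)
       = \<phi> z * (w' z * ?dw z (B' z)) + \<phi> z * ?dw z (cm z) + \<phi> z * ?dw z (H' z)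
        + w' z ^ 2 * ?d z (B' z) + w' z * ?d z (cm z) + w' z * ?d z (H' z)" for z
    proof -
      have "conv k (\<lambda>z. w z *\<^sub>R B z + H z) z = w' z *\<^sub>R B' z + cm z + H' z"
        using moll_add[OF k Lq_field_L1(2)[OF wB1] Lq_field_L1(2)[OF H1], of z]
        by (simp add: cm_def w'_def B'_def H'_def)
      then show ?thesis
        by (simp add: frechet_mult[OF s\<phi> sw] linear_add[OF lin\<phi>] linear_add[OF linw]
            linear_scale[OF lin\<phi>] linear_scale[OF linw] power2_eq_square algebra_simps)
    qed
    ultimately show ?thesis using i1 i2 i4 i5 i6 i7 by simp
  qed
  \<comment> \<open>the continuity equation tested with \<open>\<phi> w'\<^sup>2\<close>\<close>
  have X2: "2 * (\<integral>z. \<phi> z * (w' z * ?dw z (B' z)) \<partial>torus) + (\<integral>z. w' z ^ 2 * ?d z (B' z) \<partial>torus) = 0"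
  proof -
    have "sper (\<lambda>z. w' z * w' z)" using pw by (simp add: sper_def)
    then have g: "slab_test a b (\<lambda>z. \<phi> z * (w' z * w' z))" by (intro slab_test_mult[OF \<phi>] smooth_mult sw)
    have "(\<integral>z. frechet_derivative (\<lambda>z. \<phi> z * (w' z * w' z)) (at z) (B' z) \<partial>torus) = 0"
      using moll_weak[OF k B1 F0 cont g ab] by (simp add: z0 B'_def)
    moreover have "frechet_derivative (\<lambda>z. \<phi> z * (w' z * w' z)) (at z) (B' z)
        = 2 * (\<phi> z * (w' z * ?dw z (B' z))) + w' z ^ 2 * ?d z (B' z)" for z
      by (simp add: frechet_mult[OF s\<phi> smooth_mult[OF sw sw]] frechet_mult[OF sw sw] power2_eq_square algebra_simps)
    ultimately show ?thesis using i1 i6 by simp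
  qed
  \<comment> \<open>the weak gradient tested with \<open>\<phi> H'\<^sub>e\<close>\<close>
  have X3: "(\<integral>z. \<phi> z * ?dw z (H' z) \<partial>torus) = (\<integral>z. \<phi> z * (\<Gamma>' z \<bullet> H' z) \<partial>torus)"
  proof -
    have each: "(\<integral>z. \<phi> z * ((H' z \<bullet> e) * ?dw z e) \<partial>torus) = (\<integral>z. \<phi> z * ((\<Gamma>' z \<bullet> e) * (H' z \<bullet> e)) \<partial>torus)"
      if e: "e \<in> Basis" for e
    proof (cases "\<forall>z. H z \<bullet> e = 0")
      case True
      have "H' z \<bullet> e = 0" for z
      proof -
        have "(\<lambda>z. H z \<bullet> e) = (\<lambda>_. 0)" using True by blast
        then show ?thesis using moll_inner[OF k Lq_field_L1(2)[OF H1], of z e] by (simp only: H'_def z0 zero_less_one)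
      qed
      then show ?thesis by simp
    next
      case False
      then have wk: "weak T (\<lambda>z. w z *\<^sub>R e) (\<lambda>z. - (\<Gamma> z \<bullet> e))" using grad[OF e] by blast
      let ?g = "\<lambda>z. \<phi> z * (H' z \<bullet> e)"
      have "sper (\<lambda>z. H' z \<bullet> e)"
        using moll_sper[OF k Lq_fieldD(1,2)[OF H1]] by (simp add: H'_def sper_def)
      then have g: "slab_test a b ?g" by (intro slab_test_mult[OF \<phi>] sH)
      have we1: "Lq_field T 1 (\<lambda>z. w z *\<^sub>R e)"
      proof (rule Lq_fieldI_bound)
        show "integrable torus (\<lambda>z. norm e * norm (w z) ^ 1)" using Lq_fieldD(4)[OF w1] by simp
      qed (use Lq_fieldD[OF w1] in \<open>auto simp: sper_def mult.commute\<close>)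
      have S1: "Lq_field T 1 (\<lambda>z. - (\<Gamma> z \<bullet> e))" using Lq_field_inner[OF G1, of "- e"] by simp
      have cw: "conv k (\<lambda>z. w z *\<^sub>R e) z = w' z *\<^sub>R e" for z
        using integral_scaleR_left[of e lborel "\<lambda>y. k (z - y) * w y"] moll_integrable[OF k Lq_field_L1(2)[OF w1], of z]
        by (simp add: conv_def w'_def)
      have cG: "conv k (\<lambda>z. - (\<Gamma> z \<bullet> e)) z = - (\<Gamma>' z \<bullet> e)" for z
        using moll_inner[OF k Lq_field_L1(2)[OF G1], of z "- e"] by (simp add: \<Gamma>'_def)
      have 1: "(\<integral>z. frechet_derivative ?g (at z) e * w' z \<partial>torus) = - (\<integral>z. (\<Gamma>' z \<bullet> e) * ?g z \<partial>torus)"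
        using moll_weak[OF k we1 S1 wk g ab] linear_scale[OF smooth_linear_deriv[OF slab_testD(1)[OF g]]]
        by (simp add: cw cG mult.commute)
      have gw: "slab_test a b (\<lambda>z. ?g z * w' z)" by (rule slab_test_mult[OF g sw pw])
      have ia: "integrable torus (\<lambda>z. ?g z * ?dw z e)" by (rule integrable_slab_test_mult[OF g smooth_deriv[OF sw]])
      have ib: "integrable torus (\<lambda>z. frechet_derivative ?g (at z) e * w' z)"
        by (rule integrable_slab_test_mult[OF slab_test_deriv[OF g] sw])
      have "(\<integral>z. ?g z * ?dw z e + frechet_derivative ?g (at z) e * w' z \<partial>torus) = 0"
        using integral_deriv_zero[OF gw, of e] by (simp only: frechet_mult[OF slab_testD(1)[OF g] sw])
      then have "(\<integral>z. ?g z * ?dw z e \<partial>torus) + (\<integral>z. frechet_derivative ?g (at z) e * w' z \<partial>torus) = 0"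
        using ia ib by simp
      then have "(\<integral>z. ?g z * ?dw z e \<partial>torus) = (\<integral>z. (\<Gamma>' z \<bullet> e) * ?g z \<partial>torus)" using 1 by simp
      then show ?thesis by (simp add: mult_ac)
    qed
    have ia: "integrable torus (\<lambda>z. \<phi> z * ((H' z \<bullet> e) * ?dw z e))" for e
      by (rule integrable_slab_test_mult[OF \<phi> smooth_mult[OF sH smooth_deriv[OF sw]]])
    have ib: "integrable torus (\<lambda>z. \<phi> z * ((\<Gamma>' z \<bullet> e) * (H' z \<bullet> e)))" for e
      by (rule integrable_slab_test_mult[OF \<phi> smooth_mult[OF sG sH]])
    have "(\<integral>z. \<phi> z * ?dw z (H' z) \<partial>torus) = (\<integral>z. (\<Sum>e\<in>Basis. \<phi> z * ((H' z \<bullet> e) * ?dw z e)) \<partial>torus)"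
      by (simp only: frechet_sum[OF sw, of _ "H' _"] sum_distrib_left)
    also have "\<dots> = (\<Sum>e\<in>Basis. (\<integral>z. \<phi> z * ((H' z \<bullet> e) * ?dw z e) \<partial>torus))"
      by (rule Bochner_Integration.integral_sum) (rule ia)
    also have "\<dots> = (\<Sum>e\<in>Basis. (\<integral>z. \<phi> z * ((\<Gamma>' z \<bullet> e) * (H' z \<bullet> e)) \<partial>torus))"
      by (intro sum.cong refl each)
    also have "\<dots> = (\<integral>z. (\<Sum>e\<in>Basis. \<phi> z * ((\<Gamma>' z \<bullet> e) * (H' z \<bullet> e))) \<partial>torus)"
      by (rule Bochner_Integration.integral_sum[symmetric]) (rule ib)
    also have "\<dots> = (\<integral>z. \<phi> z * (\<Gamma>' z \<bullet> H' z) \<partial>torus)"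
      by (simp only: GH sum_distrib_left)
    finally show ?thesis .
  qed
  have "(\<integral>z. 1/2 * (w' z)\<^sup>2 * ?d z (B' z) \<partial>torus) = 1/2 * (\<integral>z. w' z ^ 2 * ?d z (B' z) \<partial>torus)"
    by (simp add: mult.assoc)
  then show ?thesis
    unfolding w'_def[symmetric] B'_def[symmetric] H'_def[symmetric] \<Gamma>'_def[symmetric]
    using X1 X2 X3 by argo
qed

text \<open>
  Let \<open>r'\<close>, \<open>V'\<close> be the mollified fields. The continuity equation
  tested with \<open>\<phi> r'\<^sup>n\<^sup>+\<^sup>1\<close> and the equation for \<open>div
  V\<close> tested with \<open>\<phi> r'\<^sup>n\<^sup>+\<^sup>2\<close> both contain
  \<open>\<phi> r'\<^sup>n\<^sup>+\<^sup>1 Dr'(V')\<close>, which is eliminated.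
\<close>

lemma renormalised_step:
  fixes r :: "real \<times> (real^'d) \<Rightarrow> real" and V :: "real \<times> (real^'d) \<Rightarrow> real \<times> (real^'d)"
  assumes r: "Lq_field T 2 r" and V: "Lq_field T 2 V" and S: "Lq_field T 1 S"
    and cont: "weak T (\<lambda>z. r z *\<^sub>R V z) (\<lambda>_. 0)" and div: "weak T V S"
  defines "cm \<equiv> \<lambda>z. conv k (\<lambda>z. r z *\<^sub>R V z) z - conv k r z *\<^sub>R conv k V z"
  shows "(\<integral>z. conv k r z ^ Suc (Suc n) * frechet_derivative \<phi> (at z) (conv k V z) \<partial>torus)
    + real (Suc n) * (\<integral>z. \<phi> z * conv k r z ^ Suc (Suc n) * conv k S z \<partial>torus)
    + real (Suc (Suc n)) * ((\<integral>z. conv k r z ^ Suc n * frechet_derivative \<phi> (at z) (cm z) \<partial>torus)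
    + real (Suc n) * (\<integral>z. \<phi> z * conv k r z ^ n * frechet_derivative (conv k r) (at z) (cm z) \<partial>torus)) = 0"
proof -
  have r1: "Lq_field T 1 r" and V1: "Lq_field T 1 V"
    using r V Lq_field_mono[of T 2 _ 1] by auto
  have rV1: "Lq_field T 1 (\<lambda>z. r z *\<^sub>R V z)" by (rule Lq_field_scaleR[OF r V])
  define r' where "r' = conv k r"
  define V' where "V' = conv k V"
  define S' where "S' = conv k S"
  have sr: "smooth r'" and pr: "sper r'" unfolding r'_def using smooth_moll[OF r1] by auto
  have sS: "smooth S'" unfolding S'_def using smooth_moll[OF S] by auto
  have sV: "smooth (\<lambda>z. V' z \<bullet> e)" and srV: "smooth (\<lambda>z. conv k (\<lambda>z. r z *\<^sub>R V z) z \<bullet> e)" for e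
    unfolding V'_def using smooth_moll_inner V1 rV1 by auto
  have cme: "cm z \<bullet> e = conv k (\<lambda>z. r z *\<^sub>R V z) z \<bullet> e + (-1) * (r' z * (V' z \<bullet> e))" for z e
    by (simp add: cm_def r'_def V'_def inner_diff_left)
  have sc: "smooth (\<lambda>z. cm z \<bullet> e)" for e
    unfolding cme by (intro smooth_add smooth_mult smooth_const srV sr sV)
  have s\<phi>: "smooth \<phi>" by (rule slab_testD(1)[OF \<phi>])
  let ?d = "\<lambda>z. frechet_derivative \<phi> (at z)" and ?dr = "\<lambda>z. frechet_derivative r' (at z)"
  note lin\<phi> = smooth_linear_deriv[OF s\<phi>] and linr = smooth_linear_deriv[OF sr]
  have F0: "Lq_field T 1 (\<lambda>_ :: real \<times> (real^'d). 0 :: real)" by (simp add: Lq_field_def sper_def)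
  have z0: "conv k (\<lambda>_. 0 :: real) z = 0" for z by (simp add: conv_def)
  have pp: "sper (\<lambda>z. r' z ^ j)" for j using pr by (simp add: sper_def)
  have i1: "integrable torus (\<lambda>z. r' z ^ Suc (Suc n) * ?d z (V' z))"
    using integrable_slab_test_deriv[OF \<phi> sV smooth_power[OF sr, of "Suc (Suc n)"]] by (simp add: mult.commute)
  have i2: "integrable torus (\<lambda>z. \<phi> z * r' z ^ Suc (Suc n) * S' z)"
    using integrable_slab_test_mult[OF \<phi> smooth_mult[OF smooth_power[OF sr, of "Suc (Suc n)"] sS]] by (simp add: mult.assoc)
  have i3: "integrable torus (\<lambda>z. r' z ^ Suc n * ?d z (cm z))"
    using integrable_slab_test_deriv[OF \<phi> sc smooth_power[OF sr, of "Suc n"]] by (simp add: mult.commute)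
  have i4: "integrable torus (\<lambda>z. \<phi> z * r' z ^ n * ?dr z (cm z))"
    using integrable_slab_test_mult[OF \<phi> smooth_mult[OF smooth_power[OF sr, of n] smooth_frechet_field[OF sr sc]]] by (simp add: mult.assoc)
  have i5: "integrable torus (\<lambda>z. \<phi> z * r' z ^ Suc n * ?dr z (V' z))"
    using integrable_slab_test_mult[OF \<phi> smooth_mult[OF smooth_power[OF sr, of "Suc n"] smooth_frechet_field[OF sr sV]]] by (simp add: mult.assoc)
  \<comment> \<open>the continuity equation tested with \<open>\<phi> r'\<^sup>n\<^sup>+\<^sup>1\<close>\<close>
  have X1: "real (Suc n) * (\<integral>z. \<phi> z * r' z ^ Suc n * ?dr z (V' z) \<partial>torus) + (\<integral>z. r' z ^ Suc (Suc n) * ?d z (V' z) \<partial>torus)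
      + real (Suc n) * (\<integral>z. \<phi> z * r' z ^ n * ?dr z (cm z) \<partial>torus) + (\<integral>z. r' z ^ Suc n * ?d z (cm z) \<partial>torus) = 0"
  proof -
    have g: "slab_test a b (\<lambda>z. \<phi> z * r' z ^ Suc n)" by (rule slab_test_mult[OF \<phi> smooth_power[OF sr] pp])
    have "(\<integral>z. frechet_derivative (\<lambda>z. \<phi> z * r' z ^ Suc n) (at z) (conv k (\<lambda>z. r z *\<^sub>R V z) z) \<partial>torus) = 0"
      using moll_weak[OF k rV1 F0 cont g ab] by (simp add: z0)
    moreover have "frechet_derivative (\<lambda>z. \<phi> z * r' z ^ Suc n) (at z) (conv k (\<lambda>z. r z *\<^sub>R V z) z)
       = real (Suc n) * (\<phi> z * r' z ^ Suc n * ?dr z (V' z)) + r' z ^ Suc (Suc n) * ?d z (V' z)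
        + real (Suc n) * (\<phi> z * r' z ^ n * ?dr z (cm z)) + r' z ^ Suc n * ?d z (cm z)" for z
    proof -
      have "conv k (\<lambda>z. r z *\<^sub>R V z) z = r' z *\<^sub>R V' z + cm z"
        by (simp add: cm_def r'_def V'_def)
      then show ?thesis
        unfolding frechet_mult[OF s\<phi> smooth_power[OF sr]] frechet_power[OF sr]
        by (simp add: linear_add[OF lin\<phi>] linear_add[OF linr]
            linear_scale[OF lin\<phi>] linear_scale[OF linr] algebra_simps)
    qed
    ultimately have "(\<integral>z. real (Suc n) * (\<phi> z * r' z ^ Suc n * ?dr z (V' z)) + r' z ^ Suc (Suc n) * ?d z (V' z)
        + real (Suc n) * (\<phi> z * r' z ^ n * ?dr z (cm z)) + r' z ^ Suc n * ?d z (cm z) \<partial>torus) = 0" by (simp only:)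
    then show ?thesis
      by (simp only: Bochner_Integration.integral_add Bochner_Integration.integrable_add
          integrable_mult_right i1 i3 i4 i5 integral_mult_right_zero)
  qed
  \<comment> \<open>the equation for \<open>div V\<close> tested with \<open>\<phi> r'\<^sup>n\<^sup>+\<^sup>2\<close>\<close>
  have X2: "real (Suc (Suc n)) * (\<integral>z. \<phi> z * r' z ^ Suc n * ?dr z (V' z) \<partial>torus) + (\<integral>z. r' z ^ Suc (Suc n) * ?d z (V' z) \<partial>torus)
      = (\<integral>z. \<phi> z * r' z ^ Suc (Suc n) * S' z \<partial>torus)"
  proof -
    have g: "slab_test a b (\<lambda>z. \<phi> z * r' z ^ Suc (Suc n))" by (rule slab_test_mult[OF \<phi> smooth_power[OF sr] pp])
    have "(\<integral>z. frechet_derivative (\<lambda>z. \<phi> z * r' z ^ Suc (Suc n)) (at z) (V' z) \<partial>torus) = (\<integral>z. \<phi> z * r' z ^ Suc (Suc n) * S' z \<partial>torus)"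
      using moll_weak[OF k V1 S div g ab] by (simp only: V'_def S'_def mult.commute)
    moreover have "frechet_derivative (\<lambda>z. \<phi> z * r' z ^ Suc (Suc n)) (at z) (V' z)
       = real (Suc (Suc n)) * (\<phi> z * r' z ^ Suc n * ?dr z (V' z)) + r' z ^ Suc (Suc n) * ?d z (V' z)" for z
      unfolding frechet_mult[OF s\<phi> smooth_power[OF sr]] frechet_power[OF sr] by (simp only: mult_ac)
    ultimately have "(\<integral>z. real (Suc (Suc n)) * (\<phi> z * r' z ^ Suc n * ?dr z (V' z)) + r' z ^ Suc (Suc n) * ?d z (V' z) \<partial>torus)
       = (\<integral>z. \<phi> z * r' z ^ Suc (Suc n) * S' z \<partial>torus)" by (simp only:)
    then show ?thesis
      by (simp only: Bochner_Integration.integral_add Bochner_Integration.integrable_add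
          integrable_mult_right i1 i5 integral_mult_right_zero)
  qed
  have alg: "Y + p * Z + q * (U + p * W) = 0"
    if "p * A + Y + p * W + U = 0" "q * A + Y = Z" "q = p + 1" for A Y Z U W p q :: real
  proof -
    have "Y + p * Z + q * (U + p * W) = q * (p * A + Y + p * W + U) - p * (q * A + Y - Z)"
      using that(3) by (simp add: algebra_simps)
    then show ?thesis using that by simp
  qed
  show ?thesis
    unfolding r'_def[symmetric] V'_def[symmetric] S'_def[symmetric]
    by (rule alg[OF X1 X2]) simp
qed

end

section \<open>Passing to the limit\<close>

lemma integral_torus_slab:
  fixes F :: "real \<times> (real^'d) \<Rightarrow> real"
  assumes "integrable torus F" "\<And>z. fst z \<notin> {a..b} \<Longrightarrow> F z = 0"
  shows "integral\<^sup>L torus F = integral\<^sup>L (slab a b) F" "integrable (slab a b) F"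
  using torus_slab[of F a b] assms by (auto dest: borel_measurable_integrable)

lemma nn_power_sum:
  fixes f g :: "'a \<Rightarrow> real"
  assumes [measurable]: "f \<in> borel_measurable M" "g \<in> borel_measurable M"
    and "\<And>x. 0 \<le> f x" "\<And>x. 0 \<le> g x" "0 < q"
  shows "(\<integral>\<^sup>+x. ennreal ((f x + g x) ^ q) \<partial>M) \<le> ennreal (3 ^ q) * ((\<integral>\<^sup>+x. ennreal (f x ^ q) \<partial>M) + (\<integral>\<^sup>+x. ennreal (g x ^ q) \<partial>M))"
proof -
  have "(\<integral>\<^sup>+x. ennreal ((f x + g x) ^ q) \<partial>M) \<le> (\<integral>\<^sup>+x. ennreal (3 ^ q) * (ennreal (f x ^ q) + ennreal (g x ^ q)) \<partial>M)"
  proof (rule nn_integral_mono)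
    fix x
    have "(f x + g x) ^ q \<le> 3 ^ q * (f x ^ q + g x ^ q)"
      using power_sum3[of "f x" "g x" 0 q] assms(3-5) by (simp add: zero_power)
    then show "ennreal ((f x + g x) ^ q) \<le> ennreal (3 ^ q) * (ennreal (f x ^ q) + ennreal (g x ^ q))"
      using assms(3,4) by (simp add: ennreal_mult[symmetric] ennreal_plus[symmetric] ennreal_leI del: ennreal_plus)
  qed
  also have "\<dots> = ennreal (3 ^ q) * ((\<integral>\<^sup>+x. ennreal (f x ^ q) \<partial>M) + (\<integral>\<^sup>+x. ennreal (g x ^ q) \<partial>M))"
    by (simp add: nn_integral_cmult nn_integral_add)
  finally show ?thesis .
qed

lemma nn_power_sum_tendsto:
  fixes f g :: "nat \<Rightarrow> 'a \<Rightarrow> real"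
  assumes "\<And>n. f n \<in> borel_measurable M" "\<And>n. g n \<in> borel_measurable M"
    and "\<And>n x. 0 \<le> f n x" "\<And>n x. 0 \<le> g n x" "0 < q"
    and "(\<lambda>n. \<integral>\<^sup>+x. ennreal (f n x ^ q) \<partial>M) \<longlonglongrightarrow> 0" "(\<lambda>n. \<integral>\<^sup>+x. ennreal (g n x ^ q) \<partial>M) \<longlonglongrightarrow> 0"
  shows "(\<lambda>n. \<integral>\<^sup>+x. ennreal ((f n x + g n x) ^ q) \<partial>M) \<longlonglongrightarrow> 0"
proof (rule tendsto_sandwich[OF _ _ tendsto_const])
  have "(\<lambda>n. ennreal (3 ^ q) * ((\<integral>\<^sup>+x. ennreal (f n x ^ q) \<partial>M) + (\<integral>\<^sup>+x. ennreal (g n x ^ q) \<partial>M))) \<longlonglongrightarrow> ennreal (3 ^ q) * (0 + 0)"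
    by (intro ennreal_tendsto_cmult tendsto_add assms) simp
  then show "(\<lambda>n. ennreal (3 ^ q) * ((\<integral>\<^sup>+x. ennreal (f n x ^ q) \<partial>M) + (\<integral>\<^sup>+x. ennreal (g n x ^ q) \<partial>M))) \<longlonglongrightarrow> 0" by simp
  show "\<forall>\<^sub>F n in sequentially. (\<integral>\<^sup>+x. ennreal ((f n x + g n x) ^ q) \<partial>M) \<le> ennreal (3 ^ q) * ((\<integral>\<^sup>+x. ennreal (f n x ^ q) \<partial>M) + (\<integral>\<^sup>+x. ennreal (g n x ^ q) \<partial>M))"
    using assms by (intro always_eventually allI nn_power_sum) auto
qed auto

lemma bilinear_limit:
  fixes F :: "nat \<Rightarrow> 'a \<Rightarrow> real" and x :: "'a \<Rightarrow> 'x::euclidean_space" and v :: "'a \<Rightarrow> 'y::euclidean_space"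
  assumes int: "\<And>n. integrable M (F n)" "integrable M G"
    and m[measurable]: "\<And>n. xs n \<in> borel_measurable M" "\<And>n. vs n \<in> borel_measurable M" "x \<in> borel_measurable M" "v \<in> borel_measurable M"
    and fin: "(\<integral>\<^sup>+z. ennreal (norm (x z) ^ 2) \<partial>M) < \<infinity>" "(\<integral>\<^sup>+z. ennreal (norm (v z) ^ 2) \<partial>M) < \<infinity>"
    and lim: "(\<lambda>n. \<integral>\<^sup>+z. ennreal (norm (xs n z - x z) ^ 2) \<partial>M) \<longlonglongrightarrow> 0" "(\<lambda>n. \<integral>\<^sup>+z. ennreal (norm (vs n z - v z) ^ 2) \<partial>M) \<longlonglongrightarrow> 0"
    and K: "0 \<le> K" "\<And>n z. \<bar>F n z - G z\<bar> \<le> K * (norm (xs n z) * norm (vs n z - v z) + norm (xs n z - x z) * norm (v z))"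
  shows "(\<lambda>n. integral\<^sup>L M (F n)) \<longlonglongrightarrow> integral\<^sup>L M G"
proof (rule integral_limit_product[OF int, where q=2 and K=K and D="\<lambda>z. norm (x z) + norm (v z)" and S="\<lambda>n z. norm (xs n z - x z) + norm (vs n z - v z)"])
  show "(\<integral>\<^sup>+z. ennreal ((norm (x z) + norm (v z))\<^sup>2) \<partial>M) < \<infinity>"
    by (rule le_less_trans[OF nn_power_sum]) (use fin in \<open>auto simp: ennreal_mult_less_top\<close>)
  show "(\<lambda>n. \<integral>\<^sup>+z. ennreal ((norm (xs n z - x z) + norm (vs n z - v z))\<^sup>2) \<partial>M) \<longlonglongrightarrow> 0"
    by (rule nn_power_sum_tendsto) (use lim in auto)
  fix n z
  let ?D = "norm (x z) + norm (v z)" and ?S = "norm (xs n z - x z) + norm (vs n z - v z)"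
  have "norm (xs n z) \<le> ?D + ?S" using norm_triangle_sub[of "xs n z" "x z"] norm_ge_zero[of "v z"] norm_ge_zero[of "vs n z - v z"] by linarith
  then have "norm (xs n z) * norm (vs n z - v z) + norm (xs n z - x z) * norm (v z) \<le> (?D + ?S) * ?S + ?S * ?D"
    by (intro add_mono mult_mono) auto
  also have "\<dots> = (?D + ?S)\<^sup>2 - ?D\<^sup>2" by (simp add: power2_eq_square algebra_simps)
  finally show "\<bar>F n z - G z\<bar> \<le> K * ((?D + ?S)\<^sup>2 - ?D\<^sup>2)"
    using K(1) by (intro order_trans[OF K(2)] mult_left_mono)
qed (use K in auto)

text \<open>
  Brings a difference of trilinear expressions into the form required by
  \<open>integral_limit_product\<close> with \<open>q = 3\<close>.
\<close>

lemma cubic_increment: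
  fixes v v' :: "'b::real_normed_vector" and x x' :: real
  defines "D \<equiv> \<bar>x\<bar> + norm v" and "S \<equiv> \<bar>x' - x\<bar> + norm (v' - v)"
  shows "norm (x'\<^sup>2 *\<^sub>R v' - x\<^sup>2 *\<^sub>R v) \<le> (D + S) ^ 3 - D ^ 3"
proof -
  have D: "0 \<le> D" "\<bar>x\<bar> \<le> D" "norm v \<le> D" and S: "0 \<le> S" "\<bar>x' - x\<bar> \<le> S" "norm (v' - v) \<le> S"
    by (auto simp: D_def S_def)
  have x': "\<bar>x'\<bar> \<le> D + S" using D S by linarith
  have "x'\<^sup>2 *\<^sub>R v' - x\<^sup>2 *\<^sub>R v = x'\<^sup>2 *\<^sub>R (v' - v) + ((x' - x) * (x' + x)) *\<^sub>R v"
    by (simp add: algebra_simps power2_eq_square)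
  then have "norm (x'\<^sup>2 *\<^sub>R v' - x\<^sup>2 *\<^sub>R v) \<le> \<bar>x'\<bar> * \<bar>x'\<bar> * norm (v' - v) + \<bar>x' - x\<bar> * \<bar>x' + x\<bar> * norm v"
    using norm_triangle_ineq[of "x'\<^sup>2 *\<^sub>R (v' - v)" "((x' - x) * (x' + x)) *\<^sub>R v"]
    by (simp add: abs_mult power2_eq_square)
  also have "\<dots> \<le> (D + S) * (D + S) * S + S * ((D + S) + D) * D"
    using D S x' by (intro add_mono mult_mono) auto
  also have "\<dots> = (D + S) ^ 3 - D ^ 3" by (simp add: power3_eq_cube algebra_simps)
  finally show ?thesis .
qed

lemma Lq_field_nn_finite:
  fixes f :: "real \<times> (real^'d) \<Rightarrow> 'b::euclidean_space"
  assumes "Lq_field T q f" shows "(\<integral>\<^sup>+z. ennreal (norm (f z) ^ q) \<partial>slab a b) < \<infinity>"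
proof -
  have "(\<integral>\<^sup>+z. ennreal (norm (norm (f z) ^ q)) \<partial>torus) < \<infinity>"
    using Lq_fieldD(4)[OF assms] unfolding integrable_iff_bounded by blast
  moreover have "(\<integral>\<^sup>+z. ennreal (norm (f z) ^ q) \<partial>slab a b) \<le> (\<integral>\<^sup>+z. ennreal (norm (f z) ^ q) \<partial>torus)"
    using Lq_fieldD(1)[OF assms] by (intro nn_integral_slab_le_torus) simp
  ultimately show ?thesis by (simp add: le_less_trans)
qed

lemma conv_measurable:
  fixes f :: "real \<times> (real^'d) \<Rightarrow> 'b::euclidean_space"
  assumes "mollifier C \<epsilon> k" "f \<in> borel_measurable borel"
  shows "conv k f \<in> borel_measurable borel"
proof -
  have [measurable]: "k \<in> borel_measurable borel" "f \<in> borel_measurable borel"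
    using mollifierD(10)[OF assms(1)] assms(2) by auto
  show ?thesis unfolding conv_def[abs_def] by measurable
qed

context
  fixes T a b C :: real and \<epsilon> :: "nat \<Rightarrow> real" and k :: "nat \<Rightarrow> real \<times> (real^'d) \<Rightarrow> real" and \<phi> :: "real \<times> (real^'d) \<Rightarrow> real"
  assumes C: "1 \<le> C" and k: "\<And>n. mollifier C (\<epsilon> n) (k n)" and \<epsilon>: "\<epsilon> \<longlonglongrightarrow> 0"
    and ab: "\<And>n. 0 < a - \<epsilon> n" "\<And>n. b + \<epsilon> n < T" and \<phi>: "slab_test a b \<phi>"
begin

lemma besov_incr_eventually:
  assumes "besov_incr a b s f"
  obtains K where "0 \<le> K" "\<forall>\<^sub>F n in sequentially. \<forall>y. norm y < \<epsilon> n \<longrightarrow>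
     (\<integral>\<^sup>+z. ennreal (norm (f (z - y) - f z) ^ 3) \<partial>slab a b) \<le> ennreal (K * \<epsilon> n powr (3 * s))"
proof -
  obtain K \<delta> where K: "0 \<le> K" "0 < \<delta>" and b: "\<And>e y. 0 < e \<Longrightarrow> e < \<delta> \<Longrightarrow> norm y < e \<Longrightarrow>
     (\<integral>\<^sup>+z. ennreal (norm (f (z - y) - f z) ^ 3) \<partial>slab a b) \<le> ennreal (K * e powr (3 * s))"
    using assms unfolding besov_incr_def by blast
  have "\<forall>\<^sub>F n in sequentially. \<epsilon> n < \<delta>" using \<epsilon> K(2) by (rule order_tendstoD(2))
  then have "\<forall>\<^sub>F n in sequentially. \<forall>y. norm y < \<epsilon> n \<longrightarrow>
     (\<integral>\<^sup>+z. ennreal (norm (f (z - y) - f z) ^ 3) \<partial>slab a b) \<le> ennreal (K * \<epsilon> n powr (3 * s))"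
  proof eventually_elim
    case (elim n)
    then show ?case by (intro allI impI b[OF mollifierD(1)[OF k]])
  qed
  with K(1) show thesis by (rule that)
qed

text \<open>
  The exponent \<open>3 * 0\<close> lets a merely bounded third factor enter
  \<open>commutator_tendsto\<close> with regularity \<open>s3 = 0\<close>.
\<close>

lemma moll_cube_bounded:
  fixes w :: "real \<times> (real^'d) \<Rightarrow> real"
  assumes w: "Lq_field T 3 w"
  obtains K where "0 \<le> K" "\<forall>\<^sub>F n in sequentially. (\<integral>\<^sup>+z. ennreal (\<bar>conv (k n) w z\<bar> ^ 3) \<partial>slab a b) \<le> ennreal (K * \<epsilon> n powr (3 * 0))"
proof -
  obtain L where L: "(\<integral>\<^sup>+z. ennreal (norm (w z) ^ 3) \<partial>slab a b) = ennreal L" "0 \<le> L"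
    using Lq_field_nn_finite[OF w, of a b] by (cases "\<integral>\<^sup>+z. ennreal (norm (w z) ^ 3) \<partial>slab a b") auto
  have m[measurable]: "w \<in> borel_measurable borel" by (rule Lq_fieldD(1)[OF w])
  have cm[measurable]: "conv (k n) w \<in> borel_measurable borel" for n by (rule conv_measurable[OF k m])
  have "(\<lambda>n. \<integral>\<^sup>+z. ennreal (norm (conv (k n) w z - w z) ^ 3) \<partial>slab a b) \<longlonglongrightarrow> 0"
    by (rule moll_tendsto[OF k \<epsilon> w]) simp
  then have "\<forall>\<^sub>F n in sequentially. (\<integral>\<^sup>+z. ennreal (norm (conv (k n) w z - w z) ^ 3) \<partial>slab a b) < 1"
    by (rule order_tendstoD(2)) simp
  then have "\<forall>\<^sub>F n in sequentially. (\<integral>\<^sup>+z. ennreal (\<bar>conv (k n) w z\<bar> ^ 3) \<partial>slab a b) \<le> ennreal (3 ^ 3 * (1 + L) * \<epsilon> n powr (3 * 0))"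
  proof eventually_elim
    case (elim n)
    have "(\<integral>\<^sup>+z. ennreal (\<bar>conv (k n) w z\<bar> ^ 3) \<partial>slab a b) \<le> (\<integral>\<^sup>+z. ennreal ((norm (conv (k n) w z - w z) + norm (w z)) ^ 3) \<partial>slab a b)"
      by (intro nn_integral_mono ennreal_leI power_mono) auto
    also have "\<dots> \<le> ennreal (3 ^ 3) * ((\<integral>\<^sup>+z. ennreal (norm (conv (k n) w z - w z) ^ 3) \<partial>slab a b) + (\<integral>\<^sup>+z. ennreal (norm (w z) ^ 3) \<partial>slab a b))"
      by (rule nn_power_sum) auto
    also have "\<dots> \<le> ennreal (3 ^ 3) * (ennreal 1 + ennreal L)"
      unfolding L(1) using elim by (intro mult_left_mono add_mono) auto
    also have "\<dots> = ennreal (3 ^ 3 * (1 + L))"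
      using L(2) by (simp only: ennreal_plus[symmetric] ennreal_mult[symmetric] add_nonneg_nonneg zero_le_one zero_le_power zero_le_numeral)
    also have "\<dots> = ennreal (3 ^ 3 * (1 + L) * \<epsilon> n powr (3 * 0))" using mollifierD(1)[OF k, of n] by simp
    finally show ?case .
  qed
  then show thesis using L(2) by (intro that[of "3 ^ 3 * (1 + L)"]) auto
qed

text \<open>
  A derivative of a mollified function enters \<open>commutator_tendsto\<close> as a third
  factor of regularity \<open>s3 = s - 1\<close>.
\<close>

lemma moll_deriv_cube:
  fixes w :: "real \<times> (real^'d) \<Rightarrow> real"
  assumes w: "Lq_field T 3 w" and s: "besov_incr a b s w" and e: "norm e = 1"
  obtains K where "0 \<le> K" "\<forall>\<^sub>F n in sequentially.
    (\<integral>\<^sup>+z. ennreal (\<bar>frechet_derivative (conv (k n) w) (at z) e\<bar> ^ 3) \<partial>slab a b) \<le> ennreal (K * \<epsilon> n powr (3 * (s - 1)))"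
proof -
  obtain K where K: "0 \<le> K" "\<forall>\<^sub>F n in sequentially. \<forall>y. norm y < \<epsilon> n \<longrightarrow>
     (\<integral>\<^sup>+z. ennreal (norm (w (z - y) - w z) ^ 3) \<partial>slab a b) \<le> ennreal (K * \<epsilon> n powr (3 * s))"
    by (rule besov_incr_eventually[OF s])
  have m[measurable]: "w \<in> borel_measurable borel" by (rule Lq_fieldD(1)[OF w])
  from K(2) have "\<forall>\<^sub>F n in sequentially.
    (\<integral>\<^sup>+z. ennreal (\<bar>frechet_derivative (conv (k n) w) (at z) e\<bar> ^ 3) \<partial>slab a b) \<le> ennreal (C ^ 3 * K * \<epsilon> n powr (3 * (s - 1)))"
  proof eventually_elim
    case (elim n)
    have en: "0 < \<epsilon> n" by (rule mollifierD(1)[OF k])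
    interpret P: sigma_finite_measure "ball_unif (\<epsilon> n) :: (real \<times> (real^'d)) measure" by (rule sigma_finite_ball_unif[OF en])
    have "(\<integral>\<^sup>+z. ennreal (\<bar>frechet_derivative (conv (k n) w) (at z) e\<bar> ^ 3) \<partial>slab a b)
      \<le> (\<integral>\<^sup>+z. ennreal ((C / \<epsilon> n * norm e) ^ 3) * (\<integral>\<^sup>+y. ennreal (norm (w (z - y) - w z) ^ 3) \<partial>ball_unif (\<epsilon> n)) \<partial>slab a b)"
      using Lq_field_L1(2)[OF w] by (intro nn_integral_mono moll_deriv_bound[OF k C m]) simp
    also have "\<dots> = ennreal ((C / \<epsilon> n) ^ 3) * (\<integral>\<^sup>+z. (\<integral>\<^sup>+y. ennreal (norm (w (z - y) - w z) ^ 3) \<partial>ball_unif (\<epsilon> n)) \<partial>slab a b)"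
      unfolding e mult_1_right by (rule nn_integral_cmult) measurable
    also have "\<dots> \<le> ennreal ((C / \<epsilon> n) ^ 3) * ennreal (K * \<epsilon> n powr (3 * s))"
      using elim by (intro mult_left_mono ball_unif_average_bound[OF en m]) auto
    also have "\<dots> = ennreal ((C / \<epsilon> n) ^ 3 * (K * \<epsilon> n powr (3 * s)))"
      using C en K(1) by (intro ennreal_mult[symmetric]) auto
    also have "(C / \<epsilon> n) ^ 3 * (K * \<epsilon> n powr (3 * s)) = C ^ 3 * K * \<epsilon> n powr (3 * (s - 1))"
    proof -
      have "\<epsilon> n powr (3 * (s - 1)) = \<epsilon> n powr (3 * s) / \<epsilon> n powr 3"
        by (simp add: powr_diff[symmetric] right_diff_distrib)
      moreover have "\<epsilon> n powr 3 = \<epsilon> n ^ 3" using en by simp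
      ultimately show ?thesis by (simp add: power_divide)
    qed
    finally show ?case .
  qed
  then show thesis using K(1) C by (intro that[of "C ^ 3 * K"]) auto
qed

lemma commutator_tendsto:
  fixes f :: "real \<times> (real^'d) \<Rightarrow> real" and W :: "real \<times> (real^'d) \<Rightarrow> real \<times> (real^'d)"
  assumes f: "Lq_field T 3 f" and W: "Lq_field T 3 W" and s1: "besov_incr a b s1 f" and s2: "besov_incr a b s2 W"
    and Q: "\<And>n. Q n \<in> borel_measurable borel" "\<And>n z. 0 \<le> Q n z"
    and KQ: "0 \<le> KQ" "\<forall>\<^sub>F n in sequentially. (\<integral>\<^sup>+z. ennreal (Q n z ^ 3) \<partial>slab a b) \<le> ennreal (KQ * \<epsilon> n powr (3 * s3))"
    and s: "0 < s1 + s2 + s3"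
  shows "(\<lambda>n. \<integral>\<^sup>+z. ennreal (norm (conv (k n) (\<lambda>z. f z *\<^sub>R W z) z - conv (k n) f z *\<^sub>R conv (k n) W z) * Q n z) \<partial>slab a b) \<longlonglongrightarrow> 0"
proof -
  obtain Kf where Kf: "0 \<le> Kf" "\<forall>\<^sub>F n in sequentially. \<forall>y. norm y < \<epsilon> n \<longrightarrow>
     (\<integral>\<^sup>+z. ennreal (norm (f (z - y) - f z) ^ 3) \<partial>slab a b) \<le> ennreal (Kf * \<epsilon> n powr (3 * s1))"
    by (rule besov_incr_eventually[OF s1])
  obtain KW where KW: "0 \<le> KW" "\<forall>\<^sub>F n in sequentially. \<forall>y. norm y < \<epsilon> n \<longrightarrow>
     (\<integral>\<^sup>+z. ennreal (norm (W (z - y) - W z) ^ 3) \<partial>slab a b) \<le> ennreal (KW * \<epsilon> n powr (3 * s2))"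
    by (rule besov_incr_eventually[OF s2])
  have f2: "Lq_field T 2 f" and W2: "Lq_field T 2 W" using f W Lq_field_mono[of T 3 _ 2] by auto
  have loc: "locally_L1 f" "locally_L1 W" "locally_L1 (\<lambda>z. f z *\<^sub>R W z)"
    using Lq_field_L1(2)[OF f] Lq_field_L1(2)[OF W] Lq_field_L1(2)[OF Lq_field_scaleR[OF f2 W2]] by auto
  have pos: "\<epsilon> n > 0" for n by (rule mollifierD(1)[OF k])
  show ?thesis
  proof (rule tendsto_sandwich[OF _ _ tendsto_const])
    show "\<forall>\<^sub>F n in sequentially. (\<integral>\<^sup>+z. ennreal (norm (conv (k n) (\<lambda>z. f z *\<^sub>R W z) z - conv (k n) f z *\<^sub>R conv (k n) W z) * Q n z) \<partial>slab a b)
       \<le> ennreal (2 * C\<^sup>2 * (Kf + KW + KQ) * \<epsilon> n powr (s1 + s2 + s3))"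
      using Kf(2) KW(2) KQ(2)
      by eventually_elim
        (rule commutator_bound[OF k C Lq_fieldD(1)[OF f] Lq_fieldD(1)[OF W] Q(1) loc Q(2) Kf(1) _ KW(1) _ KQ(1)], auto)
    have "(\<lambda>n. \<epsilon> n powr (s1 + s2 + s3)) \<longlonglongrightarrow> 0"
      by (rule tendsto_zero_powrI[OF \<epsilon> tendsto_const _ s]) (simp add: pos less_imp_le)
    then have "(\<lambda>n. 2 * C\<^sup>2 * (Kf + KW + KQ) * \<epsilon> n powr (s1 + s2 + s3)) \<longlonglongrightarrow> 2 * C\<^sup>2 * (Kf + KW + KQ) * 0"
      by (intro tendsto_mult_left)
    then show "(\<lambda>n. ennreal (2 * C\<^sup>2 * (Kf + KW + KQ) * \<epsilon> n powr (s1 + s2 + s3))) \<longlonglongrightarrow> 0"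
      using tendsto_ennrealI[of _ "2 * C\<^sup>2 * (Kf + KW + KQ) * 0"] by simp
  qed auto
qed

lemma integral_tendsto_zero:
  fixes F :: "nat \<Rightarrow> real \<times> (real^'d) \<Rightarrow> real"
  assumes int: "\<And>n. integrable (slab a b) (F n)" and I: "finite I"
    and m: "\<And>i n. i \<in> I \<Longrightarrow> A i n \<in> borel_measurable borel"
    and b: "\<And>n z. \<bar>F n z\<bar> \<le> M * (\<Sum>i\<in>I. A i n z)" "0 \<le> M" "\<And>i n z. i \<in> I \<Longrightarrow> 0 \<le> A i n z"
    and lim: "\<And>i. i \<in> I \<Longrightarrow> (\<lambda>n. \<integral>\<^sup>+z. ennreal (A i n z) \<partial>slab a b) \<longlonglongrightarrow> 0"
  shows "(\<lambda>n. integral\<^sup>L (slab a b) (F n)) \<longlonglongrightarrow> 0"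
proof -
  have "(\<lambda>n. integral\<^sup>L (slab a b) (F n)) \<longlonglongrightarrow> integral\<^sup>L (slab a b) (\<lambda>_ :: real \<times> (real^'d). 0 :: real)"
  proof (rule tendsto_L1_int)
    show "(\<lambda>n. \<integral>\<^sup>+z. norm (F n z - 0) \<partial>slab a b) \<longlonglongrightarrow> 0"
    proof (rule tendsto_sandwich[OF _ _ tendsto_const])
      show "\<forall>\<^sub>F n in sequentially. (\<integral>\<^sup>+z. norm (F n z - 0) \<partial>slab a b) \<le> ennreal M * (\<Sum>i\<in>I. \<integral>\<^sup>+z. ennreal (A i n z) \<partial>slab a b)"
      proof (intro always_eventually allI)
        fix n
        have "(\<integral>\<^sup>+z. norm (F n z - 0) \<partial>slab a b) \<le> (\<integral>\<^sup>+z. ennreal M * (\<Sum>i\<in>I. ennreal (A i n z)) \<partial>slab a b)"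
        proof (rule nn_integral_mono)
          fix z
          have "ennreal (norm (F n z - 0)) \<le> ennreal (M * (\<Sum>i\<in>I. A i n z))" using b(1) by (intro ennreal_leI) simp
          also have "\<dots> = ennreal M * (\<Sum>i\<in>I. ennreal (A i n z))"
            using b(2,3) by (simp add: ennreal_mult sum_nonneg sum_ennreal)
          finally show "ennreal (norm (F n z - 0)) \<le> ennreal M * (\<Sum>i\<in>I. ennreal (A i n z))" .
        qed
        also have "\<dots> = ennreal M * (\<Sum>i\<in>I. \<integral>\<^sup>+z. ennreal (A i n z) \<partial>slab a b)"
          using m by (subst nn_integral_cmult) (auto simp: nn_integral_sum)
        finally show "(\<integral>\<^sup>+z. norm (F n z - 0) \<partial>slab a b) \<le> ennreal M * (\<Sum>i\<in>I. \<integral>\<^sup>+z. ennreal (A i n z) \<partial>slab a b)" .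
      qed
      have "(\<lambda>n. ennreal M * (\<Sum>i\<in>I. \<integral>\<^sup>+z. ennreal (A i n z) \<partial>slab a b)) \<longlonglongrightarrow> ennreal M * (\<Sum>i\<in>I. 0)"
        by (intro ennreal_tendsto_cmult tendsto_sum lim) simp_all
      then show "(\<lambda>n. ennreal M * (\<Sum>i\<in>I. \<integral>\<^sup>+z. ennreal (A i n z) \<partial>slab a b)) \<longlonglongrightarrow> 0" by simp
    qed auto
  qed (use int in auto)
  then show ?thesis by simp
qed

lemma frechet_norm_bound:
  assumes "smooth f"
  shows "\<bar>frechet_derivative f (at z) v\<bar> \<le> 1 * (\<Sum>e\<in>Basis. norm v * \<bar>frechet_derivative f (at z) e\<bar>)"
  using frechet_bound[OF assms, of z "\<lambda>e. \<bar>frechet_derivative f (at z) e\<bar>" v]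
  by (simp add: sum_distrib_left mult.commute)

text \<open>
  The two commutator terms have orders
  \<open>\<epsilon>\<^sup>s\<^sup>1\<^sup>+\<^sup>s\<^sup>2\<close> (third factor
  \<open>w\<close> itself) and
  \<open>\<epsilon>\<^sup>2\<^sup>s\<^sup>1\<^sup>+\<^sup>s\<^sup>2\<^sup>-\<^sup>1\<close>
  (third factor \<open>D(k * w)\<close>); both vanish, the first because \<open>s1 \<le>
  1\<close>. The other terms converge as products: one of three factors in
  \<open>L\<^sup>3\<close>, two of two factors in \<open>L\<^sup>2\<close>.
\<close>

lemma kinetic_limit:
  fixes w :: "real \<times> (real^'d) \<Rightarrow> real" and B H \<Gamma> :: "real \<times> (real^'d) \<Rightarrow> real \<times> (real^'d)"
  assumes w: "Lq_field T 3 w" and B: "Lq_field T 3 B" and H: "Lq_field T 2 H" and \<Gamma>: "Lq_field T 2 \<Gamma>"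
    and mom: "weak T (\<lambda>z. w z *\<^sub>R B z + H z) (\<lambda>_. 0)"
    and cont: "weak T B (\<lambda>_. 0)"
    and grad: "\<And>e. e \<in> Basis \<Longrightarrow> (\<forall>z. H z \<bullet> e = 0) \<or> weak T (\<lambda>z. w z *\<^sub>R e) (\<lambda>z. - (\<Gamma> z \<bullet> e))"
    and s1: "besov_incr a b s1 w" and s2: "besov_incr a b s2 B" and s: "1 < 2 * s1 + s2" "s1 \<le> 1"
  shows "(\<integral>z. 1/2 * (w z)\<^sup>2 * frechet_derivative \<phi> (at z) (B z) \<partial>torus)
    + (\<integral>z. w z * frechet_derivative \<phi> (at z) (H z) \<partial>torus)
    + (\<integral>z. \<phi> z * (\<Gamma> z \<bullet> H z) \<partial>torus) = 0"
    and "integrable torus (\<lambda>z. 1/2 * (w z)\<^sup>2 * frechet_derivative \<phi> (at z) (B z))"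
    and "integrable torus (\<lambda>z. w z * frechet_derivative \<phi> (at z) (H z))"
    and "integrable torus (\<lambda>z. \<phi> z * (\<Gamma> z \<bullet> H z))"
proof -
  have w2: "Lq_field T 2 w" and B2: "Lq_field T 2 B"
    by (rule Lq_field_mono[OF w]; simp) (rule Lq_field_mono[OF B]; simp)
  have w1: "Lq_field T 1 w" and B1: "Lq_field T 1 B" and H1: "Lq_field T 1 H" and G1: "Lq_field T 1 \<Gamma>"
    using Lq_field_mono[OF w, of 1] Lq_field_mono[OF B, of 1] Lq_field_mono[OF H, of 1] Lq_field_mono[OF \<Gamma>, of 1] by simp_all
  have wB1: "Lq_field T 1 (\<lambda>z. w z *\<^sub>R B z)" by (rule Lq_field_scaleR[OF w2 B2])
  note m[measurable] = Lq_fieldD(1)[OF w] Lq_fieldD(1)[OF B] Lq_fieldD(1)[OF H] Lq_fieldD(1)[OF \<Gamma>]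
  have cm[measurable]: "conv (k n) w \<in> borel_measurable borel" "conv (k n) B \<in> borel_measurable borel"
    "conv (k n) H \<in> borel_measurable borel" "conv (k n) \<Gamma> \<in> borel_measurable borel" for n
    by (intro conv_measurable[OF k] m)+
  have s\<phi>: "smooth \<phi>" by (rule slab_testD(1)[OF \<phi>])
  have [measurable]: "\<phi> \<in> borel_measurable borel" by (rule smooth_measurable[OF s\<phi>])
  let ?d = "\<lambda>z. frechet_derivative \<phi> (at z)"
  note lin = smooth_linear_deriv[OF s\<phi>]
  have dm[measurable]: "(\<lambda>z. ?d z (V z)) \<in> borel_measurable borel" if "V \<in> borel_measurable borel" for V
    by (rule measurable_frechet_field[OF s\<phi> that])
  obtain M where M: "0 < M" "\<And>z v. \<bar>?d z v\<bar> \<le> M * norm v" by (rule slab_test_deriv_bounded[OF \<phi>]) blast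
  obtain N where N: "0 < N" "\<And>z. \<bar>\<phi> z\<bar> \<le> N" by (rule slab_test_bounded[OF \<phi>]) blast
  let ?cm = "\<lambda>n z. conv (k n) (\<lambda>z. w z *\<^sub>R B z) z - conv (k n) w z *\<^sub>R conv (k n) B z"
  have cmm[measurable]: "?cm n \<in> borel_measurable borel" for n
  proof -
    have [measurable]: "conv (k n) (\<lambda>z. w z *\<^sub>R B z) \<in> borel_measurable borel" by (rule conv_measurable[OF k]) measurable
    show ?thesis by measurable
  qed
  have sw: "smooth (conv (k n) w)" for n using smooth_moll(1)[OF k ab \<phi> w1] .
  have smB: "smooth (\<lambda>z. conv (k n) B z \<bullet> e)" "smooth (\<lambda>z. conv (k n) H z \<bullet> e)" "smooth (\<lambda>z. conv (k n) \<Gamma> z \<bullet> e)"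
    "smooth (\<lambda>z. conv (k n) (\<lambda>z. w z *\<^sub>R B z) z \<bullet> e)" for n e
    using smooth_moll_inner[OF k ab \<phi>] B1 H1 G1 wB1 by auto
  have sc: "smooth (\<lambda>z. ?cm n z \<bullet> e)" for n e
  proof -
    have eq: "?cm n z \<bullet> e = conv (k n) (\<lambda>z. w z *\<^sub>R B z) z \<bullet> e + (-1) * (conv (k n) w z * (conv (k n) B z \<bullet> e))" for z
      by (simp add: inner_diff_left)
    show ?thesis unfolding eq by (intro smooth_add smooth_mult smooth_const smB sw)
  qed
  define A1 where "A1 = (\<lambda>n z. 1/2 * (conv (k n) w z)\<^sup>2 * ?d z (conv (k n) B z))"
  define A2 where "A2 = (\<lambda>n z. conv (k n) w z * ?d z (conv (k n) H z))"
  define A3 where "A3 = (\<lambda>n z. \<phi> z * (conv (k n) \<Gamma> z \<bullet> conv (k n) H z))"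
  define A4 where "A4 = (\<lambda>n z. conv (k n) w z * ?d z (?cm n z))"
  define A5 where "A5 = (\<lambda>n z. \<phi> z * frechet_derivative (conv (k n) w) (at z) (?cm n z))"
  have step: "integral\<^sup>L torus (A1 n) + integral\<^sup>L torus (A2 n) + integral\<^sup>L torus (A3 n) + integral\<^sup>L torus (A4 n) + integral\<^sup>L torus (A5 n) = 0" for n
    using kinetic_step[OF k[of n] ab[of n] \<phi> w2 B2 H \<Gamma> mom cont grad]
    unfolding A1_def A2_def A3_def A4_def A5_def by blast
  note z = frechet_field_zero_outside[OF \<phi>] slab_testD(3)[OF \<phi>]
  have i1: "integrable torus (A1 n)" for n
  proof -
    have "integrable torus (\<lambda>z. ?d z (conv (k n) B z) * (1/2 * (conv (k n) w z) ^ 2))"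
      by (rule integrable_slab_test_deriv[OF \<phi> smB(1) smooth_mult[OF smooth_const smooth_power[OF sw]]])
    then show ?thesis by (simp add: A1_def mult.commute)
  qed
  have i2: "integrable torus (A2 n)" for n
    using integrable_slab_test_deriv[OF \<phi> smB(2) sw] by (simp add: A2_def mult.commute)
  have i3: "integrable torus (A3 n)" for n
  proof -
    have eq: "A3 n z = \<phi> z * (\<Sum>e\<in>Basis. (conv (k n) \<Gamma> z \<bullet> e) * (conv (k n) H z \<bullet> e))" for z
      unfolding A3_def by (subst euclidean_inner) (rule refl)
    have "integrable torus (\<lambda>z. \<phi> z * (\<Sum>e\<in>Basis. (conv (k n) \<Gamma> z \<bullet> e) * (conv (k n) H z \<bullet> e)))"
      by (rule integrable_slab_test_mult[OF \<phi>]) (intro smooth_sum smooth_mult smB)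
    then show ?thesis by (simp only: eq[symmetric])
  qed
  have i4: "integrable torus (A4 n)" for n
    using integrable_slab_test_deriv[OF \<phi> sc sw] by (simp add: A4_def mult.commute)
  have i5: "integrable torus (A5 n)" for n
    unfolding A5_def by (rule integrable_slab_test_mult[OF \<phi> smooth_frechet_field[OF sw sc]])
  have zA: "A1 n z = 0" "A2 n z = 0" "A3 n z = 0" "A4 n z = 0" "A5 n z = 0" if "fst z \<notin> {a..b}" for n z
    using z[OF that] by (simp_all add: A1_def A2_def A3_def A4_def A5_def)
  define G1 where "G1 = (\<lambda>z. 1/2 * (w z)\<^sup>2 * ?d z (B z))"
  define G2 where "G2 = (\<lambda>z. w z * ?d z (H z))"
  define G3 where "G3 = (\<lambda>z. \<phi> z * (\<Gamma> z \<bullet> H z))"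
  have g1: "integrable torus G1"
  proof (rule Bochner_Integration.integrable_bound)
    show "integrable torus (\<lambda>z. M / 2 * (2 * norm (w z) ^ 3 + norm (B z) ^ 3))"
      by (intro integrable_mult_right Bochner_Integration.integrable_add Lq_fieldD(4)[OF w] Lq_fieldD(4)[OF B])
    show "AE z in torus. norm (G1 z) \<le> norm (M / 2 * (2 * norm (w z) ^ 3 + norm (B z) ^ 3))"
    proof (rule AE_I2)
      fix z
      have "norm (G1 z) = 1/2 * (\<bar>w z\<bar> * \<bar>w z\<bar> * \<bar>?d z (B z)\<bar>)"
        by (simp add: G1_def abs_mult power2_eq_square)
      also have "\<dots> \<le> 1/2 * (\<bar>w z\<bar> * \<bar>w z\<bar> * (M * norm (B z)))"
        by (intro mult_left_mono M) auto
      also have "\<dots> = M / 2 * (\<bar>w z\<bar> * \<bar>w z\<bar> * norm (B z))" by simp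
      also have "\<dots> \<le> M / 2 * (\<bar>w z\<bar> ^ 3 + \<bar>w z\<bar> ^ 3 + norm (B z) ^ 3)"
        using M by (intro mult_left_mono young3) auto
      finally show "norm (G1 z) \<le> norm (M / 2 * (2 * norm (w z) ^ 3 + norm (B z) ^ 3))" using M by simp
    qed
    show "G1 \<in> borel_measurable torus" unfolding G1_def by measurable
  qed
  have g2: "integrable torus G2"
  proof (rule Bochner_Integration.integrable_bound)
    show "integrable torus (\<lambda>z. M * (norm (w z) ^ 2 + norm (H z) ^ 2))"
      by (intro integrable_mult_right Bochner_Integration.integrable_add Lq_fieldD(4)[OF w2] Lq_fieldD(4)[OF H])
    show "AE z in torus. norm (G2 z) \<le> norm (M * (norm (w z) ^ 2 + norm (H z) ^ 2))"
    proof (rule AE_I2)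
      fix z
      have "norm (G2 z) \<le> \<bar>w z\<bar> * (M * norm (H z))" unfolding G2_def real_norm_def abs_mult
        by (intro mult_left_mono M) auto
      also have "\<dots> = M * (\<bar>w z\<bar> * norm (H z))" by simp
      also have "\<dots> \<le> M * (\<bar>w z\<bar> ^ 2 + norm (H z) ^ 2)"
        using M by (intro mult_left_mono young2) auto
      finally show "norm (G2 z) \<le> norm (M * (norm (w z) ^ 2 + norm (H z) ^ 2))" using M by simp
    qed
    show "G2 \<in> borel_measurable torus" unfolding G2_def by measurable
  qed
  have g3: "integrable torus G3"
  proof (rule Bochner_Integration.integrable_bound)
    show "integrable torus (\<lambda>z. N * (norm (\<Gamma> z) ^ 2 + norm (H z) ^ 2))"
      by (intro integrable_mult_right Bochner_Integration.integrable_add Lq_fieldD(4)[OF \<Gamma>] Lq_fieldD(4)[OF H])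
    show "AE z in torus. norm (G3 z) \<le> norm (N * (norm (\<Gamma> z) ^ 2 + norm (H z) ^ 2))"
    proof (rule AE_I2)
      fix z
      have "norm (G3 z) \<le> N * (norm (\<Gamma> z) * norm (H z))" unfolding G3_def real_norm_def abs_mult
        using N by (intro mult_mono Cauchy_Schwarz_ineq2) auto
      also have "\<dots> \<le> N * (norm (\<Gamma> z) ^ 2 + norm (H z) ^ 2)"
        using N by (intro mult_left_mono young2) auto
      finally show "norm (G3 z) \<le> norm (N * (norm (\<Gamma> z) ^ 2 + norm (H z) ^ 2))" using N by simp
    qed
    show "G3 \<in> borel_measurable torus" unfolding G3_def by measurable
  qed
  have zG: "G1 z = 0" "G2 z = 0" "G3 z = 0" if "fst z \<notin> {a..b}" for z
    using z[OF that] by (simp_all add: G1_def G2_def G3_def)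
  note tw3 = moll_tendsto[OF k \<epsilon> w, of a b] and tB3 = moll_tendsto[OF k \<epsilon> B, of a b]
    and tw2 = moll_tendsto[OF k \<epsilon> w2, of a b] and tH = moll_tendsto[OF k \<epsilon> H, of a b] and tG = moll_tendsto[OF k \<epsilon> \<Gamma>, of a b]
  have L1: "(\<lambda>n. integral\<^sup>L (slab a b) (A1 n)) \<longlonglongrightarrow> integral\<^sup>L (slab a b) G1"
  proof (rule integral_limit_product[where q=3 and K="M / 2" and D="\<lambda>z. \<bar>w z\<bar> + norm (B z)"
        and S="\<lambda>n z. \<bar>conv (k n) w z - w z\<bar> + norm (conv (k n) B z - B z)"])
    show "integrable (slab a b) (A1 n)" for n by (rule integral_torus_slab(2)[OF i1]) (rule zA(1))
    show "integrable (slab a b) G1" by (rule integral_torus_slab(2)[OF g1]) (rule zG(1))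
    show "(\<integral>\<^sup>+z. ennreal ((\<bar>w z\<bar> + norm (B z)) ^ 3) \<partial>slab a b) < \<infinity>"
      by (rule le_less_trans[OF nn_power_sum])
         (use Lq_field_nn_finite[OF w, of a b] Lq_field_nn_finite[OF B, of a b] in \<open>auto simp: ennreal_mult_less_top\<close>)
    show "(\<lambda>n. \<integral>\<^sup>+z. ennreal ((\<bar>conv (k n) w z - w z\<bar> + norm (conv (k n) B z - B z)) ^ 3) \<partial>slab a b) \<longlonglongrightarrow> 0"
      by (rule nn_power_sum_tendsto) (use tw3 tB3 in auto)
    fix n z
    have eq: "A1 n z - G1 z = 1/2 * ?d z ((conv (k n) w z)\<^sup>2 *\<^sub>R conv (k n) B z - (w z)\<^sup>2 *\<^sub>R B z)"
      by (simp add: A1_def G1_def linear_diff[OF lin] linear_scale[OF lin] algebra_simps)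
    have "\<bar>A1 n z - G1 z\<bar> \<le> 1/2 * (M * norm ((conv (k n) w z)\<^sup>2 *\<^sub>R conv (k n) B z - (w z)\<^sup>2 *\<^sub>R B z))"
      unfolding eq abs_mult by (intro mult_mono M(2)) auto
    also have "\<dots> \<le> 1/2 * (M * ((\<bar>w z\<bar> + norm (B z) + (\<bar>conv (k n) w z - w z\<bar> + norm (conv (k n) B z - B z))) ^ 3 - (\<bar>w z\<bar> + norm (B z)) ^ 3))"
      using M(1) by (intro mult_left_mono cubic_increment) auto
    finally show "\<bar>A1 n z - G1 z\<bar> \<le> M / 2 * ((\<bar>w z\<bar> + norm (B z) + (\<bar>conv (k n) w z - w z\<bar> + norm (conv (k n) B z - B z))) ^ 3 - (\<bar>w z\<bar> + norm (B z)) ^ 3)"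
      by simp
  qed (use M in auto)
  have L2: "(\<lambda>n. integral\<^sup>L (slab a b) (A2 n)) \<longlonglongrightarrow> integral\<^sup>L (slab a b) G2"
  proof (rule bilinear_limit[where K=M and x=w and v=H and xs="\<lambda>n. conv (k n) w" and vs="\<lambda>n. conv (k n) H"])
    show "integrable (slab a b) (A2 n)" for n by (rule integral_torus_slab(2)[OF i2]) (rule zA(2))
    show "integrable (slab a b) G2" by (rule integral_torus_slab(2)[OF g2]) (rule zG(2))
    fix n z
    have "A2 n z - G2 z = conv (k n) w z * ?d z (conv (k n) H z - H z) + (conv (k n) w z - w z) * ?d z (H z)"
      by (simp add: A2_def G2_def linear_diff[OF lin] algebra_simps)
    also have "\<bar>\<dots>\<bar> \<le> \<bar>conv (k n) w z\<bar> * \<bar>?d z (conv (k n) H z - H z)\<bar> + \<bar>conv (k n) w z - w z\<bar> * \<bar>?d z (H z)\<bar>"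
      using abs_triangle_ineq by (simp only: abs_mult[symmetric])
    also have "\<dots> \<le> \<bar>conv (k n) w z\<bar> * (M * norm (conv (k n) H z - H z)) + \<bar>conv (k n) w z - w z\<bar> * (M * norm (H z))"
      by (intro add_mono mult_left_mono M) auto
    finally show "\<bar>A2 n z - G2 z\<bar> \<le> M * (norm (conv (k n) w z) * norm (conv (k n) H z - H z) + norm (conv (k n) w z - w z) * norm (H z))"
      by (simp add: algebra_simps)
  qed (use M Lq_field_nn_finite[OF w2, of a b] Lq_field_nn_finite[OF H, of a b] tw2 tH in auto)
  have L3: "(\<lambda>n. integral\<^sup>L (slab a b) (A3 n)) \<longlonglongrightarrow> integral\<^sup>L (slab a b) G3"
  proof (rule bilinear_limit[where K=N and x=\<Gamma> and v=H and xs="\<lambda>n. conv (k n) \<Gamma>" and vs="\<lambda>n. conv (k n) H"])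
    show "integrable (slab a b) (A3 n)" for n by (rule integral_torus_slab(2)[OF i3]) (rule zA(3))
    show "integrable (slab a b) G3" by (rule integral_torus_slab(2)[OF g3]) (rule zG(3))
    fix n z
    have "A3 n z - G3 z = \<phi> z * (conv (k n) \<Gamma> z \<bullet> (conv (k n) H z - H z) + (conv (k n) \<Gamma> z - \<Gamma> z) \<bullet> H z)"
      by (simp add: A3_def G3_def inner_diff_left inner_diff_right algebra_simps)
    then have "\<bar>A3 n z - G3 z\<bar> = \<bar>\<phi> z\<bar> * \<bar>conv (k n) \<Gamma> z \<bullet> (conv (k n) H z - H z) + (conv (k n) \<Gamma> z - \<Gamma> z) \<bullet> H z\<bar>"
      by (simp add: abs_mult)
    also have "\<dots> \<le> N * (norm (conv (k n) \<Gamma> z) * norm (conv (k n) H z - H z) + norm (conv (k n) \<Gamma> z - \<Gamma> z) * norm (H z))"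
      using N by (intro mult_mono order_trans[OF abs_triangle_ineq] add_mono Cauchy_Schwarz_ineq2) auto
    finally show "\<bar>A3 n z - G3 z\<bar> \<le> N * (norm (conv (k n) \<Gamma> z) * norm (conv (k n) H z - H z) + norm (conv (k n) \<Gamma> z - \<Gamma> z) * norm (H z))" .
  qed (use N Lq_field_nn_finite[OF \<Gamma>, of a b] Lq_field_nn_finite[OF H, of a b] tG tH in auto)
  have L4: "(\<lambda>n. integral\<^sup>L (slab a b) (A4 n)) \<longlonglongrightarrow> 0"
  proof -
    obtain K where K: "0 \<le> K" "\<forall>\<^sub>F n in sequentially. (\<integral>\<^sup>+z. ennreal (\<bar>conv (k n) w z\<bar> ^ 3) \<partial>slab a b) \<le> ennreal (K * \<epsilon> n powr (3 * 0))"
      by (rule moll_cube_bounded[OF w])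
    show ?thesis
    proof (rule integral_tendsto_zero[where I="{()}" and M=M and A="\<lambda>_ n z. norm (?cm n z) * \<bar>conv (k n) w z\<bar>"])
      show "integrable (slab a b) (A4 n)" for n by (rule integral_torus_slab(2)[OF i4]) (rule zA(4))
      show "\<bar>A4 n z\<bar> \<le> M * (\<Sum>i\<in>{()}. norm (?cm n z) * \<bar>conv (k n) w z\<bar>)" for n z
        using mult_left_mono[OF M(2)[of z "?cm n z"] abs_ge_zero[of "conv (k n) w z"]]
        by (simp add: A4_def abs_mult mult_ac)
      show "(\<lambda>n. \<integral>\<^sup>+z. ennreal (norm (?cm n z) * \<bar>conv (k n) w z\<bar>) \<partial>slab a b) \<longlonglongrightarrow> 0"
        by (rule commutator_tendsto[OF w B s1 s2 _ _ K]) (use s in auto)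
    qed (use M in auto)
  qed
  have L5: "(\<lambda>n. integral\<^sup>L (slab a b) (A5 n)) \<longlonglongrightarrow> 0"
  proof (rule integral_tendsto_zero[where I=Basis and M=N and A="\<lambda>e n z. norm (?cm n z) * \<bar>frechet_derivative (conv (k n) w) (at z) e\<bar>"])
    have dwm[measurable]: "(\<lambda>z. frechet_derivative (conv (k n) w) (at z) e) \<in> borel_measurable borel" for n e
      by (intro smooth_measurable smooth_deriv sw)
    show "integrable (slab a b) (A5 n)" for n by (rule integral_torus_slab(2)[OF i5]) (rule zA(5))
    show "\<bar>A5 n z\<bar> \<le> N * (\<Sum>e\<in>Basis. norm (?cm n z) * \<bar>frechet_derivative (conv (k n) w) (at z) e\<bar>)" for n z
      unfolding A5_def abs_mult using N frechet_norm_bound[OF sw, of n z "?cm n z"] by (intro mult_mono) auto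
    show "(\<lambda>z. norm (?cm n z) * \<bar>frechet_derivative (conv (k n) w) (at z) e\<bar>) \<in> borel_measurable borel" for e n
      by measurable
    show "(\<lambda>n. \<integral>\<^sup>+z. ennreal (norm (?cm n z) * \<bar>frechet_derivative (conv (k n) w) (at z) e\<bar>) \<partial>slab a b) \<longlonglongrightarrow> 0"
      if e: "e \<in> Basis" for e
    proof -
      obtain K where K: "0 \<le> K" "\<forall>\<^sub>F n in sequentially.
        (\<integral>\<^sup>+z. ennreal (\<bar>frechet_derivative (conv (k n) w) (at z) e\<bar> ^ 3) \<partial>slab a b) \<le> ennreal (K * \<epsilon> n powr (3 * (s1 - 1)))"
        by (rule moll_deriv_cube[OF w s1 norm_Basis[OF e]])
      show ?thesis by (rule commutator_tendsto[OF w B s1 s2 _ _ K]) (use s in auto)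
    qed
  qed (use N in auto)
  have "(\<lambda>n. integral\<^sup>L (slab a b) (A1 n) + integral\<^sup>L (slab a b) (A2 n) + integral\<^sup>L (slab a b) (A3 n) + integral\<^sup>L (slab a b) (A4 n) + integral\<^sup>L (slab a b) (A5 n))
    \<longlonglongrightarrow> integral\<^sup>L (slab a b) G1 + integral\<^sup>L (slab a b) G2 + integral\<^sup>L (slab a b) G3 + 0 + 0"
    by (intro tendsto_add L1 L2 L3 L4 L5)
  moreover have "integral\<^sup>L (slab a b) (A1 n) + integral\<^sup>L (slab a b) (A2 n) + integral\<^sup>L (slab a b) (A3 n) + integral\<^sup>L (slab a b) (A4 n) + integral\<^sup>L (slab a b) (A5 n) = 0" for n
    using step[of n] integral_torus_slab(1)[OF i1 zA(1)] integral_torus_slab(1)[OF i2 zA(2)]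
      integral_torus_slab(1)[OF i3 zA(3)] integral_torus_slab(1)[OF i4 zA(4)] integral_torus_slab(1)[OF i5 zA(5)]
    by simp
  ultimately have "integral\<^sup>L (slab a b) G1 + integral\<^sup>L (slab a b) G2 + integral\<^sup>L (slab a b) G3 = 0"
    by (simp add: LIMSEQ_const_iff)
  then have "integral\<^sup>L torus G1 + integral\<^sup>L torus G2 + integral\<^sup>L torus G3 = 0"
    using integral_torus_slab(1)[OF g1 zG(1)] integral_torus_slab(1)[OF g2 zG(2)] integral_torus_slab(1)[OF g3 zG(3)] by simp
  then show "(\<integral>z. 1/2 * (w z)\<^sup>2 * ?d z (B z) \<partial>torus) + (\<integral>z. w z * ?d z (H z) \<partial>torus) + (\<integral>z. \<phi> z * (\<Gamma> z \<bullet> H z) \<partial>torus) = 0"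
    by (simp only: G1_def G2_def G3_def)
  show "integrable torus (\<lambda>z. 1/2 * (w z)\<^sup>2 * ?d z (B z))" "integrable torus (\<lambda>z. w z * ?d z (H z))" "integrable torus (\<lambda>z. \<phi> z * (\<Gamma> z \<bullet> H z))"
    using g1 g2 g3 by (simp_all only: G1_def G2_def G3_def)
qed

text \<open>
  As in \<open>kinetic_limit\<close>, with the density as the field that is multiplied in. The
  powers of the density cause no loss of integrability since \<open>r\<close> is bounded and
  mollification preserves the bound.
\<close>

lemma renormalised_limit:
  fixes r S :: "real \<times> (real^'d) \<Rightarrow> real" and V :: "real \<times> (real^'d) \<Rightarrow> real \<times> (real^'d)"
  assumes r: "Lq_field T 3 r" and V: "Lq_field T 3 V" and S: "Lq_field T 2 S" and R: "\<And>z. \<bar>r z\<bar> \<le> R"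
    and cont: "weak T (\<lambda>z. r z *\<^sub>R V z) (\<lambda>_. 0)" and div: "weak T V S"
    and s1: "besov_incr a b s1 r" and s2: "besov_incr a b s2 V" and s: "1 < 2 * s1 + s2" "s1 \<le> 1"
  shows "(\<integral>z. r z ^ Suc (Suc m) * frechet_derivative \<phi> (at z) (V z) \<partial>torus)
    + real (Suc m) * (\<integral>z. \<phi> z * r z ^ Suc (Suc m) * S z \<partial>torus) = 0"
proof -
  have r2: "Lq_field T 2 r" and V2: "Lq_field T 2 V"
    by (rule Lq_field_mono[OF r]; simp) (rule Lq_field_mono[OF V]; simp)
  have r1: "Lq_field T 1 r" and V1: "Lq_field T 1 V" and S1: "Lq_field T 1 S"
    using Lq_field_mono[OF r, of 1] Lq_field_mono[OF V, of 1] Lq_field_mono[OF S, of 1] by simp_all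
  have R0: "0 \<le> R" using R[of 0] by linarith
  have rV1: "Lq_field T 1 (\<lambda>z. r z *\<^sub>R V z)" by (rule Lq_field_scaleR[OF r2 V2])
  note m[measurable] = Lq_fieldD(1)[OF r] Lq_fieldD(1)[OF V] Lq_fieldD(1)[OF S]
  have cm[measurable]: "conv (k n) r \<in> borel_measurable borel" "conv (k n) V \<in> borel_measurable borel"
    "conv (k n) S \<in> borel_measurable borel" for n
    by (intro conv_measurable[OF k] m)+
  have rR: "\<bar>conv (k n) r z\<bar> \<le> R" for n z
  proof -
    have i: "integrable lborel (\<lambda>y. k n y *\<^sub>R r (z - y))" by (rule moll_integrable'[OF k]) (use Lq_field_L1(2)[OF r] m in auto)
    have "\<bar>conv (k n) r z\<bar> \<le> (\<integral>y. norm (k n y *\<^sub>R r (z - y)) \<partial>lborel)"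
      unfolding conv_alt(1)[OF mollifierD(10)[OF k] m(1)] real_norm_def[symmetric] by (rule integral_norm_bound)
    also have "\<dots> \<le> (\<integral>y. k n y * R \<partial>lborel)"
    proof (rule integral_mono)
      show "integrable lborel (\<lambda>y. norm (k n y *\<^sub>R r (z - y)))" by (rule integrable_norm[OF i])
      show "integrable lborel (\<lambda>y. k n y * R)" using mollifierD(6)[OF k] by simp
      show "norm (k n y *\<^sub>R r (z - y)) \<le> k n y * R" for y
        using mollifierD(3)[OF k, of n y] R[of "z - y"] by (simp add: abs_mult mult_left_mono)
    qed
    also have "\<dots> = R" using mollifierD(6,7)[OF k, of n] by simp
    finally show ?thesis .
  qed
  have s\<phi>: "smooth \<phi>" by (rule slab_testD(1)[OF \<phi>])
  have [measurable]: "\<phi> \<in> borel_measurable borel" by (rule smooth_measurable[OF s\<phi>])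
  let ?d = "\<lambda>z. frechet_derivative \<phi> (at z)" and ?m = "Suc (Suc m)"
  note lin = smooth_linear_deriv[OF s\<phi>]
  have dm[measurable]: "(\<lambda>z. ?d z (V z)) \<in> borel_measurable borel"
    by (rule measurable_frechet_field[OF s\<phi> m(2)])
  obtain M where M: "0 < M" "\<And>z v. \<bar>?d z v\<bar> \<le> M * norm v" by (rule slab_test_deriv_bounded[OF \<phi>]) blast
  obtain N where N: "0 < N" "\<And>z. \<bar>\<phi> z\<bar> \<le> N" by (rule slab_test_bounded[OF \<phi>]) blast
  let ?cm = "\<lambda>n z. conv (k n) (\<lambda>z. r z *\<^sub>R V z) z - conv (k n) r z *\<^sub>R conv (k n) V z"
  have cmm[measurable]: "?cm n \<in> borel_measurable borel" for n
  proof -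
    have [measurable]: "conv (k n) (\<lambda>z. r z *\<^sub>R V z) \<in> borel_measurable borel" by (rule conv_measurable[OF k]) measurable
    show ?thesis by measurable
  qed
  have sr: "smooth (conv (k n) r)" and sS: "smooth (conv (k n) S)" for n
    using smooth_moll(1)[OF k ab \<phi>] r1 S1 by auto
  have smV: "smooth (\<lambda>z. conv (k n) V z \<bullet> e)" "smooth (\<lambda>z. conv (k n) (\<lambda>z. r z *\<^sub>R V z) z \<bullet> e)" for n e
    using smooth_moll_inner[OF k ab \<phi>] V1 rV1 by auto
  have sc: "smooth (\<lambda>z. ?cm n z \<bullet> e)" for n e
  proof -
    have eq: "?cm n z \<bullet> e = conv (k n) (\<lambda>z. r z *\<^sub>R V z) z \<bullet> e + (-1) * (conv (k n) r z * (conv (k n) V z \<bullet> e))" for z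
      by (simp add: inner_diff_left)
    show ?thesis unfolding eq by (intro smooth_add smooth_mult smooth_const smV sr)
  qed
  define A1 where "A1 = (\<lambda>n z. conv (k n) r z ^ ?m * ?d z (conv (k n) V z))"
  define A2 where "A2 = (\<lambda>n z. \<phi> z * conv (k n) r z ^ ?m * conv (k n) S z)"
  define A3 where "A3 = (\<lambda>n z. conv (k n) r z ^ Suc m * ?d z (?cm n z))"
  define A4 where "A4 = (\<lambda>n z. \<phi> z * conv (k n) r z ^ m * frechet_derivative (conv (k n) r) (at z) (?cm n z))"
  have step: "integral\<^sup>L torus (A1 n) + real (Suc m) * integral\<^sup>L torus (A2 n)
      + real ?m * (integral\<^sup>L torus (A3 n) + real (Suc m) * integral\<^sup>L torus (A4 n)) = 0" for n
    using renormalised_step[OF k[of n] ab[of n] \<phi> r2 V2 S1 cont div, of m]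
    unfolding A1_def A2_def A3_def A4_def by blast
  note z = frechet_field_zero_outside[OF \<phi>] slab_testD(3)[OF \<phi>]
  have i1: "integrable torus (A1 n)" for n
    using integrable_slab_test_deriv[OF \<phi> smV(1) smooth_power[OF sr, of n ?m]] unfolding A1_def by (simp add: mult.commute)
  have i2: "integrable torus (A2 n)" for n
    using integrable_slab_test_mult[OF \<phi> smooth_mult[OF smooth_power[OF sr, of n ?m] sS]] unfolding A2_def by (simp add: mult.assoc)
  have i3: "integrable torus (A3 n)" for n
    using integrable_slab_test_deriv[OF \<phi> sc smooth_power[OF sr, of n "Suc m"]] unfolding A3_def by (simp add: mult.commute)
  have i4: "integrable torus (A4 n)" for n
    using integrable_slab_test_mult[OF \<phi> smooth_mult[OF smooth_power[OF sr, of n m] smooth_frechet_field[OF sr sc]]]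
    unfolding A4_def by (simp add: mult.assoc)
  have zA: "A1 n z = 0" "A2 n z = 0" "A3 n z = 0" "A4 n z = 0" if "fst z \<notin> {a..b}" for n z
    using z[OF that] by (simp_all add: A1_def A2_def A3_def A4_def)
  define G1 where "G1 = (\<lambda>z. r z ^ ?m * ?d z (V z))"
  define G2 where "G2 = (\<lambda>z. \<phi> z * r z ^ ?m * S z)"
  have rp: "\<bar>r z ^ j\<bar> \<le> R ^ j" "\<bar>conv (k n) r z ^ j\<bar> \<le> R ^ j" for n z j
    unfolding power_abs by (intro power_mono R rR; simp)+
  have g1: "integrable torus G1"
  proof (rule Bochner_Integration.integrable_bound)
    show "integrable torus (\<lambda>z. R ^ ?m * M * norm (V z))"
      using Lq_field_L1(1)[OF V] by (intro integrable_mult_right integrable_norm) simp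
    show "AE z in torus. norm (G1 z) \<le> norm (R ^ ?m * M * norm (V z))"
    proof (rule AE_I2)
      fix z
      have "norm (G1 z) \<le> R ^ ?m * (M * norm (V z))" unfolding G1_def real_norm_def abs_mult
        using R0 by (intro mult_mono M rp) auto
      then show "norm (G1 z) \<le> norm (R ^ ?m * M * norm (V z))" using M R0 by (simp add: mult.assoc)
    qed
    show "G1 \<in> borel_measurable torus" unfolding G1_def by measurable
  qed
  have g2: "integrable torus G2"
  proof (rule Bochner_Integration.integrable_bound)
    show "integrable torus (\<lambda>z. N * R ^ ?m * norm (S z))"
      using Lq_field_L1(1)[OF S] by (intro integrable_mult_right integrable_norm) simp
    show "AE z in torus. norm (G2 z) \<le> norm (N * R ^ ?m * norm (S z))"
    proof (rule AE_I2)
      fix z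
      have "norm (G2 z) \<le> N * R ^ ?m * \<bar>S z\<bar>" unfolding G2_def real_norm_def abs_mult
        using R0 N by (intro mult_mono rp) auto
      then show "norm (G2 z) \<le> norm (N * R ^ ?m * norm (S z))" using N R0 by simp
    qed
    show "G2 \<in> borel_measurable torus" unfolding G2_def by measurable
  qed
  have zG: "G1 z = 0" "G2 z = 0" if "fst z \<notin> {a..b}" for z
    using z[OF that] by (simp_all add: G1_def G2_def)
  have pd: "\<bar>x ^ Suc j - y ^ Suc j\<bar> \<le> real (Suc j) * R ^ j * \<bar>x - y\<bar>" if "\<bar>x\<bar> \<le> R" "\<bar>y\<bar> \<le> R" for x y :: real and j
  proof (induction j)
    case (Suc j)
    have "x ^ Suc (Suc j) - y ^ Suc (Suc j) = x * (x ^ Suc j - y ^ Suc j) + (x - y) * y ^ Suc j"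
      by (simp add: algebra_simps)
    also have "\<bar>\<dots>\<bar> \<le> \<bar>x\<bar> * \<bar>x ^ Suc j - y ^ Suc j\<bar> + \<bar>x - y\<bar> * \<bar>y ^ Suc j\<bar>"
      unfolding abs_mult[symmetric] by (rule abs_triangle_ineq)
    also have "\<dots> \<le> R * (real (Suc j) * R ^ j * \<bar>x - y\<bar>) + \<bar>x - y\<bar> * R ^ Suc j"
      using that R0 Suc by (intro add_mono mult_mono) (auto simp: power_abs intro: power_mono simp del: power_Suc)
    also have "\<dots> = real (Suc (Suc j)) * R ^ Suc j * \<bar>x - y\<bar>" by (simp add: algebra_simps)
    finally show ?case .
  qed simp
  define c where "c = real ?m * R ^ Suc m"
  have c0: "0 \<le> c" using R0 by (simp add: c_def)
  note tV = moll_tendsto[OF k \<epsilon> V2, of a b] and tr = moll_tendsto[OF k \<epsilon> r2, of a b] and tS = moll_tendsto[OF k \<epsilon> S, of a b]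
  have tp: "(\<lambda>n. \<integral>\<^sup>+z. ennreal (norm (conv (k n) r z ^ ?m - r z ^ ?m) ^ 2) \<partial>slab a b) \<longlonglongrightarrow> 0"
  proof (rule tendsto_sandwich[OF _ _ tendsto_const])
    show "\<forall>\<^sub>F n in sequentially. (\<integral>\<^sup>+z. ennreal (norm (conv (k n) r z ^ ?m - r z ^ ?m) ^ 2) \<partial>slab a b)
       \<le> ennreal (c ^ 2) * (\<integral>\<^sup>+z. ennreal (norm (conv (k n) r z - r z) ^ 2) \<partial>slab a b)"
    proof (intro always_eventually allI)
      fix n
      have "(\<integral>\<^sup>+z. ennreal (norm (conv (k n) r z ^ ?m - r z ^ ?m) ^ 2) \<partial>slab a b)
         \<le> (\<integral>\<^sup>+z. ennreal (c ^ 2) * ennreal (norm (conv (k n) r z - r z) ^ 2) \<partial>slab a b)"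
      proof (rule nn_integral_mono)
        fix z
        have "norm (conv (k n) r z ^ ?m - r z ^ ?m) \<le> c * norm (conv (k n) r z - r z)"
          using pd[of "conv (k n) r z" "r z" "Suc m", OF rR R] by (simp add: c_def)
        then have "norm (conv (k n) r z ^ ?m - r z ^ ?m) ^ 2 \<le> (c * norm (conv (k n) r z - r z)) ^ 2"
          by (rule power_mono) simp
        then show "ennreal (norm (conv (k n) r z ^ ?m - r z ^ ?m) ^ 2) \<le> ennreal (c ^ 2) * ennreal (norm (conv (k n) r z - r z) ^ 2)"
          by (subst ennreal_mult[symmetric]) (auto intro!: ennreal_leI simp: power_mult_distrib)
      qed
      also have "\<dots> = ennreal (c ^ 2) * (\<integral>\<^sup>+z. ennreal (norm (conv (k n) r z - r z) ^ 2) \<partial>slab a b)"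
        by (rule nn_integral_cmult) measurable
      finally show "(\<integral>\<^sup>+z. ennreal (norm (conv (k n) r z ^ ?m - r z ^ ?m) ^ 2) \<partial>slab a b)
         \<le> ennreal (c ^ 2) * (\<integral>\<^sup>+z. ennreal (norm (conv (k n) r z - r z) ^ 2) \<partial>slab a b)" .
    qed
    have "(\<lambda>n. ennreal (c ^ 2) * (\<integral>\<^sup>+z. ennreal (norm (conv (k n) r z - r z) ^ 2) \<partial>slab a b)) \<longlonglongrightarrow> ennreal (c ^ 2) * 0"
      by (intro ennreal_tendsto_cmult tr) simp_all
    then show "(\<lambda>n. ennreal (c ^ 2) * (\<integral>\<^sup>+z. ennreal (norm (conv (k n) r z - r z) ^ 2) \<partial>slab a b)) \<longlonglongrightarrow> 0" by simp
  qed auto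
  have fp: "(\<integral>\<^sup>+z. ennreal (norm (r z ^ ?m) ^ 2) \<partial>slab a b) < \<infinity>"
  proof -
    have "(\<integral>\<^sup>+z. ennreal (norm (r z ^ ?m) ^ 2) \<partial>slab a b) \<le> (\<integral>\<^sup>+z. ennreal ((R ^ ?m) ^ 2) \<partial>(slab a b :: (real \<times> (real^'d)) measure))"
      using rp(1)[of _ ?m] by (intro nn_integral_mono ennreal_leI power_mono) auto
    also have "\<dots> < \<infinity>"
    proof -
      have "emeasure (slab a b :: (real \<times> (real^'d)) measure) UNIV \<noteq> \<infinity>"
        using finite_measure.emeasure_finite[OF finite_measure_slab] by simp
      then show ?thesis by (simp add: ennreal_mult_less_top less_top)
    qed
    finally show ?thesis .
  qed
  have L1: "(\<lambda>n. integral\<^sup>L (slab a b) (A1 n)) \<longlonglongrightarrow> integral\<^sup>L (slab a b) G1"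
  proof (rule bilinear_limit[where K=M and x="\<lambda>z. r z ^ ?m" and v=V and xs="\<lambda>n z. conv (k n) r z ^ ?m" and vs="\<lambda>n. conv (k n) V"])
    show "integrable (slab a b) (A1 n)" for n by (rule integral_torus_slab(2)[OF i1]) (rule zA(1))
    show "integrable (slab a b) G1" by (rule integral_torus_slab(2)[OF g1]) (rule zG(1))
    fix n z
    let ?x = "conv (k n) r z ^ ?m"
    have "A1 n z - G1 z = ?x * ?d z (conv (k n) V z - V z) + (?x - r z ^ ?m) * ?d z (V z)"
      unfolding A1_def G1_def linear_diff[OF lin] left_diff_distrib right_diff_distrib by simp
    also have "\<bar>\<dots>\<bar> \<le> \<bar>?x\<bar> * \<bar>?d z (conv (k n) V z - V z)\<bar> + \<bar>?x - r z ^ ?m\<bar> * \<bar>?d z (V z)\<bar>"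
      unfolding abs_mult[symmetric] by (rule abs_triangle_ineq)
    also have "\<dots> \<le> \<bar>?x\<bar> * (M * norm (conv (k n) V z - V z)) + \<bar>?x - r z ^ ?m\<bar> * (M * norm (V z))"
      by (intro add_mono mult_left_mono M) auto
    also have "\<dots> = M * (norm ?x * norm (conv (k n) V z - V z) + norm (?x - r z ^ ?m) * norm (V z))"
      unfolding real_norm_def distrib_left by (simp only: mult_ac)
    finally show "\<bar>A1 n z - G1 z\<bar> \<le> M * (norm ?x * norm (conv (k n) V z - V z) + norm (?x - r z ^ ?m) * norm (V z))" .
  next
    show "(\<lambda>z. conv (k n) r z ^ ?m) \<in> borel_measurable (slab a b)" for n by measurable
    show "(\<lambda>z. r z ^ ?m) \<in> borel_measurable (slab a b)" by measurable
  qed (use M fp Lq_field_nn_finite[OF V2, of a b] tp tV in \<open>auto simp del: power_Suc\<close>)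
  have L2: "(\<lambda>n. integral\<^sup>L (slab a b) (A2 n)) \<longlonglongrightarrow> integral\<^sup>L (slab a b) G2"
  proof (rule bilinear_limit[where K=N and x="\<lambda>z. r z ^ ?m" and v=S and xs="\<lambda>n z. conv (k n) r z ^ ?m" and vs="\<lambda>n. conv (k n) S"])
    show "integrable (slab a b) (A2 n)" for n by (rule integral_torus_slab(2)[OF i2]) (rule zA(2))
    show "integrable (slab a b) G2" by (rule integral_torus_slab(2)[OF g2]) (rule zG(2))
    fix n z
    let ?x = "conv (k n) r z ^ ?m"
    have "A2 n z - G2 z = \<phi> z * (?x * (conv (k n) S z - S z) + (?x - r z ^ ?m) * S z)"
      unfolding A2_def G2_def left_diff_distrib right_diff_distrib distrib_left mult.assoc by simp
    then have "\<bar>A2 n z - G2 z\<bar> = \<bar>\<phi> z\<bar> * \<bar>?x * (conv (k n) S z - S z) + (?x - r z ^ ?m) * S z\<bar>"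
      by (simp only: abs_mult)
    also have "\<dots> \<le> N * (\<bar>?x\<bar> * \<bar>conv (k n) S z - S z\<bar> + \<bar>?x - r z ^ ?m\<bar> * \<bar>S z\<bar>)"
    proof (intro mult_mono N(2))
      show "\<bar>?x * (conv (k n) S z - S z) + (?x - r z ^ ?m) * S z\<bar> \<le> \<bar>?x\<bar> * \<bar>conv (k n) S z - S z\<bar> + \<bar>?x - r z ^ ?m\<bar> * \<bar>S z\<bar>"
        unfolding abs_mult[symmetric] by (rule abs_triangle_ineq)
    qed (use N in auto)
    finally show "\<bar>A2 n z - G2 z\<bar> \<le> N * (norm ?x * norm (conv (k n) S z - S z) + norm (?x - r z ^ ?m) * norm (S z))"
      by (simp only: real_norm_def)
  next
    show "(\<lambda>z. conv (k n) r z ^ ?m) \<in> borel_measurable (slab a b)" for n by measurable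
    show "(\<lambda>z. r z ^ ?m) \<in> borel_measurable (slab a b)" by measurable
  qed (use N fp Lq_field_nn_finite[OF S, of a b] tp tS in \<open>auto simp del: power_Suc\<close>)
  have L3: "(\<lambda>n. integral\<^sup>L (slab a b) (A3 n)) \<longlonglongrightarrow> 0"
  proof (rule integral_tendsto_zero[where I="{()}" and M="R ^ Suc m * M" and A="\<lambda>_ n z. norm (?cm n z) * 1"])
    show "integrable (slab a b) (A3 n)" for n by (rule integral_torus_slab(2)[OF i3]) (rule zA(3))
    show "\<bar>A3 n z\<bar> \<le> R ^ Suc m * M * (\<Sum>i\<in>{()}. norm (?cm n z) * 1)" for n z
    proof -
      have "\<bar>A3 n z\<bar> \<le> R ^ Suc m * (M * norm (?cm n z))"
        unfolding A3_def abs_mult using R0 by (intro mult_mono rp M) auto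
      then show ?thesis by (simp add: mult.assoc)
    qed
    obtain L where L: "emeasure (slab a b :: (real \<times> (real^'d)) measure) UNIV = ennreal L" "0 \<le> L"
      using finite_measure.emeasure_eq_measure[OF finite_measure_slab] measure_nonneg by blast
    show "(\<lambda>n. \<integral>\<^sup>+z. ennreal (norm (?cm n z) * 1) \<partial>slab a b) \<longlonglongrightarrow> 0"
    proof (rule commutator_tendsto[OF r V s1 s2 _ _ L(2), where ?s3.0=0 and Q="\<lambda>_ _. 1"])
      show "\<forall>\<^sub>F n in sequentially. (\<integral>\<^sup>+z. ennreal (1 ^ 3) \<partial>(slab a b :: (real \<times> (real^'d)) measure)) \<le> ennreal (L * \<epsilon> n powr (3 * 0))"
        using L mollifierD(1)[OF k] by (intro always_eventually allI) (simp add: less_imp_neq[symmetric])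
    qed (use s in auto)
  qed (use M R0 in auto)
  have L4: "(\<lambda>n. integral\<^sup>L (slab a b) (A4 n)) \<longlonglongrightarrow> 0"
  proof (rule integral_tendsto_zero[where I=Basis and M="N * R ^ m" and A="\<lambda>e n z. norm (?cm n z) * \<bar>frechet_derivative (conv (k n) r) (at z) e\<bar>"])
    have dwm[measurable]: "(\<lambda>z. frechet_derivative (conv (k n) r) (at z) e) \<in> borel_measurable borel" for n e
      by (intro smooth_measurable smooth_deriv sr)
    show "integrable (slab a b) (A4 n)" for n by (rule integral_torus_slab(2)[OF i4]) (rule zA(4))
    show "\<bar>A4 n z\<bar> \<le> N * R ^ m * (\<Sum>e\<in>Basis. norm (?cm n z) * \<bar>frechet_derivative (conv (k n) r) (at z) e\<bar>)" for n z
      unfolding A4_def abs_mult using N R0 frechet_norm_bound[OF sr, of n z "?cm n z"] by (intro mult_mono rp) auto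
    show "(\<lambda>z. norm (?cm n z) * \<bar>frechet_derivative (conv (k n) r) (at z) e\<bar>) \<in> borel_measurable borel" for e n
      by measurable
    show "(\<lambda>n. \<integral>\<^sup>+z. ennreal (norm (?cm n z) * \<bar>frechet_derivative (conv (k n) r) (at z) e\<bar>) \<partial>slab a b) \<longlonglongrightarrow> 0"
      if e: "e \<in> Basis" for e
    proof -
      obtain K where K: "0 \<le> K" "\<forall>\<^sub>F n in sequentially.
        (\<integral>\<^sup>+z. ennreal (\<bar>frechet_derivative (conv (k n) r) (at z) e\<bar> ^ 3) \<partial>slab a b) \<le> ennreal (K * \<epsilon> n powr (3 * (s1 - 1)))"
        by (rule moll_deriv_cube[OF r s1 norm_Basis[OF e]])
      show ?thesis by (rule commutator_tendsto[OF r V s1 s2 _ _ K]) (use s in auto)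
    qed
  qed (use N R0 in auto)
  have "(\<lambda>n. integral\<^sup>L (slab a b) (A1 n) + real (Suc m) * integral\<^sup>L (slab a b) (A2 n)
      + real ?m * (integral\<^sup>L (slab a b) (A3 n) + real (Suc m) * integral\<^sup>L (slab a b) (A4 n)))
    \<longlonglongrightarrow> integral\<^sup>L (slab a b) G1 + real (Suc m) * integral\<^sup>L (slab a b) G2 + real ?m * (0 + real (Suc m) * 0)"
    by (intro tendsto_add tendsto_mult_left L1 L2 L3 L4)
  moreover have "integral\<^sup>L (slab a b) (A1 n) + real (Suc m) * integral\<^sup>L (slab a b) (A2 n)
      + real ?m * (integral\<^sup>L (slab a b) (A3 n) + real (Suc m) * integral\<^sup>L (slab a b) (A4 n)) = 0" for n
    using step[of n] integral_torus_slab(1)[OF i1 zA(1)] integral_torus_slab(1)[OF i2 zA(2)]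
      integral_torus_slab(1)[OF i3 zA(3)] integral_torus_slab(1)[OF i4 zA(4)]
    by (simp only:)
  ultimately have "integral\<^sup>L (slab a b) G1 + real (Suc m) * integral\<^sup>L (slab a b) G2 = 0"
    by (simp add: LIMSEQ_const_iff)
  then have "integral\<^sup>L torus G1 + real (Suc m) * integral\<^sup>L torus G2 = 0"
    using integral_torus_slab(1)[OF g1 zG(1)] integral_torus_slab(1)[OF g2 zG(2)] by (simp only:)
  then show ?thesis by (simp only: G1_def G2_def)
qed

end

section \<open>The pressure potential\<close>

lemma power_over_deriv:
  fixes x :: real assumes "x \<noteq> 0"
  shows "((\<lambda>x. x ^ (2 * i) / x) has_real_derivative (2 * real i - 1) * x ^ (2 * i) / x\<^sup>2) (at x)"
proof (cases i)
  case 0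
  then show ?thesis using assms by (auto intro!: derivative_eq_intros simp: power2_eq_square)
next
  case (Suc j)
  have "((\<lambda>x. x ^ (2 * j + 1)) has_real_derivative real (2 * j + 1) * x ^ (2 * j)) (at x)"
    using DERIV_pow[of "2 * j + 1" x] by simp
  moreover have "(\<lambda>x::real. x ^ (2 * i) / x) = (\<lambda>x. x ^ (2 * j + 1))"
    by (auto simp: Suc fun_eq_iff)
  moreover have "(2 * real i - 1) * x ^ (2 * i) / x\<^sup>2 = real (2 * j + 1) * x ^ (2 * j)"
    using assms by (simp add: Suc power2_eq_square)
  ultimately show ?thesis by simp
qed

text \<open>
  Stone-Weierstrass applied to \<open>p (sqrt t)\<close> approximates \<open>p\<close> by even
  polynomials. The potential of \<open>s ^ j\<close> is \<open>s ^ j / (j - 1)\<close> plus a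
  multiple of \<open>s\<close>, except for \<open>j = 1\<close>, where a logarithm occurs; even
  exponents avoid this case. The free multiple \<open>\<kappa> * s\<close> is fixed by agreement
  at \<open>hi\<close>, from where the errors are integrated downwards: \<open>s * \<integral>
  \<delta> / x\<^sup>2\<close> over \<open>{s..hi}\<close> is at most \<open>\<delta>\<close>,
  uniformly down to \<open>s = 0\<close>.
\<close>

lemma pressure_approx_pos:
  assumes lo: "0 \<le> lo" "lo \<le> hi" "0 < hi" and p: "pressure_law lo hi p" and \<delta>: "0 < \<delta>"
  obtains a :: "nat \<Rightarrow> real" and n \<kappa> where
    "\<And>s. s \<in> {lo..hi} \<Longrightarrow> \<bar>p s - (\<Sum>i\<le>n. a i * s ^ (2 * i))\<bar> \<le> \<delta>"
    "\<And>s. s \<in> {lo..hi} \<Longrightarrow> 0 < s \<Longrightarrow> \<bar>s * (LBINT x=ereal 1..ereal s. p x / x\<^sup>2) - ((\<Sum>i\<le>n. a i / (2 * real i - 1) * s ^ (2 * i)) + \<kappa> * s)\<bar> \<le> \<delta>"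
proof -
  have cp: "continuous_on {lo..hi} p"
    and ip: "\<And>r. r \<in> {lo..hi} \<Longrightarrow> 0 < r \<Longrightarrow> interval_lebesgue_integrable lborel (ereal 1) (ereal r) (\<lambda>s. p s / s\<^sup>2)"
    using p by (auto simp: pressure_law_def)
  have "continuous_on {lo\<^sup>2..hi\<^sup>2} (\<lambda>t. p (sqrt t))"
  proof (rule continuous_on_compose2[OF cp])
    show "continuous_on {lo\<^sup>2..hi\<^sup>2} sqrt" by (intro continuous_intros)
    show "sqrt ` {lo\<^sup>2..hi\<^sup>2} \<subseteq> {lo..hi}"
    proof
      fix y assume "y \<in> sqrt ` {lo\<^sup>2..hi\<^sup>2}"
      then obtain t where t: "y = sqrt t" "lo\<^sup>2 \<le> t" "t \<le> hi\<^sup>2" by auto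
      then have "sqrt (lo\<^sup>2) \<le> y" "y \<le> sqrt (hi\<^sup>2)" by (simp_all only: real_sqrt_le_mono)
      then show "y \<in> {lo..hi}" using lo by simp
    qed
  qed
  then obtain g where g: "real_polynomial_function g" "\<And>t. t \<in> {lo\<^sup>2..hi\<^sup>2} \<Longrightarrow> \<bar>p (sqrt t) - g t\<bar> < \<delta>"
    using Stone_Weierstrass_real_polynomial_function[OF compact_Icc _ \<delta>] by blast
  then obtain a n where ga: "g = (\<lambda>x. \<Sum>i\<le>n. a i * x ^ i)" using real_polynomial_function_iff_sum by blast
  define c where "c = (\<lambda>s. \<Sum>i\<le>n. a i * s ^ (2 * i))"
  define b where "b = (\<lambda>s. \<Sum>i\<le>n. a i / (2 * real i - 1) * s ^ (2 * i))"
  have pc: "\<bar>p s - c s\<bar> \<le> \<delta>" if "s \<in> {lo..hi}" for s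
  proof -
    have "s\<^sup>2 \<in> {lo\<^sup>2..hi\<^sup>2}" using that lo by (auto intro: power_mono)
    from g(2)[OF this] have "\<bar>p s - g (s\<^sup>2)\<bar> < \<delta>" using that lo by simp
    then show ?thesis by (simp add: ga c_def power_mult)
  qed
  define \<Phi> where "\<Phi> = (\<lambda>r. LBINT s=ereal 1..ereal r. p s / s\<^sup>2)"
  \<comment> \<open>this choice makes the approximation of the potential exact at \<open>hi\<close>\<close>
  define \<kappa> where "\<kappa> = \<Phi> hi - b hi / hi"
  have pos: "\<bar>s * \<Phi> s - (b s + \<kappa> * s)\<bar> \<le> \<delta>" if s: "s \<in> {lo..hi}" "0 < s" for s
  proof -
    have c1: "continuous_on {s..hi} (\<lambda>x. p x / x\<^sup>2)"
      using s by (intro continuous_intros continuous_on_subset[OF cp]) auto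
    have int: "interval_lebesgue_integrable lborel (ereal s) (ereal hi) (\<lambda>x. p x / x\<^sup>2)"
      using s c1 by (intro interval_integrable_continuous_on) auto
    have i1: "interval_lebesgue_integrable lborel (ereal 1) (ereal hi) (\<lambda>x. p x / x\<^sup>2)"
      using lo by (intro ip) auto
    have i2: "interval_lebesgue_integrable lborel (ereal 1) (ereal s) (\<lambda>x. p x / x\<^sup>2)"
      using s by (intro ip) auto
    have "\<Phi> s + (LBINT x=ereal s..ereal hi. p x / x\<^sup>2) = \<Phi> hi"
      unfolding \<Phi>_def
    proof (rule interval_integral_sum)
      consider "1 \<le> s" | "s < 1" "hi \<le> 1" | "s < 1" "1 < hi" by linarith
      then show "interval_lebesgue_integrable lborel (min (ereal 1) (min (ereal s) (ereal hi))) (max (ereal 1) (max (ereal s) (ereal hi))) (\<lambda>x. p x / x\<^sup>2)"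
      proof cases
        case 1
        then have "min (ereal 1) (min (ereal s) (ereal hi)) = ereal 1" "max (ereal 1) (max (ereal s) (ereal hi)) = ereal hi"
          using s by (auto simp: min_def max_def)
        then show ?thesis using i1 by simp
      next
        case 2
        then have "min (ereal 1) (min (ereal s) (ereal hi)) = ereal s" "max (ereal 1) (max (ereal s) (ereal hi)) = ereal 1"
          using s by (auto simp: min_def max_def)
        then show ?thesis using iffD1[OF interval_integrable_endpoints_reverse i2] by (simp only:)
      next
        case 3
        then have "min (ereal 1) (min (ereal s) (ereal hi)) = ereal s" "max (ereal 1) (max (ereal s) (ereal hi)) = ereal hi"
          using s by (auto simp: min_def max_def)
        then show ?thesis using int by simp
      qed
    qed
    moreover have "(LBINT x=ereal s..ereal hi. p x / x\<^sup>2) = integral {s..hi} (\<lambda>x. p x / x\<^sup>2)"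
      using s c1 by (intro interval_integral_eq_integral borel_integrable_atLeastAtMost') auto
    ultimately have \<Phi>s: "\<Phi> s = \<Phi> hi - integral {s..hi} (\<lambda>x. p x / x\<^sup>2)" by simp
    have hc: "((\<lambda>x. c x / x\<^sup>2) has_integral (b hi / hi - b s / s)) {s..hi}"
    proof (rule fundamental_theorem_of_calculus)
      fix x assume x: "x \<in> {s..hi}"
      then have x0: "x \<noteq> 0" using s by auto
      have "((\<lambda>x. \<Sum>i\<le>n. a i / (2 * real i - 1) * (x ^ (2 * i) / x)) has_real_derivative
          (\<Sum>i\<le>n. a i / (2 * real i - 1) * ((2 * real i - 1) * x ^ (2 * i) / x\<^sup>2))) (at x)"
        by (intro DERIV_sum DERIV_cmult power_over_deriv x0)
      moreover have "(\<lambda>x. \<Sum>i\<le>n. a i / (2 * real i - 1) * (x ^ (2 * i) / x)) = (\<lambda>x. b x / x)"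
        by (simp add: b_def sum_divide_distrib)
      moreover have "(\<Sum>i\<le>n. a i / (2 * real i - 1) * ((2 * real i - 1) * x ^ (2 * i) / x\<^sup>2)) = c x / x\<^sup>2"
      proof -
        have "2 * real i - 1 \<noteq> 0" for i
        proof
          assume "2 * real i - 1 = 0"
          then have "real (2 * i) = real 1" by simp
          then have "2 * i = 1" using of_nat_eq_iff by blast
          then show False by presburger
        qed
        then show ?thesis by (simp add: c_def sum_divide_distrib)
      qed
      ultimately have "((\<lambda>x. b x / x) has_real_derivative c x / x\<^sup>2) (at x)" by simp
      then show "((\<lambda>x. b x / x) has_vector_derivative c x / x\<^sup>2) (at x within {s..hi})"
        by (simp add: has_real_derivative_iff_has_vector_derivative has_vector_derivative_at_within)
    qed (use s in auto)
    have hd: "((\<lambda>x. \<delta> / x\<^sup>2) has_integral (- \<delta> / hi - (- \<delta> / s))) {s..hi}"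
    proof (rule fundamental_theorem_of_calculus)
      fix x assume x: "x \<in> {s..hi}"
      then have x0: "x \<noteq> 0" using s by auto
      have "((\<lambda>x. - \<delta> / x) has_real_derivative \<delta> / x\<^sup>2) (at x)"
        using x0 by (auto intro!: derivative_eq_intros simp: power2_eq_square)
      then show "((\<lambda>x. - \<delta> / x) has_vector_derivative \<delta> / x\<^sup>2) (at x within {s..hi})"
        by (simp add: has_real_derivative_iff_has_vector_derivative has_vector_derivative_at_within)
    qed (use s in auto)
    have ipx: "(\<lambda>x. p x / x\<^sup>2) integrable_on {s..hi}" by (rule integrable_continuous_interval[OF c1])
    have "norm (integral {s..hi} (\<lambda>x. p x / x\<^sup>2 - c x / x\<^sup>2)) \<le> integral {s..hi} (\<lambda>x. \<delta> / x\<^sup>2)"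
    proof (rule integral_norm_bound_integral)
      show "(\<lambda>x. p x / x\<^sup>2 - c x / x\<^sup>2) integrable_on {s..hi}"
        using ipx hc by (intro integrable_diff) (auto simp: integrable_on_def)
      show "(\<lambda>x. \<delta> / x\<^sup>2) integrable_on {s..hi}" using hd by (auto simp: integrable_on_def)
      fix x assume "x \<in> {s..hi}"
      then have "\<bar>p x - c x\<bar> / x\<^sup>2 \<le> \<delta> / x\<^sup>2" using s by (intro divide_right_mono pc) auto
      then show "norm (p x / x\<^sup>2 - c x / x\<^sup>2) \<le> \<delta> / x\<^sup>2" by (simp add: diff_divide_distrib[symmetric] abs_divide)
    qed
    moreover have "integral {s..hi} (\<lambda>x. p x / x\<^sup>2 - c x / x\<^sup>2) = integral {s..hi} (\<lambda>x. p x / x\<^sup>2) - (b hi / hi - b s / s)"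
      using Henstock_Kurzweil_Integration.integral_diff[OF ipx has_integral_integrable[OF hc]] integral_unique[OF hc] by simp
    ultimately have J: "\<bar>integral {s..hi} (\<lambda>x. p x / x\<^sup>2) - (b hi / hi - b s / s)\<bar> \<le> \<delta> / s - \<delta> / hi"
      using integral_unique[OF hd] by simp
    have "s * \<Phi> s - (b s + \<kappa> * s) = - s * (integral {s..hi} (\<lambda>x. p x / x\<^sup>2) - (b hi / hi - b s / s))"
      using s by (simp add: \<Phi>s \<kappa>_def field_simps)
    then have "\<bar>s * \<Phi> s - (b s + \<kappa> * s)\<bar> = s * \<bar>integral {s..hi} (\<lambda>x. p x / x\<^sup>2) - (b hi / hi - b s / s)\<bar>"
      using s by (simp add: abs_mult)
    also have "\<dots> \<le> s * (\<delta> / s - \<delta> / hi)" using s by (intro mult_left_mono J) auto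
    also have "\<dots> \<le> \<delta>" using s \<delta> lo by (simp add: right_diff_distrib)
    finally show ?thesis .
  qed
  show thesis
  proof (rule that[of a n \<kappa>])
    show "\<bar>p s - (\<Sum>i\<le>n. a i * s ^ (2 * i))\<bar> \<le> \<delta>" if "s \<in> {lo..hi}" for s
      using pc[OF that] by (simp add: c_def)
    show "\<bar>s * (LBINT x=ereal 1..ereal s. p x / x\<^sup>2) - ((\<Sum>i\<le>n. a i / (2 * real i - 1) * s ^ (2 * i)) + \<kappa> * s)\<bar> \<le> \<delta>"
      if "s \<in> {lo..hi}" "0 < s" for s
      using pos[OF that] by (simp add: \<Phi>_def b_def)
  qed
qed

text \<open>
  At zero only the constant term survives, and its coefficient is \<open>a 0 / (- 1)\<close>.
\<close>

lemma potential_sum_zero: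
  "(\<Sum>i\<le>n. a i / (2 * real i - 1) * 0 ^ (2 * i)) = - (\<Sum>i\<le>n. a i * (0::real) ^ (2 * i))"
  unfolding sum_negf[symmetric]
proof (rule sum.cong[OF refl])
  fix i show "a i / (2 * real i - 1) * 0 ^ (2 * i) = - (a i * (0::real) ^ (2 * i))"
    by (cases "i = 0") (simp_all add: power_0_left)
qed

text \<open>
  The polynomial approximations of the potential are uniform up to the vacuum and have the value
  \<open>- p 0\<close> there up to the approximation error, so the limit that defines
  \<open>P(0)\<close> exists.
\<close>

lemma pressure_potential_zero:
  assumes "0 < hi" and p: "pressure_law 0 hi p"
  shows "pressure_potential p 0 = - p 0"
proof -
  let ?Q = "\<lambda>s. s * (LBINT x=ereal 1..ereal s. p x / x\<^sup>2)"
  have "(?Q \<longlongrightarrow> - p 0) (at_right 0)"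
  proof (rule tendstoI)
    fix e :: real assume e: "0 < e"
    then have "0 < e / 4" by simp
    then obtain a :: "nat \<Rightarrow> real" and n \<kappa> where
      A: "\<And>s. s \<in> {0..hi} \<Longrightarrow> \<bar>p s - (\<Sum>i\<le>n. a i * s ^ (2 * i))\<bar> \<le> e / 4"
      "\<And>s. s \<in> {0..hi} \<Longrightarrow> 0 < s \<Longrightarrow> \<bar>?Q s - ((\<Sum>i\<le>n. a i / (2 * real i - 1) * s ^ (2 * i)) + \<kappa> * s)\<bar> \<le> e / 4"
      by (rule pressure_approx_pos[OF order_refl less_imp_le[OF assms(1)] assms(1) p]) blast
    define B where "B = (\<lambda>s. (\<Sum>i\<le>n. a i / (2 * real i - 1) * s ^ (2 * i)) + \<kappa> * s)"
    have B0: "\<bar>B 0 + p 0\<bar> \<le> e / 4"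
    proof -
      have "B 0 = - (\<Sum>i\<le>n. a i * 0 ^ (2 * i))"
        by (simp only: B_def potential_sum_zero mult_zero_right add_0_right)
      moreover have "(0::real) \<in> {0..hi}" using assms(1) by simp
      ultimately show ?thesis using A(1)[of 0] by linarith
    qed
    have "(B \<longlongrightarrow> B 0) (at_right 0)" unfolding B_def by (intro tendsto_intros)
    then have "\<forall>\<^sub>F s in at_right 0. dist (B s) (B 0) < e / 4" using e by (intro tendstoD) auto
    moreover have "\<forall>\<^sub>F s in at_right 0. \<bar>?Q s - B s\<bar> \<le> e / 4"
      unfolding eventually_at_right_field B_def using assms(1) A(2) by (intro exI[of _ hi]) auto
    ultimately show "\<forall>\<^sub>F s in at_right 0. dist (?Q s) (- p 0) < e"
    proof eventually_elim
      case (elim s)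
      then show ?case using B0 e unfolding dist_real_def by linarith
    qed
  qed
  then have "Lim (at_right 0) ?Q = - p 0" by (intro tendsto_Lim) auto
  then show ?thesis by (simp add: pressure_potential_def)
qed

lemma pressure_approx:
  assumes lo: "0 \<le> lo" "lo \<le> hi" "0 < hi" and p: "pressure_law lo hi p" and \<delta>: "0 < \<delta>"
  obtains a :: "nat \<Rightarrow> real" and n \<kappa> where
    "\<And>s. s \<in> {lo..hi} \<Longrightarrow> \<bar>p s - (\<Sum>i\<le>n. a i * s ^ (2 * i))\<bar> \<le> \<delta>"
    "\<And>s. s \<in> {lo..hi} \<Longrightarrow> \<bar>pressure_potential p s - ((\<Sum>i\<le>n. a i / (2 * real i - 1) * s ^ (2 * i)) + \<kappa> * s)\<bar> \<le> \<delta>"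
proof -
  obtain a :: "nat \<Rightarrow> real" and n \<kappa> where
    A: "\<And>s. s \<in> {lo..hi} \<Longrightarrow> \<bar>p s - (\<Sum>i\<le>n. a i * s ^ (2 * i))\<bar> \<le> \<delta>"
    "\<And>s. s \<in> {lo..hi} \<Longrightarrow> 0 < s \<Longrightarrow> \<bar>s * (LBINT x=ereal 1..ereal s. p x / x\<^sup>2) - ((\<Sum>i\<le>n. a i / (2 * real i - 1) * s ^ (2 * i)) + \<kappa> * s)\<bar> \<le> \<delta>"
    by (rule pressure_approx_pos[OF lo p \<delta>]) blast
  show thesis
  proof (rule that[of a n \<kappa>])
    show "\<bar>p s - (\<Sum>i\<le>n. a i * s ^ (2 * i))\<bar> \<le> \<delta>" if "s \<in> {lo..hi}" for s by (rule A(1)[OF that])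
    show "\<bar>pressure_potential p s - ((\<Sum>i\<le>n. a i / (2 * real i - 1) * s ^ (2 * i)) + \<kappa> * s)\<bar> \<le> \<delta>" if s: "s \<in> {lo..hi}" for s
    proof (cases "s = 0")
      case False
      then show ?thesis using A(2)[OF s] s lo by (simp add: pressure_potential_def Let_def)
    next
      case True
      then have "lo = 0" using s lo by simp
      then show ?thesis
      proof -
        have "(\<Sum>i\<le>n. a i / (2 * real i - 1) * s ^ (2 * i)) + \<kappa> * s = - (\<Sum>i\<le>n. a i * 0 ^ (2 * i))"
          unfolding True by (simp only: potential_sum_zero mult_zero_right add_0_right)
        moreover have "pressure_potential p s = - p 0"
          using pressure_potential_zero[OF lo(3)] p \<open>lo = 0\<close> True by simp
        moreover have "\<bar>p 0 - (\<Sum>i\<le>n. a i * 0 ^ (2 * i))\<bar> \<le> \<delta>" using A(1)[of 0] lo \<open>lo = 0\<close> by simp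
        ultimately show ?thesis by linarith
      qed
    qed
  qed
qed

text \<open>
  A uniform limit of polynomials.
\<close>

lemma pressure_potential_continuous:
  assumes lo: "0 \<le> lo" "lo \<le> hi" "0 < hi" and p: "pressure_law lo hi p"
  shows "continuous_on {lo..hi} (pressure_potential p)"
proof -
  have "\<exists>B. continuous_on {lo..hi} B \<and> (\<forall>s\<in>{lo..hi}. \<bar>pressure_potential p s - B s\<bar> \<le> 1 / real (Suc n))" for n
  proof -
    have "0 < 1 / real (Suc n)" by simp
    then obtain a :: "nat \<Rightarrow> real" and N \<kappa> where
      A: "\<And>s. s \<in> {lo..hi} \<Longrightarrow> \<bar>pressure_potential p s - ((\<Sum>i\<le>N. a i / (2 * real i - 1) * s ^ (2 * i)) + \<kappa> * s)\<bar> \<le> 1 / real (Suc n)"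
      by (rule pressure_approx[OF lo p]) blast
    have "continuous_on {lo..hi} (\<lambda>s. (\<Sum>i\<le>N. a i / (2 * real i - 1) * s ^ (2 * i)) + \<kappa> * s)"
      by (intro continuous_intros)
    then show ?thesis using A by blast
  qed
  then obtain B where B: "\<And>n. continuous_on {lo..hi} (B n)"
    "\<And>n s. s \<in> {lo..hi} \<Longrightarrow> \<bar>pressure_potential p s - B n s\<bar> \<le> 1 / real (Suc n)" by metis
  have "uniform_limit {lo..hi} B (pressure_potential p) sequentially"
  proof (rule uniform_limitI)
    fix e :: real assume "0 < e"
    then obtain N where N: "1 / real (Suc N) < e" using nat_approx_posE by metis
    show "\<forall>\<^sub>F n in sequentially. \<forall>s\<in>{lo..hi}. dist (B n s) (pressure_potential p s) < e"
    proof (rule eventually_sequentiallyI[of N], rule ballI)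
      fix n s assume "N \<le> n" "s \<in> {lo..hi}"
      then have "1 / real (Suc n) \<le> 1 / real (Suc N)" by (simp add: frac_le)
      then show "dist (B n s) (pressure_potential p s) < e"
        using B(2)[OF \<open>s \<in> {lo..hi}\<close>, of n] N by (simp add: dist_real_def abs_minus_commute)
    qed
  qed
  then show ?thesis
    by (intro uniform_limit_theorem[OF always_eventually]) (auto intro: B(1))
qed

section \<open>Renormalisation with the pressure law\<close>

lemma mollifier_sequence:
  assumes "0 < a" "b < T"
  obtains C \<epsilon> and k :: "nat \<Rightarrow> real \<times> (real^'d) \<Rightarrow> real" where "1 \<le> C" "\<And>n. mollifier C (\<epsilon> n) (k n)" "\<epsilon> \<longlonglongrightarrow> 0"
    "\<And>n. 0 < a - \<epsilon> n" "\<And>n. b + \<epsilon> n < T"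
proof -
  obtain C where C: "1 \<le> C" "\<And>\<epsilon>. 0 < \<epsilon> \<Longrightarrow> \<exists>k :: real \<times> (real^'d) \<Rightarrow> real. mollifier C \<epsilon> k"
    by (rule mollifier_exists) blast
  define d where "d = min a (T - b) / 2"
  have d: "0 < d" "d < a" "d < T - b" using assms by (auto simp: d_def min_def)
  define \<epsilon> where "\<epsilon> = (\<lambda>n. d / real (Suc n))"
  have e: "0 < \<epsilon> n" "\<epsilon> n \<le> d" for n
  proof -
    show "0 < \<epsilon> n" using d by (simp add: \<epsilon>_def)
    have "d * 1 \<le> d * real (Suc n)" using d by (intro mult_left_mono) auto
    then show "\<epsilon> n \<le> d" by (simp add: \<epsilon>_def divide_le_eq)
  qed
  have "\<forall>n. \<exists>k :: real \<times> (real^'d) \<Rightarrow> real. mollifier C (\<epsilon> n) k" using C(2) e(1) by blast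
  then obtain k :: "nat \<Rightarrow> real \<times> (real^'d) \<Rightarrow> real" where k: "\<forall>n. mollifier C (\<epsilon> n) (k n)"
    using choice[of "\<lambda>n k. mollifier C (\<epsilon> n) k"] by blast
  have "(\<lambda>n. d * inverse (real (Suc n))) \<longlonglongrightarrow> d * 0"
    by (intro tendsto_mult_left LIMSEQ_inverse_real_of_nat)
  then have lim: "\<epsilon> \<longlonglongrightarrow> 0" by (simp add: \<epsilon>_def divide_inverse)
  show thesis
  proof (rule that[OF C(1) _ lim])
    show "mollifier C (\<epsilon> n) (k n)" for n using k by blast
    show "0 < a - \<epsilon> n" for n using e(2)[of n] d by linarith
    show "b + \<epsilon> n < T" for n using e(2)[of n] d by linarith
  qed
qed

text \<open>
  Nothing is known about \<open>h\<close> outside \<open>{lo..hi}\<close>; composing with the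
  retraction onto this interval replaces it by a continuous function.
\<close>

lemma clamp_measurable:
  fixes h :: "real \<Rightarrow> real" and r :: "real \<times> (real^'d) \<Rightarrow> real"
  assumes h: "continuous_on {lo..hi} h" and r[measurable]: "r \<in> borel_measurable borel" and lo: "lo \<le> hi"
    and b: "\<And>z. fst z \<in> {0<..<T} \<Longrightarrow> lo \<le> r z \<and> r z \<le> hi"
  shows "(\<lambda>z. if fst z \<in> {0<..<T} then h (r z) else 0) \<in> borel_measurable borel"
proof -
  have "continuous_on UNIV (\<lambda>x. h (max lo (min hi x)))"
    using lo by (intro continuous_on_compose2[OF h] continuous_intros) auto
  then have [measurable]: "(\<lambda>x. h (max lo (min hi x))) \<in> borel_measurable borel"
    by (rule borel_measurable_continuous_onI)
  have m: "(\<lambda>z. indicator {0<..<T} (fst z) * h (max lo (min hi (r z)))) \<in> borel_measurable borel"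
    by measurable
  have "(\<lambda>z. if fst z \<in> {0<..<T} then h (r z) else 0) = (\<lambda>z. indicator {0<..<T} (fst z) * h (max lo (min hi (r z))))"
  proof
    fix z :: "real \<times> (real^'d)"
    show "(if fst z \<in> {0<..<T} then h (r z) else 0) = indicator {0<..<T} (fst z) * h (max lo (min hi (r z)))"
      using b[of z] by (cases "fst z \<in> {0<..<T}") (auto simp: indicator_def max_def min_def)
  qed
  then show ?thesis using m by simp
qed

lemma continuous_law_bounded:
  fixes h :: "real \<Rightarrow> real"
  assumes "continuous_on {lo..hi} h"
  obtains M where "0 < M" "\<And>x. x \<in> {lo..hi} \<Longrightarrow> \<bar>h x\<bar> \<le> M"
proof -
  have "bounded (h ` {lo..hi})" by (intro compact_imp_bounded compact_continuous_image assms) simp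
  then obtain M where "0 < M" "\<forall>x\<in>h ` {lo..hi}. norm x \<le> M" unfolding bounded_pos by blast
  then show thesis by (intro that[of M]) auto
qed

text \<open>
  The relation \<open>\<partial>\<^sub>t P(\<rho>) + div(P(\<rho>)u) + p(\<rho>) div u =
  0\<close>, with \<open>V = (1, u)\<close> and \<open>S = - div u\<close>. It is linear in
  \<open>p\<close> and holds for each monomial: \<open>s ^ 0\<close> gives the definition of
  \<open>div u\<close>, \<open>s ^ 1\<close> the continuity equation, higher powers
  \<open>renormalised_limit\<close>. The relation is stable under uniform approximation of
  \<open>p\<close> and \<open>P\<close>, so that continuity of \<open>p\<close> suffices.
\<close>

lemma renormalised_pressure:
  fixes r S \<phi> :: "real \<times> (real^'d) \<Rightarrow> real" and V :: "real \<times> (real^'d) \<Rightarrow> real \<times> (real^'d)"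
  assumes T: "0 < a" "b < T" and \<phi>: "slab_test a b \<phi>"
    and r: "Lq_field T 3 r" and V: "Lq_field T 3 V" and S: "Lq_field T 2 S"
    and lo: "0 \<le> lo" "lo \<le> hi" "0 < hi" and p: "pressure_law lo hi p"
    and bd: "\<And>z. fst z \<in> {0<..<T} \<Longrightarrow> lo \<le> r z \<and> r z \<le> hi"
    and cont: "weak T (\<lambda>z. r z *\<^sub>R V z) (\<lambda>_. 0)" and div: "weak T V S"
    and s1: "besov_incr a b s1 r" and s2: "besov_incr a b s2 V" and s: "1 < 2 * s1 + s2" "s1 \<le> 1"
  shows "(\<integral>z. (if fst z \<in> {0<..<T} then pressure_potential p (r z) else 0) * frechet_derivative \<phi> (at z) (V z) \<partial>torus)
    + (\<integral>z. \<phi> z * ((if fst z \<in> {0<..<T} then p (r z) else 0) * S z) \<partial>torus) = 0" (is "?X = 0")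
proof -
  let ?d = "\<lambda>z. frechet_derivative \<phi> (at z) (V z)"
  let ?P = "\<lambda>z. if fst z \<in> {0<..<T} then pressure_potential p (r z) else 0"
  let ?p = "\<lambda>z. if fst z \<in> {0<..<T} then p (r z) else 0"
  have cp: "continuous_on {lo..hi} p" using p by (simp add: pressure_law_def)
  note cP = pressure_potential_continuous[OF lo p]
  have s\<phi>: "smooth \<phi>" by (rule slab_testD(1)[OF \<phi>])
  note m[measurable] = Lq_fieldD(1)[OF r] Lq_fieldD(1)[OF V] Lq_fieldD(1)[OF S] smooth_measurable[OF s\<phi>]
  have [measurable]: "?P \<in> borel_measurable borel" "?p \<in> borel_measurable borel"
    using clamp_measurable[OF cP m(1) lo(2) bd] clamp_measurable[OF cp m(1) lo(2) bd] by auto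
  have test: "test_fun T \<phi>" by (rule slab_test_test_fun[OF \<phi> T])
  have R: "\<bar>r z\<bar> \<le> hi" for z
    using bd[of z] lo Lq_fieldD(3)[OF r, of z] by (cases "fst z \<in> {0<..<T}") auto
  obtain M where M: "0 < M" "\<And>z v. \<bar>frechet_derivative \<phi> (at z) v\<bar> \<le> M * norm v" by (rule slab_test_deriv_bounded[OF \<phi>]) blast
  obtain N where N: "0 < N" "\<And>z. \<bar>\<phi> z\<bar> \<le> N" by (rule slab_test_bounded[OF \<phi>]) blast
  have dm[measurable]: "?d \<in> borel_measurable borel" by (rule measurable_frechet_field[OF s\<phi> m(2)])
  have intd: "integrable torus ?d"
  proof (rule Bochner_Integration.integrable_bound)
    show "integrable torus (\<lambda>z. M * norm (V z))" using Lq_field_L1(1)[OF V] by (intro integrable_mult_right integrable_norm) simp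
    show "AE z in torus. norm (?d z) \<le> norm (M * norm (V z))" using M by (intro AE_I2) simp
  qed measurable
  have intS: "integrable torus (\<lambda>z. \<phi> z * S z)"
    using Lq_field_L1(1)[OF S] m(4) by (intro integrable_bounded_mult[of _ N] N) auto
  have intb: "integrable torus (\<lambda>z. h z * g z)" if "h \<in> borel_measurable borel" "\<And>z. \<bar>h z\<bar> \<le> L" "integrable torus g"
    for h g :: "real \<times> (real^'d) \<Rightarrow> real" and L
    by (rule integrable_bounded_mult[OF that])
  have rp: "(\<lambda>z. r z ^ j) \<in> borel_measurable borel" "\<bar>r z ^ j\<bar> \<le> hi ^ j" for j z
    unfolding power_abs by (measurable, intro power_mono R) simp
  have ip1: "integrable torus (\<lambda>z. r z ^ j * ?d z)" and ip2: "integrable torus (\<lambda>z. r z ^ j * (\<phi> z * S z))" for j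
    using intb[OF rp] intd intS by blast+
  have mono: "(\<integral>z. r z ^ j * ?d z \<partial>torus) + (real j - 1) * (\<integral>z. r z ^ j * (\<phi> z * S z) \<partial>torus) = 0" for j
  proof -
    consider "j = 0" | "j = 1" | i where "j = Suc (Suc i)"
      by (metis One_nat_def not0_implies_Suc)
    then show ?thesis
    proof cases
      case 1
      then show ?thesis using div test by (simp add: weak_def mult.commute)
    next
      case 2
      have "(\<integral>z. frechet_derivative \<phi> (at z) (r z *\<^sub>R V z) \<partial>torus) = 0"
        using cont test by (simp add: weak_def)
      then show ?thesis using 2 by (simp add: linear_scale[OF smooth_linear_deriv[OF s\<phi>]])
    next
      case 3
      obtain C \<epsilon> and k :: "nat \<Rightarrow> real \<times> (real^'d) \<Rightarrow> real" where K: "1 \<le> C" "\<And>n. mollifier C (\<epsilon> n) (k n)" "\<epsilon> \<longlonglongrightarrow> 0"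
        "\<And>n. 0 < a - \<epsilon> n" "\<And>n. b + \<epsilon> n < T" by (rule mollifier_sequence[OF T]) blast
      have "(\<integral>z. r z ^ Suc (Suc i) * ?d z \<partial>torus) + real (Suc i) * (\<integral>z. \<phi> z * r z ^ Suc (Suc i) * S z \<partial>torus) = 0"
        by (rule renormalised_limit[OF K \<phi> r V S R cont div s1 s2 s])
      moreover have "(\<lambda>z. \<phi> z * r z ^ Suc (Suc i) * S z) = (\<lambda>z. r z ^ Suc (Suc i) * (\<phi> z * S z))"
        by (simp only: mult_ac)
      ultimately show ?thesis using 3 by (simp only: of_nat_Suc add_diff_cancel_left')
    qed
  qed
  define I where "I = (\<integral>z. \<bar>?d z\<bar> \<partial>torus) + (\<integral>z. \<bar>\<phi> z * S z\<bar> \<partial>torus)"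
  obtain LP where LP: "0 < LP" "\<And>x. x \<in> {lo..hi} \<Longrightarrow> \<bar>pressure_potential p x\<bar> \<le> LP" by (rule continuous_law_bounded[OF cP]) blast
  obtain Lp where Lp: "0 < Lp" "\<And>x. x \<in> {lo..hi} \<Longrightarrow> \<bar>p x\<bar> \<le> Lp" by (rule continuous_law_bounded[OF cp]) blast
  have iP: "integrable torus (\<lambda>z. ?P z * ?d z)"
  proof (rule intb[OF _ _ intd])
    show "\<bar>?P z\<bar> \<le> LP" for z using LP bd[of z] by auto
  qed measurable
  have ipS: "integrable torus (\<lambda>z. ?p z * (\<phi> z * S z))"
  proof (rule intb[OF _ _ intS])
    show "\<bar>?p z\<bar> \<le> Lp" for z using Lp bd[of z] by auto
  qed measurable
  have X: "?X = (\<integral>z. ?P z * ?d z \<partial>torus) + (\<integral>z. ?p z * (\<phi> z * S z) \<partial>torus)"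
    by (simp only: mult.left_commute)
  have zd: "?d z = 0" "\<phi> z = 0" if "fst z \<notin> {0<..<T}" for z
    using that T by (intro frechet_field_zero_outside[OF \<phi>] slab_testD(3)[OF \<phi>]; auto)+
  have est: "\<bar>?X\<bar> \<le> \<delta> * I" if \<delta>: "0 < \<delta>" for \<delta>
  proof -
    obtain c :: "nat \<Rightarrow> real" and n \<kappa> where
      A: "\<And>s. s \<in> {lo..hi} \<Longrightarrow> \<bar>p s - (\<Sum>i\<le>n. c i * s ^ (2 * i))\<bar> \<le> \<delta>"
      "\<And>s. s \<in> {lo..hi} \<Longrightarrow> \<bar>pressure_potential p s - ((\<Sum>i\<le>n. c i / (2 * real i - 1) * s ^ (2 * i)) + \<kappa> * s)\<bar> \<le> \<delta>"
      by (rule pressure_approx[OF lo p \<delta>]) blast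
    let ?q = "\<lambda>z. \<Sum>i\<le>n. c i * r z ^ (2 * i)"
    let ?B = "\<lambda>z. (\<Sum>i\<le>n. c i / (2 * real i - 1) * r z ^ (2 * i)) + \<kappa> * r z"
    have Be: "?B z * ?d z = (\<Sum>i\<le>n. c i / (2 * real i - 1) * (r z ^ (2 * i) * ?d z)) + \<kappa> * (r z ^ 1 * ?d z)" for z
      by (simp add: distrib_right sum_distrib_right mult.assoc)
    have qe: "?q z * (\<phi> z * S z) = (\<Sum>i\<le>n. c i * (r z ^ (2 * i) * (\<phi> z * S z)))" for z
      by (simp add: sum_distrib_right mult.assoc)
    have iB: "integrable torus (\<lambda>z. ?B z * ?d z)"
      unfolding Be by (intro Bochner_Integration.integrable_add Bochner_Integration.integrable_sum integrable_mult_right ip1)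
    have iq: "integrable torus (\<lambda>z. ?q z * (\<phi> z * S z))"
      unfolding qe by (intro Bochner_Integration.integrable_sum integrable_mult_right ip2)
    have "(\<integral>z. ?B z * ?d z \<partial>torus) = (\<Sum>i\<le>n. c i / (2 * real i - 1) * (\<integral>z. r z ^ (2 * i) * ?d z \<partial>torus)) + \<kappa> * (\<integral>z. r z ^ 1 * ?d z \<partial>torus)"
      unfolding Be
      by (subst Bochner_Integration.integral_add) (simp_all only: Bochner_Integration.integral_sum Bochner_Integration.integrable_sum integrable_mult_right ip1 integral_mult_right_zero)
    also have "\<dots> = (\<Sum>i\<le>n. - c i * (\<integral>z. r z ^ (2 * i) * (\<phi> z * S z) \<partial>torus))"
    proof -
      have "c i / (2 * real i - 1) * (\<integral>z. r z ^ (2 * i) * ?d z \<partial>torus) = - c i * (\<integral>z. r z ^ (2 * i) * (\<phi> z * S z) \<partial>torus)" for i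
      proof -
        have nz: "2 * real i - 1 \<noteq> 0"
        proof
          assume "2 * real i - 1 = 0"
          then have "real (2 * i) = real 1" by simp
          then have "2 * i = 1" using of_nat_eq_iff by blast
          then show False by presburger
        qed
        have "(\<integral>z. r z ^ (2 * i) * ?d z \<partial>torus) = - (2 * real i - 1) * (\<integral>z. r z ^ (2 * i) * (\<phi> z * S z) \<partial>torus)"
          using mono[of "2 * i"] by (simp add: algebra_simps)
        moreover have "x / q * X = - x * Y" if "q \<noteq> 0" "X = - q * Y" for x q X Y :: real using that by simp
        ultimately show ?thesis using nz by blast
      qed
      moreover have "(\<integral>z. r z ^ 1 * ?d z \<partial>torus) = 0" using mono[of 1] by simp
      ultimately show ?thesis by simp
    qed
    also have "\<dots> = - (\<integral>z. ?q z * (\<phi> z * S z) \<partial>torus)"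
      unfolding qe
      by (simp only: Bochner_Integration.integral_sum integrable_mult_right ip2 integral_mult_right_zero) (simp add: sum_negf)
    finally have bracket: "(\<integral>z. ?B z * ?d z \<partial>torus) + (\<integral>z. ?q z * (\<phi> z * S z) \<partial>torus) = 0" by simp
    have "?X = ((\<integral>z. ?P z * ?d z \<partial>torus) - (\<integral>z. ?B z * ?d z \<partial>torus)) + ((\<integral>z. ?p z * (\<phi> z * S z) \<partial>torus) - (\<integral>z. ?q z * (\<phi> z * S z) \<partial>torus))"
      unfolding X using bracket by simp
    also have "\<dots> = (\<integral>z. ?P z * ?d z - ?B z * ?d z \<partial>torus) + (\<integral>z. ?p z * (\<phi> z * S z) - ?q z * (\<phi> z * S z) \<partial>torus)"
      by (simp only: Bochner_Integration.integral_diff iP iB ipS iq)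
    finally have "\<bar>?X\<bar> \<le> \<bar>\<integral>z. ?P z * ?d z - ?B z * ?d z \<partial>torus\<bar> + \<bar>\<integral>z. ?p z * (\<phi> z * S z) - ?q z * (\<phi> z * S z) \<partial>torus\<bar>"
      by (simp only: abs_triangle_ineq)
    also have "\<dots> \<le> (\<integral>z. \<delta> * \<bar>?d z\<bar> \<partial>torus) + (\<integral>z. \<delta> * \<bar>\<phi> z * S z\<bar> \<partial>torus)"
    proof (intro add_mono)
      show "\<bar>\<integral>z. ?P z * ?d z - ?B z * ?d z \<partial>torus\<bar> \<le> (\<integral>z. \<delta> * \<bar>?d z\<bar> \<partial>torus)"
        unfolding real_norm_def[symmetric]
      proof (rule order_trans, rule integral_norm_bound, rule integral_mono)
        show "integrable torus (\<lambda>z. norm (?P z * ?d z - ?B z * ?d z))"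
          by (intro integrable_norm Bochner_Integration.integrable_diff iP iB)
        show "integrable torus (\<lambda>z. \<delta> * norm (?d z))" by (intro integrable_mult_right integrable_norm intd)
        show "norm (?P z * ?d z - ?B z * ?d z) \<le> \<delta> * norm (?d z)" for z
        proof (cases "fst z \<in> {0<..<T}")
          case True
          then have "\<bar>?P z - ?B z\<bar> \<le> \<delta>" using A(2)[of "r z"] bd[of z] by simp
          then show ?thesis unfolding left_diff_distrib[symmetric] norm_mult by (intro mult_right_mono) auto
        qed (simp add: zd)
      qed
      show "\<bar>\<integral>z. ?p z * (\<phi> z * S z) - ?q z * (\<phi> z * S z) \<partial>torus\<bar> \<le> (\<integral>z. \<delta> * \<bar>\<phi> z * S z\<bar> \<partial>torus)"
        unfolding real_norm_def[symmetric]
      proof (rule order_trans, rule integral_norm_bound, rule integral_mono)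
        show "integrable torus (\<lambda>z. norm (?p z * (\<phi> z * S z) - ?q z * (\<phi> z * S z)))"
          by (intro integrable_norm Bochner_Integration.integrable_diff ipS iq)
        show "integrable torus (\<lambda>z. \<delta> * norm (\<phi> z * S z))" by (intro integrable_mult_right integrable_norm intS)
        show "norm (?p z * (\<phi> z * S z) - ?q z * (\<phi> z * S z)) \<le> \<delta> * norm (\<phi> z * S z)" for z
        proof (cases "fst z \<in> {0<..<T}")
          case True
          then have "\<bar>?p z - ?q z\<bar> \<le> \<delta>" using A(1)[of "r z"] bd[of z] by simp
          then show ?thesis unfolding left_diff_distrib[symmetric] norm_mult[of "_ - _"] by (intro mult_right_mono) auto
        qed (simp add: zd)
      qed
    qed
    also have "\<dots> = \<delta> * I" by (simp add: I_def distrib_left)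
    finally show ?thesis .
  qed
  have I0: "0 \<le> I" by (simp add: I_def)
  have "\<bar>?X\<bar> \<le> 0 + e" if "0 < e" for e
  proof -
    have "\<bar>?X\<bar> \<le> e / (I + 1) * I" using that I0 by (intro est) auto
    also have "\<dots> \<le> e" using that I0 by (simp add: field_simps)
    finally show ?thesis by simp
  qed
  then have "\<bar>?X\<bar> \<le> 0" by (rule field_le_epsilon)
  then show ?thesis by simp
qed

section \<open>The energy identity\<close>

lemma measurable_nth[measurable (raw)]:
  fixes f :: "'m \<Rightarrow> ('b::euclidean_space)^'n"
  assumes [measurable]: "f \<in> borel_measurable M"
  shows "(\<lambda>z. f z $ i) \<in> borel_measurable M"
  by (rule measurable_compose[OF assms borel_measurable_continuous_onI])
    (intro continuous_intros)

text \<open>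
  Besov regularity passes to \<open>h\<close> when its increments are dominated. The domination
  is only needed for short shifts that start inside the slab, where extensions by zero are not
  yet felt.
\<close>

lemma besov_incr_bound:
  fixes f :: "real \<times> (real^'d) \<Rightarrow> 'a::euclidean_space" and g :: "real \<times> (real^'d) \<Rightarrow> 'b::euclidean_space"
    and h :: "real \<times> (real^'d) \<Rightarrow> 'c::euclidean_space"
  assumes f: "besov_incr a b s f" and g: "besov_incr a b s g" and m: "f \<in> borel_measurable borel" "g \<in> borel_measurable borel"
    and \<delta>: "0 < \<delta>"
    and b: "\<And>z y. fst z \<in> {a..b} \<Longrightarrow> norm y < \<delta> \<Longrightarrow> norm (h (z - y) - h z) \<le> norm (f (z - y) - f z) + norm (g (z - y) - g z)"
    and hm: "h \<in> borel_measurable borel"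
  shows "besov_incr a b s h"
proof -
  note [measurable] = m hm
  obtain K1 \<delta>1 where 1: "0 \<le> K1" "0 < \<delta>1" "\<And>e y. 0 < e \<Longrightarrow> e < \<delta>1 \<Longrightarrow> norm y < e \<Longrightarrow>
     (\<integral>\<^sup>+z. ennreal (norm (f (z - y) - f z) ^ 3) \<partial>slab a b) \<le> ennreal (K1 * e powr (3 * s))"
    using f unfolding besov_incr_def by blast
  obtain K2 \<delta>2 where 2: "0 \<le> K2" "0 < \<delta>2" "\<And>e y. 0 < e \<Longrightarrow> e < \<delta>2 \<Longrightarrow> norm y < e \<Longrightarrow>
     (\<integral>\<^sup>+z. ennreal (norm (g (z - y) - g z) ^ 3) \<partial>slab a b) \<le> ennreal (K2 * e powr (3 * s))"
    using g unfolding besov_incr_def by blast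
  show ?thesis
    unfolding besov_incr_def
  proof (rule exI[of _ "3 ^ 3 * (K1 + K2)"], intro conjI exI[of _ "min \<delta> (min \<delta>1 \<delta>2)"] allI impI)
    show "0 \<le> 3 ^ 3 * (K1 + K2)" "0 < min \<delta> (min \<delta>1 \<delta>2)" using 1 2 \<delta> by auto
    fix e :: real and y :: "real \<times> (real^'d)"
    assume e: "0 < e" "e < min \<delta> (min \<delta>1 \<delta>2)" "norm y < e"
    have "(\<integral>\<^sup>+z. ennreal (norm (h (z - y) - h z) ^ 3) \<partial>slab a b)
       \<le> (\<integral>\<^sup>+z. ennreal ((norm (f (z - y) - f z) + norm (g (z - y) - g z)) ^ 3) \<partial>slab a b)"
    proof -
      have "indicator ({a..b} \<times> cell) z * ennreal (norm (h (z - y) - h z) ^ 3)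
        \<le> indicator ({a..b} \<times> cell) z * ennreal ((norm (f (z - y) - f z) + norm (g (z - y) - g z)) ^ 3)" for z
      proof (cases "fst z \<in> {a..b}")
        case True
        then have "norm (h (z - y) - h z) \<le> norm (f (z - y) - f z) + norm (g (z - y) - g z)"
          using e by (intro b) auto
        then show ?thesis by (intro mult_left_mono ennreal_leI power_mono) auto
      qed (cases z, auto simp: indicator_def)
      then show ?thesis by (subst (1 2) nn_integral_slab) (measurable, intro nn_integral_mono)
    qed
    also have "\<dots> \<le> ennreal (3 ^ 3) * ((\<integral>\<^sup>+z. ennreal (norm (f (z - y) - f z) ^ 3) \<partial>slab a b) + (\<integral>\<^sup>+z. ennreal (norm (g (z - y) - g z) ^ 3) \<partial>slab a b))"
      by (rule nn_power_sum) auto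
    also have "\<dots> \<le> ennreal (3 ^ 3) * (ennreal (K1 * e powr (3 * s)) + ennreal (K2 * e powr (3 * s)))"
      using e by (intro mult_left_mono add_mono 1 2) auto
    also have "\<dots> = ennreal (3 ^ 3 * (K1 * e powr (3 * s) + K2 * e powr (3 * s)))"
      using 1(1) 2(1) by (subst ennreal_plus[symmetric], simp, simp, subst ennreal_mult[symmetric]) auto
    also have "\<dots> = ennreal (3 ^ 3 * (K1 + K2) * e powr (3 * s))" by (simp add: algebra_simps)
    finally show "(\<integral>\<^sup>+z. ennreal (norm (h (z - y) - h z) ^ 3) \<partial>slab a b) \<le> ennreal (3 ^ 3 * (K1 + K2) * e powr (3 * s))" .
  qed
qed

lemma sum_axis_cart: "(\<Sum>j\<in>UNIV. (x $ j) *\<^sub>R axis j 1) = (x :: real^'d)"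
  using basis_expansion[of x] by (simp add: scalar_mult_eq_scaleR)

lemma matrix_vector_symmetric:
  fixes A :: "real^'d^'d"
  assumes "transpose A = A"
  shows "A *v x = (\<Sum>i\<in>UNIV. (x $ i) *\<^sub>R (A $ i))"
proof -
  have "A $ j $ i = A $ i $ j" for i j using assms by (metis transpose_def vec_lambda_beta)
  then show ?thesis by (simp add: vec_eq_iff matrix_vector_mult_def mult.commute)
qed

lemma Lq_field_dom:
  fixes f :: "real \<times> (real^'d) \<Rightarrow> 'a::euclidean_space" and g :: "real \<times> (real^'d) \<Rightarrow> 'b::euclidean_space"
    and h :: "real \<times> (real^'d) \<Rightarrow> 'c::euclidean_space"
  assumes f: "Lq_field T q f" and g: "Lq_field T q g" and q: "0 < q" and m: "h \<in> borel_measurable borel" and per: "sper h"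
    and b: "\<And>z. norm (h z) \<le> norm (f z) + norm (g z)"
  shows "Lq_field T q h"
proof (rule Lq_fieldI_bound[OF m per])
  show "h z = 0" if "fst z \<notin> {0<..<T}" for z using b[of z] Lq_fieldD(3)[OF f that] Lq_fieldD(3)[OF g that] by simp
  show "integrable torus (\<lambda>z. 3 ^ q * (norm (f z) ^ q + norm (g z) ^ q))"
    by (intro integrable_mult_right Bochner_Integration.integrable_add Lq_fieldD(4)[OF f] Lq_fieldD(4)[OF g])
  show "norm (h z) ^ q \<le> 3 ^ q * (norm (f z) ^ q + norm (g z) ^ q)" for z
    using order_trans[OF power_mono[OF b[of z] norm_ge_zero, of q], of "3 ^ q * (norm (f z) ^ q + norm (g z) ^ q)"]
      power_sum3[of "norm (f z)" "norm (g z)" 0 q] q by (simp add: zero_power del: power_mono_iff)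
qed

lemma Lq_field_le:
  fixes f :: "real \<times> (real^'d) \<Rightarrow> 'a::euclidean_space" and h :: "real \<times> (real^'d) \<Rightarrow> 'c::euclidean_space"
  assumes f: "Lq_field T q f" and q: "0 < q" and m: "h \<in> borel_measurable borel" and per: "sper h"
    and b: "\<And>z. norm (h z) \<le> norm (f z)"
  shows "Lq_field T q h"
  by (rule Lq_field_dom[OF f f q m per]) (rule order_trans[OF b], simp)

lemma Lq_field_Pair:
  fixes f :: "real \<times> (real^'d) \<Rightarrow> 'a::euclidean_space" and g :: "real \<times> (real^'d) \<Rightarrow> 'b::euclidean_space"
  assumes f: "Lq_field T q f" and g: "Lq_field T q g" and q: "0 < q"
  shows "Lq_field T q (\<lambda>z. (f z, g z))"
proof (rule Lq_field_dom[OF f g q])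
  show "(\<lambda>z. (f z, g z)) \<in> borel_measurable borel" by (intro borel_measurable_Pair Lq_fieldD(1)[OF f] Lq_fieldD(1)[OF g])
  show "sper (\<lambda>z. (f z, g z))" using Lq_fieldD(2)[OF f] Lq_fieldD(2)[OF g] by (simp add: sper_def)
qed (rule norm_Pair_le)

lemma Lq_field_bounded:
  fixes f :: "real \<times> (real^'d) \<Rightarrow> 'a::euclidean_space"
  assumes "f \<in> borel_measurable borel" "sper f" "\<And>z. fst z \<notin> {0<..<T} \<Longrightarrow> f z = 0" "\<And>z. norm (f z) \<le> M" "0 < q"
  shows "Lq_field T q f"
proof (rule Lq_fieldI_bound[OF assms(1-3)])
  show "integrable torus (\<lambda>z :: real \<times> (real^'d). M ^ q * indicator {0..T} (fst z))"
    by (intro integrable_mult_right integrable_torus_time)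
  show "norm (f z) ^ q \<le> M ^ q * indicator {0..T} (fst z)" for z
    using assms(3)[of z] assms(5) power_mono[OF assms(4)[of z] norm_ge_zero, of q]
    by (cases "fst z \<in> {0<..<T}") (auto simp: indicator_def zero_power)
qed

lemma Lq_field_sum:
  fixes f :: "'i \<Rightarrow> real \<times> (real^'d) \<Rightarrow> 'b::euclidean_space"
  assumes "\<And>i. i \<in> I \<Longrightarrow> Lq_field T 1 (f i)"
  shows "Lq_field T 1 (\<lambda>z. \<Sum>i\<in>I. f i z)"
  using assms
proof (induction I rule: infinite_finite_induct)
  case (insert i I)
  then show ?case using Lq_field_add[of T "f i" "\<lambda>z. \<Sum>i\<in>I. f i z"] by simp
qed (simp_all add: Lq_field_def sper_def)

lemma integrable_frechet_field:
  fixes V :: "real \<times> (real^'d) \<Rightarrow> real \<times> (real^'d)"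
  assumes \<phi>: "slab_test a b \<phi>" and V: "Lq_field T 1 V"
  shows "integrable torus (\<lambda>z. frechet_derivative \<phi> (at z) (V z))"
proof -
  obtain M where M: "0 < M" "\<And>z v. \<bar>frechet_derivative \<phi> (at z) v\<bar> \<le> M * norm v" by (rule slab_test_deriv_bounded[OF \<phi>]) blast
  show ?thesis
  proof (rule Bochner_Integration.integrable_bound)
    show "integrable torus (\<lambda>z. M * norm (V z))" using Lq_field_L1(1)[OF V] by (intro integrable_mult_right integrable_norm) simp
    show "AE z in torus. norm (frechet_derivative \<phi> (at z) (V z)) \<le> norm (M * norm (V z))" using M by (intro AE_I2) simp
    show "(\<lambda>z. frechet_derivative \<phi> (at z) (V z)) \<in> borel_measurable torus"
      using measurable_frechet_field[OF slab_testD(1)[OF \<phi>] Lq_fieldD(1)[OF V]] by simp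
  qed
qed

lemma integrable_slab_test_Lq_field:
  fixes s :: "real \<times> (real^'d) \<Rightarrow> real"
  assumes \<phi>: "slab_test a b \<phi>" and s: "Lq_field T 1 s"
  shows "integrable torus (\<lambda>z. \<phi> z * s z)"
proof -
  obtain N where "0 < N" "\<And>z. \<bar>\<phi> z\<bar> \<le> N" by (rule slab_test_bounded[OF \<phi>]) blast
  then show ?thesis
    using Lq_field_L1(1)[OF s] smooth_measurable[OF slab_testD(1)[OF \<phi>]] by (intro integrable_bounded_mult[of _ N]) auto
qed

lemma Basis_spacetime:
  "(Basis :: (real \<times> (real^'d)) set) = insert (1, 0) (range (\<lambda>j. (0, axis j 1)))"
  by (auto simp: Basis_prod_def Basis_vec_def)

lemma besov_incr_component:
  fixes u :: "real \<times> (real^'d) \<Rightarrow> real^'d"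
  assumes "besov_incr a b s u" "u \<in> borel_measurable borel"
  shows "besov_incr a b s (\<lambda>z. u z $ i)"
proof (rule besov_incr_bound[OF assms(1,1,2,2) zero_less_one])
  show "norm (u (z - y) $ i - u z $ i) \<le> norm (u (z - y) - u z) + norm (u (z - y) - u z)" for z y
    using component_le_norm_cart[of "u (z - y) - u z" i] by simp
  show "(\<lambda>z. u z $ i) \<in> borel_measurable borel" using assms(2) by measurable
qed

text \<open>
  The momentum equation of each component is fed into \<open>kinetic_limit\<close> with \<open>B
  = (\<rho>, \<rho>u)\<close> and \<open>H\<^sub>i = (0, p e\<^sub>i -
  \<sigma>\<^sub>i)\<close>, which requires \<open>2\<alpha> + \<beta> > 1\<close>; the density
  is fed into \<open>renormalised_pressure\<close> with \<open>V = (1, u)\<close>, which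
  requires \<open>2\<beta> + \<alpha> > 1\<close>. In the sum over all components the pressure
  work \<open>p div u\<close> cancels between the two. Symmetry of \<open>\<sigma>\<close>
  identifies \<open>\<Sum>\<^sub>i u\<^sub>i \<sigma>\<^sub>i\<close> with
  \<open>\<sigma>u\<close>.
\<close>

lemma energy_identity:
  fixes \<rho> :: "real \<times> (real^'d) \<Rightarrow> real" and u :: "real \<times> (real^'d) \<Rightarrow> real^'d" and G \<sigma> :: "real \<times> (real^'d) \<Rightarrow> real^'d^'d"
  assumes \<rho>: "Lq_field T 3 \<rho>" and u: "Lq_field T 3 u" and \<rho>u: "Lq_field T 3 (\<lambda>z. \<rho> z *\<^sub>R u z)" and G: "Lq_field T 2 G" and \<sigma>: "Lq_field T 2 \<sigma>"
    and sym: "\<And>z. transpose (\<sigma> z) = \<sigma> z"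
    and lo: "0 \<le> lo" "lo \<le> hi" "0 < hi" and p: "pressure_law lo hi p"
    and bd: "\<And>z. fst z \<in> {0<..<T} \<Longrightarrow> lo \<le> \<rho> z \<and> \<rho> z \<le> hi"
    and pr_def: "pr = (\<lambda>z. if fst z \<in> {0<..<T} then p (\<rho> z) else 0)"
    and pot_def: "pot = (\<lambda>z. if fst z \<in> {0<..<T} then pressure_potential p (\<rho> z) else 0)"
    and E_def: "E = (\<lambda>z. 1/2 * \<rho> z * (norm (u z))\<^sup>2 + pot z)"
    and F_def: "F = (\<lambda>z. (1/2 * \<rho> z * (norm (u z))\<^sup>2 + pr z + pot z) *\<^sub>R u z - \<sigma> z *v u z)"
  shows "Lq_field T 1 E" "Lq_field T 1 F" "Lq_field T 1 (\<lambda>z. \<sigma> z \<bullet> G z)" "Lq_field T 2 pr"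
    and "\<lbrakk>\<And>i. weak T (\<lambda>z. (u z $ i) *\<^sub>R (\<rho> z, \<rho> z *\<^sub>R u z) + (0, pr z *\<^sub>R axis i 1 - \<sigma> z $ i)) (\<lambda>_. 0);
      weak T (\<lambda>z. (\<rho> z, \<rho> z *\<^sub>R u z)) (\<lambda>_. 0);
      \<And>i j. weak T (\<lambda>z. (u z $ i) *\<^sub>R (0, axis j 1)) (\<lambda>z. - (G z $ i $ j));
      \<And>a b. 0 < a \<Longrightarrow> b < T \<Longrightarrow> besov_incr a b \<alpha> u;
      \<And>a b. 0 < a \<Longrightarrow> b < T \<Longrightarrow> besov_incr a b \<beta> \<rho>;
      \<And>a b. 0 < a \<Longrightarrow> b < T \<Longrightarrow> besov_incr a b \<beta> (\<lambda>z. \<rho> z *\<^sub>R u z);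
      1 < 2 * \<alpha> + \<beta>; 1 < 2 * \<beta> + \<alpha>; \<alpha> \<le> 1; \<beta> \<le> 1; 0 < a; b < T; slab_test a b \<phi>\<rbrakk> \<Longrightarrow>
      (\<integral>z. frechet_derivative \<phi> (at z) (E z, F z) \<partial>torus) = (\<integral>z. \<phi> z * (\<sigma> z \<bullet> G z) \<partial>torus)"
proof -
  have cp: "continuous_on {lo..hi} p" using p by (simp add: pressure_law_def)
  note cP = pressure_potential_continuous[OF lo p]
  note m[measurable] = Lq_fieldD(1)[OF \<rho>] Lq_fieldD(1)[OF u] Lq_fieldD(1)[OF G] Lq_fieldD(1)[OF \<sigma>]
  have prm[measurable]: "pr \<in> borel_measurable borel" and potm[measurable]: "pot \<in> borel_measurable borel"
    unfolding pr_def pot_def using clamp_measurable[OF cP m(1) lo(2) bd] clamp_measurable[OF cp m(1) lo(2) bd] by auto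
  obtain LP where LP: "0 < LP" "\<And>x. x \<in> {lo..hi} \<Longrightarrow> \<bar>pressure_potential p x\<bar> \<le> LP" by (rule continuous_law_bounded[OF cP]) blast
  obtain Lp where Lp: "0 < Lp" "\<And>x. x \<in> {lo..hi} \<Longrightarrow> \<bar>p x\<bar> \<le> Lp" by (rule continuous_law_bounded[OF cp]) blast
  have per: "sper \<rho>" "sper u" "sper G" "sper \<sigma>" using Lq_fieldD(2) \<rho> u G \<sigma> by blast+
  have prz: "pr z = 0" and potz: "pot z = 0" if "fst z \<notin> {0<..<T}" for z
    unfolding pr_def pot_def by (rule if_not_P[OF that])+
  have perp: "sper pr" "sper pot" using per(1) by (simp_all add: sper_def pr_def pot_def del: greaterThanLessThan_iff)
  have prb: "norm (pr z) \<le> Lp" and potb: "norm (pot z) \<le> LP" for z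
    using LP Lp bd[of z] by (auto simp: pr_def pot_def)
  have fpr: "Lq_field T q pr" and fpot: "Lq_field T q pot" if "0 < q" for q
    by (rule Lq_field_bounded[OF prm perp(1) prz prb that], assumption) (rule Lq_field_bounded[OF potm perp(2) potz potb that])
  show "Lq_field T 2 pr" by (rule fpr) simp
  have u2: "Lq_field T 2 u" and u1: "Lq_field T 1 u" and G1: "Lq_field T 1 G" and \<sigma>1: "Lq_field T 1 \<sigma>"
    using Lq_field_mono[OF u, of 2] Lq_field_mono[OF u, of 1] Lq_field_mono[OF G, of 1] Lq_field_mono[OF \<sigma>, of 1] by simp_all
  have \<rho>b: "\<bar>\<rho> z\<bar> \<le> hi" for z
    using bd[of z] lo Lq_fieldD(3)[OF \<rho>, of z] by (cases "fst z \<in> {0<..<T}") auto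
  have ui: "Lq_field T q (\<lambda>z. u z $ i)" if "Lq_field T q u" "0 < q" for i q
    by (rule Lq_field_le[OF that]) (use per(2) component_le_norm_cart[of "u _" i] in \<open>auto simp: sper_def\<close>)
  have \<sigma>i: "Lq_field T 2 (\<lambda>z. \<sigma> z $ i)" for i
    by (rule Lq_field_le[OF \<sigma>]) (use per(4) Finite_Cartesian_Product.norm_nth_le[of "\<sigma> _" i] in \<open>auto simp: sper_def\<close>)
  have Gi: "Lq_field T 2 (\<lambda>z. G z $ i)" for i
    by (rule Lq_field_le[OF G]) (use per(3) Finite_Cartesian_Product.norm_nth_le[of "G _" i] in \<open>auto simp: sper_def\<close>)
  have Gij: "Lq_field T 2 (\<lambda>z. G z $ i $ j)" for i j
    by (rule Lq_field_le[OF Gi[of i]]) (use per(3) component_le_norm_cart[of "G _ $ i" j] in \<open>auto simp: sper_def\<close>)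
  have \<sigma>u: "\<sigma> z *v u z = (\<Sum>i\<in>UNIV. (u z $ i) *\<^sub>R (\<sigma> z $ i))" for z
    by (rule matrix_vector_symmetric[OF sym])
  have kin: "Lq_field T 1 (\<lambda>z. 1/2 * \<rho> z * (norm (u z))\<^sup>2)"
  proof (rule Lq_fieldI_bound)
    show "integrable torus (\<lambda>z. hi * norm (u z) ^ 2)" by (intro integrable_mult_right Lq_fieldD(4)[OF u2])
    show "norm (1/2 * \<rho> z * (norm (u z))\<^sup>2) ^ 1 \<le> hi * norm (u z) ^ 2" for z
    proof -
      have "\<bar>\<rho> z\<bar> * (norm (u z))\<^sup>2 \<le> hi * (norm (u z))\<^sup>2" using \<rho>b by (intro mult_right_mono) auto
      moreover have "0 \<le> \<bar>\<rho> z\<bar> * (norm (u z))\<^sup>2" by simp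
      moreover have "norm (1/2 * \<rho> z * (norm (u z))\<^sup>2) ^ 1 = 1/2 * (\<bar>\<rho> z\<bar> * (norm (u z))\<^sup>2)" by (simp add: abs_mult)
      ultimately show ?thesis by linarith
    qed
  qed (use per Lq_fieldD(3)[OF \<rho>] in \<open>auto simp: sper_def\<close>)
  show fE: "Lq_field T 1 E" unfolding E_def by (intro Lq_field_add kin fpot) simp
  have kinu: "Lq_field T 1 (\<lambda>z. (1/2 * \<rho> z * (norm (u z))\<^sup>2) *\<^sub>R u z)"
  proof (rule Lq_fieldI_bound)
    show "integrable torus (\<lambda>z. hi * norm (u z) ^ 3)" by (intro integrable_mult_right Lq_fieldD(4)[OF u])
    show "norm ((1/2 * \<rho> z * (norm (u z))\<^sup>2) *\<^sub>R u z) ^ 1 \<le> hi * norm (u z) ^ 3" for z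
    proof -
      have "\<bar>\<rho> z\<bar> * norm (u z) ^ 3 \<le> hi * norm (u z) ^ 3" using \<rho>b by (intro mult_right_mono) auto
      moreover have "0 \<le> \<bar>\<rho> z\<bar> * norm (u z) ^ 3" by simp
      moreover have "norm ((1/2 * \<rho> z * (norm (u z))\<^sup>2) *\<^sub>R u z) ^ 1 = 1/2 * (\<bar>\<rho> z\<bar> * norm (u z) ^ 3)"
        by (simp add: abs_mult power2_eq_square power3_eq_cube)
      ultimately show ?thesis by linarith
    qed
  qed (use per Lq_fieldD(3)[OF \<rho>] in \<open>auto simp: sper_def\<close>)
  have fsu: "Lq_field T 1 (\<lambda>z. - (\<sigma> z *v u z))"
  proof -
    have "Lq_field T 1 (\<lambda>z. \<Sum>i\<in>UNIV. (- (u z $ i)) *\<^sub>R (\<sigma> z $ i))"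
    proof (intro Lq_field_sum Lq_field_scaleR \<sigma>i)
      show "Lq_field T 2 (\<lambda>z. - (u z $ i))" for i
        by (rule Lq_field_le[OF u2]) (use per(2) component_le_norm_cart[of "u _" i] in \<open>auto simp: sper_def\<close>)
    qed
    then show ?thesis unfolding \<sigma>u by (simp add: sum_negf)
  qed
  show fF: "Lq_field T 1 F"
  proof -
    have "Lq_field T 1 (\<lambda>z. ((1/2 * \<rho> z * (norm (u z))\<^sup>2) *\<^sub>R u z + pr z *\<^sub>R u z) + (pot z *\<^sub>R u z + - (\<sigma> z *v u z)))"
      by (intro Lq_field_add kinu fsu Lq_field_scaleR fpr fpot u2) auto
    moreover have "F = (\<lambda>z. ((1/2 * \<rho> z * (norm (u z))\<^sup>2) *\<^sub>R u z + pr z *\<^sub>R u z) + (pot z *\<^sub>R u z + - (\<sigma> z *v u z)))"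
      by (simp add: F_def fun_eq_iff scaleR_add_left)
    ultimately show ?thesis by simp
  qed
  show fD: "Lq_field T 1 (\<lambda>z. \<sigma> z \<bullet> G z)"
  proof (rule Lq_fieldI_bound)
    show "integrable torus (\<lambda>z. norm (\<sigma> z) ^ 2 + norm (G z) ^ 2)"
      by (intro Bochner_Integration.integrable_add Lq_fieldD(4)[OF \<sigma>] Lq_fieldD(4)[OF G])
    show "norm (\<sigma> z \<bullet> G z) ^ 1 \<le> norm (\<sigma> z) ^ 2 + norm (G z) ^ 2" for z
      using Cauchy_Schwarz_ineq2[of "\<sigma> z" "G z"] young2[of "norm (\<sigma> z)" "norm (G z)"] by simp
  qed (use per Lq_fieldD(3)[OF \<sigma>] in \<open>auto simp: sper_def\<close>)
  assume mom: "\<And>i. weak T (\<lambda>z. (u z $ i) *\<^sub>R (\<rho> z, \<rho> z *\<^sub>R u z) + (0, pr z *\<^sub>R axis i 1 - \<sigma> z $ i)) (\<lambda>_. 0)"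
    and cont: "weak T (\<lambda>z. (\<rho> z, \<rho> z *\<^sub>R u z)) (\<lambda>_. 0)"
    and grad: "\<And>i j. weak T (\<lambda>z. (u z $ i) *\<^sub>R (0, axis j 1)) (\<lambda>z. - (G z $ i $ j))"
    and bu: "\<And>a b. 0 < a \<Longrightarrow> b < T \<Longrightarrow> besov_incr a b \<alpha> u" and b\<rho>: "\<And>a b. 0 < a \<Longrightarrow> b < T \<Longrightarrow> besov_incr a b \<beta> \<rho>"
    and b\<rho>u: "\<And>a b. 0 < a \<Longrightarrow> b < T \<Longrightarrow> besov_incr a b \<beta> (\<lambda>z. \<rho> z *\<^sub>R u z)"
    and ex: "1 < 2 * \<alpha> + \<beta>" "1 < 2 * \<beta> + \<alpha>" "\<alpha> \<le> 1" "\<beta> \<le> 1" and ab: "0 < a" "b < T" and \<phi>: "slab_test a b \<phi>"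
  let ?d = "\<lambda>z. frechet_derivative \<phi> (at z)"
  define B where "B = (\<lambda>z. (\<rho> z, \<rho> z *\<^sub>R u z))"
  define H where "H = (\<lambda>i z. (0 :: real, pr z *\<^sub>R axis i 1 - \<sigma> z $ i))"
  define \<Gamma> where "\<Gamma> = (\<lambda>i z. (0 :: real, G z $ i))"
  \<comment> \<open>the velocity \<open>(1, u)\<close>, cut off in time like all other fields\<close>
  define V where "V = (\<lambda>z. (indicator {0<..<T} (fst z) :: real, u z))"
  define S where "S = (\<lambda>z. - trace (G z))"
  have lin: "linear (?d z)" for z by (rule smooth_linear_deriv[OF slab_testD(1)[OF \<phi>]])
  have [measurable]: "(fst :: real \<times> (real^'d) \<Rightarrow> real) \<in> borel_measurable borel"
    by (intro borel_measurable_continuous_onI continuous_intros)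
  have Bm: "B \<in> borel_measurable borel" and Vm: "V \<in> borel_measurable borel"
    unfolding B_def V_def by (intro borel_measurable_Pair; measurable)+
  have fB: "Lq_field T 3 B"
    unfolding B_def by (rule Lq_field_Pair[OF \<rho> \<rho>u]) simp
  have find: "Lq_field T 3 (\<lambda>z :: real \<times> (real^'d). indicator {0<..<T} (fst z) :: real)"
    by (rule Lq_field_bounded[where M=1]) (auto simp: sper_def indicator_def)
  have fV: "Lq_field T 3 V"
    unfolding V_def by (rule Lq_field_Pair[OF find u]) simp
  have fV1: "Lq_field T 1 V" using Lq_field_mono[OF fV, of 1] by simp
  have fH: "Lq_field T 2 (H i)" for i
  proof (rule Lq_field_dom[OF fpr \<sigma>i[of i]])
    show "H i \<in> borel_measurable borel" unfolding H_def by (intro borel_measurable_Pair; measurable)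
    show "sper (H i)" using perp per(4) by (simp add: H_def sper_def)
    show "norm (H i z) \<le> norm (pr z) + norm (\<sigma> z $ i)" for z
      using norm_triangle_ineq4[of "pr z *\<^sub>R axis i (1::real)" "\<sigma> z $ i"] by (simp add: H_def)
  qed auto
  have f\<Gamma>: "Lq_field T 2 (\<Gamma> i)" for i
  proof (rule Lq_field_le[OF Gi[of i]])
    show "\<Gamma> i \<in> borel_measurable borel" unfolding \<Gamma>_def by (intro borel_measurable_Pair; measurable)
    show "sper (\<Gamma> i)" using per(3) by (simp add: \<Gamma>_def sper_def)
  qed (auto simp: \<Gamma>_def)
  have fS: "Lq_field T 2 S"
  proof -
    have m: "S \<in> borel_measurable borel" unfolding S_def trace_def by measurable
    have b: "norm (S z) \<le> real CARD('d) * norm (G z)" for z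
    proof -
      have "norm (S z) \<le> (\<Sum>i\<in>UNIV. \<bar>G z $ i $ i\<bar>)" unfolding S_def trace_def by (simp add: sum_abs)
      also have "\<dots> \<le> (\<Sum>i\<in>(UNIV::'d set). norm (G z))"
        by (intro sum_mono order_trans[OF component_le_norm_cart] Finite_Cartesian_Product.norm_nth_le)
      finally show ?thesis by simp
    qed
    show ?thesis
    proof (rule Lq_fieldI_bound[OF m])
      show "sper S" using per(3) by (simp add: sper_def S_def)
      show "S z = 0" if "fst z \<notin> {0<..<T}" for z using b[of z] Lq_fieldD(3)[OF G that] by simp
      show "integrable torus (\<lambda>z. (real CARD('d))\<^sup>2 * norm (G z) ^ 2)" by (intro integrable_mult_right Lq_fieldD(4)[OF G])
      show "norm (S z) ^ 2 \<le> (real CARD('d))\<^sup>2 * norm (G z) ^ 2" for z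
        using power_mono[OF b[of z] norm_ge_zero, of 2] by (simp add: power_mult_distrib)
    qed
  qed
  have \<rho>V: "\<rho> z *\<^sub>R V z = B z" for z
    using Lq_fieldD(3)[OF \<rho>, of z] by (auto simp: V_def B_def indicator_def)
  \<comment> \<open>the time component of \<open>V\<close> is constant on the support of a test function and has no divergence\<close>
  have weakV: "weak T V S"
    unfolding weak_def
  proof (intro allI impI)
    fix \<psi> :: "real \<times> (real^'d) \<Rightarrow> real" assume test: "test_fun T \<psi>"
    then obtain a' b' where \<psi>: "0 < a'" "b' < T" "slab_test a' b' \<psi>" by (rule test_fun_slab_test)
    let ?e = "\<lambda>z. frechet_derivative \<psi> (at z)"
    note l = smooth_linear_deriv[OF slab_testD(1)[OF \<psi>(3)]]
    have eq: "?e z (V z) = ?e z (1, 0) + (\<Sum>j\<in>UNIV. ?e z ((u z $ j) *\<^sub>R (0, axis j 1)))" for z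
    proof (cases "fst z \<in> {0<..<T}")
      case True
      have "V z = (1, 0) + (\<Sum>j\<in>UNIV. (u z $ j) *\<^sub>R (0, axis j 1))"
      proof -
        have "(\<Sum>j\<in>UNIV. (u z $ j) *\<^sub>R (0, axis j 1)) = (0 :: real, \<Sum>j\<in>UNIV. (u z $ j) *\<^sub>R axis j (1::real))"
          by (simp add: prod_eq_iff fst_sum snd_sum)
        then show ?thesis using True by (simp add: V_def sum_axis_cart)
      qed
      then show ?thesis by (simp only: linear_add[OF l] linear_sum[OF l])
    next
      case False
      then have "fst z \<notin> {a'..b'}" using \<psi> by auto
      then show ?thesis by (simp add: frechet_field_zero_outside[OF \<psi>(3)])
    qed
    have fe: "Lq_field T 1 (\<lambda>z. (u z $ j) *\<^sub>R (0 :: real, axis j (1::real) :: real^'d))" for j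
      by (rule Lq_field_le[OF ui[OF u1]]) (use per(2) in \<open>auto simp: sper_def\<close>)
    have G1j: "Lq_field T 1 (\<lambda>z. G z $ j $ j)" for j using Lq_field_mono[OF Gij, of 1] by simp
    have "(\<integral>z. ?e z (V z) \<partial>torus) = (\<integral>z. ?e z (1, 0) \<partial>torus) + (\<Sum>j\<in>UNIV. (\<integral>z. ?e z ((u z $ j) *\<^sub>R (0, axis j 1)) \<partial>torus))"
      unfolding eq
      by (simp only: Bochner_Integration.integral_add Bochner_Integration.integral_sum Bochner_Integration.integrable_sum
          integrable_slab_test[OF slab_test_deriv[OF \<psi>(3)]] integrable_frechet_field[OF \<psi>(3) fe])
    also have "\<dots> = (\<Sum>j\<in>UNIV. (\<integral>z. - (G z $ j $ j) * \<psi> z \<partial>torus))"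
      using grad test integral_deriv_zero[OF \<psi>(3)] by (simp add: weak_def)
    also have "\<dots> = (\<Sum>j\<in>UNIV. - (\<integral>z. \<psi> z * (G z $ j $ j) \<partial>torus))"
      by (simp add: mult.commute)
    also have "\<dots> = - (\<integral>z. (\<Sum>j\<in>UNIV. \<psi> z * (G z $ j $ j)) \<partial>torus)"
      by (simp only: sum_negf Bochner_Integration.integral_sum integrable_slab_test_Lq_field[OF \<psi>(3) G1j])
    also have "\<dots> = (\<integral>z. S z * \<psi> z \<partial>torus)"
      by (simp add: S_def trace_def sum_distrib_left mult.commute)
    finally show "(\<integral>z. ?e z (V z) \<partial>torus) = (\<integral>z. S z * \<psi> z \<partial>torus)" .
  qed
  define \<delta> where "\<delta> = min a (T - b)"
  have \<delta>: "0 < \<delta>" using ab by (simp add: \<delta>_def)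
  have bV: "besov_incr a b \<alpha> V"
  proof (rule besov_incr_bound[OF bu[OF ab] bu[OF ab] m(2) m(2) \<delta> _ Vm])
    fix z y :: "real \<times> (real^'d)" assume z: "fst z \<in> {a..b}" and y: "norm y < \<delta>"
    have "\<bar>fst y\<bar> \<le> norm y" using norm_fst_le[of "fst y" "snd y"] by simp
    then have "fst (z - y) \<in> {0<..<T}" "fst z \<in> {0<..<T}" using z y ab by (auto simp: \<delta>_def)
    then have "V (z - y) - V z = (0, u (z - y) - u z)" by (simp add: V_def)
    then show "norm (V (z - y) - V z) \<le> norm (u (z - y) - u z) + norm (u (z - y) - u z)" by simp
  qed
  have bB: "besov_incr a b \<beta> B"
  proof (rule besov_incr_bound[OF b\<rho>[OF ab] b\<rho>u[OF ab] m(1) Lq_fieldD(1)[OF \<rho>u] \<delta> _ Bm])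
    show "norm (B (z - y) - B z) \<le> norm (\<rho> (z - y) - \<rho> z) + norm (\<rho> (z - y) *\<^sub>R u (z - y) - \<rho> z *\<^sub>R u z)" for z y
      unfolding B_def by (simp only: diff_Pair) (rule norm_Pair_le)
  qed
  obtain C \<epsilon> and k :: "nat \<Rightarrow> real \<times> (real^'d) \<Rightarrow> real" where K: "1 \<le> C" "\<And>n. mollifier C (\<epsilon> n) (k n)" "\<epsilon> \<longlonglongrightarrow> 0"
    "\<And>n. 0 < a - \<epsilon> n" "\<And>n. b + \<epsilon> n < T" by (rule mollifier_sequence[OF ab]) blast
  define k1 where "k1 = (\<lambda>i z. 1/2 * (u z $ i)\<^sup>2 * ?d z (B z))"
  define k2 where "k2 = (\<lambda>i z. (u z $ i) * ?d z (H i z))"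
  define k3 where "k3 = (\<lambda>i z. \<phi> z * (\<Gamma> i z \<bullet> H i z))"
  have gradi: "(\<forall>z. H i z \<bullet> e = 0) \<or> weak T (\<lambda>z. (u z $ i) *\<^sub>R e) (\<lambda>z. - (\<Gamma> i z \<bullet> e))"
    if "e \<in> Basis" for i e
  proof -
    consider "e = (1, 0)" | j where "e = (0, axis j 1)" using \<open>e \<in> Basis\<close> unfolding Basis_spacetime by auto
    then show ?thesis
    proof cases
      case 1 then show ?thesis by (simp add: H_def)
    next
      case 2
      then have "weak T (\<lambda>z. (u z $ i) *\<^sub>R e) (\<lambda>z. - (\<Gamma> i z \<bullet> e))"
        using grad[of i j] by (simp add: \<Gamma>_def inner_axis)
      then show ?thesis ..
    qed
  qed
  have momi: "weak T (\<lambda>z. (u z $ i) *\<^sub>R B z + H i z) (\<lambda>_. 0)" for i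
    using mom[of i] by (simp add: B_def H_def)
  have contB: "weak T B (\<lambda>_. 0)" using cont by (simp add: B_def)
  have ui3: "Lq_field T 3 (\<lambda>z. u z $ i)" for i by (rule ui[OF u]) simp
  note kl = kinetic_limit[OF K \<phi> ui3 fB fH f\<Gamma> momi contB gradi besov_incr_component[OF bu[OF ab] m(2)] bB ex(1) ex(3)]
  have kz: "integral\<^sup>L torus (k1 i) + integral\<^sup>L torus (k2 i) + integral\<^sup>L torus (k3 i) = 0" for i
    unfolding k1_def k2_def k3_def by (rule kl(1))
  have ki: "integrable torus (k1 i)" "integrable torus (k2 i)" "integrable torus (k3 i)" for i
    unfolding k1_def k2_def k3_def using kl(2-4)[of i] by blast+
  have cV: "weak T (\<lambda>z. \<rho> z *\<^sub>R V z) (\<lambda>_. 0)" using contB by (simp add: \<rho>V)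
  have rz: "(\<integral>z. pot z * ?d z (V z) \<partial>torus) + (\<integral>z. \<phi> z * (pr z * S z) \<partial>torus) = 0"
    unfolding pot_def pr_def
    by (rule renormalised_pressure[OF ab \<phi> \<rho> fV fS lo p bd cV weakV b\<rho>[OF ab] bV ex(2) ex(4)])
  have ri1: "integrable torus (\<lambda>z. pot z * ?d z (V z))"
    by (rule integrable_bounded_mult[of _ LP]) (use potb integrable_frechet_field[OF \<phi> fV1] in auto)
  have ri2: "integrable torus (\<lambda>z. \<phi> z * (pr z * S z))"
    using integrable_slab_test_Lq_field[OF \<phi> Lq_field_scaleR[OF fpr fS]] by simp
  have tz: "t \<in> {a..b} \<Longrightarrow> t \<in> {0<..<T}" for t using ab by auto
  have pointwise: "?d z (E z, F z) - \<phi> z * (\<sigma> z \<bullet> G z) = (\<Sum>i\<in>UNIV. k1 i z + k2 i z + k3 i z) + (pot z * ?d z (V z) + \<phi> z * (pr z * S z))" for z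
  proof (cases "fst z \<in> {a..b}")
    case False
    then show ?thesis
      by (simp add: k1_def k2_def k3_def frechet_field_zero_outside[OF \<phi>] slab_testD(3)[OF \<phi>])
  next
    case True
    then have Vz: "V z = (1, u z)" using tz[OF True] by (simp add: V_def)
    have s1: "(\<Sum>i\<in>UNIV. k1 i z) = 1/2 * (norm (u z))\<^sup>2 * ?d z (B z)"
    proof -
      have "(norm (u z))\<^sup>2 = (\<Sum>i\<in>UNIV. (u z $ i)\<^sup>2)"
        unfolding power2_norm_eq_inner inner_vec_def by (simp add: power2_eq_square)
      then show ?thesis by (simp add: k1_def sum_distrib_right sum_distrib_left sum_divide_distrib)
    qed
    have s2: "(\<Sum>i\<in>UNIV. k2 i z) = ?d z (0, pr z *\<^sub>R u z - \<sigma> z *v u z)"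
    proof -
      have "(\<Sum>i\<in>UNIV. (u z $ i) *\<^sub>R H i z) = (0, pr z *\<^sub>R u z - \<sigma> z *v u z)"
      proof -
        have "(\<Sum>i\<in>UNIV. (u z $ i) *\<^sub>R (pr z *\<^sub>R axis i 1 - \<sigma> z $ i))
          = pr z *\<^sub>R (\<Sum>i\<in>UNIV. (u z $ i) *\<^sub>R axis i 1) - (\<Sum>i\<in>UNIV. (u z $ i) *\<^sub>R (\<sigma> z $ i))"
          by (simp add: scaleR_diff_right sum_subtractf scaleR_sum_right mult.commute)
        then show ?thesis by (simp add: H_def prod_eq_iff fst_sum snd_sum sum_axis_cart \<sigma>u)
      qed
      then have "?d z (0, pr z *\<^sub>R u z - \<sigma> z *v u z) = ?d z (\<Sum>i\<in>UNIV. (u z $ i) *\<^sub>R H i z)" by simp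
      also have "\<dots> = (\<Sum>i\<in>UNIV. k2 i z)"
        by (simp only: linear_sum[OF lin] linear_scale[OF lin] real_scaleR_def k2_def)
      finally show ?thesis by simp
    qed
    have s3: "(\<Sum>i\<in>UNIV. k3 i z) = \<phi> z * (pr z * trace (G z) - \<sigma> z \<bullet> G z)"
    proof -
      have "\<Gamma> i z \<bullet> H i z = pr z * (G z $ i $ i) - \<sigma> z $ i \<bullet> G z $ i" for i
        by (simp add: \<Gamma>_def H_def inner_diff_right inner_axis inner_commute[of "\<sigma> z $ i"])
      then have "(\<Sum>i\<in>UNIV. k3 i z) = (\<Sum>i\<in>UNIV. \<phi> z * (pr z * (G z $ i $ i) - \<sigma> z $ i \<bullet> G z $ i))"
        by (simp add: k3_def)
      also have "\<dots> = \<phi> z * (pr z * (\<Sum>i\<in>UNIV. G z $ i $ i) - (\<Sum>i\<in>UNIV. \<sigma> z $ i \<bullet> G z $ i))"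
        by (simp add: right_diff_distrib sum_subtractf sum_distrib_left)
      finally show ?thesis unfolding trace_def inner_vec_def[of "\<sigma> z" "G z"] .
    qed
    have "?d z (E z, F z) = ?d z ((1/2 * (norm (u z))\<^sup>2) *\<^sub>R B z + (0, pr z *\<^sub>R u z - \<sigma> z *v u z) + pot z *\<^sub>R V z)"
      by (simp add: E_def F_def B_def Vz algebra_simps)
    also have "\<dots> = 1/2 * (norm (u z))\<^sup>2 * ?d z (B z) + ?d z (0, pr z *\<^sub>R u z - \<sigma> z *v u z) + pot z * ?d z (V z)"
      by (simp only: linear_add[OF lin] linear_scale[OF lin] real_scaleR_def)
    finally show ?thesis
      by (simp add: sum.distrib s1 s2 s3 S_def algebra_simps)
  qed
  have fEF: "Lq_field T 1 (\<lambda>z. (E z, F z))"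
    by (rule Lq_field_Pair[OF fE fF]) simp
  have "(\<integral>z. ?d z (E z, F z) - \<phi> z * (\<sigma> z \<bullet> G z) \<partial>torus)
      = (\<Sum>i\<in>UNIV. integral\<^sup>L torus (k1 i) + integral\<^sup>L torus (k2 i) + integral\<^sup>L torus (k3 i))
        + ((\<integral>z. pot z * ?d z (V z) \<partial>torus) + (\<integral>z. \<phi> z * (pr z * S z) \<partial>torus))"
    unfolding pointwise
    by (simp only: Bochner_Integration.integral_add Bochner_Integration.integral_sum Bochner_Integration.integrable_sum
        Bochner_Integration.integrable_add ki ri1 ri2)
  also have "\<dots> = 0" by (simp only: kz rz sum.neutral_const add_0_right)
  finally have "(\<integral>z. ?d z (E z, F z) - \<phi> z * (\<sigma> z \<bullet> G z) \<partial>torus) = 0" .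
  then show "(\<integral>z. ?d z (E z, F z) \<partial>torus) = (\<integral>z. \<phi> z * (\<sigma> z \<bullet> G z) \<partial>torus)"
    using integrable_frechet_field[OF \<phi> fEF] integrable_slab_test_Lq_field[OF \<phi> fD] by simp
qed

section \<open>Borel representatives\<close>

definition agree :: "real \<Rightarrow> (real \<times> (real^'d) \<Rightarrow> 'b) \<Rightarrow> (real \<times> (real^'d) \<Rightarrow> 'b) \<Rightarrow> bool" where
  "agree T f g \<longleftrightarrow> (AE z in lborel. fst z \<in> {0<..<T} \<longrightarrow> f z = g z)"

lemma AE_lborel_translate:
  assumes "AE z in (lborel :: 'a::euclidean_space measure). P z"
  shows "AE z in lborel. P (z - c)"
proof -
  obtain N where N: "N \<in> null_sets lborel" "{z. \<not> P z} \<subseteq> N"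
    using assms unfolding eventually_ae_filter by auto
  have "{z. \<not> P (z - c)} \<subseteq> {z. z - c \<in> N}" using N(2) by blast
  then show ?thesis
    using null_sets_translation[OF N(1), of c] unfolding eventually_ae_filter by auto
qed

text \<open>
  The exceptional set is a countable union of lattice translates of a null set.
\<close>

lemma AE_periodic:
  fixes P :: "real \<times> (real^'d) \<Rightarrow> bool"
  assumes AE: "AE z in lborel. fst z \<in> {0<..<T} \<longrightarrow> snd z \<in> hcell \<longrightarrow> P z"
    and per: "\<And>z k. k \<in> lattice \<Longrightarrow> fst z \<in> {0<..<T} \<Longrightarrow> P (z - (0, k)) \<Longrightarrow> P z"
  shows "AE z in lborel. fst z \<in> {0<..<T} \<longrightarrow> P z"
proof -
  have "AE z in (lborel :: (real \<times> (real^'d)) measure). \<forall>k\<in>lattice.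
      fst (z - (0, k)) \<in> {0<..<T} \<longrightarrow> snd (z - (0, k)) \<in> hcell \<longrightarrow> P (z - (0, k))"
    by (intro AE_ball_countable' lattice_countable AE_lborel_translate[OF AE])
  then show ?thesis
  proof eventually_elim
    case (elim z)
    show ?case
    proof
      assume z: "fst z \<in> {0<..<T}"
      have "snd z - vfloor (snd z) \<in> hcell" using hcell_vfloor[OF vfloor_lattice] by blast
      then have "P (z - (0, vfloor (snd z)))" using bspec[OF elim vfloor_lattice[of "snd z"]] z by simp
      then show "P z" by (rule per[OF vfloor_lattice z])
    qed
  qed
qed

text \<open>
  Wrapping the values in an option turns periodicity at times in \<open>(0,T)\<close> into
  periodicity at all times, without a default value in the range type.
\<close>

lemma space_periodic_lattice:
  assumes "space_periodic T w" "k \<in> lattice" "fst z \<in> {0<..<T}"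
  shows "w (z - (0, k)) = w z"
proof -
  define f where "f = (\<lambda>z. if fst z \<in> {0<..<T} then Some (w z) else None)"
  have "sper f"
    unfolding sper_def
  proof (intro allI)
    fix z i
    show "f (z + (0, axis i 1)) = f z"
      using assms(1) by (cases z) (simp add: f_def space_periodic_def periodic_def)
  qed
  from sper_lattice[OF this assms(2), of "z - (0, k)"] show ?thesis
    using assms(3) by (simp add: f_def)
qed

lemma lebesgue_borel_representative:
  fixes f :: "'a::euclidean_space \<Rightarrow> 'b::euclidean_space"
  assumes "f \<in> borel_measurable lebesgue"
  obtains g where "g \<in> borel_measurable borel" "AE z in lborel. f z = g z"
proof -
  have "\<exists>g. g \<in> borel_measurable borel \<and> (AE z in lborel. f z \<bullet> b = g z)" for b
    using completion_ex_borel_measurable_real[of "\<lambda>z. f z \<bullet> b" lborel] assms by auto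
  then obtain g where g: "\<And>b. g b \<in> borel_measurable borel" "\<And>b. AE z in lborel. f z \<bullet> b = g b z" by metis
  have "AE z in lborel. \<forall>b\<in>Basis. f z \<bullet> b = g b z" by (rule AE_finite_allI) (use g(2) in auto)
  then have "AE z in lborel. f z = (\<Sum>b\<in>Basis. g b z *\<^sub>R b)"
  proof eventually_elim
    case (elim z)
    then show ?case using euclidean_representation[of "f z"] by simp
  qed
  moreover have "(\<lambda>z. \<Sum>b\<in>Basis. g b z *\<^sub>R b) \<in> borel_measurable borel" using g(1) by measurable
  ultimately show thesis using that by blast
qed

lemma hcell_cell: "x \<in> hcell \<Longrightarrow> x \<in> cell"
  by (auto simp: hcell_def cell_def mem_box_cart less_imp_le)

text \<open>
  A Borel version on one cell is spread periodically by reducing the space variable modulo the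
  lattice.
\<close>

lemma representative:
  fixes w :: "real \<times> (real^'d) \<Rightarrow> 'b::euclidean_space"
  assumes per: "space_periodic T w" and m: "set_borel_measurable lebesgue (spacetime T) w"
  obtains F where "F \<in> borel_measurable borel" "sper F" "\<And>z. fst z \<notin> {0<..<T} \<Longrightarrow> F z = 0" "agree T w F"
proof -
  obtain h where h[measurable]: "h \<in> borel_measurable borel" and wh: "AE z in lborel. indicator (spacetime T) z *\<^sub>R w z = h z"
    by (rule lebesgue_borel_representative[OF m[unfolded set_borel_measurable_def]]) blast
  define F where "F = (\<lambda>z. if fst z \<in> {0<..<T} then h (fst z, snd z - vfloor (snd z)) else 0)"
  have [measurable]: "(vfloor :: real^'d \<Rightarrow> _) \<in> borel_measurable borel"
  proof -
    have "(\<lambda>x :: real^'d. \<Sum>i\<in>UNIV. (of_int \<lfloor>x $ i\<rfloor> :: real) *\<^sub>R axis i (1::real)) \<in> borel_measurable borel" by measurable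
    moreover have "vfloor x = (\<Sum>i\<in>UNIV. (of_int \<lfloor>x $ i\<rfloor> :: real) *\<^sub>R axis i (1::real))" for x :: "real^'d"
      using sum_axis_cart[of "vfloor x"] by (simp add: vfloor_def)
    ultimately show ?thesis by presburger
  qed
  have "(\<lambda>z :: real \<times> (real^'d). (fst z, snd z - vfloor (snd z))) \<in> borel_measurable borel"
    by (intro borel_measurable_Pair; measurable)
  from measurable_compose[OF this h] have Fm: "F \<in> borel_measurable borel" unfolding F_def by measurable
  have Fper: "sper F"
    unfolding sper_def
  proof (intro allI)
    fix z :: "real \<times> (real^'d)" and i
    have "vfloor (snd z + axis i 1) = vfloor (snd z) + axis i 1"
      by (simp add: vfloor_def vec_eq_iff axis_def)
    then show "F (z + (0, axis i 1)) = F z" by (simp add: F_def)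
  qed
  have "agree T w F"
    unfolding agree_def
  proof (rule AE_periodic)
    show "AE z in lborel. fst z \<in> {0<..<T} \<longrightarrow> snd z \<in> hcell \<longrightarrow> w z = F z"
      using wh
    proof eventually_elim
      case (elim z)
      show ?case
      proof (intro impI)
        assume z: "fst z \<in> {0<..<T}" "snd z \<in> hcell"
        have "vfloor (snd z) = 0" using hcell_vfloor[of 0 "snd z"] z by (auto simp: lattice_def image_iff intro!: exI[of _ "\<lambda>_. 0"] simp: vec_eq_iff)
        moreover have "z \<in> spacetime T" using z hcell_cell by (cases z) (auto simp: spacetime_def)
        ultimately show "w z = F z" using elim z by (simp add: F_def)
      qed
    qed
    fix z and k :: "real^'d" assume k: "k \<in> lattice" and z: "fst z \<in> {0<..<T}" and e: "w (z - (0, k)) = F (z - (0, k))"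
    show "w z = F z" using e space_periodic_lattice[OF per k z] sper_lattice[OF Fper k, of "z - (0, k)"] by simp
  qed
  moreover have "F z = 0" if "fst z \<notin> {0<..<T}" for z unfolding F_def by (rule if_not_P[OF that])
  ultimately show thesis using that[OF Fm Fper] by blast
qed

lemma spacetime_measurable[measurable]: "spacetime T \<in> sets (borel :: (real \<times> (real^'d)) measure)"
  unfolding spacetime_def borel_prod[symmetric] by measurable

lemma transfer_integral:
  fixes f F :: "real \<times> (real^'d) \<Rightarrow> 'b::euclidean_space"
  assumes F[measurable]: "F \<in> borel_measurable borel" and z: "\<And>z. fst z \<notin> {0<..<T} \<Longrightarrow> F z = 0" and a: "agree T f F"
  shows "(LINT z:spacetime T|lebesgue. f z) = integral\<^sup>L torus F"
    and "set_integrable lebesgue (spacetime T) f \<longleftrightarrow> integrable torus F"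
proof -
  let ?G = "\<lambda>z. indicator (UNIV \<times> cell) z *\<^sub>R F z"
  have Gm: "?G \<in> borel_measurable lborel" by measurable
  have ae: "AE z in lebesgue. ?G z = indicator (spacetime T) z *\<^sub>R f z"
  proof (rule AE_completion)
    show "AE z in lborel. ?G z = indicator (spacetime T) z *\<^sub>R f z"
      using a unfolding agree_def
    proof eventually_elim
      case (elim z)
      then show ?case using z[of z]
        by (cases z) (auto simp: indicator_def spacetime_def)
    qed
  qed
  have Gl: "?G \<in> borel_measurable lebesgue" using measurable_completion[OF Gm] by simp
  have fl: "(\<lambda>z. indicator (spacetime T) z *\<^sub>R f z) \<in> borel_measurable lebesgue"
    by (rule borel_measurable_AE[OF Gl ae])
  show "(LINT z:spacetime T|lebesgue. f z) = integral\<^sup>L torus F"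
    unfolding set_lebesgue_integral_def torus_integral_eq(1)[OF F]
    using integral_cong_AE[OF Gl fl ae] integral_completion[OF Gm] by simp
  show "set_integrable lebesgue (spacetime T) f \<longleftrightarrow> integrable torus F"
    unfolding set_integrable_def torus_integral_eq(2)[OF F]
    using integrable_cong_AE[OF Gl fl ae] integrable_completion[OF Gm] by simp
qed

lemma L1_loc_transfer:
  fixes f F :: "real \<times> (real^'d) \<Rightarrow> 'b::euclidean_space"
  assumes F: "Lq_field T 1 F" and a: "agree T f F"
  shows "L1_loc T f"
  unfolding L1_loc_def
proof (intro allI impI)
  fix a b :: real assume ab: "0 < a" "b < T"
  have "set_integrable lebesgue (spacetime T) f"
    using transfer_integral(2)[OF Lq_fieldD(1)[OF F] Lq_fieldD(3)[OF F] a] Lq_field_L1(1)[OF F] by simp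
  then show "set_integrable lebesgue ({a..b} \<times> cell) f"
  proof (rule set_integrable_subset)
    show "{a..b} \<times> cell \<in> sets (lebesgue :: (real \<times> (real^'d)) measure)" using slab_set_measurable(1)[of a b] by simp
    show "{a..b} \<times> cell \<subseteq> (spacetime T :: (real \<times> (real^'d)) set)" using ab by (auto simp: spacetime_def)
  qed
qed

lemma Lq_field_of_Lq:
  fixes w F :: "real \<times> (real^'d) \<Rightarrow> 'b::euclidean_space"
  assumes L: "Lq_on (real n) (spacetime T) w" and n: "0 < n"
    and F[measurable]: "F \<in> borel_measurable borel" and per: "sper F" and z: "\<And>z. fst z \<notin> {0<..<T} \<Longrightarrow> F z = 0"
    and a: "agree T w F"
  shows "Lq_field T n F"
proof -
  have eq: "norm (F z) powr real n = norm (F z) ^ n" for z using n by (intro powr_realpow') auto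
  have "agree T (\<lambda>z. norm (w z) powr real n) (\<lambda>z. norm (F z) powr real n)"
    using a unfolding agree_def by eventually_elim simp
  then have "integrable torus (\<lambda>z. norm (F z) powr real n)"
    using L z by (subst transfer_integral(2)[symmetric]) (auto simp: Lq_on_def)
  then show ?thesis using per z unfolding Lq_field_def eq by simp
qed

text \<open>
  For shifts \<open>y\<close> shorter than \<open>min a (T - b)\<close> the slab lies inside the
  shift domain of \<open>- y\<close>, on which the Besov seminorm controls the increments. The
  seminorm is the cube root of a Bochner integral, which has the default value \<open>0\<close>
  for functions that are not integrable; hence integrability of the cubed increments is
  established first.
\<close>

lemma besov_incr_of_Besov:
  fixes w F :: "real \<times> (real^'d) \<Rightarrow> 'b::euclidean_space"
  assumes B: "Besov 3 s T w" and F: "Lq_field T 3 F" and agr: "agree T w F" and s: "0 \<le> s" and ab: "0 < a" "b < T"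
  shows "besov_incr a b s F"
proof -
  note [measurable] = Lq_fieldD(1)[OF F]
  obtain M where M: "\<And>\<xi>. \<xi> \<noteq> 0 \<Longrightarrow> Lq_norm 3 (shift_domain T \<xi>) (\<lambda>z. w (z + \<xi>) - w z) / norm \<xi> powr s \<le> M"
    using B unfolding Besov_def bdd_above_def by auto
  define C where "C = max M 0"
  show ?thesis
    unfolding besov_incr_def
  proof (rule exI[of _ "C ^ 3"], intro conjI exI[of _ "min a (T - b)"] allI impI)
    show "0 \<le> C ^ 3" "0 < min a (T - b)" using ab by (auto simp: C_def)
    fix e :: real and y :: "real \<times> (real^'d)"
    assume e: "0 < e" "e < min a (T - b)" "norm y < e"
    let ?f = "\<lambda>z. norm (F (z - y) - F z) ^ 3"
    show "(\<integral>\<^sup>+z. ennreal (?f z) \<partial>slab a b) \<le> ennreal (C ^ 3 * e powr (3 * s))"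
    proof (cases "y = 0")
      case True then show ?thesis by simp
    next
      case False
      let ?S = "shift_domain T (- y)"
      let ?g = "\<lambda>z. indicator ?S z *\<^sub>R ?f z"
      have Sm[measurable]: "?S \<in> sets borel"
      proof -
        have "?S = spacetime T \<inter> {z. fst z + fst (- y) \<in> {0<..<T}}" by (auto simp: shift_domain_def)
        moreover have "{z :: real \<times> (real^'d). fst z + fst (- y) \<in> {0<..<T}} \<in> sets borel" by measurable
        ultimately show ?thesis by simp
      qed
      have y: "\<bar>fst y\<bar> < e" using e norm_fst_le[of "fst y" "snd y"] by simp
      have it: "integrable torus ?f"
      proof (rule Bochner_Integration.integrable_bound)
        have "sper (\<lambda>z. norm (F z) ^ 3)" using Lq_fieldD(2)[OF F] by (simp add: sper_def)
        from integrable_torus_translate[OF Lq_fieldD(4)[OF F] this, of "- y"]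
        show "integrable torus (\<lambda>z. 3 ^ 3 * (norm (F (z - y)) ^ 3 + norm (F z) ^ 3))"
          by (intro integrable_mult_right Bochner_Integration.integrable_add Lq_fieldD(4)[OF F]) simp
        show "AE z in torus. norm (?f z) \<le> norm (3 ^ 3 * (norm (F (z - y)) ^ 3 + norm (F z) ^ 3))"
        proof (intro AE_I2)
          fix z
          have "?f z \<le> (norm (F (z - y)) + norm (F z)) ^ 3" by (intro power_mono norm_triangle_ineq4) simp
          also have "\<dots> \<le> 3 ^ 3 * (norm (F (z - y)) ^ 3 + norm (F z) ^ 3)"
            using power_sum3[of "norm (F (z - y))" "norm (F z)" 0 3] by simp
          finally show "norm (?f z) \<le> norm (3 ^ 3 * (norm (F (z - y)) ^ 3 + norm (F z) ^ 3))" by simp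
        qed
      qed measurable
      have gm: "?g \<in> borel_measurable lborel" by measurable
      have ig: "integrable lborel ?g"
      proof (rule Bochner_Integration.integrable_bound)
        show "integrable lborel (\<lambda>z. indicator (UNIV \<times> cell) z *\<^sub>R ?f z)"
          using it by (subst torus_integral_eq(2)[symmetric]) auto
        show "AE z in lborel. norm (?g z) \<le> norm (indicator (UNIV \<times> cell) z *\<^sub>R ?f z)"
          by (intro AE_I2) (auto simp: indicator_def shift_domain_def spacetime_def)
      qed (rule gm)
      define I where "I = (LINT z:?S|lebesgue. norm (w (z + - y) - w z) powr 3)"
      have I: "I = integral\<^sup>L lborel ?g"
      proof -
        have ae: "AE z in lebesgue. ?g z = indicator ?S z *\<^sub>R norm (w (z + - y) - w z) powr 3"
        proof (rule AE_completion)
          show "AE z in lborel. ?g z = indicator ?S z *\<^sub>R norm (w (z + - y) - w z) powr 3"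
            using agr[unfolded agree_def] AE_lborel_translate[OF agr[unfolded agree_def], of y]
          proof eventually_elim
            case (elim z)
            show ?case
            proof (cases "z \<in> ?S")
              case True
              then have "w z = F z" "w (z - y) = F (z - y)" using elim by (auto simp: shift_domain_def spacetime_def)
              then show ?thesis by simp
            qed simp
          qed
        qed
        have gl: "?g \<in> borel_measurable lebesgue" using measurable_completion[OF gm] by simp
        show ?thesis
          unfolding I_def set_lebesgue_integral_def
          using integral_cong_AE[OF gl borel_measurable_AE[OF gl ae] ae] integral_completion[OF gm] by simp
      qed
      have I0: "0 \<le> I" unfolding I by (intro integral_nonneg_AE AE_I2) simp
      have "I powr (1/3) \<le> C * e powr s"
      proof -
        have "I powr (1/3) / norm y powr s \<le> M" using M[of "- y"] False by (simp add: Lq_norm_def I_def)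
        then have "I powr (1/3) \<le> M * norm y powr s" using False by (simp add: divide_simps split: if_splits)
        also have "\<dots> \<le> C * e powr s"
          using e s False by (intro mult_mono powr_mono2) (auto simp: C_def)
        finally show ?thesis .
      qed
      then have "(I powr (1/3)) ^ 3 \<le> (C * e powr s) ^ 3" by (intro power_mono) auto
      moreover have "(I powr (1/3)) ^ 3 = I" using powr_numeral[of "I powr (1/3)" "num.Bit1 num.One"] I0 by (simp add: powr_powr)
      moreover have "(C * e powr s) ^ 3 = C ^ 3 * e powr (3 * s)" using powr_numeral[of "e powr s" "num.Bit1 num.One"] by (simp add: power_mult_distrib powr_powr mult.commute)
      ultimately have le: "I \<le> C ^ 3 * e powr (3 * s)" by simp
      have "(\<integral>\<^sup>+z. ennreal (?f z) \<partial>slab a b) = (\<integral>\<^sup>+z. indicator ({a..b} \<times> cell) z * ennreal (?f z) \<partial>lborel)"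
        by (rule nn_integral_slab) measurable
      also have "\<dots> \<le> (\<integral>\<^sup>+z. ennreal (?g z) \<partial>lborel)"
      proof (rule nn_integral_mono)
        fix z :: "real \<times> (real^'d)"
        have "z \<in> {a..b} \<times> cell \<Longrightarrow> z \<in> ?S" using y e ab by (auto simp: shift_domain_def spacetime_def)
        then show "indicator ({a..b} \<times> cell) z * ennreal (?f z) \<le> ennreal (?g z)"
          by (auto simp: indicator_def)
      qed
      also have "\<dots> = ennreal I" unfolding I by (rule nn_integral_eq_integral[OF ig]) simp
      also have "\<dots> \<le> ennreal (C ^ 3 * e powr (3 * s))" by (rule ennreal_leI[OF le])
      finally show ?thesis .
    qed
  qed
qed

lemma distr_fun_transfer:
  fixes f F \<psi> :: "real \<times> (real^'d) \<Rightarrow> real"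
  assumes F: "Lq_field T 1 F" and a: "agree T f F" and \<psi>: "\<psi> \<in> borel_measurable borel"
  shows "distr_fun T f \<psi> = (\<integral>z. F z * \<psi> z \<partial>torus)"
  unfolding distr_fun_def
proof (rule transfer_integral(1))
  show "(\<lambda>z. F z * \<psi> z) \<in> borel_measurable borel" using Lq_fieldD(1)[OF F] \<psi> by measurable
  show "agree T (\<lambda>z. f z * \<psi> z) (\<lambda>z. F z * \<psi> z)" using a unfolding agree_def by eventually_elim simp
qed (simp add: Lq_fieldD(3)[OF F])

lemma distr_direction:
  fixes f F :: "real \<times> (real^'d) \<Rightarrow> real"
  assumes F: "Lq_field T 1 F" and a: "agree T f F" and \<phi>: "slab_test a b \<phi>"
  shows "distr_fun T f (\<lambda>z. frechet_derivative \<phi> (at z) v) = (\<integral>z. frechet_derivative \<phi> (at z) (F z *\<^sub>R v) \<partial>torus)"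
    and "integrable torus (\<lambda>z. frechet_derivative \<phi> (at z) (F z *\<^sub>R v))"
proof -
  have l: "frechet_derivative \<phi> (at z) (F z *\<^sub>R v) = F z * frechet_derivative \<phi> (at z) v" for z
    using linear_scale[OF smooth_linear_deriv[OF slab_testD(1)[OF \<phi>]]] by simp
  have s: "(\<lambda>z. frechet_derivative \<phi> (at z) v) \<in> borel_measurable borel"
    by (rule smooth_measurable[OF slab_testD(1)[OF slab_test_deriv[OF \<phi>]]])
  show "distr_fun T f (\<lambda>z. frechet_derivative \<phi> (at z) v) = (\<integral>z. frechet_derivative \<phi> (at z) (F z *\<^sub>R v) \<partial>torus)"
    unfolding l by (rule distr_fun_transfer[OF F a s])
  show "integrable torus (\<lambda>z. frechet_derivative \<phi> (at z) (F z *\<^sub>R v))"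
    unfolding l using integrable_slab_test_Lq_field[OF slab_test_deriv[OF \<phi>] F, of v] by (simp add: mult.commute)
qed

lemma agree_nth:
  assumes "agree T f F" shows "agree T (\<lambda>z. f z $ j) (\<lambda>z. F z $ j)"
  using assms unfolding agree_def by eventually_elim simp

lemma Lq_field_nth:
  fixes F :: "real \<times> (real^'d) \<Rightarrow> ('b::euclidean_space)^'n"
  assumes "Lq_field T q F" "0 < q" shows "Lq_field T q (\<lambda>z. F z $ j)"
  by (rule Lq_field_le[OF assms])
    (use Lq_fieldD(1,2)[OF assms(1)] Finite_Cartesian_Product.norm_nth_le in \<open>auto simp: sper_def\<close>)

lemma distr_dt_transfer:
  fixes f F :: "real \<times> (real^'d) \<Rightarrow> real"
  assumes "Lq_field T 1 F" "agree T f F" "slab_test a b \<phi>"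
  shows "distr_dt T f \<phi> = - (\<integral>z. frechet_derivative \<phi> (at z) (F z, 0) \<partial>torus)"
    "integrable torus (\<lambda>z. frechet_derivative \<phi> (at z) (F z, 0))"
  using distr_direction[OF assms, of "(1, 0)"] by (simp_all add: distr_dt_def)

lemma distr_dx_transfer:
  fixes f F :: "real \<times> (real^'d) \<Rightarrow> real"
  assumes "Lq_field T 1 F" "agree T f F" "slab_test a b \<phi>"
  shows "distr_dx T i f \<phi> = - (\<integral>z. frechet_derivative \<phi> (at z) (0, F z *\<^sub>R axis i 1) \<partial>torus)"
    "integrable torus (\<lambda>z. frechet_derivative \<phi> (at z) (0, F z *\<^sub>R axis i 1))"
  using distr_direction[OF assms, of "(0, axis i 1)"] by (simp_all add: distr_dx_def)

lemma distr_div_transfer: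
  fixes f F :: "real \<times> (real^'d) \<Rightarrow> real^'d"
  assumes F: "Lq_field T 1 F" and a: "agree T f F" and \<phi>: "slab_test a b \<phi>"
  shows "distr_div T f \<phi> = - (\<integral>z. frechet_derivative \<phi> (at z) (0, F z) \<partial>torus)"
    "integrable torus (\<lambda>z. frechet_derivative \<phi> (at z) (0, F z))"
proof -
  note t = distr_dx_transfer[OF Lq_field_nth[OF F zero_less_one] agree_nth[OF a] \<phi>]
  have eq: "frechet_derivative \<phi> (at z) (0, F z) = (\<Sum>j\<in>UNIV. frechet_derivative \<phi> (at z) (0, (F z $ j) *\<^sub>R axis j 1))" for z
  proof -
    have "(0, F z) = (\<Sum>j\<in>UNIV. (0 :: real, (F z $ j) *\<^sub>R axis j (1::real)))"
      by (simp add: prod_eq_iff fst_sum snd_sum sum_axis_cart)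
    then show ?thesis by (simp only: linear_sum[OF smooth_linear_deriv[OF slab_testD(1)[OF \<phi>]]])
  qed
  show "integrable torus (\<lambda>z. frechet_derivative \<phi> (at z) (0, F z))"
    unfolding eq by (intro Bochner_Integration.integrable_sum t(2))
  show "distr_div T f \<phi> = - (\<integral>z. frechet_derivative \<phi> (at z) (0, F z) \<partial>torus)"
    unfolding eq distr_div_def by (simp only: t(1) Bochner_Integration.integral_sum t(2) sum_negf)
qed

section \<open>The local energy equality\<close>

lemma slice_integral_transfer:
  fixes f F :: "real^'d \<Rightarrow> real"
  assumes F[measurable]: "F \<in> borel_measurable borel" and a: "AE x in lborel. f x = F x"
  shows "(LINT x:cell|lebesgue. f x) = (\<integral>x. indicator cell x *\<^sub>R F x \<partial>lborel)"
proof -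
  let ?G = "\<lambda>x. indicator cell x *\<^sub>R F x"
  have Gm: "?G \<in> borel_measurable lborel" by measurable
  have ae: "AE x in lebesgue. ?G x = indicator cell x *\<^sub>R f x"
    by (rule AE_completion) (use a in eventually_elim, simp)
  have Gl: "?G \<in> borel_measurable lebesgue" using measurable_completion[OF Gm] by simp
  show ?thesis
    unfolding set_lebesgue_integral_def
    using integral_cong_AE[OF Gl borel_measurable_AE[OF Gl ae] ae] integral_completion[OF Gm] by simp
qed

text \<open>
  A test function on space-time restricts to a periodic test function at each time. The identity
  of weak derivatives holds on almost every time slice and is integrated in time.
\<close>

lemma gradient_weak:
  fixes u v :: "real \<times> (real^'d) \<Rightarrow> real^'d" and Du G :: "real \<times> (real^'d) \<Rightarrow> real^'d^'d"
  assumes H: "AE t in lebesgue. t \<in> {0<..<T} \<longrightarrow> H1_gradient (\<lambda>x. u (t, x)) (\<lambda>x. Du (t, x))"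
    and v: "Lq_field T 1 v" and G: "Lq_field T 1 G" and uv: "agree T u v" and DG: "agree T Du G"
  shows "weak T (\<lambda>z. (v z $ i) *\<^sub>R (0, axis j 1)) (\<lambda>z. - (G z $ i $ j))"
  unfolding weak_def
proof (intro allI impI)
  fix \<phi> :: "real \<times> (real^'d) \<Rightarrow> real" assume test: "test_fun T \<phi>"
  then obtain a b where ab: "0 < a" "b < T" and \<phi>: "slab_test a b \<phi>" by (rule test_fun_slab_test)
  let ?d = "\<lambda>z. frechet_derivative \<phi> (at z)"
  define f1 where "f1 = (\<lambda>z. v z $ i * ?d z (0, axis j 1))"
  define f2 where "f2 = (\<lambda>z. G z $ i $ j * \<phi> z)"
  have vi: "Lq_field T 1 (\<lambda>z. v z $ i)" and Gij: "Lq_field T 1 (\<lambda>z. G z $ i $ j)"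
    by (intro Lq_field_nth v G; simp)+
  have i1: "integrable torus f1" unfolding f1_def
    using integrable_slab_test_Lq_field[OF slab_test_deriv[OF \<phi>] vi, of "(0, axis j 1)"] by (simp add: mult.commute)
  have i2: "integrable torus f2" unfolding f2_def
    using integrable_slab_test_Lq_field[OF \<phi> Gij] by (simp add: mult.commute)
  have m1[measurable]: "f1 \<in> borel_measurable borel" and m2[measurable]: "f2 \<in> borel_measurable borel"
    using borel_measurable_integrable[OF i1] borel_measurable_integrable[OF i2] by (simp_all cong: measurable_cong_sets)
  let ?I = "\<lambda>f z. indicator (UNIV \<times> cell) z *\<^sub>R (f z :: real)"
  have j1: "integrable (lborel \<Otimes>\<^sub>M lborel) (?I f1)" and j2: "integrable (lborel \<Otimes>\<^sub>M lborel) (?I f2)"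
    using i1 i2 unfolding lborel_prod torus_integral_eq(2)[OF m1] torus_integral_eq(2)[OF m2] by simp_all
  have sl: "AE t in lborel. t \<in> {0<..<T} \<longrightarrow> H1_gradient (\<lambda>x. u (t, x)) (\<lambda>x. Du (t, x))"
    using H by (simp only: AE_completion_iff)
  have au: "AE t in lborel. AE x in lborel. t \<in> {0<..<T} \<longrightarrow> u (t, x) = v (t, x)"
  proof -
    have "AE z in lborel \<Otimes>\<^sub>M lborel. fst z \<in> {0<..<T} \<longrightarrow> u z = v z"
      using uv unfolding agree_def lborel_prod .
    from lborel_pair.AE_pair[OF this] show ?thesis by simp
  qed
  have aG: "AE t in lborel. AE x in lborel. t \<in> {0<..<T} \<longrightarrow> Du (t, x) = G (t, x)"
  proof -
    have "AE z in lborel \<Otimes>\<^sub>M lborel. fst z \<in> {0<..<T} \<longrightarrow> Du z = G z"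
      using DG unfolding agree_def lborel_prod .
    from lborel_pair.AE_pair[OF this] show ?thesis by simp
  qed
  have slice: "(\<integral>x. ?I f1 (t, x) + ?I f2 (t, x) \<partial>lborel) = 0"
    if t: "t \<in> {0<..<T} \<longrightarrow> H1_gradient (\<lambda>x. u (t, x)) (\<lambda>x. Du (t, x))"
      and u: "AE x in lborel. t \<in> {0<..<T} \<longrightarrow> u (t, x) = v (t, x)"
      and D: "AE x in lborel. t \<in> {0<..<T} \<longrightarrow> Du (t, x) = G (t, x)"
      and k1: "integrable lborel (\<lambda>x. ?I f1 (t, x))" and k2: "integrable lborel (\<lambda>x. ?I f2 (t, x))" for t
  proof (cases "t \<in> {0<..<T}")
    case False
    then have "f1 (t, x) = 0" "f2 (t, x) = 0" for x
      using Lq_fieldD(3)[OF v, of "(t, x)"] Lq_fieldD(3)[OF G, of "(t, x)"] by (simp_all only: f1_def f2_def fst_conv) simp_all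
    then show ?thesis by simp
  next
    case True
    let ?\<eta> = "\<lambda>x. \<phi> (t, x)"
    have bl: "bounded_linear (\<lambda>x :: real^'d. (0 :: real, x))" by (intro bounded_linear_Pair bounded_linear_zero bounded_linear_ident)
    have sm: "smooth ?\<eta>" using smooth_affine[OF bl slab_testD(1)[OF \<phi>], of "(t, 0)"] by simp
    have per: "periodic ?\<eta>" using test by (simp add: test_fun_def)
    have d\<eta>: "frechet_derivative ?\<eta> (at x) w = ?d (t, x) (0, w)" for x w
    proof -
      have "(\<phi> has_derivative ?d (t, x)) (at (t, x))" by (rule smooth_has_derivative[OF slab_testD(1)[OF \<phi>]])
      then have "(?\<eta> has_derivative (\<lambda>w. ?d (t, x) (0, w))) (at x)"
        by (rule has_derivative_compose[rotated]) (auto intro!: derivative_eq_intros)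
      then show ?thesis by (simp add: frechet_derivative_at[symmetric])
    qed
    have sm1: "(\<lambda>x. f1 (t, x)) \<in> borel_measurable borel" "(\<lambda>x. f2 (t, x)) \<in> borel_measurable borel"
      by (intro measurable_compose[OF _ m1] measurable_compose[OF _ m2] borel_measurable_continuous_onI continuous_intros)+
    have "(LINT x:cell|lebesgue. u (t, x) $ i * frechet_derivative ?\<eta> (at x) (axis j 1)) = - (LINT x:cell|lebesgue. Du (t, x) $ i $ j * ?\<eta> x)"
      using t True sm per unfolding H1_gradient_def by blast
    moreover have "(LINT x:cell|lebesgue. u (t, x) $ i * frechet_derivative ?\<eta> (at x) (axis j 1)) = (\<integral>x. indicator cell x *\<^sub>R f1 (t, x) \<partial>lborel)"
      by (rule slice_integral_transfer[OF sm1(1)]) (use u in eventually_elim, use True in \<open>simp add: f1_def d\<eta>\<close>)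
    moreover have "(LINT x:cell|lebesgue. Du (t, x) $ i $ j * ?\<eta> x) = (\<integral>x. indicator cell x *\<^sub>R f2 (t, x) \<partial>lborel)"
      by (rule slice_integral_transfer[OF sm1(2)]) (use D in eventually_elim, use True in \<open>simp add: f2_def\<close>)
    ultimately have "(\<integral>x. indicator cell x *\<^sub>R f1 (t, x) \<partial>lborel) + (\<integral>x. indicator cell x *\<^sub>R f2 (t, x) \<partial>lborel) = 0" by simp
    moreover have ind: "(indicator (UNIV \<times> cell) (t, x) :: real) = indicator cell x" for x by (simp add: indicator_def)
    ultimately show ?thesis using k1 k2 unfolding ind by simp
  qed
  have "(\<integral>z. f1 z + f2 z \<partial>torus) = (\<integral>z. ?I f1 z + ?I f2 z \<partial>(lborel \<Otimes>\<^sub>M lborel))"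
    unfolding lborel_prod by (subst torus_integral_eq(1)) (simp_all add: distrib_left)
  also have "\<dots> = (\<integral>t. (\<integral>x. ?I f1 (t, x) + ?I f2 (t, x) \<partial>lborel) \<partial>lborel)"
    by (rule lborel_pair.integral_fst'[symmetric]) (intro Bochner_Integration.integrable_add j1 j2)
  also have "\<dots> = 0"
  proof (rule integral_eq_zero_AE)
    show "AE t in lborel. (\<integral>x. ?I f1 (t, x) + ?I f2 (t, x) \<partial>lborel) = 0"
      using sl au aG lborel_pair.AE_integrable_fst'[OF j1] lborel_pair.AE_integrable_fst'[OF j2]
      by eventually_elim (rule slice)
  qed
  finally have "integral\<^sup>L torus f1 + integral\<^sup>L torus f2 = 0" using i1 i2 by simp
  moreover have "?d z ((v z $ i) *\<^sub>R (0, axis j 1)) = f1 z" for z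
    using linear_scale[OF smooth_linear_deriv[OF slab_testD(1)[OF \<phi>]], of z "v z $ i" "(0, axis j 1)"] by (simp add: f1_def)
  moreover have "(\<integral>z. - (G z $ i $ j) * \<phi> z \<partial>torus) = - integral\<^sup>L torus f2" by (simp add: f2_def)
  ultimately show "(\<integral>z. ?d z ((v z $ i) *\<^sub>R (0, axis j 1)) \<partial>torus) = (\<integral>z. - (G z $ i $ j) * \<phi> z \<partial>torus)" by simp
qed

text \<open>
  Only the symmetry and square integrability of the stress enter, so that constant and
  degenerate viscosity are covered together. Every distribution is expressed through the
  integral of \<open>D\<phi>\<close> applied to a Borel field, where
  \<open>energy_identity\<close> applies.
\<close>

lemma local_energy_of_flow:
  fixes \<rho> r :: "real \<times> (real^'d) \<Rightarrow> real" and u v :: "real \<times> (real^'d) \<Rightarrow> real^'d"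
    and Du G \<sigma> s :: "real \<times> (real^'d) \<Rightarrow> real^'d^'d"
  assumes agr: "agree T \<rho> r" "agree T u v" "agree T Du G" "agree T \<sigma> s"
    and r: "Lq_field T 3 r" and v: "Lq_field T 3 v" and rv: "Lq_field T 3 (\<lambda>z. r z *\<^sub>R v z)" and G: "Lq_field T 2 G" and s: "Lq_field T 2 s"
    and sym: "\<And>z. transpose (s z) = s z"
    and lo: "0 \<le> lo" "lo \<le> hi" "0 < hi" and p: "pressure_law lo hi p"
    and bd: "\<And>z. fst z \<in> {0<..<T} \<Longrightarrow> lo \<le> r z \<and> r z \<le> hi"
    and grad: "\<And>i j. weak T (\<lambda>z. (v z $ i) *\<^sub>R (0, axis j 1)) (\<lambda>z. - (G z $ i $ j))"
    and bm: "\<And>a b. 0 < a \<Longrightarrow> b < T \<Longrightarrow> besov_incr a b \<alpha> v"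
      "\<And>a b. 0 < a \<Longrightarrow> b < T \<Longrightarrow> besov_incr a b \<beta> r"
      "\<And>a b. 0 < a \<Longrightarrow> b < T \<Longrightarrow> besov_incr a b \<beta> (\<lambda>z. r z *\<^sub>R v z)"
    and ex: "1 < 2 * \<alpha> + \<beta>" "1 < 2 * \<beta> + \<alpha>" "\<alpha> \<le> 1" "\<beta> \<le> 1"
    and flow: "compressible_flow T p \<sigma> \<rho> u"
  shows "local_energy_equality T p \<sigma> \<rho> u Du"
proof -
  define pr where "pr = (\<lambda>z. if fst z \<in> {0<..<T} then p (r z) else 0)"
  define pot where "pot = (\<lambda>z. if fst z \<in> {0<..<T} then pressure_potential p (r z) else 0)"
  define E where "E = (\<lambda>z. 1/2 * r z * (norm (v z))\<^sup>2 + pot z)"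
  define F where "F = (\<lambda>z. (1/2 * r z * (norm (v z))\<^sup>2 + pr z + pot z) *\<^sub>R v z - s z *v v z)"
  note ei = energy_identity[OF r v rv G s sym lo p _ pr_def pot_def E_def F_def, OF bd]
  have fE: "Lq_field T 1 E" and fF: "Lq_field T 1 F" and fD: "Lq_field T 1 (\<lambda>z. s z \<bullet> G z)" and fpr2: "Lq_field T 2 pr"
    by (rule ei; assumption)+
  have fpr: "Lq_field T 1 pr" and fs: "Lq_field T 1 s" and r1: "Lq_field T 1 r" and v2: "Lq_field T 2 v"
    and rv1: "Lq_field T 1 (\<lambda>z. r z *\<^sub>R v z)" and rv2: "Lq_field T 2 (\<lambda>z. r z *\<^sub>R v z)"
    using Lq_field_mono[OF fpr2, of 1] Lq_field_mono[OF s, of 1] Lq_field_mono[OF r, of 1] Lq_field_mono[OF v, of 2] Lq_field_mono[OF rv, of 1] Lq_field_mono[OF rv, of 2]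
    by simp_all
  have rvi: "Lq_field T 1 (\<lambda>z. r z * v z $ i)" "Lq_field T 2 (\<lambda>z. r z * v z $ i)" for i
    using Lq_field_nth[OF rv1, of i] Lq_field_nth[OF rv2, of i] by simp_all
  have apr: "agree T (\<lambda>z. p (\<rho> z)) pr"
    using agr(1) unfolding agree_def by eventually_elim (simp add: pr_def)
  have aE: "agree T (\<lambda>z. 1/2 * \<rho> z * (norm (u z))\<^sup>2 + pressure_potential p (\<rho> z)) E"
    using agr(1,2) unfolding agree_def by eventually_elim (simp add: E_def pot_def)
  have aD: "agree T (\<lambda>z. \<sigma> z \<bullet> Du z) (\<lambda>z. s z \<bullet> G z)"
    using agr(3,4) unfolding agree_def by eventually_elim simp
  have aF: "agree T (\<lambda>z. (1/2 * \<rho> z * (norm (u z))\<^sup>2 + p (\<rho> z) + pressure_potential p (\<rho> z)) *\<^sub>R u z - \<sigma> z *v u z) F"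
    using agr(1,2,4) unfolding agree_def by eventually_elim (simp add: F_def pr_def pot_def)
  have arv: "agree T (\<lambda>z. \<rho> z *\<^sub>R u z) (\<lambda>z. r z *\<^sub>R v z)"
    using agr(1,2) unfolding agree_def by eventually_elim simp
  have arvi: "agree T (\<lambda>z. \<rho> z * u z $ i) (\<lambda>z. r z * v z $ i)" for i
    using agr(1,2) unfolding agree_def by eventually_elim simp
  have arvv: "agree T (\<lambda>z. (\<rho> z * u z $ i) *\<^sub>R u z) (\<lambda>z. (r z * v z $ i) *\<^sub>R v z)" for i
    using agr(1,2) unfolding agree_def by eventually_elim simp
  have mom: "weak T (\<lambda>z. (v z $ i) *\<^sub>R (r z, r z *\<^sub>R v z) + (0, pr z *\<^sub>R axis i 1 - s z $ i)) (\<lambda>_. 0)" for i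
    unfolding weak_def
  proof (intro allI impI)
    fix \<phi> :: "real \<times> (real^'d) \<Rightarrow> real" assume test: "test_fun T \<phi>"
    then obtain a b where \<phi>: "slab_test a b \<phi>" by (rule test_fun_slab_test)
    let ?d = "\<lambda>z. frechet_derivative \<phi> (at z)"
    have lin: "linear (?d z)" for z by (rule smooth_linear_deriv[OF slab_testD(1)[OF \<phi>]])
    note t1 = distr_dt_transfer[OF rvi(1)[of i] arvi[of i] \<phi>]
      and t2 = distr_div_transfer[OF Lq_field_scaleR[OF rvi(2)[of i] v2] arvv[of i] \<phi>]
      and t3 = distr_dx_transfer[OF fpr apr \<phi>, of i]
      and t4 = distr_div_transfer[OF Lq_field_nth[OF fs zero_less_one, of i] agree_nth[OF agr(4), of i] \<phi>]
    have eq: "?d z ((v z $ i) *\<^sub>R (r z, r z *\<^sub>R v z) + (0, pr z *\<^sub>R axis i 1 - s z $ i))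
      = ?d z (r z * v z $ i, 0) + ?d z (0, (r z * v z $ i) *\<^sub>R v z) + ?d z (0, pr z *\<^sub>R axis i 1) - ?d z (0, s z $ i)" for z
    proof -
      have "(v z $ i) *\<^sub>R (r z, r z *\<^sub>R v z) + (0, pr z *\<^sub>R axis i 1 - s z $ i)
        = (r z * v z $ i, 0) + (0, (r z * v z $ i) *\<^sub>R v z) + (0, pr z *\<^sub>R axis i 1) - (0, s z $ i)"
        by (simp add: mult.commute)
      then show ?thesis by (simp only: linear_add[OF lin] linear_diff[OF lin])
    qed
    have "distr_dt T (\<lambda>z. \<rho> z * u z $ i) \<phi> + distr_div T (\<lambda>z. (\<rho> z * u z $ i) *\<^sub>R u z) \<phi>
              + distr_dx T i (\<lambda>z. p (\<rho> z)) \<phi> = distr_div T (\<lambda>z. \<sigma> z $ i) \<phi>"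
      using flow test unfolding compressible_flow_def by blast
    then have "(\<integral>z. ?d z (r z * v z $ i, 0) \<partial>torus) + (\<integral>z. ?d z (0, (r z * v z $ i) *\<^sub>R v z) \<partial>torus)
        + (\<integral>z. ?d z (0, pr z *\<^sub>R axis i 1) \<partial>torus) - (\<integral>z. ?d z (0, s z $ i) \<partial>torus) = 0"
      unfolding t1(1) t2(1) t3(1) t4(1) by linarith
    then show "(\<integral>z. ?d z ((v z $ i) *\<^sub>R (r z, r z *\<^sub>R v z) + (0, pr z *\<^sub>R axis i 1 - s z $ i)) \<partial>torus) = (\<integral>z. 0 * \<phi> z \<partial>torus)"
      unfolding eq
      by (simp only: Bochner_Integration.integral_add Bochner_Integration.integral_diff Bochner_Integration.integrable_add
          t1(2) t2(2) t3(2) t4(2) mult_zero_left Bochner_Integration.integral_zero)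
  qed
  have cont: "weak T (\<lambda>z. (r z, r z *\<^sub>R v z)) (\<lambda>_. 0)"
    unfolding weak_def
  proof (intro allI impI)
    fix \<phi> :: "real \<times> (real^'d) \<Rightarrow> real" assume test: "test_fun T \<phi>"
    then obtain a b where \<phi>: "slab_test a b \<phi>" by (rule test_fun_slab_test)
    let ?d = "\<lambda>z. frechet_derivative \<phi> (at z)"
    have lin: "linear (?d z)" for z by (rule smooth_linear_deriv[OF slab_testD(1)[OF \<phi>]])
    note t1 = distr_dt_transfer[OF r1 agr(1) \<phi>] and t2 = distr_div_transfer[OF rv1 arv \<phi>]
    have eq: "?d z (r z, r z *\<^sub>R v z) = ?d z (r z, 0) + ?d z (0, r z *\<^sub>R v z)" for z
      using linear_add[OF lin, of z "(r z, 0)" "(0, r z *\<^sub>R v z)"] by simp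
    have "distr_dt T \<rho> \<phi> + distr_div T (\<lambda>z. \<rho> z *\<^sub>R u z) \<phi> = 0"
      using flow test unfolding compressible_flow_def by blast
    then show "(\<integral>z. ?d z (r z, r z *\<^sub>R v z) \<partial>torus) = (\<integral>z. 0 * \<phi> z \<partial>torus)"
      unfolding eq t1(1) t2(1) using t1(2) t2(2) by simp
  qed
  show ?thesis
    unfolding local_energy_equality_def Let_def
  proof (intro conjI allI impI)
    show "L1_loc T (\<lambda>z. 1/2 * \<rho> z * (norm (u z))\<^sup>2 + pressure_potential p (\<rho> z))" by (rule L1_loc_transfer[OF fE aE])
    show "L1_loc T (\<lambda>z. \<sigma> z \<bullet> Du z)" by (rule L1_loc_transfer[OF fD aD])
    show "L1_loc T (\<lambda>z. (1/2 * \<rho> z * (norm (u z))\<^sup>2 + p (\<rho> z) + pressure_potential p (\<rho> z)) *\<^sub>R u z - \<sigma> z *v u z)"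
      by (rule L1_loc_transfer[OF fF aF])
    fix \<phi> :: "real \<times> (real^'d) \<Rightarrow> real" assume test: "test_fun T \<phi>"
    then obtain a b where ab: "0 < a" "b < T" and \<phi>: "slab_test a b \<phi>" by (rule test_fun_slab_test)
    let ?d = "\<lambda>z. frechet_derivative \<phi> (at z)"
    have eq: "?d z (E z, F z) = ?d z (E z, 0) + ?d z (0, F z)" for z
      using linear_add[OF smooth_linear_deriv[OF slab_testD(1)[OF \<phi>]], of z "(E z, 0)" "(0, F z)"] by simp
    note t1 = distr_dt_transfer[OF fE aE \<phi>] and t2 = distr_div_transfer[OF fF aF \<phi>]
    have "(\<integral>z. ?d z (E z, F z) \<partial>torus) = (\<integral>z. \<phi> z * (s z \<bullet> G z) \<partial>torus)"
      by (rule ei(5)[OF _ mom cont grad bm ex ab \<phi>])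
    then have "(\<integral>z. ?d z (E z, 0) \<partial>torus) + (\<integral>z. ?d z (0, F z) \<partial>torus) = (\<integral>z. (s z \<bullet> G z) * \<phi> z \<partial>torus)"
      unfolding eq using t1(2) t2(2) by (simp add: mult.commute)
    then show "distr_dt T (\<lambda>z. 1/2 * \<rho> z * (norm (u z))\<^sup>2 + pressure_potential p (\<rho> z)) \<phi> + distr_fun T (\<lambda>z. \<sigma> z \<bullet> Du z) \<phi>
       + distr_div T (\<lambda>z. (1/2 * \<rho> z * (norm (u z))\<^sup>2 + p (\<rho> z) + pressure_potential p (\<rho> z)) *\<^sub>R u z - \<sigma> z *v u z) \<phi> = 0"
      unfolding t1(1) t2(1) distr_fun_transfer[OF fD aD smooth_measurable[OF slab_testD(1)[OF \<phi>]]] by linarith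
  qed
qed

lemma viscous_stress_linear: "linear (viscous_stress \<mu> \<nu> :: real^'d^'d \<Rightarrow> _)"
  by (rule linearI)
    (simp_all add: viscous_stress_def trace_def transpose_def mat_def vec_eq_iff sum.distrib sum_distrib_left[symmetric] algebra_simps)

lemma viscous_stress_symmetric: "transpose (viscous_stress \<mu> \<nu> A) = viscous_stress \<mu> \<nu> A"
  by (simp add: viscous_stress_def transpose_def mat_def vec_eq_iff)

lemma Lq_field_le_scaled:
  fixes f :: "real \<times> (real^'d) \<Rightarrow> 'a::euclidean_space" and h :: "real \<times> (real^'d) \<Rightarrow> 'c::euclidean_space"
  assumes f: "Lq_field T q f" and m: "h \<in> borel_measurable borel" and per: "sper h"
    and b: "\<And>z. norm (h z) \<le> K * norm (f z)"
  shows "Lq_field T q h"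
proof (rule Lq_fieldI_bound[OF m per])
  show "h z = 0" if "fst z \<notin> {0<..<T}" for z using b[of z] Lq_fieldD(3)[OF f that] by simp
  show "integrable torus (\<lambda>z. K ^ q * norm (f z) ^ q)" by (intro integrable_mult_right Lq_fieldD(4)[OF f])
  show "norm (h z) ^ q \<le> K ^ q * norm (f z) ^ q" for z
    using power_mono[OF b[of z] norm_ge_zero, of q] by (simp add: power_mult_distrib)
qed

lemma stress_Lq_field:
  fixes G :: "real \<times> (real^'d) \<Rightarrow> real^'d^'d" and r :: "real \<times> (real^'d) \<Rightarrow> real"
  assumes G: "Lq_field T 2 G" and r: "r \<in> borel_measurable borel" "sper r" and b: "\<And>z. \<bar>r z\<bar> \<le> M"
  shows "Lq_field T 2 (\<lambda>z. r z *\<^sub>R viscous_stress \<mu> \<nu> (G z))"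
proof -
  obtain K where K: "0 < K" "\<And>A :: real^'d^'d. norm (viscous_stress \<mu> \<nu> A) \<le> K * norm A"
    using linear_bounded_pos[OF viscous_stress_linear] by blast
  have "(viscous_stress \<mu> \<nu> :: real^'d^'d \<Rightarrow> _) \<in> borel_measurable borel"
    by (intro borel_measurable_continuous_onI linear_continuous_on linear_conv_bounded_linear[THEN iffD1] viscous_stress_linear)
  from measurable_compose[OF Lq_fieldD(1)[OF G] this] r(1)
  have m: "(\<lambda>z. r z *\<^sub>R viscous_stress \<mu> \<nu> (G z)) \<in> borel_measurable borel" by measurable
  show ?thesis
  proof (rule Lq_field_le_scaled[OF G m])
    show "sper (\<lambda>z. r z *\<^sub>R viscous_stress \<mu> \<nu> (G z))" using r(2) Lq_fieldD(2)[OF G] by (simp add: sper_def)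
    show "norm (r z *\<^sub>R viscous_stress \<mu> \<nu> (G z)) \<le> (M * K) * norm (G z)" for z
      using mult_mono[OF b[of z] K(2)[of "G z"]] order_trans[OF abs_ge_zero b[of z]] by (simp add: mult.assoc)
  qed
qed

text \<open>
  Used to see that the density bounds are consistent: bounds that hold almost everywhere would
  say nothing on a null set.
\<close>

lemma spacetime_not_null:
  assumes "0 < T" "AE z in lebesgue. z \<in> (spacetime T :: (real \<times> (real^'d)) set) \<longrightarrow> Q"
  shows Q
proof (rule ccontr)
  assume "\<not> Q"
  let ?U = "{0<..<T} \<times> box 0 (1 :: real^'d)"
  have "AE z in lebesgue. z \<notin> (spacetime T :: (real \<times> (real^'d)) set)" using assms(2) \<open>\<not> Q\<close> by simp
  then have "(spacetime T :: (real \<times> (real^'d)) set) \<in> null_sets lebesgue"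
    using spacetime_measurable[of T] by (subst (asm) AE_iff_null_sets[symmetric]) simp_all
  then have "negligible (spacetime T :: (real \<times> (real^'d)) set)" by (simp add: negligible_iff_null_sets)
  moreover have "?U \<subseteq> spacetime T" using box_subset_cbox by (auto simp: spacetime_def cell_def)
  ultimately have "negligible ?U" by (rule negligible_subset)
  moreover have "open ?U" by (intro open_Times open_greaterThanLessThan open_box)
  moreover have "(T/2, \<chi> i. 1/2) \<in> ?U" using assms(1) by (simp add: mem_box_cart)
  ultimately show False using open_not_negligible by blast
qed

theorem corollary3p3:
  fixes T \<mu> \<nu> \<alpha> \<beta> \<rho>lo \<rho>hi :: real
    and p :: "real \<Rightarrow> real"
    and \<rho> :: "real \<times> (real^'d) \<Rightarrow> real"
    and u :: "real \<times> (real^'d) \<Rightarrow> real^'d"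
    and Du :: "real \<times> (real^'d) \<Rightarrow> real^'d^'d"
  assumes "0 < T" and "0 < \<mu>" and "0 \<le> \<nu>"
    and "0 \<le> \<alpha>" and "\<alpha> \<le> 1" and "0 \<le> \<beta>" and "\<beta> \<le> 1"
    and "\<beta> > max (1 - 2 * \<alpha>) ((1 - \<alpha>) / 2)"
    and "Besov 3 \<alpha> T u"
    and "L2_H1 T u Du"
    and "Besov 3 \<beta> T \<rho>" and "Besov 3 \<beta> T (\<lambda>z. \<rho> z *\<^sub>R u z)"
    and "0 \<le> \<rho>lo"
    and "AE z in lebesgue. z \<in> spacetime T \<longrightarrow> \<rho>lo \<le> \<rho> z \<and> \<rho> z \<le> \<rho>hi"
    and "pressure_law \<rho>lo \<rho>hi p"
    and "\<rho>hi = 0 \<Longrightarrow> \<exists>h>0. pressure_law 0 h p"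
  shows "(navier_stokes T p \<mu> \<nu> \<rho> u Du \<longrightarrow>
            local_energy_equality T p (\<lambda>z. viscous_stress \<mu> \<nu> (Du z)) \<rho> u Du) \<and>
         (degenerate_navier_stokes T p \<mu> \<nu> \<rho> u Du \<longrightarrow>
            local_energy_equality T p (\<lambda>z. \<rho> z *\<^sub>R viscous_stress \<mu> \<nu> (Du z)) \<rho> u Du)"
proof -
  have ex: "1 < 2 * \<alpha> + \<beta>" "1 < 2 * \<beta> + \<alpha>" using assms(8) by (auto simp: max_def split: if_splits)
  have "AE z in lebesgue. z \<in> (spacetime T :: (real \<times> (real^'d)) set) \<longrightarrow> \<rho>lo \<le> \<rho>hi"
    using assms(14) by eventually_elim auto
  then have le: "\<rho>lo \<le> \<rho>hi" by (rule spacetime_not_null[OF assms(1)])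
  \<comment> \<open>for \<open>\<rho>hi = 0\<close> the interval is enlarged to one on which the limit defining \<open>P(0)\<close> is controlled\<close>
  obtain lo hi where lo: "0 \<le> lo" "lo \<le> hi" "0 < hi" and p: "pressure_law lo hi p"
    and lohi: "\<And>x. \<rho>lo \<le> x \<Longrightarrow> x \<le> \<rho>hi \<Longrightarrow> lo \<le> x \<and> x \<le> hi"
  proof (cases "\<rho>hi = 0")
    case True
    then obtain h where "h > 0" "pressure_law 0 h p" using assms(16) by blast
    then show thesis using that[of 0 h] True assms(13) by force
  next
    case False
    then show thesis using that[of \<rho>lo \<rho>hi] assms(13,15) le by force
  qed
  have Lu: "space_periodic T u" "Lq_on 3 (spacetime T) u"
    and L\<rho>: "space_periodic T \<rho>" "Lq_on 3 (spacetime T) \<rho>"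
    and L\<rho>u: "Lq_on 3 (spacetime T) (\<lambda>z. \<rho> z *\<^sub>R u z)"
    and LD: "space_periodic T Du" "Lq_on 2 (spacetime T) Du"
    and H: "AE t in lebesgue. t \<in> {0<..<T} \<longrightarrow> H1_gradient (\<lambda>x. u (t, x)) (\<lambda>x. Du (t, x))"
    using assms(9-12) by (simp_all add: Besov_def L2_H1_def Lq_spacetime_def)
  obtain v where v: "v \<in> borel_measurable borel" "sper v" "\<And>z. fst z \<notin> {0<..<T} \<Longrightarrow> v z = 0" and uv: "agree T u v"
    by (rule representative[OF Lu(1)]) (use Lu(2) in \<open>auto simp: Lq_on_def\<close>)
  obtain G where G: "G \<in> borel_measurable borel" "sper G" "\<And>z. fst z \<notin> {0<..<T} \<Longrightarrow> G z = 0" and DG: "agree T Du G"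
    by (rule representative[OF LD(1)]) (use LD(2) in \<open>auto simp: Lq_on_def\<close>)
  obtain R where R: "R \<in> borel_measurable borel" "sper R" "\<And>z. fst z \<notin> {0<..<T} \<Longrightarrow> R z = 0" and \<rho>R: "agree T \<rho> R"
    by (rule representative[OF L\<rho>(1)]) (use L\<rho>(2) in \<open>auto simp: Lq_on_def\<close>)
  have \<rho>b: "AE z in lborel. fst z \<in> {0<..<T} \<longrightarrow> lo \<le> \<rho> z \<and> \<rho> z \<le> hi"
  proof (rule AE_periodic)
    show "AE z in lborel. fst z \<in> {0<..<T} \<longrightarrow> snd z \<in> hcell \<longrightarrow> lo \<le> \<rho> z \<and> \<rho> z \<le> hi"
      using assms(14)[unfolded AE_completion_iff]
    proof eventually_elim
      case (elim z)
      then show ?case using lohi[of "\<rho> z"] hcell_cell[of "snd z"] by (cases z) (auto simp: spacetime_def)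
    qed
  qed (use space_periodic_lattice[OF L\<rho>(1)] in simp)
  \<comment> \<open>clamping makes the bounds on the density hold pointwise, where \<open>p\<close> and \<open>P\<close> are continuous\<close>
  define r where "r = (\<lambda>z. if fst z \<in> {0<..<T} then max lo (min hi (R z)) else 0)"
  have rm: "r \<in> borel_measurable borel" unfolding r_def using R(1) by measurable
  have rz: "r z = 0" if "fst z \<notin> {0<..<T}" for z unfolding r_def by (rule if_not_P[OF that])
  have bd: "lo \<le> r z \<and> r z \<le> hi" if "fst z \<in> {0<..<T}" for z unfolding r_def using lo if_P[OF that] by auto
  have rp: "sper r" using R(2) by (simp add: sper_def r_def del: greaterThanLessThan_iff)
  have \<rho>r: "agree T \<rho> r"
    using \<rho>R \<rho>b unfolding agree_def by eventually_elim (auto simp: r_def)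
  have \<rho>uv: "agree T (\<lambda>z. \<rho> z *\<^sub>R u z) (\<lambda>z. r z *\<^sub>R v z)"
    using \<rho>r uv unfolding agree_def by eventually_elim simp
  have fv: "Lq_field T 3 v" using Lq_field_of_Lq[of 3 T u v] Lu(2) v uv by simp
  have fG: "Lq_field T 2 G" using Lq_field_of_Lq[of 2 T Du G] LD(2) G DG by simp
  have fr: "Lq_field T 3 r" using Lq_field_of_Lq[of 3 T \<rho> r] L\<rho>(2) rm rp rz \<rho>r by simp
  have frv: "Lq_field T 3 (\<lambda>z. r z *\<^sub>R v z)"
  proof -
    have "(\<lambda>z. r z *\<^sub>R v z) \<in> borel_measurable borel" using rm v(1) by measurable
    moreover have "sper (\<lambda>z. r z *\<^sub>R v z)" using rp v(2) by (simp add: sper_def)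
    ultimately show ?thesis using Lq_field_of_Lq[of 3 T "\<lambda>z. \<rho> z *\<^sub>R u z" "\<lambda>z. r z *\<^sub>R v z"] L\<rho>u \<rho>uv rz by simp
  qed
  have grad: "weak T (\<lambda>z. (v z $ i) *\<^sub>R (0, axis j 1)) (\<lambda>z. - (G z $ i $ j))" for i j
    using Lq_field_mono[OF fv, of 1] Lq_field_mono[OF fG, of 1] by (intro gradient_weak[OF H _ _ uv DG]) simp_all
  note energy = local_energy_of_flow[OF \<rho>r uv DG _ fr fv frv fG _ _ lo p bd grad
      besov_incr_of_Besov[OF assms(9) fv uv assms(4)] besov_incr_of_Besov[OF assms(11) fr \<rho>r assms(6)]
      besov_incr_of_Besov[OF assms(12) frv \<rho>uv assms(6)] ex assms(5,7)]
  have rb: "\<bar>r z\<bar> \<le> hi" for z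
    using bd[of z] rz[of z] lo by (cases "fst z \<in> {0<..<T}") auto
  show ?thesis
  proof (intro conjI impI)
    assume "navier_stokes T p \<mu> \<nu> \<rho> u Du"
    then show "local_energy_equality T p (\<lambda>z. viscous_stress \<mu> \<nu> (Du z)) \<rho> u Du"
      unfolding navier_stokes_def
    proof (rule energy[rotated -1])
      show "agree T (\<lambda>z. viscous_stress \<mu> \<nu> (Du z)) (\<lambda>z. viscous_stress \<mu> \<nu> (G z))"
        using DG unfolding agree_def by eventually_elim simp
      show "Lq_field T 2 (\<lambda>z. viscous_stress \<mu> \<nu> (G z))"
        using stress_Lq_field[OF fG, of "\<lambda>_. 1" 1 \<mu> \<nu>] by (simp add: sper_def)
    qed (rule viscous_stress_symmetric)
  next
    assume "degenerate_navier_stokes T p \<mu> \<nu> \<rho> u Du"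
    then show "local_energy_equality T p (\<lambda>z. \<rho> z *\<^sub>R viscous_stress \<mu> \<nu> (Du z)) \<rho> u Du"
      unfolding degenerate_navier_stokes_def
    proof (rule energy[rotated -1])
      show "agree T (\<lambda>z. \<rho> z *\<^sub>R viscous_stress \<mu> \<nu> (Du z)) (\<lambda>z. r z *\<^sub>R viscous_stress \<mu> \<nu> (G z))"
        using DG \<rho>r unfolding agree_def by eventually_elim simp
      show "Lq_field T 2 (\<lambda>z. r z *\<^sub>R viscous_stress \<mu> \<nu> (G z))" by (rule stress_Lq_field[OF fG rm rp rb])
      show "transpose (r z *\<^sub>R viscous_stress \<mu> \<nu> (G z)) = r z *\<^sub>R viscous_stress \<mu> \<nu> (G z)" for z
        using viscous_stress_symmetric[of \<mu> \<nu> "G z"] by (simp add: transpose_def vec_eq_iff)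
    qed
  qed
qed

end
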